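(* Let $\delta\in(1,\infty)$ and let $n,p\to+\infty$ with $n/p\to\delta$. For each $(n,p)$ let $(x_i,y_i)_{i=1}^n$ be i.i.d. observations from the single-index model described in the context (Gaussian covariates $x_i\sim N(0,I_p)$, unit index $w\in\mathbb{R}^p$, fixed link function $F$), and suppose that the non-triviality assumption (N) and the loss assumption (L) of the context hold. Let $\delta_\infty\in(0,+\infty]$ be the threshold defined in the context by $1/\delta_\infty=\inf_{t\in\mathbb{R}}\varphi(t)$. Then $$\mathbb{P}\Bigl(\text{the infimum } \inf_{b\in\mathbb{R}^p}\sum_{i=1}^n \ell_{y_i}(x_i^\top b)\text{ is attained}\Bigr)\to\begin{cases}1&\text{if }\delta>\delta_\infty,\\ 0&\text{if }\delta<\delta_\infty.\end{cases}$$
   Context: Model. $\mathcal Y\subset\mathbb{R}$; $F:\mathbb{R}\times\mathbb{R}\to[0,1]$ is a fixed deterministic function; $w\in\mathbb{R}^p$ is deterministic with $\|w\|=1$ (it may depend on $p$). The pairs $(x_i,y_i)$ are i.i.d. with $x_i\sim N(0,I_p)$, $y_i\in\mathcal Y$ and $\mathbb{P}(y_i\le t\mid x_i)=F(t,x_i^\top w)$ for all $t\in\mathbb{R}$. $(U,Y)$ denotes a random pair with the same law as $(x_i^\top w,y_i)$ (this law does not depend on $n,p$; in particular $U\sim N(0,1)$), and $G\sim N(0,1)$ is independent of $(U,Y)$. Loss. For each $y\in\mathcal Y$ a function $\ell_y:\mathbb{R}\to\mathbb{R}$ is given, with $y\mapsto \ell_y(t)$ measurable for each $t$. Define the events $\Omega_\vee=\Omega_\vee(Y)=\{\ell_Y\text{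 is coercive, i.e. }\ell_Y(t)\to+\infty\text{ as }|t|\to\infty\}$, $\Omega_\nearrow=\Omega_\nearrow(Y)=\{\ell_Y\text{ is strictly increasing}\}$, $\Omega_\searrow=\Omega_\searrow(Y)=\{\ell_Y\text{ is strictly decreasing}\}$. (For strictly convex losses these three events form a partition.) $I\{\cdot\}$ denotes an indicator. Assumption (N): $\ell_y$ is strictly convex for every $y\in\mathcal Y$, and $$\mathbb{E}\bigl[U^2(I\{\Omega_\vee\}+I\{\Omega_\searrow,U>0\}+I\{\Omega_\nearrow,U<0\})\bigr]>0,\qquad \mathbb{E}\bigl[U^2(I\{\Omega_\vee\}+I\{\Omega_\searrow,U<0\}+I\{\Omega_\nearrow,U>0\})\bigr]>0.$$ Assumption (L): (1) for all $y\in\mathcal Y$, $\ell_y$ is $C^1$, strictly convex and not constant; (2) $\mathbb{E}[|\inf_u\ell_Y(u)|]<\infty$ and $\mathbb{E}[|\ell_Y(G)|]<\infty$; (3) $\mathbb{P}(\Omega_\vee)<1$; (4) there are a constant $b>0$ and a positive $\sigma(Y)$-measurable random variable $D(Y)$ with $\mathbb{E}[D(Y)]<\infty$ and $\mathbb{E}[D(Y)^2I\{\Omega_\vee\}]<\infty$ such that for all $u\in\mathbb{R}$: $\ell_Y(u)\ge -D(Y)+u/b$ on $\Omega_\nearrow$, $\ell_Y(u)\ge -D(Y)+|u|/b$ on $\Omega_\vee$, and $\ell_Y(u)\ge -D(Y)-u/b$ on $\Omega_\searrow$. Threshold. With $a_+=\max(a,0)$, $a_-=\max(-a,0)$, $a_\pm^2=(a_\pm)^2$,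 $$\varphi(t)=\mathbb{E}[(G+Ut)^2I\{\Omega_\vee\}]+\mathbb{E}[(G+Ut)_+^2I\{\Omega_\nearrow\}]+\mathbb{E}[(G+Ut)_-^2I\{\Omega_\searrow\}],\qquad \frac1{\delta_\infty}=\inf_{t\in\mathbb{R}}\varphi(t),$$ with $\delta_\infty=+\infty$ if the infimum is $0$. *)

theory Defs
  imports "HOL-Probability.Probability"
begin

text \<open>
  Since the dimension p varies along a sequence, a vector of R^p is a function from nat to real
  that is extensional on {..<p}, i.e. an element of the space of the finite product measure
  \<^term>\<open>\<Pi>\<^sub>M j\<in>{..<p}. (borel :: real measure)\<close>.
\<close>

definition real_vectors :: "nat \<Rightarrow> (nat \<Rightarrow> real) set" where
  "real_vectors p = {..<p} \<rightarrow>\<^sub>E UNIV"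

definition inner_prod :: "nat \<Rightarrow> (nat \<Rightarrow> real) \<Rightarrow> (nat \<Rightarrow> real) \<Rightarrow> real" where
  "inner_prod p u v = (\<Sum>j<p. u j * v j)"

abbreviation borel_vec :: "nat \<Rightarrow> (nat \<Rightarrow> real) measure" where
  "borel_vec p \<equiv> (\<Pi>\<^sub>M j\<in>{..<p}. borel)"

definition std_gaussian_vec :: "nat \<Rightarrow> (nat \<Rightarrow> real) measure" where
  "std_gaussian_vec p = (\<Pi>\<^sub>M j\<in>{..<p}. density lborel std_normal_density)"

text \<open>
  The sample of size n in dimension p.  The conditional probability of the event y_i \<le> t given x_i
  is the conditional expectation of its indicator with respect to the sigma-algebra generated by x_i.
\<close>

definition single_index_sample ::
  "(real \<Rightarrow> real \<Rightarrow> real) \<Rightarrow> real set \<Rightarrow> 'a measure \<Rightarrow> nat \<Rightarrow> nat \<Rightarrow> (nat \<Rightarrow> real) \<Rightarrow>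
   (nat \<Rightarrow> 'a \<Rightarrow> nat \<Rightarrow> real) \<Rightarrow> (nat \<Rightarrow> 'a \<Rightarrow> real) \<Rightarrow> bool" where
  "single_index_sample F \<Y> M n p w x y \<longleftrightarrow>
     prob_space M \<and>
     w \<in> real_vectors p \<and> L2_set w {..<p} = 1 \<and>
     (\<forall>i<n. x i \<in> measurable M (borel_vec p)) \<and>
     (\<forall>i<n. y i \<in> borel_measurable M) \<and>
     (\<forall>i<n. \<forall>\<omega>\<in>space M. y i \<omega> \<in> \<Y>) \<and>
     prob_space.indep_vars M (\<lambda>_. borel_vec p \<Otimes>\<^sub>M borel) (\<lambda>i \<omega>. (x i \<omega>, y i \<omega>)) {..<n} \<and>
     (\<forall>i<n. \<forall>i'<n. distr M (borel_vec p \<Otimes>\<^sub>M borel) (\<lambda>\<omega>. (x i \<omega>, y i \<omega>))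
                  = distr M (borel_vec p \<Otimes>\<^sub>M borel) (\<lambda>\<omega>. (x i' \<omega>, y i' \<omega>))) \<and>
     (\<forall>i<n. distr M (borel_vec p) (x i) = std_gaussian_vec p) \<and>
     (\<forall>i<n. \<forall>t. AE \<omega> in M.
        real_cond_exp M (vimage_algebra (space M) (x i) (borel_vec p))
          (indicator {\<omega>' \<in> space M. y i \<omega>' \<le> t}) \<omega>
        = F t (inner_prod p (x i \<omega>) w))"

definition strictly_convex :: "(real \<Rightarrow> real) \<Rightarrow> bool" where
  "strictly_convex f \<longleftrightarrow>
     (\<forall>s t u. s \<noteq> t \<longrightarrow> 0 < u \<longrightarrow> u < 1 \<longrightarrow> f ((1 - u) * s + u * t) < (1 - u) * f s + u * f t)"

definition coercive :: "(real \<Rightarrow> real) \<Rightarrow> bool" where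
  "coercive f \<longleftrightarrow> filterlim f at_top at_infinity"

definition strictly_decreasing :: "(real \<Rightarrow> real) \<Rightarrow> bool" where
  "strictly_decreasing f \<longleftrightarrow> (\<forall>s t. s < t \<longrightarrow> f t < f s)"

definition Omega_coercive :: "'b measure \<Rightarrow> (real \<Rightarrow> real \<Rightarrow> real) \<Rightarrow> ('b \<Rightarrow> real) \<Rightarrow> 'b set" where
  "Omega_coercive N \<l> Y = {\<omega> \<in> space N. coercive (\<l> (Y \<omega>))}"

definition Omega_incr :: "'b measure \<Rightarrow> (real \<Rightarrow> real \<Rightarrow> real) \<Rightarrow> ('b \<Rightarrow> real) \<Rightarrow> 'b set" where
  "Omega_incr N \<l> Y = {\<omega> \<in> space N. strict_mono (\<l> (Y \<omega>))}"

definition Omega_decr :: "'b measure \<Rightarrow> (real \<Rightarrow> real \<Rightarrow> real) \<Rightarrow> ('b \<Rightarrow> real) \<Rightarrow> 'b set" where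
  "Omega_decr N \<l> Y = {\<omega> \<in> space N. strictly_decreasing (\<l> (Y \<omega>))}"

definition nontriviality_assumption ::
  "real set \<Rightarrow> (real \<Rightarrow> real \<Rightarrow> real) \<Rightarrow> 'b measure \<Rightarrow> ('b \<Rightarrow> real) \<Rightarrow> ('b \<Rightarrow> real) \<Rightarrow> bool" where
  "nontriviality_assumption \<Y> \<l> N U Y \<longleftrightarrow>
     (\<forall>y\<in>\<Y>. strictly_convex (\<l> y)) \<and>
     0 < (\<integral>\<omega>. (U \<omega>)\<^sup>2 * (indicator (Omega_coercive N \<l> Y) \<omega>
            + indicator (Omega_decr N \<l> Y \<inter> {\<omega>'. U \<omega>' > 0}) \<omega>
            + indicator (Omega_incr N \<l> Y \<inter> {\<omega>'. U \<omega>' < 0}) \<omega>) \<partial>N) \<and>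
     0 < (\<integral>\<omega>. (U \<omega>)\<^sup>2 * (indicator (Omega_coercive N \<l> Y) \<omega>
            + indicator (Omega_decr N \<l> Y \<inter> {\<omega>'. U \<omega>' < 0}) \<omega>
            + indicator (Omega_incr N \<l> Y \<inter> {\<omega>'. U \<omega>' > 0}) \<omega>) \<partial>N)"

text \<open>
  The infimum of a loss is taken in the extended reals, so that integrability of its absolute value
  entails that it is almost surely finite.  The sigma(Y)-measurable variable D(Y) is given by
  a measurable function D on the range of Y; the bounds involving it are required almost surely.
\<close>

definition loss_assumption ::
  "real set \<Rightarrow> (real \<Rightarrow> real \<Rightarrow> real) \<Rightarrow> 'b measure \<Rightarrow> ('b \<Rightarrow> real) \<Rightarrow> ('b \<Rightarrow> real) \<Rightarrow> bool" where
  "loss_assumption \<Y> \<l> N Y G \<longleftrightarrow>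
     (\<forall>y\<in>\<Y>. \<l> y C1_differentiable_on UNIV \<and> strictly_convex (\<l> y) \<and> \<not> ((\<l> y) constant_on UNIV)) \<and>
     (\<integral>\<^sup>+\<omega>. e2ennreal \<bar>INF u. ereal (\<l> (Y \<omega>) u)\<bar> \<partial>N) < \<infinity> \<and>
     integrable N (\<lambda>\<omega>. \<bar>\<l> (Y \<omega>) (G \<omega>)\<bar>) \<and>
     measure N (Omega_coercive N \<l> Y) < 1 \<and>
     (\<exists>b>0. \<exists>D \<in> borel_measurable (restrict_space borel \<Y>).
        (AE \<omega> in N. 0 < D (Y \<omega>)) \<and>
        integrable N (\<lambda>\<omega>. D (Y \<omega>)) \<and>
        integrable N (\<lambda>\<omega>. (D (Y \<omega>))\<^sup>2 * indicator (Omega_coercive N \<l> Y) \<omega>) \<and>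
        (AE \<omega> in N. \<forall>u.
           (\<omega> \<in> Omega_incr N \<l> Y \<longrightarrow> \<l> (Y \<omega>) u \<ge> - D (Y \<omega>) + u / b) \<and>
           (\<omega> \<in> Omega_coercive N \<l> Y \<longrightarrow> \<l> (Y \<omega>) u \<ge> - D (Y \<omega>) + \<bar>u\<bar> / b) \<and>
           (\<omega> \<in> Omega_decr N \<l> Y \<longrightarrow> \<l> (Y \<omega>) u \<ge> - D (Y \<omega>) - u / b)))"

definition phi ::
  "(real \<Rightarrow> real \<Rightarrow> real) \<Rightarrow> 'b measure \<Rightarrow> ('b \<Rightarrow> real) \<Rightarrow> ('b \<Rightarrow> real) \<Rightarrow> ('b \<Rightarrow> real) \<Rightarrow> real \<Rightarrow> real" where
  "phi \<l> N U Y G t =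
     (\<integral>\<omega>. (G \<omega> + U \<omega> * t)\<^sup>2 * indicator (Omega_coercive N \<l> Y) \<omega> \<partial>N) +
     (\<integral>\<omega>. (max (G \<omega> + U \<omega> * t) 0)\<^sup>2 * indicator (Omega_incr N \<l> Y) \<omega> \<partial>N) +
     (\<integral>\<omega>. (max (- (G \<omega> + U \<omega> * t)) 0)\<^sup>2 * indicator (Omega_decr N \<l> Y) \<omega> \<partial>N)"

definition delta_infty ::
  "(real \<Rightarrow> real \<Rightarrow> real) \<Rightarrow> 'b measure \<Rightarrow> ('b \<Rightarrow> real) \<Rightarrow> ('b \<Rightarrow> real) \<Rightarrow> ('b \<Rightarrow> real) \<Rightarrow> ereal" where
  "delta_infty \<l> N U Y G =
     (if (INF t. phi \<l> N U Y G t) = 0 then \<infinity> else ereal (1 / (INF t. phi \<l> N U Y G t)))"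

definition empirical_risk ::
  "(real \<Rightarrow> real \<Rightarrow> real) \<Rightarrow> nat \<Rightarrow> nat \<Rightarrow> (nat \<Rightarrow> nat \<Rightarrow> real) \<Rightarrow> (nat \<Rightarrow> real) \<Rightarrow> (nat \<Rightarrow> real) \<Rightarrow> real" where
  "empirical_risk \<l> n p x y b = (\<Sum>i<n. \<l> (y i) (inner_prod p (x i) b))"

definition infimum_attained :: "(nat \<Rightarrow> real) set \<Rightarrow> ((nat \<Rightarrow> real) \<Rightarrow> real) \<Rightarrow> bool" where
  "infimum_attained S f \<longleftrightarrow> (\<exists>b\<in>S. \<forall>b'\<in>S. f b \<le> f b')"

end

(*
The infimum is attained as soon as no nonzero b satisfies X b in C, where the cone C consists of the
directions along which no loss increases, provided the losses are bounded below; conversely a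
direction b with X b nonzero and in C excludes a minimiser.  After a rotation of R^p the design has the index
u = X w as its first column, while the other columns are independent standard Gaussian vectors.
There is a b with X b in C and positive last coordinate unless the last column has positive
distance from C modulo the span of the other columns; in that case the optimality conditions of the
distance determine a unique active set S, of more than p - 1 rows, on which the residual of the
last column is its Gram-Schmidt residual.  By rotation invariance the probability that a given S is
active does not depend on the number of Gaussian columns, so that it can be computed with one
Gaussian column, where the problem is to minimise over t the empirical version of phi.
There |S| / n tends to min phi by the law of large numbers, stationarity, and Gaussian integration by
parts.  Comparing p / n with min phi settles whether X b in C is solvable with <f, b> > 0, for any one f
orthogonal to w.  A b that is not a multiple of w is seen by more than half of a family of such
f, projected from the moment curve, so Markov's inequality passes to all b at a bounded cost.
*)

theory Submission
  imports Defs
begin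

text \<open>The obstacle is that the law of large numbers comes without a rate. Counting replaces
  it: a fixed fraction of the family would have to fail at the same time, and Markov's inequality
  loses a factor 4, whatever the rate. Multiples of \<open>w\<close> escape the family, and
  assumption (N) excludes them.

  The probability of an active set S forgets the number of columns because it factors. The
  conditions on S only see the direction of a residual in dimension |S| - 1, which is uniform on the
  sphere. Given the rows of this residual, the conditions off S are homogeneous conditions on a
  multiple of a standard Gaussian vector. Neither factor involves the number of columns, provided
  that the residual does not degenerate; this is what |S| > p - 1 ensures. Uniqueness makes the
  events for distinct S disjoint, so their probabilities add up, in the same way for many columns as
  for one.\<close>

section \<open>Inner products over an index set and reflections\<close>

definition ip :: "'i set => ('i => real) => ('i => real) => real" where
  "ip S x y = (\<Sum>i\<in>S. x i * y i)"

lemma ip_sym: "ip S x y = ip S y x"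
  by (simp add: ip_def mult.commute)

lemma ip_diff_left: "ip S (%i. x i - y i) z = ip S x z - ip S y z"
  by (simp add: ip_def algebra_simps sum_subtractf)

lemma ip_add_left: "ip S (%i. x i + y i) z = ip S x z + ip S y z"
  by (simp add: ip_def algebra_simps sum.distrib)

lemma ip_scale_left: "ip S (%i. c * x i) z = c * ip S x z"
  by (simp add: ip_def algebra_simps sum_distrib_left)

lemma ip_sum_left: "ip S (%i. \<Sum>j\<in>J. f j i) z = (\<Sum>j\<in>J. ip S (f j) z)"
  unfolding ip_def by (subst sum.swap) (simp add: sum_distrib_right)

lemma ip_diff_right: "ip S z (%i. x i - y i) = ip S z x - ip S z y"
  by (simp add: ip_sym[of S z] ip_diff_left)

lemma ip_add_right: "ip S z (%i. x i + y i) = ip S z x + ip S z y"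
  by (simp add: ip_sym[of S z] ip_add_left)

lemma ip_scale_right: "ip S z (%i. c * x i) = c * ip S z x"
  by (simp add: ip_sym[of S z] ip_scale_left)

lemma ip_sum_right: "ip S z (%i. \<Sum>j\<in>J. f j i) = (\<Sum>j\<in>J. ip S z (f j))"
  by (simp add: ip_sym[of S z] ip_sum_left)

lemma ip_cong: "(\<And>i. i \<in> S ==> x i = x' i) ==> (\<And>i. i \<in> S ==> y i = y' i) ==> ip S x y = ip S x' y'"
  by (simp add: ip_def)

lemma ip_self_nonneg [simp]: "0 \<le> ip S x x"
  by (simp add: ip_def sum_nonneg)

lemma ip_self_eq_0_iff: "finite S ==> ip S x x = 0 \<longleftrightarrow> (\<forall>i\<in>S. x i = 0)"
  by (simp add: ip_def sum_nonneg_eq_0_iff)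

lemma ip_zero_left: "(\<And>i. i \<in> S ==> x i = 0) ==> ip S x y = 0"
  by (simp add: ip_def)

lemma ip_self_pos: "finite S ==> i \<in> S ==> x i ~= 0 ==> 0 < ip S x x"
  using ip_self_eq_0_iff[of S x] ip_self_nonneg[of S x] by (metis less_eq_real_def)

text \<open>Householder reflection on the coordinates in \<open>S\<close>, extended by the identity,
  so that rows outside an active set stay in place. If \<open>a\<close> vanishes on
  \<open>S\<close>, division by zero turns it into the identity.\<close>

definition hrefl :: "'i set => ('i => real) => ('i => real) => 'i => real" where
  "hrefl S a x = (%i. if i \<in> S then x i - 2 * ip S x a / ip S a a * a i else x i)"

lemma ip_hrefl:
  assumes "finite S" shows "ip S (hrefl S a x) (hrefl S a y) = ip S x y"
proof -
  let ?c = "%x. 2 * ip S x a / ip S a a"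
  have "ip S (hrefl S a x) (hrefl S a y) = ip S (%i. x i - ?c x * a i) (%i. y i - ?c y * a i)"
    by (rule ip_cong) (simp_all add: hrefl_def)
  also have "\<dots> = ip S x y - ?c y * ip S x a - ?c x * ip S y a + ?c x * ?c y * ip S a a"
    unfolding ip_diff_left ip_diff_right ip_scale_left ip_scale_right ip_sym[of S a y] by (simp add: algebra_simps)
  also have "\<dots> = ip S x y"
  proof (cases "ip S a a = 0")
    case False
    then show ?thesis by (simp add: field_simps)
  qed simp
  finally show ?thesis .
qed

lemma hrefl_hrefl:
  assumes "finite S" shows "hrefl S a (hrefl S a x) = x"
proof -
  have "ip S (hrefl S a x) a = ip S (%i. x i - 2 * ip S x a / ip S a a * a i) a"
    by (rule ip_cong) (auto simp: hrefl_def)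
  also have "\<dots> = ip S x a - 2 * ip S x a / ip S a a * ip S a a"
    by (simp only: ip_diff_left ip_scale_left)
  finally have "ip S (hrefl S a x) a = - ip S x a \<or> ip S a a = 0" by auto
  then show ?thesis
  proof
    assume h: "ip S (hrefl S a x) a = - ip S x a"
    show ?thesis
    proof
      fix i
      show "hrefl S a (hrefl S a x) i = x i"
        unfolding hrefl_def[of S a "hrefl S a x"] h by (simp add: hrefl_def)
    qed
  next
    assume h: "ip S a a = 0"
    show ?thesis unfolding hrefl_def h by auto
  qed
qed

lemma hrefl_diff: "hrefl S a (%i. x i - y i) = (%i. hrefl S a x i - hrefl S a y i)"
  by (rule ext) (simp add: hrefl_def ip_diff_left algebra_simps diff_divide_distrib)

lemma hrefl_add: "hrefl S a (%i. x i + y i) = (%i. hrefl S a x i + hrefl S a y i)"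
  by (rule ext) (simp add: hrefl_def ip_add_left algebra_simps add_divide_distrib)

lemma hrefl_scale: "hrefl S a (%i. c * x i) = (%i. c * hrefl S a x i)"
  by (rule ext) (simp add: hrefl_def ip_scale_left algebra_simps)

lemma hrefl_sum: "finite J ==> hrefl S a (%i. \<Sum>j\<in>J. f j i) = (%i. \<Sum>j\<in>J. hrefl S a (f j) i)"
proof (induction J rule: finite_induct)
  case empty
  show ?case by (rule ext) (simp add: hrefl_def ip_def)
next
  case (insert j J)
  then show ?case by (simp add: hrefl_add)
qed

lemma hrefl_cong: "(\<And>i. i \<in> S ==> x i = y i) ==> i \<in> S ==> hrefl S a x i = hrefl S a y i"
  using ip_cong[of S x y a a] by (simp add: hrefl_def)

text \<open>The hyperplane orthogonal to the difference of two vectors of equal length is the mirror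
  between them. If the difference vanishes on \<open>S\<close>, the degenerate reflection is the
  identity and the vectors agree there.\<close>

lemma hrefl_swap:
  assumes "finite S" "ip S x x = ip S y y" "i \<in> S"
  shows "hrefl S (%i. x i - y i) x i = y i"
proof (cases "ip S (%i. x i - y i) (%i. x i - y i) = 0")
  case True
  then have "x i = y i" using assms ip_self_eq_0_iff[of S "%i. x i - y i"] by auto
  then show ?thesis by (simp add: hrefl_def)
next
  case False
  have "ip S (%i. x i - y i) (%i. x i - y i) = 2 * ip S x (%i. x i - y i)"
    by (simp add: ip_diff_left ip_diff_right assms(2) ip_sym[of S y x])
  then show ?thesis using False assms(3) by (simp add: hrefl_def)
qed

lemma hrefl_orth:
  assumes "ip S x a = 0" shows "hrefl S a x = x"
  using assms by (auto simp: hrefl_def)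

subsection \<open>Gram-Schmidt orthogonalisation with respect to a set of coordinates\<close>

text \<open>
  The inner products only involve the coordinates in \<open>S\<close>, whereas the linear combinations are
  formed in all coordinates.  A vector that vanishes on \<open>S\<close> is skipped, as division by zero is zero.
\<close>

function gs :: "'i set => (nat => 'i => real) => nat => 'i => real" where
  "gs S z k = (%i. z k i -
     (\<Sum>j<k. ip S (z k) (gs S z j) / ip S (gs S z j) (gs S z j) * gs S z j i))"
  by auto
termination by (relation "Wellfounded.measure (%(_, _, k). k)") auto

declare gs.simps [simp del]

abbreviation gsr :: "'i set => (nat => 'i => real) => nat => nat => real" where
  "gsr S z k j \<equiv> ip S (z k) (gs S z j) / ip S (gs S z j) (gs S z j)"

text \<open>Coefficients of the Gram-Schmidt vectors in terms of the original ones, a unit lower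
  triangular matrix. They depend on the coordinates in \<open>S\<close> only, so that outside
  \<open>S\<close> a Gram-Schmidt vector is a combination of the columns whose coefficients are
  determined elsewhere.\<close>

function gc :: "'i set => (nat => 'i => real) => nat => nat => real" where
  "gc S z k l = (if l = k then 1 else if l < k then - (\<Sum>j<k. gsr S z k j * gc S z j l) else 0)"
  by auto
termination by (relation "Wellfounded.measure (%(_, _, k, _). k)") auto

declare gc.simps [simp del]

lemma gc_self [simp]: "gc S z k k = 1"
  by (simp add: gc.simps[of S z k k])

lemma gs_0 [simp]: "gs S z 0 = z 0"
  by (simp add: gs.simps[of S z 0])

lemma z_eq_gs: "z k i = gs S z k i + (\<Sum>j<k. gsr S z k j * gs S z j i)"
  by (simp add: gs.simps[of S z k])

lemma gs_eq_gc: "gs S z k i = (\<Sum>l\<le>k. gc S z k l * z l i)"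
proof (induction k rule: less_induct)
  case (less k)
  \<comment> \<open>The coefficients vanish above the diagonal, so all sums may run over the same
    range.\<close>
  have "gs S z j i = (\<Sum>l<k. gc S z j l * z l i)" if "j < k" for j
  proof -
    have "(\<Sum>l<k. gc S z j l * z l i) = (\<Sum>l\<le>j. gc S z j l * z l i)"
      by (rule sum.mono_neutral_right) (use that in \<open>auto simp: gc.simps[of S z j]\<close>)
    then show ?thesis using less[OF that] by simp
  qed
  then have "gs S z k i = z k i - (\<Sum>j<k. gsr S z k j * (\<Sum>l<k. gc S z j l * z l i))"
    unfolding gs.simps[of S z k] by simp
  also have "(\<Sum>j<k. gsr S z k j * (\<Sum>l<k. gc S z j l * z l i)) =
      (\<Sum>l<k. (\<Sum>j<k. gsr S z k j * gc S z j l) * z l i)"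
    unfolding sum_distrib_left sum_distrib_right by (subst sum.swap) (simp only: mult.assoc)
  also have "\<dots> = - (\<Sum>l<k. gc S z k l * z l i)"
    unfolding sum_negf[symmetric] by (rule sum.cong) (simp_all add: gc.simps[of S z k])
  also have "z k i - \<dots> = (\<Sum>l\<le>k. gc S z k l * z l i)"
    unfolding lessThan_Suc_atMost[symmetric] sum.lessThan_Suc by simp
  finally show ?case .
qed

lemma gs_orth_aux:
  assumes "finite S" shows "\<forall>j<k. ip S (gs S z k) (gs S z j) = 0"
proof (induction k rule: less_induct)
  case (less k)
  show ?case
  proof (intro allI impI)
    fix j assume j: "j < k"
    define h where "h = gs S z"
    define r where "r = gsr S z k"
    have hk: "h k = (%i. z k i - (\<Sum>l<k. r l * h l i))"
      unfolding h_def r_def by (rule gs.simps)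
    have ho: "ip S (h l) (h j) = 0" if "l < k" "l ~= j" for l
      using less[of l] less[of j] that j ip_sym[of S "h l" "h j"]
      unfolding h_def by (metis linorder_neqE_nat)
    have "ip S (h k) (h j) = ip S (z k) (h j) - (\<Sum>l<k. r l * ip S (h l) (h j))"
      by (subst hk) (simp only: ip_diff_left ip_sum_left ip_scale_left)
    also have "(\<Sum>l<k. r l * ip S (h l) (h j)) = (\<Sum>l<k. if l = j then r j * ip S (h j) (h j) else 0)"
      by (rule sum.cong) (simp_all add: ho)
    also have "\<dots> = r j * ip S (h j) (h j)"
      using j by simp
    \<comment> \<open>If \<open>h j\<close> vanishes on \<open>S\<close>, both sides are zero,
      whatever the quotient in \<open>r j\<close>.\<close>
    also have "\<dots> = ip S (z k) (h j)"
    proof (cases "ip S (h j) (h j) = 0")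
      case True
      then have "ip S (h j) (z k) = 0"
        using assms by (intro ip_zero_left) (simp add: ip_self_eq_0_iff)
      then show ?thesis using True ip_sym[of S "h j" "z k"] by simp
    qed (simp add: r_def h_def)
    finally show "ip S (gs S z k) (gs S z j) = 0" by (simp add: h_def)
  qed
qed

lemma gs_orth:
  assumes "finite S" "j ~= k" shows "ip S (gs S z k) (gs S z j) = 0"
  using gs_orth_aux[OF assms(1), of k z] gs_orth_aux[OF assms(1), of j z] assms(2)
  by (cases j k rule: linorder_cases) (auto simp: ip_sym)

text \<open>The transition between the two families is unit triangular, so their initial segments
  have the same span.\<close>

lemma orth_gs_iff: "(\<forall>j<k. ip S x (gs S z j) = 0) \<longleftrightarrow> (\<forall>j<k. ip S x (z j) = 0)"
proof -
  have eq: "ip S x (z j) = ip S x (gs S z j) + (\<Sum>l<j. gsr S z j l * ip S x (gs S z l))" for j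
  proof -
    have "ip S x (z j) = ip S x (%i. gs S z j i + (\<Sum>l<j. gsr S z j l * gs S z l i))"
      by (rule ip_cong) (use z_eq_gs in auto)
    then show ?thesis by (simp only: ip_add_right ip_sum_right ip_scale_right)
  qed
  show ?thesis
  proof (induction k)
    case (Suc k)
    have "ip S x (z k) = ip S x (gs S z k)" if "\<forall>j<k. ip S x (gs S z j) = 0"
      using that by (simp add: eq[of k])
    then show ?case using Suc by (auto simp: less_Suc_eq)
  qed simp
qed

lemma gs_orth_z:
  assumes "finite S" "j < k" shows "ip S (gs S z k) (z j) = 0"
  using orth_gs_iff[of k S "gs S z k" z] gs_orth[OF assms(1)] assms(2) by auto

lemma span_gs: "\<exists>d. \<forall>i. (\<Sum>l<k. a l * z l i) = (\<Sum>l<k. d l * gs S z l i)"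
proof (induction k)
  case (Suc k)
  then obtain d where d: "\<And>i. (\<Sum>l<k. a l * z l i) = (\<Sum>l<k. d l * gs S z l i)" by auto
  show ?case
  proof (intro exI allI)
    fix i
    have "(\<Sum>l<Suc k. a l * z l i) = (\<Sum>l<k. d l * gs S z l i) + a k * (gs S z k i + (\<Sum>j<k. gsr S z k j * gs S z j i))"
      using d z_eq_gs[of z k i S] by simp
    also have "\<dots> = (\<Sum>l<Suc k. (if l = k then a k else d l + a k * gsr S z k l) * gs S z l i)"
      by (simp add: algebra_simps sum.distrib sum_distrib_left)
    finally show "(\<Sum>l<Suc k. a l * z l i) = (\<Sum>l<Suc k. (if l = k then a k else d l + a k * gsr S z k l) * gs S z l i)" .
  qed
qed simp

text \<open>The normal equations characterise the residual. Equality is claimed in all coordinates,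
  not just in \<open>S\<close>, because the values outside \<open>S\<close> enter the optimality
  conditions; it rests on uniqueness of the coefficients, which \<open>nz\<close> provides.\<close>

lemma gs_unique:
  assumes S: "finite S" and s: "\<And>i. s i = z k i + (\<Sum>l<k. a l * z l i)"
    and orth: "\<And>l. l < k ==> ip S s (z l) = 0"
    and nz: "\<And>l. l < k ==> \<exists>i\<in>S. gs S z l i ~= 0"
  shows "s = gs S z k"
proof -
  obtain d where d: "\<And>i. (\<Sum>l<k. a l * z l i) = (\<Sum>l<k. d l * gs S z l i)"
    using span_gs[where a = a and z = z and k = k and S = S] by auto
  define c where "c l = gsr S z k l + d l" for l
  define h where "h = gs S z"
  have s_eq: "s = (%i. h k i + (\<Sum>l<k. c l * h l i))"
  proof
    fix i
    have "(\<Sum>l<k. c l * h l i) = (\<Sum>l<k. gsr S z k l * gs S z l i) + (\<Sum>l<k. d l * gs S z l i)"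
      by (simp only: c_def h_def distrib_right sum.distrib)
    then show "s i = h k i + (\<Sum>l<k. c l * h l i)"
      using s[of i] d[of i] z_eq_gs[of z k i S] unfolding h_def by linarith
  qed
  have ho: "ip S (h i) (h j) = 0" if "i ~= j" for i j
    using gs_orth[OF S] that unfolding h_def by metis
  have orth': "\<forall>l<k. ip S s (h l) = 0"
    unfolding h_def orth_gs_iff using orth by simp
  have c0: "c l = 0" if l: "l < k" for l
  proof -
    have "0 = ip S s (h l)" using orth' l by simp
    also have "\<dots> = ip S (h k) (h l) + (\<Sum>j<k. c j * ip S (h j) (h l))"
      by (subst s_eq) (simp only: ip_add_left ip_sum_left ip_scale_left)
    also have "(\<Sum>j<k. c j * ip S (h j) (h l)) = (\<Sum>j<k. if j = l then c l * ip S (h l) (h l) else 0)"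
      by (rule sum.cong) (simp_all add: ho)
    also have "ip S (h k) (h l) + \<dots> = c l * ip S (h l) (h l)"
      using l by (simp add: ho)
    finally have "c l * ip S (h l) (h l) = 0" by (rule sym)
    moreover have "ip S (h l) (h l) ~= 0"
      using nz[OF l] ip_self_eq_0_iff[OF S, of "h l"] unfolding h_def by simp
    ultimately show ?thesis by simp
  qed
  show ?thesis
    using s_eq c0 unfolding h_def[symmetric] by simp
qed

text \<open>\<open>a\<close> is the residual of the coordinate vector at \<open>i\<close> after
  projection onto the family \<open>b\<close>, and its squared norm is the gap in Bessel's
  inequality. Summed over \<open>i\<close>, this involves the trace of a projection, from which the
  dimension counts below are obtained.\<close>

lemma bessel_coordinate:
  fixes m :: nat
  assumes S: "finite S" and i: "i \<in> S"
    and orth: "\<And>j l. j < m ==> l < m ==> j ~= l ==> ip S (b j) (b l) = 0"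
  defines "a \<equiv> %x. (if x = i then 1 else 0) - (\<Sum>j<m. b j i / ip S (b j) (b j) * b j x)"
  shows "\<forall>j<m. ip S a (b j) = 0" and "ip S a a = 1 - (\<Sum>j<m. (b j i)\<^sup>2 / ip S (b j) (b j))"
proof -
  have e: "ip S (%x. if x = i then 1 else 0) y = y i" for y
    using S i by (simp add: ip_def if_distrib[where f="%u. u * _"] cong: if_cong)
  have ao: "ip S a (b j) = 0" if j: "j < m" for j
  proof -
    have "ip S a (b j) = b j i - (\<Sum>l<m. b l i / ip S (b l) (b l) * ip S (b l) (b j))"
      unfolding a_def by (simp only: ip_diff_left ip_sum_left ip_scale_left e)
    also have "(\<Sum>l<m. b l i / ip S (b l) (b l) * ip S (b l) (b j)) =
       (\<Sum>l<m. if l = j then b j i / ip S (b j) (b j) * ip S (b j) (b j) else 0)"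
      by (rule sum.cong) (use orth j in auto)
    also have "\<dots> = b j i / ip S (b j) (b j) * ip S (b j) (b j)"
      using j by (subst sum.delta) auto
    also have "b j i - \<dots> = 0"
      using i ip_self_eq_0_iff[OF S, of "b j"] by auto
    finally show ?thesis .
  qed
  then show "\<forall>j<m. ip S a (b j) = 0" by blast
  have "ip S a a = ip S a (%x. if x = i then 1 else 0) - (\<Sum>j<m. b j i / ip S (b j) (b j) * ip S a (b j))"
    by (subst (2) a_def) (simp only: ip_diff_right ip_sum_right ip_scale_right)
  also have "\<dots> = a i" using ao e[of a] ip_sym[of S a "%x. if x = i then 1 else 0"] by simp
  finally show "ip S a a = 1 - (\<Sum>j<m. (b j i)\<^sup>2 / ip S (b j) (b j))"
    by (simp add: a_def power2_eq_square)
qed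

text \<open>Otherwise every coordinate vector would have a zero Bessel gap; adding these up over
  \<open>S\<close> gives \<open>card S \<le> m\<close>.\<close>

lemma ex_orth_vector:
  assumes S: "finite S" and m: "m < card S"
    and orth: "\<And>j l. j < m ==> l < m ==> j ~= l ==> ip S (b j) (b l) = 0"
  shows "\<exists>a. (\<exists>i\<in>S. a i ~= 0) \<and> (\<forall>j<m. ip S a (b j) = 0)"
proof (rule ccontr)
  assume c: "\<not> ?thesis"
  have "(\<Sum>j<m. (b j i)\<^sup>2 / ip S (b j) (b j)) = 1" if i: "i \<in> S" for i
  proof -
    define a where "a \<equiv> %x. (if x = i then 1 else 0) - (\<Sum>j<m. b j i / ip S (b j) (b j) * b j x)"
    have "\<forall>j<m. ip S a (b j) = 0" "ip S a a = 1 - (\<Sum>j<m. (b j i)\<^sup>2 / ip S (b j) (b j))"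
      using bessel_coordinate[OF S i, of m b] orth unfolding a_def by auto
    moreover from this c have "\<forall>i\<in>S. a i = 0" by blast
    ultimately show ?thesis using ip_self_eq_0_iff[OF S, of a] by auto
  qed
  then have "real (card S) = (\<Sum>i\<in>S. \<Sum>j<m. (b j i)\<^sup>2 / ip S (b j) (b j))" by simp
  also have "\<dots> = (\<Sum>j<m. ip S (b j) (b j) / ip S (b j) (b j))"
    by (subst sum.swap) (simp add: ip_def power2_eq_square sum_divide_distrib[symmetric])
  also have "\<dots> \<le> (\<Sum>j<m. 1)"
    by (rule sum_mono) simp
  finally show False using m by simp
qed

text \<open>The same trace read the other way: each member of the family contributes 1 to it, and
  each coordinate at most 1.\<close>

lemma orth_family_card_le:
  assumes S: "finite S"
    and orth: "\<And>j l. j < m ==> l < m ==> j ~= l ==> ip S (b j) (b l) = 0"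
    and nz: "\<And>j. j < m ==> \<exists>i\<in>S. b j i ~= 0"
  shows "m \<le> card S"
proof -
  have nz': "ip S (b j) (b j) ~= 0" if "j < m" for j
    using nz[OF that] ip_self_eq_0_iff[OF S, of "b j"] by simp
  have "real m = (\<Sum>j<m. ip S (b j) (b j) / ip S (b j) (b j))"
    using nz' by simp
  also have "\<dots> = (\<Sum>i\<in>S. \<Sum>j<m. (b j i)\<^sup>2 / ip S (b j) (b j))"
    by (subst sum.swap) (simp add: ip_def power2_eq_square sum_divide_distrib[symmetric])
  also have "\<dots> \<le> (\<Sum>i\<in>S. 1)"
  proof (rule sum_mono)
    fix i assume i: "i \<in> S"
    show "(\<Sum>j<m. (b j i)\<^sup>2 / ip S (b j) (b j)) \<le> 1"
      using bessel_coordinate(2)[OF S i, of m b] orth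
        ip_self_nonneg[of S "%x. (if x = i then 1 else 0) - (\<Sum>j<m. b j i / ip S (b j) (b j) * b j x)"]
      by auto
  qed
  finally show ?thesis by simp
qed

lemma orth_basis_complete:
  assumes S: "finite S" and m: "card S \<le> m"
    and orth: "\<And>j l. j < m ==> l < m ==> j ~= l ==> ip S (b j) (b l) = 0"
    and nz: "\<And>j. j < m ==> \<exists>i\<in>S. b j i ~= 0"
    and x: "\<And>j. j < m ==> ip S x (b j) = 0" and i: "i \<in> S"
  shows "x i = 0"
proof (rule ccontr)
  assume xi: "x i ~= 0"
  have "Suc m \<le> card S"
  proof (rule orth_family_card_le[OF S, of "Suc m" "b(m := x)"])
    fix j l assume "j < Suc m" "l < Suc m" "j ~= l"
    then show "ip S ((b(m := x)) j) ((b(m := x)) l) = 0"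
      using orth[of j l] x[of l] x[of j, unfolded ip_sym[of S x "b j"]] by (auto simp: less_Suc_eq)
  next
    fix j assume "j < Suc m"
    then show "\<exists>i\<in>S. (b(m := x)) j i ~= 0"
      using nz[of j] xi i by (auto simp: less_Suc_eq)
  qed
  then show False using m by simp
qed

text \<open>Gram-Schmidt consists of inner products on \<open>S\<close> and linear combinations, and
  a reflection respects both.\<close>

lemma gs_hrefl:
  assumes S: "finite S" shows "gs S (%k. hrefl S a (z k)) k = hrefl S a (gs S z k)"
proof (induction k rule: less_induct)
  case (less k)
  let ?w = "%k. hrefl S a (z k)"
  have "gs S ?w k = (%i. ?w k i - (\<Sum>j<k. gsr S ?w k j * gs S ?w j i))"
    by (rule gs.simps)
  also have "\<dots> = (%i. ?w k i - (\<Sum>j<k. gsr S z k j * hrefl S a (gs S z j) i))"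
    using less ip_hrefl[OF S] by auto
  also have "\<dots> = hrefl S a (%i. z k i - (\<Sum>j<k. gsr S z k j * gs S z j i))"
    by (simp only: hrefl_diff hrefl_sum[OF finite_lessThan] hrefl_scale)
  also have "(%i. z k i - (\<Sum>j<k. gsr S z k j * gs S z j i)) = gs S z k"
    by (rule gs.simps[symmetric])
  finally show ?case .
qed

text \<open>On \<open>S\<close> the vector \<open>z 0\<close> is supported at \<open>i0\<close>, so
  that projecting it out erases the coordinate \<open>i0\<close> and orthogonalisation goes on as on
  \<open>V\<close>. Outside \<open>S\<close> the erasing leaves a trace, namely a multiple of
  \<open>z 0\<close>.\<close>

lemma gs_eliminate_coordinate:
  assumes S: "finite S" "i0 \<in> S" and V: "V = S - {i0}"
    and z0: "\<And>i. i \<in> V ==> z 0 i = 0" "z 0 i0 ~= 0"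
  shows "gs S z (Suc k) = (%i. gs V (%k. z (Suc k)) k i - gs V (%k. z (Suc k)) k i0 / z 0 i0 * z 0 i)"
proof (induction k rule: less_induct)
  case (less k)
  let ?h = "gs V (%k. z (Suc k))"
  have SV: "ip S x y = x i0 * y i0 + ip V x y" for x y
    using S by (simp add: ip_def V sum.remove[OF S])
  have hV: "gs S z (Suc j) i = ?h j i" if "j < k" "i \<in> V" for i j
    unfolding less[OF that(1)] using z0(1)[OF that(2)] by simp
  have h0: "gs S z (Suc j) i0 = 0" if "j < k" for j
    unfolding less[OF that(1)] using z0(2) by simp
  have g: "ip S x (gs S z (Suc j)) = ip V x (?h j)" if "j < k" for x j
    unfolding SV h0[OF that] using hV[OF that] by (simp cong: ip_cong)
  have g': "ip S (gs S z (Suc j)) (gs S z (Suc j)) = ip V (?h j) (?h j)" if "j < k" for j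
    unfolding SV h0[OF that] using hV[OF that] by (simp cong: ip_cong)
  have r0: "ip S (z (Suc k)) (z 0) / ip S (z 0) (z 0) = z (Suc k) i0 / z 0 i0"
  proof -
    have "ip V x (z 0) = 0" for x using z0 by (subst ip_sym, intro ip_zero_left) auto
    then show ?thesis using z0 by (simp add: SV)
  qed
  show ?case
  proof
    fix i
    have "gs S z (Suc k) i = z (Suc k) i - z (Suc k) i0 / z 0 i0 * z 0 i -
      (\<Sum>j<k. ip V (z (Suc k)) (?h j) / ip V (?h j) (?h j) * (?h j i - ?h j i0 / z 0 i0 * z 0 i))"
      (is "_ = _ - ?s")
    proof -
      have "gs S z (Suc k) i = z (Suc k) i - (\<Sum>j<Suc k. gsr S z (Suc k) j * gs S z j i)"
        by (simp only: gs.simps[of S z "Suc k"])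
      also have "(\<Sum>j<Suc k. gsr S z (Suc k) j * gs S z j i) =
          z (Suc k) i0 / z 0 i0 * z 0 i + (\<Sum>j<k. gsr S z (Suc k) (Suc j) * gs S z (Suc j) i)"
        by (simp only: sum.lessThan_Suc_shift gs_0 r0)
      also have "(\<Sum>j<k. gsr S z (Suc k) (Suc j) * gs S z (Suc j) i) = ?s"
        by (rule sum.cong) (use g g' less in \<open>auto simp del: times_divide_eq_left\<close>)
      finally show ?thesis by simp
    qed
    also have "\<dots> = ?h k i - ?h k i0 / z 0 i0 * z 0 i"
      unfolding gs.simps[of V "%k. z (Suc k)" k]
      by (simp add: algebra_simps sum_subtractf sum_distrib_left diff_divide_distrib sum_divide_distrib)
    finally show "gs S z (Suc k) i = ?h k i - ?h k i0 / z 0 i0 * z 0 i" .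
  qed
qed

subsection \<open>Standard Gaussian product measures\<close>

abbreviation gauss :: "real measure" where "gauss \<equiv> std_normal_distribution"

definition Gam :: "'i set => ('i => real) measure" where
  "Gam I = PiM I (%_. gauss)"

lemma prob_space_std_normal: "prob_space gauss"
  by (rule prob_space_normal_density) simp

lemma product_prob_space_std_normal: "product_prob_space (%_. gauss)"
  by (intro product_prob_spaceI prob_space_std_normal)

lemma product_sigma_finite_std_normal: "product_sigma_finite (%_. gauss)"
  using product_prob_space_std_normal product_prob_space.axioms(1) by blast

lemma prob_space_Gam: "prob_space (Gam I)"
  unfolding Gam_def by (intro prob_space_PiM prob_space_std_normal)

lemma sets_Gam [measurable_cong, simp]: "sets (Gam I) = sets (PiM I (%_. borel))"
  unfolding Gam_def by (intro sets_PiM_cong) auto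

lemma space_Gam [simp]: "space (Gam I) = (\<Pi>\<^sub>E i\<in>I. UNIV)"
  unfolding Gam_def by (simp add: space_PiM)

lemma Gam_component_measurable: "i \<in> I ==> (%x. x i) \<in> borel_measurable (Gam I)"
  by (simp add: measurable_cong_sets[OF sets_Gam refl])

definition mpres :: "'b measure => ('b => 'b) => bool" where
  "mpres M T \<longleftrightarrow> T \<in> M \<rightarrow>\<^sub>M M \<and> distr M M T = M"

lemma mpres_measurable: "mpres M T ==> T \<in> M \<rightarrow>\<^sub>M M"
  by (simp add: mpres_def)

lemma mpres_distr: "mpres M T ==> f \<in> M \<rightarrow>\<^sub>M N ==> distr M N (%x. f (T x)) = distr M N f"
  using distr_distr[of f M N T M] by (simp add: mpres_def comp_def)

lemma mpres_comp: "mpres M S ==> mpres M T ==> mpres M (%x. S (T x))"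
  using mpres_distr[of M T S M] measurable_comp[of T M M S M] by (simp add: mpres_def comp_def)

lemma mpresI:
  assumes T: "T \<in> M \<rightarrow>\<^sub>M M"
    and eq: "\<And>f. f \<in> borel_measurable M ==> (\<integral>\<^sup>+x. f (T x) \<partial>M) = (\<integral>\<^sup>+x. f x \<partial>M)"
  shows "mpres M T"
  unfolding mpres_def
proof (intro conjI T measure_eqI)
  fix A assume "A \<in> sets (distr M M T)"
  then have A: "A \<in> sets M" by simp
  have "emeasure (distr M M T) A = (\<integral>\<^sup>+x. indicator A x \<partial>distr M M T)" using A by simp
  also have "\<dots> = (\<integral>\<^sup>+x. indicator A (T x) \<partial>M)"
    using A T by (intro nn_integral_distr) auto
  also have "\<dots> = (\<integral>\<^sup>+x. indicator A x \<partial>M)" using A by (intro eq) auto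
  finally show "emeasure (distr M M T) A = emeasure M A" using A by simp
qed simp

lemma nn_integral_lborel_shear_fst:
  fixes K :: "real \<times> real => ennreal"
  assumes [measurable]: "K \<in> borel_measurable (borel \<Otimes>\<^sub>M borel)"
  shows "(\<integral>\<^sup>+z. K (fst z + alpha * snd z, snd z) \<partial>(lborel \<Otimes>\<^sub>M lborel)) = (\<integral>\<^sup>+z. K z \<partial>(lborel \<Otimes>\<^sub>M lborel))"
proof -
  have "(\<integral>\<^sup>+z. K (fst z + alpha * snd z, snd z) \<partial>(lborel \<Otimes>\<^sub>M lborel)) =
      (\<integral>\<^sup>+y. \<integral>\<^sup>+x. K (x + alpha * y, y) \<partial>lborel \<partial>lborel)"
    by (subst lborel_pair.nn_integral_snd[symmetric]) auto
  also have "\<dots> = (\<integral>\<^sup>+y. \<integral>\<^sup>+x. K (x, y) \<partial>lborel \<partial>lborel)"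
  proof (rule nn_integral_cong)
    fix y :: real
    show "(\<integral>\<^sup>+x. K (x + alpha * y, y) \<partial>lborel) = (\<integral>\<^sup>+x. K (x, y) \<partial>lborel)"
      using nn_integral_real_affine[of "%x. K (x, y)" 1 "alpha * y"] by (simp add: add.commute)
  qed
  also have "\<dots> = (\<integral>\<^sup>+z. K z \<partial>(lborel \<Otimes>\<^sub>M lborel))"
    by (subst lborel_pair.nn_integral_snd[symmetric]) auto
  finally show ?thesis .
qed

lemma nn_integral_lborel_shear_snd:
  fixes K :: "real \<times> real => ennreal"
  assumes [measurable]: "K \<in> borel_measurable (borel \<Otimes>\<^sub>M borel)"
  shows "(\<integral>\<^sup>+z. K (fst z, snd z + beta * fst z) \<partial>(lborel \<Otimes>\<^sub>M lborel)) = (\<integral>\<^sup>+z. K z \<partial>(lborel \<Otimes>\<^sub>M lborel))"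
proof -
  have "(\<integral>\<^sup>+z. K (fst z, snd z + beta * fst z) \<partial>(lborel \<Otimes>\<^sub>M lborel)) =
      (\<integral>\<^sup>+x. \<integral>\<^sup>+y. K (x, y + beta * x) \<partial>lborel \<partial>lborel)"
    by (subst lborel.nn_integral_fst[symmetric]) auto
  also have "\<dots> = (\<integral>\<^sup>+x. \<integral>\<^sup>+y. K (x, y) \<partial>lborel \<partial>lborel)"
  proof (rule nn_integral_cong)
    fix x :: real
    show "(\<integral>\<^sup>+y. K (x, y + beta * x) \<partial>lborel) = (\<integral>\<^sup>+y. K (x, y) \<partial>lborel)"
      using nn_integral_real_affine[of "%y. K (x, y)" 1 "beta * x"] by (simp add: add.commute)
  qed
  also have "\<dots> = (\<integral>\<^sup>+z. K z \<partial>(lborel \<Otimes>\<^sub>M lborel))"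
    by (subst lborel.nn_integral_fst[symmetric]) auto
  finally show ?thesis .
qed

text \<open>A rotation is the composition of three shears, each of which preserves Lebesgue measure.\<close>

lemma nn_integral_std_normal_rotation:
  fixes F :: "real \<times> real => ennreal"
  assumes [measurable]: "F \<in> borel_measurable (borel \<Otimes>\<^sub>M borel)"
    and cs: "c\<^sup>2 + s\<^sup>2 = 1" "s ~= 0"
  shows "(\<integral>\<^sup>+x. \<integral>\<^sup>+y. F (c * x + s * y, - s * x + c * y) \<partial>gauss \<partial>gauss)
    = (\<integral>\<^sup>+x. \<integral>\<^sup>+y. F (x, y) \<partial>gauss \<partial>gauss)"
proof -
  \<comment> \<open>The tangent of half the angle: shears by \<open>alpha\<close>,
    \<open>- s\<close> and \<open>alpha\<close> compose to the rotation.\<close>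
  define alpha where "alpha = (1 - c) / s"
  define p where "p z = ennreal (std_normal_density (fst z) * std_normal_density (snd z))" for z :: "real \<times> real"
  have [measurable]: "p \<in> borel_measurable (borel \<Otimes>\<^sub>M borel)" unfolding p_def by measurable
  have conv: "(\<integral>\<^sup>+x. \<integral>\<^sup>+y. H (x, y) \<partial>gauss \<partial>gauss) =
      (\<integral>\<^sup>+z. p z * H z \<partial>(lborel \<Otimes>\<^sub>M lborel))"
    if [measurable]: "H \<in> borel_measurable (borel \<Otimes>\<^sub>M borel)" for H :: "real \<times> real => ennreal"
  proof -
    have "(\<integral>\<^sup>+x. \<integral>\<^sup>+y. H (x, y) \<partial>gauss \<partial>gauss) =
       (\<integral>\<^sup>+x. \<integral>\<^sup>+y. p (x, y) * H (x, y) \<partial>lborel \<partial>lborel)"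
      by (simp add: nn_integral_density p_def ennreal_mult' nn_integral_cmult[symmetric] mult.assoc)
    also have "\<dots> = (\<integral>\<^sup>+z. p z * H z \<partial>(lborel \<Otimes>\<^sub>M lborel))"
      by (subst lborel.nn_integral_fst[symmetric]) auto
    finally show ?thesis .
  qed
  let ?rot = "%z. (c * fst z + s * snd z, - s * fst z + c * snd z)"
  have prot: "p (?rot z) = p z" for z
  proof -
    have "(c * fst z + s * snd z)\<^sup>2 + (- s * fst z + c * snd z)\<^sup>2 = (c\<^sup>2 + s\<^sup>2) * ((fst z)\<^sup>2 + (snd z)\<^sup>2)"
      by (simp add: power2_eq_square algebra_simps)
    moreover have "std_normal_density a * std_normal_density b = (1 / sqrt (2 * pi))\<^sup>2 * exp (- ((a\<^sup>2 + b\<^sup>2) / 2))" for a b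
    proof -
      have "exp (- a\<^sup>2 / 2) * exp (- b\<^sup>2 / 2) = exp (- ((a\<^sup>2 + b\<^sup>2) / 2))"
        by (simp add: exp_add[symmetric] add_divide_distrib)
      moreover have "(r * u) * (r * v) = r\<^sup>2 * (u * v)" for r u v :: real
        by (simp add: power2_eq_square)
      ultimately show ?thesis by (simp only: std_normal_density_def)
    qed
    ultimately show ?thesis using cs(1) by (simp only: p_def fst_conv snd_conv) simp
  qed
  define K where "K z = p z * F z" for z
  have [measurable]: "K \<in> borel_measurable (borel \<Otimes>\<^sub>M borel)" unfolding K_def by measurable
  define K1 where "K1 z = K (fst z + alpha * snd z, snd z)" for z
  have [measurable]: "K1 \<in> borel_measurable (borel \<Otimes>\<^sub>M borel)" unfolding K1_def by measurable
  define K2 where "K2 z = K1 (fst z, snd z + (- s) * fst z)" for z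
  have [measurable]: "K2 \<in> borel_measurable (borel \<Otimes>\<^sub>M borel)" unfolding K2_def by measurable
  have rot: "K2 (fst z + alpha * snd z, snd z) = K (?rot z)" for z
  proof -
    have 1: "snd z + (- s) * (fst z + alpha * snd z) = - s * fst z + c * snd z"
      using cs by (simp add: alpha_def field_simps)
    have "alpha * (1 + c) = s" "alpha * s = 1 - c"
      using cs by (simp_all add: alpha_def field_simps power2_eq_square)
    moreover have "alpha * snd z + alpha * (- s * fst z + c * snd z) = alpha * (1 + c) * snd z - (alpha * s) * fst z"
      by (simp add: algebra_simps)
    ultimately have 2: "fst z + alpha * snd z + alpha * (- s * fst z + c * snd z) = c * fst z + s * snd z"
      by (simp add: left_diff_distrib)
    show ?thesis unfolding K2_def K1_def fst_conv snd_conv 1 2 ..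
  qed
  have "(\<integral>\<^sup>+x. \<integral>\<^sup>+y. F (c * x + s * y, - s * x + c * y) \<partial>gauss \<partial>gauss)
      = (\<integral>\<^sup>+z. p z * F (?rot z) \<partial>(lborel \<Otimes>\<^sub>M lborel))"
    using conv[of "%z. F (?rot z)"] by simp
  also have "\<dots> = (\<integral>\<^sup>+z. K2 (fst z + alpha * snd z, snd z) \<partial>(lborel \<Otimes>\<^sub>M lborel))"
    by (simp only: rot K_def prot)
  also have "\<dots> = (\<integral>\<^sup>+z. K z \<partial>(lborel \<Otimes>\<^sub>M lborel))"
  proof -
    have "(\<integral>\<^sup>+z. K2 (fst z + alpha * snd z, snd z) \<partial>(lborel \<Otimes>\<^sub>M lborel)) = (\<integral>\<^sup>+z. K2 z \<partial>(lborel \<Otimes>\<^sub>M lborel))"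
      by (rule nn_integral_lborel_shear_fst) simp
    also have "\<dots> = (\<integral>\<^sup>+z. K1 z \<partial>(lborel \<Otimes>\<^sub>M lborel))"
      unfolding K2_def by (rule nn_integral_lborel_shear_snd) simp
    also have "\<dots> = (\<integral>\<^sup>+z. K z \<partial>(lborel \<Otimes>\<^sub>M lborel))"
      unfolding K1_def by (rule nn_integral_lborel_shear_fst) simp
    finally show ?thesis .
  qed
  also have "\<dots> = (\<integral>\<^sup>+x. \<integral>\<^sup>+y. F (x, y) \<partial>gauss \<partial>gauss)"
    unfolding K_def by (rule conv[symmetric]) simp
  finally show ?thesis .
qed

lemma nn_integral_std_normal_uminus:
  assumes [measurable]: "f \<in> borel_measurable borel"
  shows "(\<integral>\<^sup>+x. f (- x) \<partial>gauss) = (\<integral>\<^sup>+x. f x \<partial>gauss)"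
proof -
  have "(\<integral>\<^sup>+x. f (- x) \<partial>gauss) = (\<integral>\<^sup>+x. std_normal_density (- x) * f (- x) \<partial>lborel)"
    by (simp add: nn_integral_density std_normal_density_def)
  also have "\<dots> = (\<integral>\<^sup>+x. std_normal_density x * f x \<partial>lborel)"
    using nn_integral_real_affine[of "%x. std_normal_density x * f x" "-1" 0] by simp
  finally show ?thesis by (simp add: nn_integral_density)
qed

section \<open>Plane rotations, sign changes and reflections of Gaussian vectors\<close>

definition givens :: "'i => 'i => real => real => ('i => real) => 'i => real" where
  "givens i j c s x = x(i := c * x i + s * x j, j := - s * x i + c * x j)"

lemma nn_integral_Gam_insert:
  assumes "finite I" "i \<notin> I" "f \<in> borel_measurable (Gam (insert i I))"
  shows "(\<integral>\<^sup>+x. f x \<partial>Gam (insert i I)) = (\<integral>\<^sup>+x. \<integral>\<^sup>+t. f (x(i := t)) \<partial>gauss \<partial>Gam I)"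
  using product_sigma_finite.product_nn_integral_insert[OF product_sigma_finite_std_normal assms(1,2)] assms(3)
  by (simp add: Gam_def)

lemma measurable_GamI:
  assumes "\<And>i. i \<in> I ==> (%x. f x i) \<in> borel_measurable M" "\<And>x. x \<in> space M ==> f x \<in> extensional I"
  shows "f \<in> M \<rightarrow>\<^sub>M Gam I"
proof -
  have "f \<in> M \<rightarrow>\<^sub>M PiM I (%_. borel)"
    using assms by (intro measurable_PiM_single') (auto simp: PiE_iff)
  then show ?thesis by (simp add: measurable_cong_sets[OF refl sets_Gam])
qed

lemma Gam_upd_measurable:
  assumes f: "f \<in> M \<rightarrow>\<^sub>M Gam I" and g: "g \<in> borel_measurable M"
  shows "(%x. (f x)(i := g x)) \<in> M \<rightarrow>\<^sub>M Gam (insert i I)"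
proof -
  have m: "(%x. f x k) \<in> borel_measurable M" if "k \<in> I" for k
    by (rule measurable_compose[OF f Gam_component_measurable[OF that]])
  have 1: "(%x. ((f x)(i := g x)) k) \<in> borel_measurable M" if k: "k \<in> insert i I" for k
  proof -
    have "(%x. ((f x)(i := g x)) k) = (if k = i then g else (%x. f x k))" by (rule ext) simp
    note eq = this
    show ?thesis
    proof (cases "k = i")
      case True
      show ?thesis unfolding trans[OF eq if_P[OF True]] by (rule g)
    next
      case False
      then have "k \<in> I" using k by blast
      show ?thesis unfolding trans[OF eq if_not_P[OF False]] by (rule m) fact
    qed
  qed
  have 2: "(f x)(i := g x) \<in> extensional (insert i I)" if "x \<in> space M" for x
    using measurable_space[OF f that] unfolding space_Gam PiE_iff extensional_def by simp
  show ?thesis by (rule measurable_GamI) (fact 1 2)+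
qed

text \<open>Fubini isolates the two coordinates that are rotated, and the planar case applies to
  them for fixed values of the others.\<close>

lemma mpres_givens:
  assumes A: "finite A" "i \<in> A" "j \<in> A" "i ~= j" and cs: "c\<^sup>2 + s\<^sup>2 = 1" "s ~= 0"
  shows "mpres (Gam A) (givens i j c s)"
proof (rule mpresI)
  have [measurable]: "(%x. x i) \<in> borel_measurable (Gam A)" "(%x. x j) \<in> borel_measurable (Gam A)"
    using A by (auto intro: Gam_component_measurable)
  have "(%x. x(i := c * x i + s * x j, j := - s * x i + c * x j)) \<in> Gam A \<rightarrow>\<^sub>M Gam (insert j (insert i A))"
    by (intro Gam_upd_measurable measurable_ident) measurable
  then show T: "givens i j c s \<in> Gam A \<rightarrow>\<^sub>M Gam A"
    using A by (simp add: givens_def[abs_def] insert_absorb)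
  fix f :: "('a => real) => ennreal" assume f: "f \<in> borel_measurable (Gam A)"
  define B where "B = A - {i, j}"
  have AB: "A = insert i (insert j B)" using A by (auto simp: B_def)
  have B: "finite B" "j \<notin> B" "i \<notin> insert j B" using A by (auto simp: B_def)
  have int: "(\<integral>\<^sup>+x. h x \<partial>Gam A) =
      (\<integral>\<^sup>+x. \<integral>\<^sup>+b. \<integral>\<^sup>+a. h (x(j := b, i := a)) \<partial>gauss \<partial>gauss \<partial>Gam B)"
    if h: "h \<in> borel_measurable (Gam A)" for h :: "('a => real) => ennreal"
  proof -
    have m: "(%z. h ((fst z)(i := snd z))) \<in> borel_measurable (Gam (insert j B) \<Otimes>\<^sub>M borel)"
      by (rule measurable_compose[OF _ h], unfold AB, rule Gam_upd_measurable) simp_all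
    have m2: "(%x. \<integral>\<^sup>+a. h (x(i := a)) \<partial>gauss) \<in> borel_measurable (Gam (insert j B))"
      using m by (intro sigma_finite_measure.borel_measurable_nn_integral[of gauss]
        prob_space_imp_sigma_finite prob_space_std_normal) (simp add: split_def cong: measurable_cong_sets)
    show ?thesis
      unfolding AB using nn_integral_Gam_insert[of "insert j B" i h] nn_integral_Gam_insert[OF B(1,2) m2] B h
      by (simp add: AB)
  qed
  have fT: "(%x. f (givens i j c s x)) \<in> borel_measurable (Gam A)"
    using measurable_compose[OF T f] .
  show "(\<integral>\<^sup>+x. f (givens i j c s x) \<partial>Gam A) = (\<integral>\<^sup>+x. f x \<partial>Gam A)"
    unfolding int[OF fT] int[OF f]
  proof (rule nn_integral_cong)
    fix x assume x: "x \<in> space (Gam B)"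
    have m: "(%z. f (x(j := fst z, i := snd z))) \<in> borel_measurable (borel \<Otimes>\<^sub>M borel)"
      by (rule measurable_compose[OF _ f], unfold AB, intro Gam_upd_measurable) (use x in simp_all)
    \<comment> \<open>The coordinate at \<open>j\<close> is integrated in the outer position, so the
      pair is read in reverse order and the sign of \<open>s\<close> changes.\<close>
    have eq: "givens i j c s (x(j := b, i := a)) = x(j := c * b + (- s) * a, i := - (- s) * b + c * a)" for a b
      using A(4) by (intro ext) (simp add: givens_def)
    show "(\<integral>\<^sup>+b. \<integral>\<^sup>+a. f (givens i j c s (x(j := b, i := a))) \<partial>gauss \<partial>gauss) =
      (\<integral>\<^sup>+b. \<integral>\<^sup>+a. f (x(j := b, i := a)) \<partial>gauss \<partial>gauss)"
      unfolding eq using nn_integral_std_normal_rotation[OF m, of c "- s"] cs by simp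
  qed
qed

lemma mpres_flip:
  assumes A: "finite A" "i \<in> A"
  shows "mpres (Gam A) (%x. x(i := - x i))"
proof (rule mpresI)
  show T: "(%x. x(i := - x i)) \<in> Gam A \<rightarrow>\<^sub>M Gam A"
    using Gam_upd_measurable[OF measurable_ident, of "%x. - x i" A i] A by (simp add: insert_absorb)
  fix f :: "('a => real) => ennreal" assume f: "f \<in> borel_measurable (Gam A)"
  define B where "B = A - {i}"
  have AB: "A = insert i B" "finite B" "i \<notin> B" using A by (auto simp: B_def)
  have fT: "(%x. f (x(i := - x i))) \<in> borel_measurable (Gam A)"
    using measurable_compose[OF T f] .
  have "(\<integral>\<^sup>+x. f (x(i := - x i)) \<partial>Gam A) = (\<integral>\<^sup>+x. \<integral>\<^sup>+t. f (x(i := - t)) \<partial>gauss \<partial>Gam B)"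
    using nn_integral_Gam_insert[OF AB(2,3), of "%x. f (x(i := - x i))"] fT AB(1) by simp
  also have "\<dots> = (\<integral>\<^sup>+x. \<integral>\<^sup>+t. f (x(i := t)) \<partial>gauss \<partial>Gam B)"
  proof (rule nn_integral_cong)
    fix x assume x: "x \<in> space (Gam B)"
    have "(%t. f (x(i := t))) \<in> borel_measurable borel"
      by (rule measurable_compose[OF _ f], unfold AB(1), intro Gam_upd_measurable) (use x in simp_all)
    then show "(\<integral>\<^sup>+t. f (x(i := - t)) \<partial>gauss) = (\<integral>\<^sup>+t. f (x(i := t)) \<partial>gauss)"
      by (rule nn_integral_std_normal_uminus)
  qed
  also have "\<dots> = (\<integral>\<^sup>+x. f x \<partial>Gam A)"
    using nn_integral_Gam_insert[OF AB(2,3), of f] f AB(1) by simp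
  finally show "(\<integral>\<^sup>+x. f (x(i := - x i)) \<partial>Gam A) = (\<integral>\<^sup>+x. f x \<partial>Gam A)" .
qed

lemma ip_givens:
  assumes A: "finite A" "i \<in> A" "j \<in> A" "i ~= j" and cs: "c\<^sup>2 + s\<^sup>2 = 1"
  shows "ip A (givens i j c s x) (givens i j c s y) = ip A x y"
proof -
  have sp: "ip A u v = u i * v i + (u j * v j + ip (A - {i} - {j}) u v)" for u v
    using A by (simp add: ip_def sum.remove[of A i] sum.remove[of "A - {i}" j])
  have "ip (A - {i} - {j}) (givens i j c s x) (givens i j c s y) = ip (A - {i} - {j}) x y"
    by (rule ip_cong) (auto simp: givens_def)
  moreover have "(c * x i + s * x j) * (c * y i + s * y j) + (- s * x i + c * x j) * (- s * y i + c * y j)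
     = (c\<^sup>2 + s\<^sup>2) * (x i * y i + x j * y j)"
    by (simp add: power2_eq_square algebra_simps)
  moreover have "givens i j c s u i = c * u i + s * u j" "givens i j c s u j = - s * u i + c * u j" for u
    using A(4) by (simp_all add: givens_def)
  ultimately show ?thesis using cs unfolding sp[of "givens i j c s x"] sp[of x] by simp
qed

lemma hrefl_givens:
  assumes A: "finite A" "i \<in> A" "j \<in> A" "i ~= j" and cs: "c\<^sup>2 + s\<^sup>2 = 1"
  shows "hrefl A (givens i j c s a) (givens i j c s x) = givens i j c s (hrefl A a x)"
proof
  fix k show "hrefl A (givens i j c s a) (givens i j c s x) k = givens i j c s (hrefl A a x) k"
    unfolding hrefl_def ip_givens[OF assms] using A
    by (simp add: givens_def algebra_simps add_divide_distrib diff_divide_distrib)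
qed

lemma givens_inverse:
  assumes "i ~= j" "c\<^sup>2 + s\<^sup>2 = 1"
  shows "givens i j c (- s) (givens i j c s x) = x"
proof -
  have *: "c * (c * t) + s * (s * t) = t" for t
    using assms(2) by (metis distrib_right mult.assoc mult_1 power2_eq_square)
  show ?thesis
  proof
    fix k show "givens i j c (- s) (givens i j c s x) k = x k"
      using assms(1) *[of "x i"] *[of "x j"] by (simp add: givens_def algebra_simps)
  qed
qed

text \<open>
  A plane rotation that kills one coordinate of the normal vector conjugates the reflection to one
  whose normal vector has smaller support; a reflection along an axis is a change of sign.
\<close>

lemma mpres_hrefl:
  assumes A: "finite A" shows "mpres (Gam A) (hrefl A a)"
proof (induction "card {i\<in>A. a i ~= 0}" arbitrary: a rule: less_induct)
  case less
  let ?B = "{i\<in>A. a i ~= 0}"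
  have fB: "finite ?B" using A by simp
  consider "?B = {}" | i where "?B = {i}" | i j where "i \<in> ?B" "j \<in> ?B" "i ~= j" by blast
  then show ?case
  proof cases
    case 1
    then have "a k = 0" if "k \<in> A" for k using that by auto
    then have "hrefl A a = (%x. x)" by (intro ext) (auto simp: hrefl_def)
    then show ?thesis by (simp add: mpres_def distr_id2)
  next
    case (2 i)
    then have i: "i \<in> A" "a i ~= 0" and z: "\<And>k. k \<in> A ==> k ~= i ==> a k = 0" by auto
    have "ip A x a = x i * a i" for x
      using A i z by (simp add: ip_def sum.remove[of A i])
    then have "hrefl A a = (%x. x(i := - x i))"
      using i z by (intro ext) (auto simp: hrefl_def)
    then show ?thesis using mpres_flip[OF A i(1)] by simp
  next
    case (3 i j)
    then have ij: "i \<in> A" "j \<in> A" "a i ~= 0" "a j ~= 0" by auto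
    define r where "r = sqrt ((a i)\<^sup>2 + (a j)\<^sup>2)"
    have r: "r > 0" "r\<^sup>2 = (a i)\<^sup>2 + (a j)\<^sup>2" using ij by (auto simp: r_def add_pos_pos)
    define c where "c = a i / r"
    define s where "s = a j / r"
    have cs: "c\<^sup>2 + s\<^sup>2 = 1" "s ~= 0" "c\<^sup>2 + (- s)\<^sup>2 = 1" "- s ~= 0"
    proof -
      have "c\<^sup>2 + s\<^sup>2 = ((a i)\<^sup>2 + (a j)\<^sup>2) / r\<^sup>2"
        by (simp add: c_def s_def power_divide add_divide_distrib)
      also have "\<dots> = 1" using r by (metis divide_self_if less_irrefl zero_less_power)
      finally show "c\<^sup>2 + s\<^sup>2 = 1" "c\<^sup>2 + (- s)\<^sup>2 = 1" by simp_all
      show "s ~= 0" "- s ~= 0" using r ij by (simp_all add: s_def)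
    qed
    have gj: "givens i j c s a j = 0" by (simp add: givens_def c_def s_def)
    have "{k \<in> A. givens i j c s a k ~= 0} \<subseteq> ?B - {j}"
      using gj ij by (auto simp: givens_def split: if_splits)
    then have "card {k \<in> A. givens i j c s a k ~= 0} \<le> card (?B - {j})"
      using fB by (intro card_mono) auto
    also have "\<dots> < card ?B" using fB ij by (intro card_Diff1_less) auto
    finally have IH: "mpres (Gam A) (hrefl A (givens i j c s a))" by (rule less)
    have "hrefl A a = (%x. givens i j c (- s) (hrefl A (givens i j c s a) (givens i j c s x)))"
      using hrefl_givens[OF A ij(1,2) 3(3) cs(1)] givens_inverse[OF 3(3) cs(1)] by simp
    moreover note mpres_comp[OF mpres_givens[OF A ij(1,2) 3(3) cs(3,4)]
        mpres_comp[OF IH mpres_givens[OF A ij(1,2) 3(3) cs(1,2)]]]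
    ultimately show ?thesis by simp
  qed
qed

subsection \<open>Uncurrying and linear combinations\<close>

lemma measurable_GamD:
  assumes "f \<in> M \<rightarrow>\<^sub>M Gam I" "i \<in> I" shows "(%x. f x i) \<in> borel_measurable M"
  by (rule measurable_compose[OF assms(1) Gam_component_measurable[OF assms(2)]])

text \<open>The bijection \<open>\<pi>\<close> lets the same statement serve for a matrix that is
  grouped by rows and for one that is grouped by columns.\<close>

lemma distr_uncurry:
  fixes A :: "'a set" and J :: "'b set" and I :: "'c set"
  assumes fin: "finite A" "finite J" and \<pi>: "bij_betw \<pi> I (A \<times> J)"
  shows uncurry_measurable: "(%x. \<lambda>k\<in>I. x (fst (\<pi> k)) (snd (\<pi> k))) \<in> PiM A (%_. Gam J) \<rightarrow>\<^sub>M Gam I"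
    and "distr (PiM A (%_. Gam J)) (Gam I) (%x. \<lambda>k\<in>I. x (fst (\<pi> k)) (snd (\<pi> k))) = Gam I"
proof -
  let ?u = "%x. \<lambda>k\<in>I. x (fst (\<pi> k)) (snd (\<pi> k))"
  let ?P = "PiM A (%_. Gam J)"
  have mem: "fst (\<pi> k) \<in> A" "snd (\<pi> k) \<in> J" if "k \<in> I" for k
    using bij_betw_apply[OF \<pi> that] by auto
  show u: "?u \<in> ?P \<rightarrow>\<^sub>M Gam I"
  proof (rule measurable_GamI)
    fix k assume k: "k \<in> I"
    have "(%x. x (fst (\<pi> k)) (snd (\<pi> k))) \<in> borel_measurable ?P"
      by (rule measurable_GamD[where f = "%x. x (fst (\<pi> k))", OF measurable_component_singleton])
        (use mem[OF k] in auto)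
    then show "(%x. ?u x k) \<in> borel_measurable ?P" using k by simp
  qed simp
  have finI: "finite I" using \<pi> fin bij_betw_finite by blast
  show "distr ?P (Gam I) ?u = Gam I"
    unfolding Gam_def[of I]
  proof (rule product_sigma_finite.PiM_eqI[OF product_sigma_finite_std_normal finI])
    fix C assume C: "\<And>k. k \<in> I ==> C k \<in> sets gauss"
    define rho where "rho = inv_into I \<pi>"
    have rho\<pi>: "rho (\<pi> k) = k" if "k \<in> I" for k
      using \<pi> that by (simp add: rho_def bij_betw_inv_into_left)
    have \<pi>rho: "\<pi> (rho q) = q" "rho q \<in> I" if "q \<in> A \<times> J" for q
      using \<pi> that inv_into_into[of q \<pi> I] bij_betw_imp_surj_on[OF \<pi>]
      by (simp_all add: rho_def bij_betw_inv_into_right)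
    have CI: "Pi\<^sub>E I C \<in> sets (Gam I)"
      unfolding Gam_def using finI C by (intro sets_PiM_I_finite) auto
    have vi: "?u -` Pi\<^sub>E I C \<inter> space ?P = (\<Pi>\<^sub>E i\<in>A. \<Pi>\<^sub>E j\<in>J. C (rho (i, j)))"
    proof (intro set_eqI iffI)
      fix x assume x: "x \<in> ?u -` Pi\<^sub>E I C \<inter> space ?P"
      have "x i j \<in> C (rho (i, j))" if "i \<in> A" "j \<in> J" for i j
        using x \<pi>rho[of "(i, j)"] that by (auto simp: PiE_iff)
      then show "x \<in> (\<Pi>\<^sub>E i\<in>A. \<Pi>\<^sub>E j\<in>J. C (rho (i, j)))"
        using x by (auto simp: PiE_iff space_PiM)
    next
      fix x assume x: "x \<in> (\<Pi>\<^sub>E i\<in>A. \<Pi>\<^sub>E j\<in>J. C (rho (i, j)))"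
      have "x (fst (\<pi> k)) (snd (\<pi> k)) \<in> C k" if "k \<in> I" for k
        using x mem[OF that] rho\<pi>[OF that] by (force simp: PiE_iff)
      then show "x \<in> ?u -` Pi\<^sub>E I C \<inter> space ?P"
        using x by (auto simp: PiE_iff space_PiM)
    qed
    have psG: "product_sigma_finite (%_::'a. Gam J)"
      by (simp add: product_sigma_finite_def prob_space_imp_sigma_finite prob_space_Gam)
    have C': "C (rho (i, j)) \<in> sets gauss" if "i \<in> A" "j \<in> J" for i j
      using C \<pi>rho[of "(i, j)"] that by auto
    have "emeasure (distr ?P (Gam I) ?u) (Pi\<^sub>E I C) = emeasure ?P (\<Pi>\<^sub>E i\<in>A. \<Pi>\<^sub>E j\<in>J. C (rho (i, j)))"
      using emeasure_distr[OF u CI] vi by simp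
    also have "\<dots> = (\<Prod>i\<in>A. emeasure (Gam J) (\<Pi>\<^sub>E j\<in>J. C (rho (i, j))))"
      using fin C' by (intro product_sigma_finite.emeasure_PiM[OF psG]) (auto simp: Gam_def intro!: sets_PiM_I_finite)
    also have "\<dots> = (\<Prod>i\<in>A. \<Prod>j\<in>J. emeasure gauss (C (rho (i, j))))"
    proof (rule prod.cong[OF refl])
      fix i assume "i \<in> A"
      then show "emeasure (Gam J) (\<Pi>\<^sub>E j\<in>J. C (rho (i, j))) = (\<Prod>j\<in>J. emeasure gauss (C (rho (i, j))))"
        unfolding Gam_def using fin C' by (intro product_sigma_finite.emeasure_PiM[OF product_sigma_finite_std_normal]) auto
    qed
    also have "\<dots> = (\<Prod>q\<in>A\<times>J. emeasure gauss (C (rho q)))"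
      by (simp add: prod.cartesian_product)
    also have "\<dots> = (\<Prod>k\<in>I. emeasure gauss (C (rho (\<pi> k))))"
      using prod.reindex_bij_betw[OF \<pi>, of "%q. emeasure gauss (C (rho q))"] by simp
    also have "\<dots> = (\<Prod>k\<in>I. emeasure gauss (C k))"
      using rho\<pi> by simp
    finally show "emeasure (distr ?P (PiM I (%_. gauss)) ?u) (Pi\<^sub>E I C) = \<dots>"
      by (simp add: Gam_def[of I])
  qed (simp add: Gam_def)
qed

text \<open>\<open>X\<close> is read as a matrix with rows in \<open>A\<close> and columns in
  \<open>J\<close>, and \<open>T\<close> acts on each column.\<close>

definition lift :: "'i set => 'j set => (('i => real) => 'i => real) => ('i \<times> 'j => real) => 'i \<times> 'j => real" where
  "lift A J T X = (\<lambda>k\<in>A \<times> J. T (\<lambda>i\<in>A. X (i, snd k)) (fst k))"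

text \<open>The columns are independent with law \<open>Gam A\<close>, and each of them is
  transformed separately.\<close>

lemma mpres_lift:
  assumes fin: "finite A" "finite J" and T: "mpres (Gam A) T"
  shows "mpres (Gam (A \<times> J)) (lift A J T)"
proof -
  let ?P = "PiM J (%_. Gam A)"
  define u where "u = (%x::'b => 'a => real. \<lambda>k\<in>A\<times>J. x (snd k) (fst k))"
  have bij: "bij_betw (%k. (snd k, fst k)) (A \<times> J) (J \<times> A)"
    by (rule bij_betwI[where g = "%k. (snd k, fst k)"]) auto
  have u: "u \<in> ?P \<rightarrow>\<^sub>M Gam (A \<times> J)" and du: "distr ?P (Gam (A \<times> J)) u = Gam (A \<times> J)"
    using distr_uncurry[OF fin(2,1) bij] by (simp_all add: u_def)
  have mT: "T \<in> Gam A \<rightarrow>\<^sub>M Gam A" using T by (rule mpres_measurable)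
  have ml: "lift A J T \<in> Gam (A \<times> J) \<rightarrow>\<^sub>M Gam (A \<times> J)"
  proof (rule measurable_GamI)
    fix k assume k: "k \<in> A \<times> J"
    have "(%X. \<lambda>i\<in>A. X (i, snd k)) \<in> Gam (A \<times> J) \<rightarrow>\<^sub>M Gam A"
    proof (rule measurable_GamI)
      fix i assume "i \<in> A"
      then show "(%X. (\<lambda>i\<in>A. X (i, snd k)) i) \<in> borel_measurable (Gam (A \<times> J))"
        using k Gam_component_measurable[of "(i, snd k)" "A \<times> J"] by auto
    qed simp
    from measurable_GamD[OF measurable_compose[OF this mT], of "fst k"]
    show "(%X. lift A J T X k) \<in> borel_measurable (Gam (A \<times> J))"
      using k by (auto simp: lift_def)
  qed (simp add: lift_def)
  have cT: "distr ?P ?P (compose J T) = ?P"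
    using distr_PiM_finite_prob_space'[OF fin(2), of "%_. Gam A" "%_. Gam A" T] mT T
    by (simp add: prob_space_Gam mpres_def)
  have mc: "compose J T \<in> ?P \<rightarrow>\<^sub>M ?P"
    unfolding compose_def
    by (rule measurable_restrict) (rule measurable_compose[OF _ mT], simp)
  have comm: "lift A J T (u x) = u (compose J T x)" if "x \<in> space ?P" for x
  proof
    fix k
    show "lift A J T (u x) k = u (compose J T x) k"
    proof (cases "k \<in> A \<times> J")
      case True
      then have e: "x (snd k) \<in> extensional A" using that by (auto simp: space_PiM PiE_iff)
      have "(\<lambda>i\<in>A. u x (i, snd k)) = x (snd k)"
        using True e by (intro ext) (auto simp: u_def extensional_def)
      then show ?thesis using True by (auto simp: lift_def u_def compose_def)
    qed (simp add: lift_def u_def)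
  qed
  have "distr (Gam (A \<times> J)) (Gam (A \<times> J)) (lift A J T) = distr ?P (Gam (A \<times> J)) (lift A J T \<circ> u)"
    by (subst du[symmetric]) (rule distr_distr[OF ml u])
  also have "\<dots> = distr ?P (Gam (A \<times> J)) (u \<circ> compose J T)"
    using comm by (intro distr_cong) auto
  also have "\<dots> = distr (distr ?P ?P (compose J T)) (Gam (A \<times> J)) u"
    by (rule distr_distr[OF u mc, symmetric])
  also have "\<dots> = Gam (A \<times> J)" unfolding cT du ..
  finally show ?thesis using ml by (simp add: mpres_def)
qed

lemma ip_measurable:
  "(\<And>i. i \<in> S ==> (%x. f x i) \<in> borel_measurable M) ==> (\<And>i. i \<in> S ==> (%x. g x i) \<in> borel_measurable M) ==>
    (%x. ip S (f x) (g x)) \<in> borel_measurable M"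
  unfolding ip_def by (intro borel_measurable_sum borel_measurable_times)

lemma ip_Gam_measurable: "(%x. ip J a x) \<in> borel_measurable (Gam J)"
  by (rule ip_measurable) (auto intro: Gam_component_measurable)

lemma Gam_component_distr:
  "j \<in> J ==> distr (Gam J) borel (%x. x j) = gauss"
  using distr_PiM_component[of J "%_. gauss" j] prob_space_std_normal
  by (simp add: Gam_def distr_cong[OF refl, of borel gauss])

text \<open>A reflection that takes \<open>a\<close> to the axis \<open>j\<close> turns the linear
  form into a multiple of one coordinate.\<close>

lemma distr_ip_Gam:
  assumes J: "finite J" "j \<in> J" "a j ~= 0"
  shows "distr (Gam J) borel (ip J a) = distr gauss borel (%t. sqrt (ip J a a) * t)"
proof -
  define r where "r = sqrt (ip J a a)"
  define e where "e = (%i. if i = j then r else 0)"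
  have ipe: "ip J e x = r * x j" for x
    using J by (simp add: ip_def e_def if_distrib[where f="%u. u * _"] cong: if_cong)
  have rr: "r * r = ip J a a" by (simp add: r_def)
  have eq: "ip J a a = ip J e e" unfolding ipe by (simp add: e_def rr)
  define T where "T = hrefl J (%i. a i - e i)"
  have T: "mpres (Gam J) T" unfolding T_def by (rule mpres_hrefl[OF J(1)])
  have Ta: "T a i = e i" if "i \<in> J" for i
    unfolding T_def by (rule hrefl_swap[OF J(1) eq that])
  have "ip J a x = r * (T x) j" for x
  proof -
    have "ip J a x = ip J (T a) (T x)" unfolding T_def by (rule ip_hrefl[OF J(1), symmetric])
    also have "\<dots> = ip J e (T x)" by (rule ip_cong) (auto simp: Ta)
    finally show ?thesis by (simp add: ipe)
  qed
  then have "distr (Gam J) borel (ip J a) = distr (Gam J) borel (%x. r * (T x) j)"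
    by (intro distr_cong) auto
  also have "\<dots> = distr (Gam J) borel (%x. r * x j)"
    using Gam_component_measurable[OF J(2)] by (intro mpres_distr[OF T, of "%x. r * x j"]) simp
  also have "\<dots> = distr (distr (Gam J) borel (%x. x j)) borel (%t. r * t)"
    using Gam_component_measurable[OF J(2)] by (subst distr_distr) (simp_all add: comp_def)
  finally show ?thesis unfolding Gam_component_distr[OF J(2)] r_def .
qed

lemma AE_ip_Gam_neq:
  assumes J: "finite J" "j \<in> J" "a j ~= 0"
  shows "AE x in Gam J. ip J a x ~= 0"
proof -
  have r: "sqrt (ip J a a) ~= 0" using ip_self_pos[of J j a] J by simp
  have "AE t in gauss. t ~= 0"
    by (subst AE_density) (auto intro: eventually_mono[OF AE_lborel_singleton])
  then have "AE t in gauss. sqrt (ip J a a) * t ~= 0"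
    using r by simp
  then have "AE t in distr gauss borel (%t. sqrt (ip J a a) * t). t ~= 0"
    by (subst AE_distr_iff) auto
  then have "AE t in distr (Gam J) borel (ip J a). t ~= 0"
    unfolding distr_ip_Gam[of J j a, OF J] .
  then show ?thesis using ip_Gam_measurable[of J a]
    by (subst (asm) AE_distr_iff) auto
qed

text \<open>The rows are independent, and a linear form of one Gaussian row is normal with the norm
  of \<open>a\<close> as its deviation. Thus the coefficients only matter through a scalar, which a
  cone does not see.\<close>

lemma distr_combination:
  assumes fin: "finite A" "finite J" and a: "j0 \<in> J" "a j0 ~= 0"
  shows "(%X. \<lambda>i\<in>A. \<Sum>j\<in>J. a j * X (i, j)) \<in> Gam (A \<times> J) \<rightarrow>\<^sub>M Gam A"
    and "(%x. \<lambda>i\<in>A. sqrt (ip J a a) * x i) \<in> Gam A \<rightarrow>\<^sub>M Gam A"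
    and "distr (Gam (A \<times> J)) (Gam A) (%X. \<lambda>i\<in>A. \<Sum>j\<in>J. a j * X (i, j)) =
      distr (Gam A) (Gam A) (%x. \<lambda>i\<in>A. sqrt (ip J a a) * x i)"
proof -
  let ?P = "PiM A (%_. Gam J)"
  let ?B = "PiM A (%_. borel :: real measure)"
  let ?L = "%X. \<lambda>i\<in>A. \<Sum>j\<in>J. a j * X (i, j)"
  let ?R = "%x. \<lambda>i\<in>A. sqrt (ip J a a) * x i"
  show mL: "?L \<in> Gam (A \<times> J) \<rightarrow>\<^sub>M Gam A"
  proof (rule measurable_GamI)
    fix i assume i: "i \<in> A"
    have "(%X. a j * X (i, j)) \<in> borel_measurable (Gam (A \<times> J))" if "j \<in> J" for j
      using Gam_component_measurable[of "(i, j)" "A \<times> J"] i that by auto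
    then show "(%X. ?L X i) \<in> borel_measurable (Gam (A \<times> J))"
      using i by simp
  qed simp
  show mR: "?R \<in> Gam A \<rightarrow>\<^sub>M Gam A"
  proof (rule measurable_GamI)
    fix i assume i: "i \<in> A"
    then show "(%X. ?R X i) \<in> borel_measurable (Gam A)"
      using Gam_component_measurable[OF i] by simp
  qed simp
  define u where "u = (%x::'a => 'b => real. \<lambda>k\<in>A\<times>J. x (fst k) (snd k))"
  have bij: "bij_betw (%k. k) (A \<times> J) (A \<times> J)" by (simp add: bij_betw_def)
  have u: "u \<in> ?P \<rightarrow>\<^sub>M Gam (A \<times> J)" and du: "distr ?P (Gam (A \<times> J)) u = Gam (A \<times> J)"
    using distr_uncurry[OF fin bij] by (simp_all add: u_def)
  define Q where "Q = distr (Gam J) borel (ip J a)"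
  have Q': "Q = distr gauss borel (%t. sqrt (ip J a a) * t)"
    unfolding Q_def by (rule distr_ip_Gam) (use fin a in auto)
  have mip: "ip J a \<in> Gam J \<rightarrow>\<^sub>M Q" using ip_Gam_measurable[of J a] by (simp add: Q_def)
  have mmul: "(%t. sqrt (ip J a a) * t) \<in> gauss \<rightarrow>\<^sub>M Q" by (simp add: Q_def)
  have pQ: "prob_space Q"
    unfolding Q_def by (rule prob_space.prob_space_distr[OF prob_space_Gam ip_Gam_measurable])
  have sQ: "sets (PiM A (%_. Q)) = sets (Gam A)"
    by (simp add: Q_def cong: sets_PiM_cong)
  have "distr (Gam J) Q (ip J a) = Q"
    by (subst (2) Q_def, rule distr_cong) (simp_all add: Q_def)
  then have 1: "distr ?P (PiM A (%_. Q)) (compose A (ip J a)) = PiM A (%_. Q)"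
    using distr_PiM_finite_prob_space'[OF fin(1), of "%_. Gam J" "%_. Q" "ip J a"] mip
    by (simp add: prob_space_Gam pQ)
  have "distr gauss Q (%t. sqrt (ip J a a) * t) = Q"
    by (subst (2) Q', rule distr_cong) (simp_all add: Q')
  then have 2: "distr (Gam A) (PiM A (%_. Q)) (compose A (%t. sqrt (ip J a a) * t)) = PiM A (%_. Q)"
    using distr_PiM_finite_prob_space'[OF fin(1), of "%_. gauss" "%_. Q" "%t. sqrt (ip J a a) * t"] mmul
    by (simp add: prob_space_std_normal pQ Gam_def)
  have "distr (Gam (A \<times> J)) (Gam A) ?L = distr ?P (Gam A) (?L \<circ> u)"
    by (subst du[symmetric]) (rule distr_distr[OF mL u])
  also have "\<dots> = distr ?P (PiM A (%_. Q)) (compose A (ip J a))"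
    by (rule distr_cong) (auto simp: sQ u_def compose_def ip_def intro!: restrict_ext)
  also have "\<dots> = distr (Gam A) (PiM A (%_. Q)) (compose A (%t. sqrt (ip J a a) * t))"
    unfolding 1 2 ..
  also have "\<dots> = distr (Gam A) (Gam A) ?R"
    by (rule distr_cong) (auto simp: sQ compose_def)
  finally show "distr (Gam (A \<times> J)) (Gam A) ?L = distr (Gam A) (Gam A) ?R" .
qed


subsection \<open>Uniqueness of the uniform distribution on the sphere\<close>

abbreviation nrm :: "'i set => ('i => real) => real" where
  "nrm V x \<equiv> sqrt (ip V x x)"

lemma nrm_hrefl: "finite V ==> nrm V (hrefl V a x) = nrm V x"
  by (simp add: ip_hrefl)

lemma ip_hrefl_swap: "finite V ==> ip V (hrefl V a x) y = ip V x (hrefl V a y)"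
  using ip_hrefl[of V a x "hrefl V a y"] by (simp add: hrefl_hrefl)

text \<open>The kernel compares directions only, and both of its marginals are constant by invariance.\<close>

definition near :: "'i set => real => ('i => real) => ('i => real) => bool" where
  "near V eps x g \<longleftrightarrow> (1 - eps) * nrm V x * nrm V g < ip V x g"

lemma near_sym: "near V eps x g \<longleftrightarrow> near V eps g x"
  by (simp add: near_def ip_sym[of V x g] mult_ac)

lemma ip_scale2: "ip V (%i. c * x i) (%i. c * x i) = c\<^sup>2 * ip V x x"
  by (simp add: ip_scale_left ip_scale_right power2_eq_square)

lemma near_scale:
  assumes "c > 0" shows "near V eps (%i. c * x i) g \<longleftrightarrow> near V eps x g"
proof -
  have "nrm V (%i. c * x i) = c * nrm V x"
    using assms by (simp add: ip_scale2 real_sqrt_mult)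
  then have "(1 - eps) * nrm V (%i. c * x i) * nrm V g = c * ((1 - eps) * nrm V x * nrm V g)"
    by simp
  then show ?thesis
    unfolding near_def ip_scale_left using assms by (metis mult_less_cancel_left_pos)
qed

lemma near_hrefl:
  assumes "finite V" shows "near V eps (hrefl V a x) g \<longleftrightarrow> near V eps x (hrefl V a g)"
  by (simp only: near_def nrm_hrefl[OF assms] ip_hrefl_swap[of V a x g, OF assms])

lemma near_cong: "(\<And>i. i \<in> V ==> x i = y i) ==> near V eps x g \<longleftrightarrow> near V eps y g"
  using ip_cong[of V x y g g] ip_cong[of V x y x y] by (simp add: near_def)

text \<open>A reflection carries the direction of \<open>x\<close> to that of \<open>y\<close>, and
  moving it to the other argument leaves \<open>near\<close> unchanged.\<close>

lemma near_transitive: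
  assumes V: "finite V" and x: "ip V x x ~= 0" and y: "ip V y y ~= 0"
  shows "\<exists>a. \<forall>g. near V eps y g \<longleftrightarrow> near V eps x (hrefl V a g)"
proof -
  have px: "nrm V x > 0" and py: "nrm V y > 0"
    using x y ip_self_nonneg[of V x] ip_self_nonneg[of V y] by (simp_all add: less_le)
  define x' where "x' = (%i. inverse (nrm V x) * x i)"
  define y' where "y' = (%i. inverse (nrm V y) * y i)"
  have "ip V x' x' = 1" "ip V y' y' = 1"
    unfolding x'_def y'_def ip_scale2 using x y by (simp_all add: power_inverse)
  then have eq: "ip V x' x' = ip V y' y'" by simp
  define a where "a = (%i. x' i - y' i)"
  have "near V eps y g \<longleftrightarrow> near V eps x (hrefl V a g)" for g
  proof -
    have "near V eps y g \<longleftrightarrow> near V eps y' g"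
      unfolding y'_def using py by (subst near_scale) auto
    also have "\<dots> \<longleftrightarrow> near V eps (hrefl V a x') g"
      unfolding a_def by (rule near_cong) (simp add: hrefl_swap[OF V eq])
    also have "\<dots> \<longleftrightarrow> near V eps x' (hrefl V a g)" by (rule near_hrefl[OF V])
    also have "\<dots> \<longleftrightarrow> near V eps x (hrefl V a g)"
      unfolding x'_def using px by (subst near_scale) auto
    finally show ?thesis .
  qed
  then show ?thesis by blast
qed

text \<open>The squared distance of two unit vectors is 2 minus twice their inner product.\<close>

lemma near_dist:
  assumes V: "finite V" and x: "ip V x x ~= 0" and y: "ip V y y ~= 0" and n: "near V eps x y"
  shows "nrm V (%i. inverse (nrm V x) * x i - inverse (nrm V y) * y i) \<le> sqrt (2 * eps)"
proof -
  have px: "nrm V x > 0" and py: "nrm V y > 0"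
    using x y ip_self_nonneg[of V x] ip_self_nonneg[of V y] by (simp_all add: less_le)
  define x' where "x' = (%i. inverse (nrm V x) * x i)"
  define y' where "y' = (%i. inverse (nrm V y) * y i)"
  have 1: "ip V x' x' = 1" "ip V y' y' = 1"
    unfolding x'_def y'_def ip_scale2 using x y by (simp_all add: power_inverse)
  have "near V eps x' y'"
    unfolding x'_def y'_def using n px py by (subst near_scale, simp, subst near_sym, subst near_scale) (auto simp: near_sym)
  then have "1 - eps < ip V x' y'" using 1 by (simp add: near_def)
  moreover have "ip V (%i. x' i - y' i) (%i. x' i - y' i) = 2 - 2 * ip V x' y'"
    unfolding ip_diff_left ip_diff_right using 1 ip_sym[of V y' x'] by simp
  ultimately have "nrm V (%i. x' i - y' i) \<le> sqrt (2 * eps)" by simp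
  then show ?thesis by (simp only: x'_def y'_def)
qed

text \<open>Provides a countable family of centres whose caps cover all nonzero vectors.\<close>

lemma near_rational:
  assumes V: "finite V" and g: "ip V g g ~= 0" and eps: "eps > 0"
  shows "\<exists>x\<in>(\<Pi>\<^sub>E i\<in>V. \<rat>). ip V x x ~= 0 \<and> near V eps x g"
proof -
  have "\<exists>q. q \<in> \<rat> \<and> \<bar>q - g i\<bar> < inverse (real (Suc m))" for m i
  proof -
    obtain r where "r \<in> \<rat>" "g i < r" "r < g i + inverse (real (Suc m))"
      using Rats_dense_in_real[of "g i" "g i + inverse (real (Suc m))"] by auto
    then show ?thesis by (intro exI[of _ r]) auto
  qed
  note ex = this
  define q where "q m i = (SOME q. q \<in> \<rat> \<and> \<bar>q - g i\<bar> < inverse (real (Suc m)))" for m i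
  have q: "q m i \<in> \<rat>" "\<bar>q m i - g i\<bar> < inverse (real (Suc m))" for m i
    using someI_ex[OF ex[of i m]] by (simp_all add: q_def)
  have lim: "(%m. q m i) \<longlonglongrightarrow> g i" for i
  proof (rule Lim_null_comparison[THEN LIM_zero_cancel])
    show "\<forall>\<^sub>F m in sequentially. norm (q m i - g i) \<le> inverse (real (Suc m))"
      using q(2) by (auto intro!: always_eventually less_imp_le)
  qed (rule LIMSEQ_inverse_real_of_nat)
  have l1: "(%m. ip V (q m) (q m)) \<longlonglongrightarrow> ip V g g" "(%m. ip V (q m) g) \<longlonglongrightarrow> ip V g g"
    unfolding ip_def by (intro tendsto_intros lim)+
  have pg: "ip V g g > 0" using g ip_self_nonneg[of V g] by linarith
  have "(%m. (1 - eps) * nrm V (q m) * nrm V g - ip V (q m) g) \<longlonglongrightarrow> (1 - eps) * nrm V g * nrm V g - ip V g g"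
    by (intro tendsto_intros l1)
  moreover have "(1 - eps) * nrm V g * nrm V g - ip V g g < 0"
    using pg eps by (simp add: mult.assoc left_diff_distrib)
  ultimately have "eventually (%m. (1 - eps) * nrm V (q m) * nrm V g - ip V (q m) g < 0) sequentially"
    by (rule order_tendstoD(2))
  moreover have "eventually (%m. ip V (q m) (q m) > 0) sequentially"
    using l1(1) pg by (rule order_tendstoD(1))
  ultimately have "eventually (%m. ip V (q m) (q m) > 0 \<and> near V eps (q m) g) sequentially"
    by eventually_elim (simp add: near_def)
  then obtain m where m: "ip V (q m) (q m) > 0" "near V eps (q m) g"
    by (auto simp: eventually_sequentially)
  let ?x = "restrict (q m) V"
  have "ip V ?x ?x = ip V (q m) (q m)" by (rule ip_cong) auto
  moreover have "near V eps ?x g \<longleftrightarrow> near V eps (q m) g" by (rule near_cong) auto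
  ultimately show ?thesis using m q(1) by (intro bexI[of _ ?x]) auto
qed

lemma near_measurable:
  assumes "\<And>i. i \<in> V ==> (%z. f z i) \<in> borel_measurable M" "\<And>i. i \<in> V ==> (%z. g z i) \<in> borel_measurable M"
  shows "{z \<in> space M. near V eps (f z) (g z)} \<in> sets M"
proof -
  have [measurable]: "(%z. ip V (f z) (f z)) \<in> borel_measurable M" "(%z. ip V (g z) (g z)) \<in> borel_measurable M"
     "(%z. ip V (f z) (g z)) \<in> borel_measurable M"
    by (rule ip_measurable; fact assms)+
  show ?thesis unfolding near_def by measurable
qed

text \<open>Invariance under all reflections fixes the law of the direction but leaves the radius
  free. Hence only functions of the direction can be compared between two such laws.\<close>

locale invariant_direction = prob_space nu for nu :: "('i => real) measure" and V :: "'i set" +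
  assumes finite_V: "finite V" and sets_nu: "sets nu = sets (Gam V)"
    and invariant: "\<And>a. mpres nu (hrefl V a)"
    and nonzero: "AE x in nu. ip V x x ~= 0"
begin

lemma component_measurable: "i \<in> V ==> (%x. x i) \<in> borel_measurable nu"
  using Gam_component_measurable[of i V] measurable_cong_sets[OF sets_nu refl] by blast

lemma near_sets: "{g \<in> space nu. near V eps x g} \<in> sets nu"
  by (rule near_measurable) (auto intro: component_measurable)

lemma near_const:
  assumes "ip V x x ~= 0" "ip V y y ~= 0"
  shows "measure nu {g \<in> space nu. near V eps x g} = measure nu {g \<in> space nu. near V eps y g}"
proof -
  obtain a where a: "\<And>g. near V eps y g \<longleftrightarrow> near V eps x (hrefl V a g)"
    using near_transitive[OF finite_V assms] by blast
  have T: "hrefl V a \<in> nu \<rightarrow>\<^sub>M nu" "distr nu nu (hrefl V a) = nu"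
    using invariant[of a] by (auto simp: mpres_def)
  have "measure nu {g \<in> space nu. near V eps x g} = measure (distr nu nu (hrefl V a)) {g \<in> space nu. near V eps x g}"
    by (simp add: T)
  also have "\<dots> = measure nu (hrefl V a -` {g \<in> space nu. near V eps x g} \<inter> space nu)"
    by (rule measure_distr[OF T(1) near_sets])
  also have "hrefl V a -` {g \<in> space nu. near V eps x g} \<inter> space nu = {g \<in> space nu. near V eps y g}"
    using measurable_space[OF T(1)] a by auto
  finally show ?thesis .
qed

text \<open>If one cap were null, all caps would be, by transitivity; but countably many caps with
  rational centres cover almost everything.\<close>

lemma near_pos:
  assumes eps: "eps > 0" and x: "ip V x x ~= 0"
  shows "measure nu {g \<in> space nu. near V eps x g} > 0"
proof (rule ccontr)
  let ?N = "%y. {g \<in> space nu. near V eps y g}"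
  assume "\<not> ?thesis"
  then have z: "measure nu (?N x) = 0" using measure_nonneg[of nu "?N x"] by linarith
  define R where "R = {y \<in> (\<Pi>\<^sub>E i\<in>V. \<rat>). ip V y y ~= 0}"
  have cR: "countable R"
    unfolding R_def by (rule countable_subset[OF _ countable_PiE[OF finite_V, of "%_. \<rat>"]])
      (auto simp: countable_rat)
  have "AE g in nu. \<forall>y\<in>R. \<not> near V eps y g"
  proof (subst AE_ball_countable[OF cR], intro ballI)
    fix y assume "y \<in> R"
    then have "measure nu (?N y) = 0" using z near_const[OF x, of y eps] by (simp add: R_def)
    then show "AE g in nu. \<not> near V eps y g"
      by (intro AE_I[of _ _ "?N y"]) (auto simp: near_sets emeasure_eq_measure)
  qed
  with nonzero have "AE g in nu. False"
  proof eventually_elim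
    case (elim g)
    then show ?case using near_rational[OF finite_V elim(1) eps] by (auto simp: R_def)
  qed
  then show False by simp
qed

end

text \<open>The kernel \<open>k\<close> on pairs of directions has the same constant marginal on
  both sides. Integrating \<open>f (fst z) * k z\<close> and \<open>f (snd z) * k z\<close>
  therefore gives the two integrals of \<open>f\<close> times this constant. On the support of
  \<open>k\<close> the two values of \<open>f\<close> differ by at most
  \<open>L * sqrt (2 * eps)\<close>; the constant is positive, so it cancels, and \<open>eps\<close>
  tends to 0.\<close>

lemma invariant_direction_unique:
  assumes "invariant_direction nu1 V" "invariant_direction nu2 V"
    and f1: "f \<in> borel_measurable (Gam V)" and f01: "\<And>x. 0 \<le> f x \<and> f x \<le> 1"
    and fL: "\<And>x y eps. near V eps x y ==> ip V x x ~= 0 ==> ip V y y ~= 0 ==> \<bar>f x - f y\<bar> \<le> L * sqrt (2 * eps)"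
    and V: "V ~= {}"
  shows "(\<integral>x. f x \<partial>nu1) = (\<integral>x. f x \<partial>nu2)"
proof -
  interpret v1: invariant_direction nu1 V by fact
  interpret v2: invariant_direction nu2 V by fact
  interpret P: pair_prob_space nu1 nu2 ..
  let ?P = "nu1 \<Otimes>\<^sub>M nu2"
  have m1: "f \<in> borel_measurable nu1" and m2: "f \<in> borel_measurable nu2"
    using f1 measurable_cong_sets[OF v1.sets_nu refl] measurable_cong_sets[OF v2.sets_nu refl] by blast+
  obtain i where i: "i \<in> V" using V by auto
  define e where "e = (%k. if k = i then 1 else (0::real))"
  have e: "ip V e e ~= 0" using ip_self_pos[OF v1.finite_V i, of e] by (simp add: e_def)
  have "\<bar>(\<integral>x. f x \<partial>nu1) - (\<integral>x. f x \<partial>nu2)\<bar> \<le> L * sqrt (2 * eps)" if eps: "eps > 0" for eps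
  proof -
    define k where "k z = (indicator {z \<in> space ?P. near V eps (fst z) (snd z)} z :: real)" for z :: "('a => real) \<times> ('a => real)"
    define k1 where "k1 = measure nu1 {g \<in> space nu1. near V eps e g}"
    define k2 where "k2 = measure nu2 {g \<in> space nu2. near V eps e g}"
    have "{z \<in> space ?P. near V eps (fst z) (snd z)} \<in> sets ?P"
      by (rule near_measurable) (auto intro: measurable_compose[OF measurable_fst v1.component_measurable]
          measurable_compose[OF measurable_snd v2.component_measurable])
    then have mk: "k \<in> borel_measurable ?P" unfolding k_def by simp
    have mf1: "(%z. f (fst z)) \<in> borel_measurable ?P" and mf2: "(%z. f (snd z)) \<in> borel_measurable ?P"
      by (rule measurable_compose[OF measurable_fst m1] measurable_compose[OF measurable_snd m2])+
    have kb: "0 \<le> k z" "k z \<le> 1" for z by (simp_all add: k_def split: split_indicator)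
    have ib: "integrable ?P (%z. h z * k z)" if "h \<in> borel_measurable ?P" "\<And>z. 0 \<le> h z \<and> h z \<le> 1" for h :: "_ => real"
    proof (rule P.integrable_const_bound[where B = 1])
      show "AE z in ?P. norm (h z * k z) \<le> 1"
        using that(2) kb by (intro AE_I2) (auto simp: abs_mult intro!: mult_le_one)
    qed (use that mk in simp)
    have E1: "(\<integral>z. h (fst z) * k z \<partial>?P) = (\<integral>x. h x \<partial>nu1) * k2"
      if h: "h \<in> borel_measurable nu1" "\<And>z. 0 \<le> h z \<and> h z \<le> 1" for h :: "_ => real"
    proof -
      have "(\<integral>z. h (fst z) * k z \<partial>?P) = (\<integral>x. \<integral>y. h (fst (x, y)) * k (x, y) \<partial>nu2 \<partial>nu1)"
        using h by (intro P.integral_fst'[symmetric] ib) (auto intro: measurable_compose[OF measurable_fst])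
      also have "\<dots> = (\<integral>x. h x * k2 \<partial>nu1)"
      proof (rule integral_cong_AE)
        show "(%x. \<integral>y. h (fst (x, y)) * k (x, y) \<partial>nu2) \<in> borel_measurable nu1"
          using h(1) mk by (intro v2.borel_measurable_lebesgue_integral)
            (auto simp: split_def intro!: borel_measurable_times measurable_compose[OF measurable_fst])
        show "(%x. h x * k2) \<in> borel_measurable nu1" using h(1) by simp
        show "AE x in nu1. (\<integral>y. h (fst (x, y)) * k (x, y) \<partial>nu2) = h x * k2"
          using v1.nonzero AE_space
        proof eventually_elim
          case (elim x)
          have "(\<integral>y. h (fst (x, y)) * k (x, y) \<partial>nu2) = h x * (\<integral>y. indicator {g \<in> space nu2. near V eps x g} y \<partial>nu2)"
            by (subst integral_mult_right_zero[symmetric], rule Bochner_Integration.integral_cong)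
              (use elim in \<open>auto simp: k_def space_pair_measure split: split_indicator\<close>)
          also have "\<dots> = h x * k2"
            using v2.near_sets[of eps x] v2.near_const[OF elim(1) e, of eps] by (simp add: k2_def)
          finally show ?case .
        qed
      qed
      finally show ?thesis by simp
    qed
    have E2: "(\<integral>z. h (snd z) * k z \<partial>?P) = (\<integral>x. h x \<partial>nu2) * k1"
      if h: "h \<in> borel_measurable nu2" "\<And>z. 0 \<le> h z \<and> h z \<le> 1" for h :: "_ => real"
    proof -
      have "(\<integral>z. h (snd z) * k z \<partial>?P) = (\<integral>y. \<integral>x. h (snd (x, y)) * k (x, y) \<partial>nu1 \<partial>nu2)"
        using h P.integral_snd[of "%x y. h (snd (x, y)) * k (x, y)"] ib[of "%z. h (snd z)"] measurable_compose[OF measurable_snd h(1)]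
        by (simp add: split_def)
      also have "\<dots> = (\<integral>y. h y * k1 \<partial>nu2)"
      proof (rule integral_cong_AE)
        have "(%z. h (fst z) * k (snd z, fst z)) \<in> borel_measurable (nu2 \<Otimes>\<^sub>M nu1)"
          using h(1) mk by (intro borel_measurable_times measurable_compose[OF measurable_fst]
            measurable_compose[OF measurable_Pair[OF measurable_snd measurable_fst]])
        then show "(%y. \<integral>x. h (snd (x, y)) * k (x, y) \<partial>nu1) \<in> borel_measurable nu2"
          by (intro v1.borel_measurable_lebesgue_integral) (simp add: split_def)
        show "(%x. h x * k1) \<in> borel_measurable nu2" using h(1) by simp
        show "AE y in nu2. (\<integral>x. h (snd (x, y)) * k (x, y) \<partial>nu1) = h y * k1"
          using v2.nonzero AE_space
        proof eventually_elim
          case (elim y)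
          have "(\<integral>x. h (snd (x, y)) * k (x, y) \<partial>nu1) = h y * (\<integral>x. indicator {g \<in> space nu1. near V eps y g} x \<partial>nu1)"
            by (subst integral_mult_right_zero[symmetric], rule Bochner_Integration.integral_cong)
              (use elim in \<open>auto simp: k_def space_pair_measure near_sym split: split_indicator\<close>)
          also have "\<dots> = h y * k1"
            using v1.near_sets[of eps y] v1.near_const[OF elim(1) e, of eps] by (simp add: k1_def)
          finally show ?case .
        qed
      qed
      finally show ?thesis by simp
    qed
    \<comment> \<open>Both are the total mass of the kernel, as one sees from constant
      \<open>h\<close>.\<close>
    have k12: "k1 = k2"
      using E1[of "%_. 1"] E2[of "%_. 1"] by (simp add: v1.prob_space v2.prob_space)
    have k: "k1 > 0" unfolding k1_def by (rule v1.near_pos[OF eps e])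
    have nz: "AE z in ?P. ip V (fst z) (fst z) ~= 0 \<and> ip V (snd z) (snd z) ~= 0"
    proof -
      have d1: "distr ?P nu1 fst = nu1"
      proof (rule measure_eqI)
        fix A assume "A \<in> sets (distr ?P nu1 fst)"
        then have A: "A \<in> sets nu1" by simp
        have "fst -` A \<inter> space ?P = A \<times> space nu2"
          using sets.sets_into_space[OF A] by (auto simp: space_pair_measure)
        then show "emeasure (distr ?P nu1 fst) A = emeasure nu1 A"
          using A by (simp add: emeasure_distr v2.emeasure_pair_measure_Times v2.emeasure_space_1)
      qed simp
      have "AE z in distr ?P nu1 fst. ip V z z ~= 0" unfolding d1 by (rule v1.nonzero)
      then have 1: "AE z in ?P. ip V (fst z) (fst z) ~= 0"
        by (rule AE_distrD[OF measurable_fst])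
      have d2: "distr ?P nu2 snd = nu2"
      proof (rule measure_eqI)
        fix A assume "A \<in> sets (distr ?P nu2 snd)"
        then have A: "A \<in> sets nu2" by simp
        have "snd -` A \<inter> space ?P = space nu1 \<times> A"
          using sets.sets_into_space[OF A] by (auto simp: space_pair_measure)
        then show "emeasure (distr ?P nu2 snd) A = emeasure nu2 A"
          using A by (simp add: emeasure_distr v2.emeasure_pair_measure_Times v1.emeasure_space_1)
      qed simp
      have "AE z in distr ?P nu2 snd. ip V z z ~= 0" unfolding d2 by (rule v2.nonzero)
      then have 2: "AE z in ?P. ip V (snd z) (snd z) ~= 0"
        by (rule AE_distrD[OF measurable_snd])
      from 1 2 show ?thesis by eventually_elim simp
    qed
    have i1: "integrable ?P (%z. f (fst z) * k z)" "integrable ?P (%z. f (snd z) * k z)" "integrable ?P (%z. 1 * k z)"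
      using ib[OF mf1] ib[OF mf2] ib[of "%_. 1"] f01 by simp_all
    have "\<bar>(\<integral>x. f x \<partial>nu1) - (\<integral>x. f x \<partial>nu2)\<bar> * k1 = \<bar>(\<integral>z. f (fst z) * k z - f (snd z) * k z \<partial>?P)\<bar>"
    proof -
      have "(\<integral>z. f (fst z) * k z - f (snd z) * k z \<partial>?P) = ((\<integral>x. f x \<partial>nu1) - (\<integral>x. f x \<partial>nu2)) * k1"
        by (subst Bochner_Integration.integral_diff[OF i1(1,2)])
          (simp only: E1[OF m1 f01] E2[OF m2 f01] k12 left_diff_distrib)
      then show ?thesis using k by (simp only: abs_mult abs_of_pos)
    qed
    also have "\<dots> \<le> (\<integral>z. \<bar>f (fst z) * k z - f (snd z) * k z\<bar> \<partial>?P)"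
      by (rule integral_abs_bound)
    also have "\<dots> \<le> (\<integral>z. L * sqrt (2 * eps) * (1 * k z) \<partial>?P)"
    proof (rule integral_mono_AE)
      show "AE z in ?P. \<bar>f (fst z) * k z - f (snd z) * k z\<bar> \<le> L * sqrt (2 * eps) * (1 * k z)"
        using nz
      proof eventually_elim
        case (elim z)
        show ?case
          using fL[of eps "fst z" "snd z"] elim by (auto simp: k_def split: split_indicator)
      qed
    qed (use i1 in \<open>auto intro!: integrable_abs Bochner_Integration.integrable_diff\<close>)
    also have "\<dots> = L * sqrt (2 * eps) * k1"
      using E1[of "%_. 1"] k12 by (simp add: v1.prob_space)
    finally show ?thesis using k by simp
  qed
  then have "\<forall>\<^sub>F eps in at_right 0. \<bar>(\<integral>x. f x \<partial>nu1) - (\<integral>x. f x \<partial>nu2)\<bar> \<le> L * sqrt (2 * eps)"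
    by (auto simp: eventually_at_filter)
  moreover have "((%eps. L * sqrt (2 * eps)) \<longlongrightarrow> L * sqrt (2 * 0)) (at_right 0)"
    by (intro tendsto_intros)
  ultimately have "\<bar>(\<integral>x. f x \<partial>nu1) - (\<integral>x. f x \<partial>nu2)\<bar> \<le> L * sqrt (2 * 0)"
    by (intro tendsto_lowerbound[of "%eps. L * sqrt (2 * eps)"]) auto
  then show ?thesis by simp
qed

text \<open>An open cone is presented as the set where a homogeneous Lipschitz function
  \<open>D\<close> is positive. The ramps \<open>f j\<close> in \<open>D / nrm V\<close> are then
  Lipschitz in the direction and increase to the indicator of the cone, which itself is not covered
  by the uniqueness result for Lipschitz functions.\<close>

lemma cone_prob_unique:
  assumes i1: "invariant_direction nu1 V" and i2: "invariant_direction nu2 V"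
    and D: "D \<in> borel_measurable (Gam V)"
    and Dhom: "\<And>c x. c > 0 ==> D (%i. c * x i) = c * D x"
    and DL: "\<And>x y. \<bar>D x - D y\<bar> \<le> L * nrm V (%i. x i - y i)"
    and V: "V ~= {}"
  shows "measure nu1 {x \<in> space nu1. D x > 0} = measure nu2 {x \<in> space nu2. D x > 0}"
proof -
  have finV: "finite V" using i1 by (simp add: invariant_direction_def invariant_direction_axioms_def)
  have L: "L \<ge> 0"
  proof -
    obtain i where i: "i \<in> V" using V by auto
    define e where "e = (%k. if k = i then 1 else (0::real))"
    have "0 < nrm V (%k. e k - 0)" using ip_self_pos[OF finV i, of e] by (simp add: e_def)
    moreover have "0 \<le> L * nrm V (%k. e k - 0)" using DL[of e "%_. 0"] by linarith
    ultimately show ?thesis by (simp add: zero_le_mult_iff)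
  qed
  have pos: "nrm V x > 0" if "ip V x x ~= 0" for x :: "'a => real"
    using that ip_self_nonneg[of V x] by (simp add: less_le)
  define f where "f j x = min 1 (real j * max 0 (D x / nrm V x))" for j x
  have mip: "(%x. ip V x x) \<in> borel_measurable (Gam V)"
    by (rule ip_measurable) (auto intro: Gam_component_measurable)
  have mf: "f j \<in> borel_measurable (Gam V)" for j
    unfolding f_def using D mip by measurable
  have f01: "0 \<le> f j x \<and> f j x \<le> 1" for j x by (simp add: f_def)
  have fL: "\<bar>f j x - f j y\<bar> \<le> (real j * L) * sqrt (2 * eps)"
    if n: "near V eps x y" "ip V x x ~= 0" "ip V y y ~= 0" for j x y eps
  proof -
    have "\<bar>f j x - f j y\<bar> \<le> real j * \<bar>D x / nrm V x - D y / nrm V y\<bar>"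
    proof -
      have "\<bar>f j x - f j y\<bar> \<le> \<bar>real j * max 0 (D x / nrm V x) - real j * max 0 (D y / nrm V y)\<bar>"
        unfolding f_def by linarith
      also have "\<dots> = real j * \<bar>max 0 (D x / nrm V x) - max 0 (D y / nrm V y)\<bar>"
        by (simp add: right_diff_distrib[symmetric] abs_mult)
      also have "\<dots> \<le> real j * \<bar>D x / nrm V x - D y / nrm V y\<bar>"
        by (rule mult_left_mono) linarith+
      finally show ?thesis .
    qed
    also have "\<dots> = real j * \<bar>D (%i. inverse (nrm V x) * x i) - D (%i. inverse (nrm V y) * y i)\<bar>"
      using Dhom[of "inverse (nrm V x)" x] Dhom[of "inverse (nrm V y)" y] pos[OF n(2)] pos[OF n(3)]
      by (simp add: divide_inverse mult.commute)
    also have "\<dots> \<le> real j * (L * nrm V (%i. inverse (nrm V x) * x i - inverse (nrm V y) * y i))"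
      by (intro mult_left_mono DL) simp
    also have "\<dots> \<le> real j * (L * sqrt (2 * eps))"
      by (intro mult_left_mono near_dist[OF finV n(2,3,1)] L) simp
    finally show ?thesis by simp
  qed
  have E: "(\<integral>x. f j x \<partial>nu1) = (\<integral>x. f j x \<partial>nu2)" for j
    by (rule invariant_direction_unique[OF i1 i2 mf f01 fL V])
  have lim: "(%j. \<integral>x. f j x \<partial>nu) \<longlonglongrightarrow> measure nu {x \<in> space nu. D x > 0}"
    if "invariant_direction nu V" for nu
  proof -
    interpret invariant_direction nu V by fact
    have mD: "D \<in> borel_measurable nu" and mf': "f j \<in> borel_measurable nu" for j
      using D mf[of j] measurable_cong_sets[OF sets_nu refl] by blast+
    let ?S = "{x \<in> space nu. D x > 0}"
    have S: "?S \<in> sets nu" using mD by measurable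
    have "(%j. \<integral>x. f j x \<partial>nu) \<longlonglongrightarrow> (\<integral>x. indicator ?S x \<partial>nu)"
    proof (rule integral_dominated_convergence[where w = "%_. 1"])
      show "AE x in nu. (%j. f j x) \<longlonglongrightarrow> indicator ?S x"
        using nonzero AE_space
      proof eventually_elim
        case (elim x)
        show ?case
        proof (cases "D x > 0")
          case True
          define r where "r = D x / nrm V x"
          have r: "r > 0" using True pos[OF elim(1)] by (simp add: r_def)
          obtain j0 :: nat where j0: "1 / r < real j0" using reals_Archimedean2 by blast
          have "f j x = 1" if "j \<ge> j0" for j
          proof -
            have "1 / r \<le> real j" using j0 that by linarith
            then have "1 \<le> real j * r" using r by (simp add: field_simps)
            then show ?thesis using r by (simp add: f_def r_def)
          qed
          then have "(%j. f j x) \<longlonglongrightarrow> 1"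
            by (intro tendsto_eventually) (auto simp: eventually_sequentially)
          then show ?thesis using True elim by simp
        next
          case False
          then have "D x / nrm V x \<le> 0" using pos[OF elim(1)] by (simp add: divide_nonpos_pos)
          then have "f j x = 0" for j by (simp add: f_def max_def)
          then show ?thesis using False by simp
        qed
      qed
      show "AE x in nu. norm (f j x) \<le> 1" for j using f01[of j] by (intro AE_I2) simp
    qed (use mf' S in auto)
    then show ?thesis using S by simp
  qed
  show ?thesis
    using LIMSEQ_unique[OF lim[OF i1]] lim[OF i2] E by simp
qed

lemma invariant_direction_Gam:
  assumes "finite V" "V ~= {}" shows "invariant_direction (Gam V) V"
proof -
  interpret prob_space "Gam V" by (rule prob_space_Gam)
  obtain i where i: "i \<in> V" using assms by auto
  have "AE x in Gam V. ip V (%k. if k = i then 1 else 0) x ~= 0"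
    by (rule AE_ip_Gam_neq[OF assms(1) i]) simp
  then have "AE x in Gam V. ip V x x ~= 0"
  proof eventually_elim
    case (elim x)
    show ?case
    proof
      assume "ip V x x = 0"
      then have "\<forall>i\<in>V. x i = 0" using ip_self_eq_0_iff[OF assms(1)] by blast
      then show False using elim by (simp add: ip_def)
    qed
  qed
  then show ?thesis
    by unfold_locales (use assms mpres_hrefl[OF assms(1)] in auto)
qed

subsection \<open>Optimality conditions on an active set\<close>

lemma gs_cong:
  assumes "\<And>j. j \<le> k ==> z j = z' j" shows "gs S z k = gs S z' k"
  using assms
proof (induction k rule: less_induct)
  case (less k)
  have "gs S z j = gs S z' j" if "j < k" for j
    using less that by simp
  then show ?case
    using less.prems[of k] unfolding gs.simps[of S z k] gs.simps[of S z' k] by simp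
qed

lemma gs_cong_on:
  assumes "\<And>j i. j \<le> k ==> i \<in> S ==> z j i = z' j i" shows "\<forall>i\<in>S. gs S z k i = gs S z' k i"
  using assms
proof (induction k rule: less_induct)
  case (less k)
  have IH: "gs S z j i = gs S z' j i" if "j < k" "i \<in> S" for j i
    using less that by simp
  have r: "gsr S z k j = gsr S z' k j" if "j < k" for j
    using less.prems[of k] IH[OF that]
    by (intro arg_cong2[where f = "(/)"] ip_cong) auto
  show ?case
    using less.prems[of k] IH r unfolding gs.simps[of S z k] gs.simps[of S z' k] by simp
qed

lemma gc_cong_on:
  assumes "\<And>j i. j \<le> k ==> i \<in> S ==> z j i = z' j i" shows "gc S z k l = gc S z' k l"
  using assms
proof (induction k arbitrary: l rule: less_induct)
  case (less k)
  have IH: "gs S z j i = gs S z' j i" if "j < k" "i \<in> S" for j i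
    using less.prems gs_cong_on[of j S z z'] that by simp
  have r: "gsr S z k j = gsr S z' k j" if "j < k" for j
    using less.prems[of k] IH[OF that]
    by (intro arg_cong2[where f = "(/)"] ip_cong) auto
  have g: "gc S z j l = gc S z' j l" if "j < k" for j l
    using less that by simp
  show ?case
    using r g unfolding gc.simps[of S z k] gc.simps[of S z' k] by simp
qed

lemma gs_measurable:
  assumes z: "\<And>k' i. k' \<le> k ==> i \<in> I ==> (%x. z x k' i) \<in> borel_measurable M" and S: "S \<subseteq> I" and i: "i \<in> I"
  shows "(%x. gs S (z x) k i) \<in> borel_measurable M"
  using z i
proof (induction k arbitrary: i rule: less_induct)
  case (less k)
  have IH: "(%x. gs S (z x) j i) \<in> borel_measurable M" if "j < k" "i \<in> I" for j i
    using less that by simp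
  have r: "(%x. gsr S (z x) k j) \<in> borel_measurable M" if "j < k" for j
    using less.prems(1)[of k] IH[OF that] S by (intro borel_measurable_divide ip_measurable) auto
  show ?case
    unfolding gs.simps[of S "z _" k]
    using less.prems(1)[of k] less.prems(2) IH r
    by (intro borel_measurable_diff borel_measurable_sum borel_measurable_times) auto
qed

text \<open>Fix all columns but \<open>l\<close>, so that the earlier vectors are fixed. As
  \<open>k < card S\<close>, some nonzero \<open>a\<close> on \<open>S\<close> is orthogonal to
  their Gram-Schmidt vectors. Its inner product with the vector in question equals its inner product
  with column \<open>l\<close>, a nondegenerate Gaussian linear form, which is almost surely
  nonzero.\<close>

lemma gs_nonzero_AE:
  fixes A :: "'i set" and J :: "'j set"
  assumes fin: "finite A" "finite J" and S: "S \<subseteq> A" and k: "k < card S" and l: "l \<in> J"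
    and zk: "\<And>X i. i \<in> S ==> z X k i = X (i, l)"
    and zj: "\<And>X X' j. j < k ==> (\<And>i m. m ~= l ==> X (i, m) = X' (i, m)) ==> z X j = z X' j"
    and mz: "\<And>j i. j \<le> k ==> i \<in> S ==> (%X. z X j i) \<in> borel_measurable (Gam (A \<times> J))"
  shows "AE X in Gam (A \<times> J). \<exists>i\<in>S. gs S (z X) k i ~= 0"
proof -
  let ?R1 = "A \<times> (J - {l})" and ?R2 = "A \<times> {l}"
  have finS: "finite S" using S fin finite_subset by blast
  have R: "?R1 \<inter> ?R2 = {}" "finite ?R1" "finite ?R2" "?R1 \<union> ?R2 = A \<times> J"
    using fin l by auto
  have dm: "distr (Gam ?R1 \<Otimes>\<^sub>M Gam ?R2) (Gam (A \<times> J)) (merge ?R1 ?R2) = Gam (A \<times> J)"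
    using product_sigma_finite.distr_merge[OF product_sigma_finite_std_normal R(1,2,3)] R(4)
    by (simp add: Gam_def)
  have mm: "merge ?R1 ?R2 \<in> Gam ?R1 \<Otimes>\<^sub>M Gam ?R2 \<rightarrow>\<^sub>M Gam (A \<times> J)"
    unfolding R(4)[symmetric] Gam_def by (rule measurable_merge)
  let ?Q = "%X. \<exists>i\<in>S. gs S (z X) k i ~= 0"
  have mQ: "{X \<in> space (Gam (A \<times> J)). ?Q X} \<in> sets (Gam (A \<times> J))"
  proof -
    have [measurable]: "(%X. gs S (z X) k i) \<in> borel_measurable (Gam (A \<times> J))" if "i \<in> S" for i
      by (rule gs_measurable[where I = S]) (use mz that in auto)
    have "{X \<in> space (Gam (A \<times> J)). gs S (z X) k i ~= 0} \<in> sets (Gam (A \<times> J))" if "i \<in> S" for i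
      using that by measurable
    then show ?thesis
      using finS by (intro sets.sets_Collect_finite_Ex) auto
  qed
  interpret P1: prob_space "Gam ?R1" by (rule prob_space_Gam)
  interpret P2: prob_space "Gam ?R2" by (rule prob_space_Gam)
  interpret P: pair_sigma_finite "Gam ?R1" "Gam ?R2" ..
  have "AE y in Gam ?R2. ?Q (merge ?R1 ?R2 (x, y))" for x
  proof -
    define z0 where "z0 = z (merge ?R1 ?R2 (x, %_. 0))"
    have zz: "z (merge ?R1 ?R2 (x, y)) j = z0 j" if "j < k" for y j
      unfolding z0_def by (rule zj[OF that]) (simp add: merge_def)
    obtain a i where a: "i \<in> S" "a i ~= 0" and ao: "\<And>j. j < k ==> ip S a (gs S z0 j) = 0"
      using ex_orth_vector[OF finS k, of "gs S z0"] gs_orth[OF finS] by metis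
    define a' where "a' = (%(i, m::'j). if i \<in> S then a i else 0)"
    have "AE y in Gam ?R2. ip ?R2 a' y ~= 0"
      by (rule AE_ip_Gam_neq[of _ "(i, l)"]) (use R a S in \<open>auto simp: a'_def\<close>)
    then show ?thesis
    proof eventually_elim
      case (elim y)
      let ?X = "merge ?R1 ?R2 (x, y)"
      show ?case
      proof (rule ccontr)
        assume n: "\<not> ?Q ?X"
        have g: "gs S (z ?X) j = gs S z0 j" if "j < k" for j
          by (rule gs_cong) (use zz that in auto)
        have "0 = ip S a (gs S (z ?X) k)"
          using n by (simp add: ip_def)
        also have "\<dots> = ip S a (z ?X k) - (\<Sum>j<k. gsr S (z ?X) k j * ip S a (gs S (z ?X) j))"
          by (subst gs.simps) (simp only: ip_diff_right ip_sum_right ip_scale_right)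
        also have "\<dots> = ip S a (z ?X k)"
          using ao g by simp
        also have "\<dots> = (\<Sum>i\<in>S. a i * y (i, l))"
          unfolding ip_def using zk S by (intro sum.cong) (auto simp: merge_def)
        also have "\<dots> = (\<Sum>i\<in>A. a' (i, l) * y (i, l))"
          using fin S by (intro sum.mono_neutral_cong_left) (auto simp: a'_def)
        also have "\<dots> = ip ?R2 a' y"
          unfolding ip_def by (simp add: sum.cartesian_product')
        finally show False using elim by simp
      qed
    qed
  qed
  then have sect: "AE x in Gam ?R1. AE y in Gam ?R2. ?Q (merge ?R1 ?R2 (x, y))"
    by (rule AE_I2)
  have "AE w in Gam ?R1 \<Otimes>\<^sub>M Gam ?R2. ?Q (merge ?R1 ?R2 w)"
  proof (rule P.AE_pair_measure[OF _ sect])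
    show "{w \<in> space (Gam ?R1 \<Otimes>\<^sub>M Gam ?R2). ?Q (merge ?R1 ?R2 w)} \<in> sets (Gam ?R1 \<Otimes>\<^sub>M Gam ?R2)"
      using measurable_sets[OF mm mQ] measurable_space[OF mm]
      by (auto simp: vimage_def Int_def conj_commute cong: conj_cong)
  qed
  then have "AE X in distr (Gam ?R1 \<Otimes>\<^sub>M Gam ?R2) (Gam (A \<times> J)) (merge ?R1 ?R2). ?Q X"
    by (subst AE_distr_iff[OF mm mQ])
  then show ?thesis unfolding dm .
qed

section \<open>The columns of the design, general position and conditions on an active set\<close>

text \<open>The index \<open>u\<close> is column 0, so Gaussian column \<open>k\<close> gets number
  \<open>Suc k\<close>. With Gaussian columns \<open>0\<close> to \<open>q\<close>, the column whose
  residual is studied has number \<open>Suc q\<close>.\<close>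

definition cols :: "('i => real) => ('i \<times> nat => real) => nat => 'i => real" where
  "cols u X k = (if k = 0 then u else (%i. X (i, k - 1)))"

lemma cols_simps [simp]: "cols u X 0 = u" "cols u X (Suc k) = (%i. X (i, k))"
  by (simp_all add: cols_def)

lemma cols_measurable:
  assumes "k \<le> Suc q" "i \<in> A" shows "(%X. cols u X k i) \<in> borel_measurable (Gam (A \<times> {..q}))"
  using assms Gam_component_measurable[of "(i, k - 1)" "A \<times> {..q}"] by (cases k) auto

text \<open>On every set of rows the columns are linearly independent as far as the number of rows
  permits. All sets are treated at once because the active set is random.\<close>

definition general_position :: "'i set => nat => ('i => real) => ('i \<times> nat => real) => bool" where
  "general_position A q u X \<longleftrightarrow> (\<forall>S\<in>Pow A. \<forall>k\<in>{..Suc q}. k < card S \<longrightarrow> (\<exists>i\<in>S. gs S (cols u X) k i ~= 0))"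

lemma general_position_AE:
  assumes A: "finite A" and u: "\<And>i. i \<in> A ==> u i ~= 0"
  shows "AE X in Gam (A \<times> {..q}). general_position A q u X"
  unfolding general_position_def
proof (intro AE_finite_allI)
  fix S k assume S: "S \<in> Pow A" and k: "k \<in> {..Suc q}"
  show "AE X in Gam (A \<times> {..q}). k < card S \<longrightarrow> (\<exists>i\<in>S. gs S (cols u X) k i ~= 0)"
  proof (cases "k < card S")
    case True
    show ?thesis
    proof (cases k)
      case 0
      then obtain i where "i \<in> S" using True by (metis card_gt_0_iff ex_in_conv)
      then show ?thesis using 0 S u by auto
    next
      case (Suc l)
      have "AE X in Gam (A \<times> {..q}). \<exists>i\<in>S. gs S (cols u X) k i ~= 0"
      proof (rule gs_nonzero_AE[where l = l])
        show "(%X. cols u X j i) \<in> borel_measurable (Gam (A \<times> {..q}))" if "j \<le> k" "i \<in> S" for j i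
          using that S k by (intro cols_measurable) auto
        show "cols u X j = cols u X' j" if "j < k" "\<And>i m. m ~= l ==> X (i, m) = X' (i, m)" for X X' j
          using that Suc by (cases j) auto
      qed (use A S True k Suc in auto)
      then show ?thesis by eventually_elim simp
    qed
  qed simp
qed (use A in auto)

lemma mpres_distr_equivariant:
  assumes T: "mpres M T" and c: "c \<in> M \<rightarrow>\<^sub>M N" and H: "H \<in> N \<rightarrow>\<^sub>M N"
    and eq: "\<And>x. x \<in> space M ==> c (T x) = H (c x)"
  shows "mpres (distr M N c) H"
  unfolding mpres_def
proof
  show "H \<in> distr M N c \<rightarrow>\<^sub>M distr M N c" using H by simp
  have "distr (distr M N c) (distr M N c) H = distr (distr M N c) N H"
    by (rule distr_cong) auto
  also have "\<dots> = distr M N (%x. H (c x))" using distr_distr[OF H c] by (simp add: comp_def)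
  also have "\<dots> = distr M N (%x. c (T x))" using eq by (intro distr_cong) auto
  also have "\<dots> = distr M N c" by (rule mpres_distr[OF T c])
  finally show "distr (distr M N c) (distr M N c) H = distr M N c" .
qed

definition last_gs :: "'i set => nat => ('i \<times> nat => real) => 'i => real" where
  "last_gs V q X = restrict (gs V (%k i. X (i, k)) q) V"

lemma last_gs_measurable: "last_gs V q \<in> Gam (V \<times> {..q}) \<rightarrow>\<^sub>M Gam V"
proof (rule measurable_GamI)
  fix i assume i: "i \<in> V"
  have "(%X. gs V (%k i. X (i, k)) q i) \<in> borel_measurable (Gam (V \<times> {..q}))"
  proof (rule gs_measurable[where I = V])
    fix k' i' assume "k' \<le> q" "i' \<in> V"
    then show "(%X. X (i', k')) \<in> borel_measurable (Gam (V \<times> {..q}))"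
      by (intro Gam_component_measurable) auto
  qed (use i in auto)
  then show "(%X. last_gs V q X i) \<in> borel_measurable (Gam (V \<times> {..q}))"
    using i by (simp add: last_gs_def)
qed (simp add: last_gs_def)

text \<open>Reflecting all columns simultaneously preserves their joint law and reflects the
  residual of the last one.\<close>

lemma invariant_direction_last_gs:
  assumes V: "finite V" and q: "q < card V"
  shows "invariant_direction (distr (Gam (V \<times> {..q})) (Gam V) (last_gs V q)) V"
proof -
  let ?M = "Gam (V \<times> {..q})" and ?c = "last_gs V q"
  interpret M: prob_space ?M by (rule prob_space_Gam)
  interpret D: prob_space "distr ?M (Gam V) ?c"
    by (rule M.prob_space_distr[OF last_gs_measurable])
  have inv: "mpres (distr ?M (Gam V) ?c) (hrefl V a)" for a
  proof (rule mpres_distr_equivariant)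
    show "mpres ?M (lift V {..q} (hrefl V a))"
      by (rule mpres_lift[OF V finite_atMost mpres_hrefl[OF V]])
    show "?c \<in> ?M \<rightarrow>\<^sub>M Gam V" by (rule last_gs_measurable)
    show "hrefl V a \<in> Gam V \<rightarrow>\<^sub>M Gam V" using mpres_hrefl[OF V] by (rule mpres_measurable)
    fix X assume "X \<in> space ?M"
    let ?z = "%k i. X (i, k)"
    show "?c (lift V {..q} (hrefl V a) X) = hrefl V a (?c X)"
    proof
      fix i
      show "?c (lift V {..q} (hrefl V a) X) i = hrefl V a (?c X) i"
      proof (cases "i \<in> V")
        case True
        have "gs V (%k i. lift V {..q} (hrefl V a) X (i, k)) q i = gs V (%k. hrefl V a (?z k)) q i"
        proof (rule gs_cong_on[THEN bspec, OF _ True])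
          fix j i assume "j \<le> q" "i \<in> V"
          then show "lift V {..q} (hrefl V a) X (i, j) = hrefl V a (?z j) i"
            by (auto simp: lift_def intro!: hrefl_cong)
        qed
        also have "\<dots> = hrefl V a (gs V ?z q) i" by (simp only: gs_hrefl[OF V])
        also have "\<dots> = hrefl V a (?c X) i"
          using True by (intro hrefl_cong) (auto simp: last_gs_def)
        finally show ?thesis using True by (simp add: last_gs_def)
      qed (simp add: last_gs_def hrefl_def)
    qed
  qed
  have nz: "AE X in ?M. \<exists>i\<in>V. gs V (%k i. X (i, k)) q i ~= 0"
  proof (rule gs_nonzero_AE[where l = q])
    fix j i assume "j \<le> q" "i \<in> V"
    then show "(%X. X (i, j)) \<in> borel_measurable ?M"
      by (intro Gam_component_measurable) auto
  qed (use V q in auto)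
  have "AE x in distr ?M (Gam V) ?c. ip V x x ~= 0"
  proof (subst AE_distr_iff[OF last_gs_measurable])
    show "{x \<in> space (Gam V). ip V x x ~= 0} \<in> sets (Gam V)"
    proof -
      have [measurable]: "(%x. ip V x x) \<in> borel_measurable (Gam V)"
        by (rule ip_measurable) (auto intro: Gam_component_measurable)
      show ?thesis by measurable
    qed
    show "AE x in ?M. ip V (?c x) (?c x) ~= 0"
      using nz
    proof eventually_elim
      case (elim X)
      then show ?case using ip_self_eq_0_iff[OF V, of "?c X"] by (auto simp: last_gs_def)
    qed
  qed
  then show ?thesis
    by unfold_locales (use V inv in auto)
qed

lemma cone_prob_combination:
  assumes fin: "finite A" "finite J" and a: "j0 \<in> J" "a j0 ~= 0"
    and C: "C \<in> sets (Gam A)" and scale: "\<And>c x. c > 0 ==> x \<in> space (Gam A) ==> (\<lambda>i\<in>A. c * x i) \<in> C \<longleftrightarrow> x \<in> C"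
  shows "measure (Gam (A \<times> J)) {X \<in> space (Gam (A \<times> J)). (\<lambda>i\<in>A. \<Sum>j\<in>J. a j * X (i, j)) \<in> C} = measure (Gam A) C"
proof -
  let ?L = "%X. \<lambda>i\<in>A. \<Sum>j\<in>J. a j * X (i, j)" and ?R = "%x. \<lambda>i\<in>A. sqrt (ip J a a) * x i"
  note dc = distr_combination[OF fin, of j0 a, OF a]
  have "measure (Gam (A \<times> J)) {X \<in> space (Gam (A \<times> J)). ?L X \<in> C} = measure (distr (Gam (A \<times> J)) (Gam A) ?L) C"
    by (subst measure_distr[OF dc(1) C]) (auto intro!: arg_cong[where f = "measure _"])
  also have "\<dots> = measure (Gam A) (?R -` C \<inter> space (Gam A))"
    unfolding dc(3) by (rule measure_distr[OF dc(2) C])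
  also have "?R -` C \<inter> space (Gam A) = C"
    using scale[of "sqrt (ip J a a)"] ip_self_pos[OF fin(2), of j0 a] a sets.sets_into_space[OF C] by auto
  finally show ?thesis .
qed

definition kkt :: "'i set => ('i => real) => ('i => real) => nat => 'i set => ('i \<times> nat => real) => bool" where
  "kkt A eps u q S X \<longleftrightarrow> (\<exists>i\<in>S. gs S (cols u X) (Suc q) i ~= 0) \<and>
     (\<forall>i\<in>S. eps i ~= 0 \<longrightarrow> 0 < eps i * gs S (cols u X) (Suc q) i) \<and>
     (\<forall>i\<in>A - S. eps i ~= 0 \<and> eps i * gs S (cols u X) (Suc q) i \<le> 0)"

lemma kkt_sets_joint:
  assumes A: "finite A" "S \<subseteq> A" and e: "\<And>i. i \<in> A ==> (%omega. e omega i) \<in> borel_measurable M"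
    and u: "\<And>i. i \<in> A ==> (%omega. u omega i) \<in> borel_measurable M"
    and X: "\<And>i j. i \<in> A ==> j \<le> q ==> (%omega. X omega (i, j)) \<in> borel_measurable M"
  shows "{omega \<in> space M. kkt A (e omega) (u omega) q S (X omega)} \<in> sets M"
proof -
  have g [measurable]: "(%omega. gs S (cols (u omega) (X omega)) (Suc q) i) \<in> borel_measurable M" if i: "i \<in> A" for i
  proof (rule gs_measurable[of _ A])
    fix j i assume "j \<le> Suc q" "i \<in> A"
    then show "(%omega. cols (u omega) (X omega) j i) \<in> borel_measurable M"
      using u X by (cases j) auto
  qed (use A i in auto)
  note e [measurable]
  have fin: "finite S" "finite (A - S)" using A by (auto intro: finite_subset)
  have "{omega \<in> space M. (\<exists>i\<in>S. gs S (cols (u omega) (X omega)) (Suc q) i ~= 0)} \<in> sets M"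
  proof (rule sets.sets_Collect_finite_Ex[OF _ fin(1)])
    fix i assume "i \<in> S"
    then have "i \<in> A" using A by auto
    then show "{omega \<in> space M. gs S (cols (u omega) (X omega)) (Suc q) i ~= 0} \<in> sets M"
      using g[of i] by measurable
  qed
  moreover have "{omega \<in> space M. (\<forall>i\<in>S. e omega i ~= 0 \<longrightarrow> 0 < e omega i * gs S (cols (u omega) (X omega)) (Suc q) i)} \<in> sets M"
  proof (rule sets.sets_Collect_finite_All[OF _ fin(1)])
    fix i assume "i \<in> S"
    then have "i \<in> A" using A by auto
    then show "{omega \<in> space M. e omega i ~= 0 \<longrightarrow> 0 < e omega i * gs S (cols (u omega) (X omega)) (Suc q) i} \<in> sets M"
      using g[of i] e[of i] by measurable
  qed
  moreover have "{omega \<in> space M. (\<forall>i\<in>A - S. e omega i ~= 0 \<and> e omega i * gs S (cols (u omega) (X omega)) (Suc q) i \<le> 0)} \<in> sets M"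
  proof (rule sets.sets_Collect_finite_All[OF _ fin(2)])
    fix i assume "i \<in> A - S"
    then have "i \<in> A" using A by auto
    then show "{omega \<in> space M. e omega i ~= 0 \<and> e omega i * gs S (cols (u omega) (X omega)) (Suc q) i \<le> 0} \<in> sets M"
      using g[of i] e[of i] by measurable
  qed
  ultimately show ?thesis unfolding kkt_def by (intro sets.sets_Collect_conj)
qed

lemma kkt_sets:
  assumes "finite A" "S \<subseteq> A"
  shows "{X \<in> space (Gam (A \<times> {..q})). kkt A eps u q S X} \<in> sets (Gam (A \<times> {..q}))"
  using assms by (intro kkt_sets_joint Gam_component_measurable) auto

lemma hrefl_to_axis:
  fixes u :: "'i => real"
  assumes S: "finite S" "i0 \<in> S" and i: "i \<in> S"
  defines "nu \<equiv> nrm S u" and "a \<equiv> %i. u i - (if i = i0 then nrm S u else 0)"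
  shows "hrefl S a u i = (if i = i0 then nu else 0)"
proof -
  have "ip S (%i. if i = i0 then nrm S u else 0) (%i. if i = i0 then nrm S u else 0) = nrm S u * nrm S u"
    using S by (simp add: ip_def if_distrib[where f="%u. u * _"] cong: if_cong)
  then have "ip S u u = ip S (%i. if i = i0 then nrm S u else 0) (%i. if i = i0 then nrm S u else 0)"
    by simp
  from hrefl_swap[OF S(1) this i] show ?thesis by (simp add: a_def nu_def)
qed

text \<open>
  Reflecting the rows in \<open>S\<close> so that \<open>u\<close> points along the axis \<open>i0\<close> turns the conditions on \<open>S\<close> into
  a condition on the direction of the residual in the remaining rows \<open>V\<close>; given these rows, the
  conditions off \<open>S\<close> are those of a multiple of a standard Gaussian vector.
\<close>

lemma kkt_rotate:
  fixes q :: nat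
  assumes A: "finite A" and S: "S \<subseteq> A" and i0: "i0 \<in> S" and u: "nrm S u > 0"
    and X: "X \<in> space (Gam (A \<times> {..q}))"
  defines "a \<equiv> %i. u i - (if i = i0 then nrm S u else 0)"
  defines "V \<equiv> S - {i0}"
  defines "h \<equiv> gs V (%k i. X (i, k)) q"
  defines "x \<equiv> %i. if i \<in> V then h i else 0"
  shows "kkt A eps u q S (lift A {..q} (hrefl A (%i. if i \<in> S then a i else 0)) X) \<longleftrightarrow>
    (nrm V x > 0 \<and> (\<forall>i\<in>S. eps i ~= 0 \<longrightarrow> 0 < eps i * hrefl S a x i)) \<and>
    (\<forall>i\<in>A - S. eps i ~= 0 \<and> eps i * (h i - h i0 / nrm S u * u i) \<le> 0)"
proof -
  have finS: "finite S" using A S finite_subset by blast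
  define TX where "TX = lift A {..q} (hrefl A (%i. if i \<in> S then a i else 0)) X"
  define ut where "ut = hrefl S a u"
  have ut_i0: "ut i0 = nrm S u" and ut_V: "\<And>i. i \<in> V ==> ut i = 0" and ut_off: "\<And>i. i \<notin> S ==> ut i = u i"
  proof -
    have *: "ut i = (if i = i0 then nrm S u else 0)" if "i \<in> S" for i
      unfolding ut_def a_def by (rule hrefl_to_axis[OF finS i0 that])
    show "ut i0 = nrm S u" "\<And>i. i \<in> V ==> ut i = 0" using * i0 by (auto simp: V_def)
    show "\<And>i. i \<notin> S ==> ut i = u i" by (simp add: ut_def hrefl_def)
  qed
  have ipA: "ip A y (%i. if i \<in> S then a i else 0) = ip S y a" for y
    unfolding ip_def using A S by (intro sum.mono_neutral_cong_right) auto
  have ipA': "ip S (%i. if i \<in> S then a i else 0) a = ip S a a"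
    by (rule ip_cong) auto
  have ext: "X (i, k) = undefined" if "i \<notin> A" for i k
    using X that by (auto simp: PiE_iff extensional_def)
  have col: "(%i. TX (i, k)) = hrefl S a (%i. X (i, k))" if "k \<le> q" for k
  proof
    fix i
    show "TX (i, k) = hrefl S a (%i. X (i, k)) i"
    proof (cases "i \<in> A")
      case True
      have "ip S (\<lambda>i\<in>A. X (i, k)) a = ip S (%i. X (i, k)) a"
        using S by (intro ip_cong) auto
      then show ?thesis
        using True that S by (auto simp: TX_def lift_def hrefl_def ipA ipA')
    next
      case False
      then show ?thesis using S ext[OF False] by (auto simp: TX_def lift_def hrefl_def)
    qed
  qed
  have "gs S (cols u TX) (Suc q) = gs S (%k. hrefl S a (cols ut X k)) (Suc q)"
  proof (rule gs_cong)
    fix j assume "j \<le> Suc q"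
    then show "cols u TX j = hrefl S a (cols ut X j)"
      using col by (cases j) (auto simp: ut_def hrefl_hrefl[OF finS])
  qed
  also have "\<dots> = hrefl S a (gs S (cols ut X) (Suc q))" by (rule gs_hrefl[OF finS])
  finally have s_eq: "gs S (cols u TX) (Suc q) = hrefl S a (gs S (cols ut X) (Suc q))" .
  define g where "g = gs S (cols ut X) (Suc q)"
  have g_eq: "g = (%i. h i - h i0 / nrm S u * ut i)"
    unfolding g_def h_def
    using gs_eliminate_coordinate[OF finS i0 meta_eq_to_obj_eq[OF V_def], of "cols ut X" q] ut_V ut_i0 u by simp
  \<comment> \<open>The correction in \<open>g_eq\<close> makes the coordinate \<open>i0\<close>
    vanish, and \<open>ut\<close> is zero on \<open>V\<close>.\<close>
  have gx: "g i = x i" if "i \<in> S" for i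
    using that ut_V ut_i0 u by (cases "i = i0") (auto simp: g_eq x_def V_def)
  have on: "hrefl S a g i = hrefl S a x i" if "i \<in> S" for i
    using gx that by (rule hrefl_cong)
  have off: "hrefl S a g i = h i - h i0 / nrm S u * u i" if "i \<notin> S" for i
    using that by (simp add: hrefl_def g_eq ut_off)
  have "(\<exists>i\<in>S. hrefl S a g i ~= 0) \<longleftrightarrow> ip S (hrefl S a g) (hrefl S a g) ~= 0"
    using ip_self_eq_0_iff[OF finS, of "hrefl S a g"] by blast
  also have "ip S (hrefl S a g) (hrefl S a g) = ip S x x"
    unfolding ip_hrefl[OF finS] by (rule ip_cong) (auto simp: gx)
  also have "ip S x x = ip V x x"
    unfolding ip_def using finS by (intro sum.mono_neutral_right) (auto simp: V_def x_def)
  also have "ip V x x ~= 0 \<longleftrightarrow> nrm V x > 0"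
    using ip_self_nonneg[of V x] by (simp add: less_le)
  finally have nz: "(\<exists>i\<in>S. hrefl S a g i ~= 0) \<longleftrightarrow> nrm V x > 0" .
  show ?thesis
    unfolding kkt_def TX_def[symmetric] s_eq g_def[symmetric] nz using on off by auto
qed

lemma Min_lipschitz:
  fixes f g :: "'k => real"
  assumes "finite K" "K ~= {}" "\<And>k. k \<in> K ==> \<bar>f k - g k\<bar> \<le> d"
  shows "\<bar>Min (f ` K) - Min (g ` K)\<bar> \<le> d"
proof -
  have *: "Min (f ` K) \<le> Min (g ` K) + d" if "\<And>k. k \<in> K ==> \<bar>f k - g k\<bar> \<le> d" for f g :: "'k => real"
  proof -
    have "Min (g ` K) \<in> g ` K" using assms by (intro Min_in) auto
    then obtain k where k: "k \<in> K" "Min (g ` K) = g k" by auto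
    have "Min (f ` K) \<le> f k" using assms k by (intro Min_le) auto
    also have "\<dots> \<le> g k + d" using that[OF k(1)] by linarith
    finally show ?thesis using k by simp
  qed
  show ?thesis using *[of f g] *[of g f] assms(3) by (simp add: abs_le_iff abs_minus_commute)
qed

lemma abs_coordinate_le_nrm: "finite S ==> i \<in> S ==> \<bar>x i\<bar> \<le> nrm S x"
proof -
  assume S: "finite S" "i \<in> S"
  have "x i * x i \<le> ip S x x"
    unfolding ip_def using S by (intro member_le_sum) auto
  from real_sqrt_le_mono[OF this] show ?thesis by simp
qed

lemma nrm_eq_L2_set: "nrm V x = L2_set x V"
  by (simp add: L2_set_def ip_def power2_eq_square)

lemma nrm_diff_le: "\<bar>nrm V x - nrm V y\<bar> \<le> nrm V (%i. x i - y i)"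
proof -
  have *: "L2_set x V \<le> L2_set y V + L2_set (%i. x i - y i) V" for x y :: "'a => real"
    using L2_set_triangle_ineq[of y "%i. x i - y i" V] by simp
  have "L2_set (%i. x i - y i) V = L2_set (%i. y i - x i) V"
    by (simp add: L2_set_def power2_commute)
  then show ?thesis unfolding nrm_eq_L2_set using *[of x y] *[of y x] by linarith
qed

lemma emeasure_prob_eq_measure: "prob_space M ==> emeasure M A = ennreal (measure M A)"
  by (rule finite_measure.emeasure_eq_measure[OF prob_space.finite_measure])

lemma scaled_le_0_iff:
  fixes c :: real
  assumes c: "c > 0" shows "e * (c * x - c * y / nu * z) \<le> 0 \<longleftrightarrow> e * (x - y / nu * z) \<le> 0"
proof -
  have "e * (c * x - c * y / nu * z) = c * (e * (x - y / nu * z))"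
    unfolding divide_inverse by (simp add: right_diff_distrib mult_ac)
  moreover have "c * t \<le> 0 \<longleftrightarrow> t \<le> 0" for t
    using c mult_le_cancel_left_pos[of c t 0] by simp
  ultimately show ?thesis by (simp only:)
qed

text \<open>After the reflection the rows split into \<open>V\<close> and \<open>W\<close>. The
  conditions on \<open>S\<close> become \<open>D > 0\<close> for a homogeneous 1-Lipschitz function
  of the residual on \<open>V\<close>, whose direction is uniform. Given the rows in
  \<open>V\<close>, the residual on \<open>W\<close> is a fixed combination of Gaussian columns,
  tested against the cone \<open>C\<close>; so this conditional probability is a constant. What
  matters is that \<open>q\<close> has disappeared from the right-hand side.\<close>

lemma kkt_prob_factor:
  fixes q :: nat
  assumes A: "finite A" and S: "S \<subseteq> A" and i0: "i0 \<in> S" and u: "nrm S u > 0" and q: "Suc q < card S"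
    and eps: "\<And>i. i \<in> A ==> \<bar>eps i\<bar> \<le> 1"
  defines "a \<equiv> %i. u i - (if i = i0 then nrm S u else 0)"
  defines "V \<equiv> S - {i0}"
  defines "W \<equiv> A - V"
  defines "K \<equiv> {i\<in>S. eps i ~= 0}"
  defines "C \<equiv> {w \<in> space (Gam W). \<forall>i\<in>A - S. eps i ~= 0 \<and> eps i * (w i - w i0 / nrm S u * u i) \<le> 0}"
  defines "d \<equiv> %x k. case k of None => nrm V x | Some i => eps i * hrefl S a (%i. if i \<in> V then x i else 0) i"
  defines "D \<equiv> %x. Min (d x ` insert None (Some ` K))"
  shows "measure (Gam (A \<times> {..q})) {X \<in> space (Gam (A \<times> {..q})). kkt A eps u q S X} =
    measure (Gam W) C * measure (Gam V) {x \<in> space (Gam V). D x > 0}"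
proof -
  have finS: "finite S" using A S finite_subset by blast
  have finV: "finite V" and finW: "finite W" and finK: "finite K"
    using A finS by (auto simp: V_def W_def K_def)
  have VW: "V \<inter> W = {}" "V \<union> W = A" "i0 \<in> W" "A - S \<subseteq> W" using S i0 by (auto simp: V_def W_def)
  have qV: "q < card V" using q i0 finS by (simp add: V_def)
  then have Vne: "V ~= {}" by auto
  let ?M = "Gam (A \<times> {..q})" and ?M1 = "Gam (V \<times> {..q})" and ?M2 = "Gam (W \<times> {..q})"
  let ?T = "lift A {..q} (hrefl A (%i. if i \<in> S then a i else 0))"
  have fin12: "finite (V \<times> {..q})" "finite (W \<times> {..q})" "(V \<times> {..q}) \<inter> (W \<times> {..q}) = {}"
    "(V \<times> {..q}) \<union> (W \<times> {..q}) = A \<times> {..q}"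
    using finV finW VW by auto
  have D_pos: "D x > 0 \<longleftrightarrow> nrm V x > 0 \<and> (\<forall>i\<in>S. eps i ~= 0 \<longrightarrow> 0 < eps i * hrefl S a (%i. if i \<in> V then x i else 0) i)" for x
    unfolding D_def using finK by (subst Min_gr_iff) (auto simp: d_def K_def)
  have D_cong: "D x = D y" if "\<And>i. i \<in> V ==> x i = y i" for x y
  proof -
    have "(%i. if i \<in> V then x i else 0) = (%i. if i \<in> V then y i else 0)" using that by auto
    moreover have "nrm V x = nrm V y" using that ip_cong[of V x y x y] by simp
    ultimately have "d x = d y" by (simp add: d_def fun_eq_iff split: option.split)
    then show ?thesis by (simp add: D_def)
  qed
  have D_hom: "D (%i. c * x i) = c * D x" if c: "c > 0" for c x
  proof -
    have dd: "d (%i. c * x i) k = c * d x k" for k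
    proof (cases k)
      case None
      then show ?thesis using c by (simp add: d_def ip_scale2 real_sqrt_mult)
    next
      case (Some i)
      have "(%i. if i \<in> V then c * x i else 0) = (%i. c * (if i \<in> V then x i else 0))" by auto
      then show ?thesis using Some by (simp add: d_def hrefl_scale)
    qed
    have "Min ((%t. c * t) ` (d x ` insert None (Some ` K))) = c * Min (d x ` insert None (Some ` K))"
      using finK c by (intro mono_Min_commute[symmetric] monoI mult_left_mono) auto
    then show ?thesis unfolding D_def image_image dd .
  qed
  have D_lip: "\<bar>D x - D y\<bar> \<le> 1 * nrm V (%i. x i - y i)" for x y
    unfolding D_def
  proof (rule Min_lipschitz)
    fix k assume k: "k \<in> insert None (Some ` K)"
    show "\<bar>d x k - d y k\<bar> \<le> 1 * nrm V (%i. x i - y i)"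
    proof (cases k)
      case None
      then show ?thesis using nrm_diff_le[of V x y] by (simp add: d_def)
    next
      case (Some i)
      then have i: "i \<in> S" using k by (auto simp: K_def)
      let ?x = "%i. if i \<in> V then x i else 0" and ?y = "%i. if i \<in> V then y i else 0"
      have "\<bar>d x k - d y k\<bar> = \<bar>eps i\<bar> * \<bar>hrefl S a (%i. ?x i - ?y i) i\<bar>"
        using Some by (simp add: d_def hrefl_diff right_diff_distrib[symmetric] abs_mult)
      also have "\<dots> \<le> 1 * \<bar>hrefl S a (%i. ?x i - ?y i) i\<bar>"
        using i S eps by (intro mult_right_mono) auto
      also have "\<dots> \<le> 1 * nrm S (hrefl S a (%i. ?x i - ?y i))"
        using abs_coordinate_le_nrm[OF finS i] by simp
      also have "nrm S (hrefl S a (%i. ?x i - ?y i)) = nrm S (%i. ?x i - ?y i)"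
        by (rule nrm_hrefl[OF finS])
      also have "\<dots> = nrm V (%i. x i - y i)"
        unfolding ip_def using finS
        by (intro arg_cong[where f = sqrt] sum.mono_neutral_cong_right) (auto simp: V_def)
      finally show ?thesis .
    qed
  qed (use finK in auto)
  have mD: "D \<in> borel_measurable (Gam V)"
  proof -
    have comp: "(%x. (if i \<in> V then x i else 0)) \<in> borel_measurable (Gam V)" for i
      using Gam_component_measurable[of i V] by (cases "i \<in> V") simp_all
    have "(%x. d x k) \<in> borel_measurable (Gam V)" if k: "k \<in> insert None (Some ` K)" for k
    proof (cases k)
      case None
      have "(%x. ip V x x) \<in> borel_measurable (Gam V)"
        by (rule ip_measurable) (auto intro: Gam_component_measurable)
      then show ?thesis using None by (simp add: d_def)
    next
      case (Some i)
      then have i: "i \<in> S" using k by (auto simp: K_def)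
      have "(%x. ip S (%i. if i \<in> V then x i else 0) a) \<in> borel_measurable (Gam V)"
        by (rule ip_measurable) (auto intro: comp)
      then show ?thesis using Some i comp[of i] by (simp add: d_def hrefl_def)
    qed
    then show ?thesis unfolding D_def using finK by (intro borel_measurable_Min) auto
  qed
  have C: "C \<in> sets (Gam W)"
  proof -
    have "{w \<in> space (Gam W). eps i ~= 0 \<and> eps i * (w i - w i0 / nrm S u * u i) \<le> 0} \<in> sets (Gam W)" if "i \<in> A - S" for i
    proof -
      have "i \<in> W" using VW(4) that by blast
      then have [measurable]: "(%w. w i) \<in> borel_measurable (Gam W)" "(%w. w i0) \<in> borel_measurable (Gam W)"
        using VW(3) by (simp_all only: Gam_component_measurable)
      have "(%w. eps i * (w i - w i0 / nrm S u * u i)) \<in> borel_measurable (Gam W)" by simp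
      from borel_measurable_le[OF this borel_measurable_const[of 0]]
      have "{w \<in> space (Gam W). eps i * (w i - w i0 / nrm S u * u i) \<le> 0} \<in> sets (Gam W)" .
      then show ?thesis by (cases "eps i = 0") simp_all
    qed
    from sets.sets_Collect_finite_All[OF this finite_Diff[OF A]] show ?thesis unfolding C_def .
  qed
  have C_scale: "(\<lambda>i\<in>W. c * w i) \<in> C \<longleftrightarrow> w \<in> C" if "c > 0" "w \<in> space (Gam W)" for c w
  proof -
    have sc: "eps i * (c * w i - c * w i0 / nrm S u * u i) \<le> 0 \<longleftrightarrow> eps i * (w i - w i0 / nrm S u * u i) \<le> 0" for i
      by (rule scaled_le_0_iff[OF that(1)])
    have iW: "i \<in> W" if "i \<in> A - S" for i using VW(4) that by blast
    show ?thesis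
      unfolding C_def mem_Collect_eq
    proof (intro conj_cong ball_cong refl)
      show "(\<lambda>i\<in>W. c * w i) \<in> space (Gam W) \<longleftrightarrow> w \<in> space (Gam W)" using that(2) by simp
      fix i assume "i \<in> A - S"
      from iW[OF this] VW(3) show "eps i * ((\<lambda>i\<in>W. c * w i) i - (\<lambda>i\<in>W. c * w i) i0 / nrm S u * u i) \<le> 0 \<longleftrightarrow>
        eps i * (w i - w i0 / nrm S u * u i) \<le> 0"
        by (simp only: restrict_apply if_True sc)
    qed
  qed
  have T: "mpres ?M ?T"
    by (rule mpres_lift[OF A finite_atMost mpres_hrefl[OF A]])
  let ?E = "{X \<in> space ?M. kkt A eps u q S X}"
  have E: "?E \<in> sets ?M" by (rule kkt_sets[OF A S])
  let ?E' = "?T -` ?E \<inter> space ?M"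
  have mT: "?T \<in> ?M \<rightarrow>\<^sub>M ?M" using T by (rule mpres_measurable)
  have E': "?E' \<in> sets ?M" by (rule measurable_sets[OF mT E])
  have "emeasure ?M ?E = emeasure (distr ?M ?M ?T) ?E" using T by (simp add: mpres_def)
  also have "\<dots> = emeasure ?M ?E'" by (rule emeasure_distr[OF mT E])
  also have "\<dots> = (\<integral>\<^sup>+X1. emeasure ?M2 ((%X2. merge (V \<times> {..q}) (W \<times> {..q}) (X1, X2)) -` ?E' \<inter> space ?M2) \<partial>?M1)"
    using product_sigma_finite.emeasure_fold_integral[OF product_sigma_finite_std_normal fin12(3,1,2), of ?E'] E' fin12(4)
    by (simp add: Gam_def)
  also have "\<dots> = (\<integral>\<^sup>+X1. indicator {X1 \<in> space ?M1. D (last_gs V q X1) > 0} X1 * ennreal (measure (Gam W) C) \<partial>?M1)"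
  proof (rule nn_integral_cong)
    fix X1 assume X1: "X1 \<in> space ?M1"
    let ?m = "%X2. merge (V \<times> {..q}) (W \<times> {..q}) (X1, X2)"
    define c where "c = gc V (%k i. X1 (i, k)) q"
    have mem: "?m X2 \<in> ?E' \<longleftrightarrow> D (last_gs V q X1) > 0 \<and> (\<lambda>i\<in>W. \<Sum>l\<in>{..q}. c l * X2 (i, l)) \<in> C"
      if X2: "X2 \<in> space ?M2" for X2
    proof -
      have sp: "?m X2 \<in> space ?M"
        using X1 X2 fin12(4) by (auto simp: merge_def PiE_iff extensional_def)
      define h where "h = gs V (%k i. ?m X2 (i, k)) q"
      have hV: "h i = last_gs V q X1 i" if "i \<in> V" for i
      proof -
        have "h i = gs V (%k i. X1 (i, k)) q i"
          unfolding h_def by (rule gs_cong_on[THEN bspec, OF _ that]) (auto simp: merge_def)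
        then show ?thesis using that by (simp add: last_gs_def)
      qed
      have hW: "h i = (\<Sum>l\<in>{..q}. c l * X2 (i, l))" if "i \<in> W" for i
      proof -
        \<comment> \<open>Only the rows in \<open>V\<close> enter the coefficients, and these are
          the rows of \<open>X1\<close>.\<close>
        have "gc V (%k i. ?m X2 (i, k)) q l = c l" for l
          unfolding c_def by (rule gc_cong_on) (auto simp: merge_def)
        then have "h i = (\<Sum>l\<le>q. c l * ?m X2 (i, l))"
          unfolding h_def gs_eq_gc by simp
        also have "\<dots> = (\<Sum>l\<in>{..q}. c l * X2 (i, l))"
          using that VW by (intro sum.cong) (auto simp: merge_def)
        finally show ?thesis .
      qed
      have "?m X2 \<in> ?E' \<longleftrightarrow> kkt A eps u q S (?T (?m X2))"
        using sp measurable_space[OF mT sp] by simp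
      also have "\<dots> \<longleftrightarrow> D h > 0 \<and> (\<forall>i\<in>A - S. eps i ~= 0 \<and> eps i * (h i - h i0 / nrm S u * u i) \<le> 0)"
      proof -
        have kr: "kkt A eps u q S (?T (?m X2)) \<longleftrightarrow>
            (nrm V (%i. if i \<in> V then h i else 0) > 0 \<and>
             (\<forall>i\<in>S. eps i ~= 0 \<longrightarrow> 0 < eps i * hrefl S a (%i. if i \<in> V then h i else 0) i)) \<and>
            (\<forall>i\<in>A - S. eps i ~= 0 \<and> eps i * (h i - h i0 / nrm S u * u i) \<le> 0)"
          unfolding a_def V_def h_def W_def by (rule kkt_rotate[OF A S i0 u sp[unfolded V_def W_def]])
        have "nrm V h = nrm V (%i. if i \<in> V then h i else 0)"
          by (intro arg_cong[where f = sqrt] ip_cong) auto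
        then show ?thesis unfolding kr D_pos by (simp only:)
      qed
      also have "D h = D (last_gs V q X1)" by (rule D_cong[OF hV])
      also have "(\<forall>i\<in>A - S. eps i ~= 0 \<and> eps i * (h i - h i0 / nrm S u * u i) \<le> 0) \<longleftrightarrow>
        (\<lambda>i\<in>W. \<Sum>l\<in>{..q}. c l * X2 (i, l)) \<in> C"
      proof -
        have "(\<lambda>i\<in>W. \<Sum>l\<in>{..q}. c l * X2 (i, l)) = restrict h W" using hW by (auto simp: restrict_def)
        moreover have "i \<in> W" if "i \<in> A - S" for i using VW(4) that by blast
        ultimately show ?thesis using VW(3) by (auto simp: C_def)
      qed
      finally show ?thesis .
    qed
    \<comment> \<open>The last column enters with coefficient 1, so the combination is not
      degenerate.\<close>
    have cq: "c q ~= 0" by (simp add: c_def)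
    have "?m -` ?E' \<inter> space ?M2 = (if D (last_gs V q X1) > 0
       then {X2 \<in> space ?M2. (\<lambda>i\<in>W. \<Sum>l\<in>{..q}. c l * X2 (i, l)) \<in> C} else {})"
      using mem by auto
    moreover have "emeasure ?M2 {X2 \<in> space ?M2. (\<lambda>i\<in>W. \<Sum>l\<in>{..q}. c l * X2 (i, l)) \<in> C} = ennreal (measure (Gam W) C)"
      using cone_prob_combination[where A = W and J = "{..q}" and ?j0.0 = q and a = c and C = C, OF finW finite_atMost _ cq C C_scale]
      by (simp only: emeasure_prob_eq_measure[OF prob_space_Gam] atMost_iff order_refl)
    ultimately show "emeasure ?M2 (?m -` ?E' \<inter> space ?M2) =
       indicator {X1 \<in> space ?M1. D (last_gs V q X1) > 0} X1 * ennreal (measure (Gam W) C)"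
      using X1 by simp
  qed
  also have "\<dots> = emeasure ?M1 {X1 \<in> space ?M1. D (last_gs V q X1) > 0} * ennreal (measure (Gam W) C)"
  proof -
    have "(%X1. D (last_gs V q X1)) \<in> borel_measurable ?M1"
      by (rule measurable_compose[OF last_gs_measurable mD])
    then have sm: "{X1 \<in> space ?M1. D (last_gs V q X1) > 0} \<in> sets ?M1" by measurable
    show ?thesis
      unfolding nn_integral_indicator[OF sm, symmetric]
      by (rule nn_integral_multc) (rule borel_measurable_indicator[OF sm])
  qed
  also have "emeasure ?M1 {X1 \<in> space ?M1. D (last_gs V q X1) > 0} = ennreal (measure (Gam V) {x \<in> space (Gam V). D x > 0})"
  proof -
    let ?nu = "distr ?M1 (Gam V) (last_gs V q)"
    have sD: "{x \<in> space (Gam V). D x > 0} \<in> sets (Gam V)" using mD by measurable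
    have "emeasure ?M1 {X1 \<in> space ?M1. D (last_gs V q X1) > 0} = emeasure ?nu {x \<in> space (Gam V). D x > 0}"
    proof -
      have "last_gs V q X \<in> space (Gam V)" for X by (simp add: last_gs_def)
      then have "last_gs V q -` {x \<in> space (Gam V). D x > 0} \<inter> space ?M1 = {X1 \<in> space ?M1. D (last_gs V q X1) > 0}"
        by blast
      then show ?thesis by (simp only: emeasure_distr[OF last_gs_measurable sD])
    qed
    also have "\<dots> = ennreal (measure ?nu {x \<in> space ?nu. D x > 0})"
      by (simp only: emeasure_prob_eq_measure[OF prob_space.prob_space_distr[OF prob_space_Gam last_gs_measurable]] space_distr)
    \<comment> \<open>Only the direction of the residual matters, so that a standard Gaussian vector
      may take its place.\<close>
    also have "measure ?nu {x \<in> space ?nu. D x > 0} = measure (Gam V) {x \<in> space (Gam V). D x > 0}"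
      by (rule cone_prob_unique[OF invariant_direction_last_gs[OF finV qV] invariant_direction_Gam[OF finV Vne] mD D_hom D_lip Vne])
    finally show ?thesis .
  qed
  finally show ?thesis
    unfolding emeasure_prob_eq_measure[OF prob_space_Gam]
    by (simp add: ennreal_mult[symmetric] mult.commute)
qed

text \<open>The factorisations for \<open>q\<close> and for \<open>0\<close> have the same
  right-hand side; the condition on \<open>card S\<close> covers both.\<close>

lemma kkt_prob_independent_of_dimension:
  assumes A: "finite A" and S: "S \<subseteq> A" and u: "\<And>i. i \<in> A ==> u i ~= 0" and q: "Suc q < card S"
    and eps: "\<And>i. i \<in> A ==> \<bar>eps i\<bar> \<le> 1"
  shows "measure (Gam (A \<times> {..q})) {X \<in> space (Gam (A \<times> {..q})). kkt A eps u q S X} =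
    measure (Gam (A \<times> {..0})) {X \<in> space (Gam (A \<times> {..0})). kkt A eps u 0 S X}"
proof -
  obtain i0 where i0: "i0 \<in> S" using q by fastforce
  have "nrm S u > 0"
    using ip_self_pos[of S i0 u] i0 S u A finite_subset by auto
  note f = kkt_prob_factor[OF A S i0 this _ eps]
  show ?thesis using f[of q] f[of 0] q by simp
qed

subsection \<open>Distance to a product of rays\<close>

text \<open>For \<open>e\<close> in {-1, 0, 1}, the distance of \<open>s\<close> to the set of moves
  along which a loss of sign \<open>e\<close> does not increase: the point 0 if
  \<open>e = 0\<close>, else the half-line \<open>e * s \<le> 0\<close>.\<close>

definition dcone :: "real => real => real" where
  "dcone e s = (if e = 0 then \<bar>s\<bar> else max (e * s) 0)"

text \<open>The residual of the projection onto the same set, which is half the derivative of the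
  squared distance.\<close>

definition rcone :: "real => real => real" where
  "rcone e s = (if e = 0 \<or> 0 < e * s then s else 0)"

lemma dcone_nonneg [simp]: "0 \<le> dcone e s"
  by (simp add: dcone_def)

lemma dcone_scale: "c > 0 ==> dcone e (c * s) = c * dcone e s"
  by (auto simp: dcone_def abs_mult max_def mult.left_commute zero_le_mult_iff mult_le_0_iff)

lemma continuous_on_dcone: "continuous_on A (dcone e)"
  unfolding dcone_def[abs_def] by (cases "e = 0") (auto intro!: continuous_intros)

lemma sign_cases: "e \<in> {-1, 0, 1::real} ==> (e = -1 ==> P) ==> (e = 0 ==> P) ==> (e = 1 ==> P) ==> P"
  by blast

lemma dcone_power2: "e \<in> {-1, 0, 1} ==> (dcone e s)\<^sup>2 = rcone e s * s"
  by (erule sign_cases) (auto simp: dcone_def rcone_def power2_eq_square max_def)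

text \<open>The residual of a projection onto a convex set is 1-Lipschitz, so the squared distance
  stays below its tangent plus the square of the increment. This and the tangent bound
  \<open>dcone_lower\<close> take the place of differentiation in what follows.\<close>

lemma dcone_upper:
  assumes "e \<in> {-1, 0, 1}" shows "(dcone e (s + t))\<^sup>2 \<le> (dcone e s)\<^sup>2 + 2 * rcone e s * t + t\<^sup>2"
proof -
  have sq: "(s + t)\<^sup>2 = s\<^sup>2 + 2 * s * t + t\<^sup>2" by (simp add: power2_sum)
  have neg: "(- s - t)\<^sup>2 = (s + t)\<^sup>2" by (simp add: power2_eq_square algebra_simps)
  consider "e = 0" | "e ~= 0" "e * s > 0" | "e ~= 0" "e * s \<le> 0" by linarith
  then show ?thesis
  proof cases
    case 2
    have "(dcone e (s + t))\<^sup>2 \<le> (s + t)\<^sup>2"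
      using assms by (cases rule: sign_cases) (auto simp: dcone_def max_def neg)
    moreover have "(dcone e s)\<^sup>2 = s\<^sup>2" "rcone e s = s"
      using assms 2 by (cases rule: sign_cases; auto simp: dcone_def rcone_def max_def)+
    ultimately show ?thesis using sq by simp
  next
    case 3
    have "dcone e (s + t) \<le> \<bar>t\<bar>"
      using assms 3 by (cases rule: sign_cases) (auto simp: dcone_def)
    then have "(dcone e (s + t))\<^sup>2 \<le> t\<^sup>2" by (simp add: abs_le_square_iff[symmetric])
    moreover have "rcone e s = 0" using 3 by (simp add: rcone_def)
    ultimately show ?thesis by (simp add: add_increasing)
  qed (simp add: dcone_def rcone_def sq)
qed

text \<open>The squared distance to a convex set is convex, and the left-hand side is its
  tangent.\<close>

lemma dcone_lower:
  assumes "e \<in> {-1, 0, 1}" shows "(dcone e s)\<^sup>2 + 2 * rcone e s * t \<le> (dcone e (s + t))\<^sup>2"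
proof -
  have sq: "(s + t)\<^sup>2 = s\<^sup>2 + 2 * s * t + t\<^sup>2" by (simp add: power2_sum)
  have neg: "(- s - t)\<^sup>2 = (s + t)\<^sup>2" by (simp add: power2_eq_square algebra_simps)
  consider "e = 0" | "e ~= 0" "e * s > 0" | "e ~= 0" "e * s \<le> 0" by linarith
  then show ?thesis
  proof cases
    case 1
    then show ?thesis using sq by (simp add: dcone_def rcone_def)
  next
    case 2
    have r: "(dcone e s)\<^sup>2 = s\<^sup>2" "rcone e s = s"
      using assms 2 by (cases rule: sign_cases; auto simp: dcone_def rcone_def max_def)+
    show ?thesis
    proof (cases "e * (s + t) > 0")
      case True
      then have "(dcone e (s + t))\<^sup>2 = (s + t)\<^sup>2"
        using assms 2 by (cases rule: sign_cases) (auto simp: dcone_def max_def neg)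
      then show ?thesis using r sq by simp
    next
      case False
      have "e * e = 1" using assms 2 by auto
      have "s * (s + 2 * t) = (e * s) * (e * s + 2 * (e * t))"
        using \<open>e * e = 1\<close> by (simp add: algebra_simps) (metis mult.assoc mult.left_commute mult_1)
      also have "\<dots> \<le> 0"
        using 2 False by (intro mult_nonneg_nonpos) (auto simp: distrib_left)
      finally have "s\<^sup>2 + 2 * s * t \<le> 0" by (simp add: power2_eq_square algebra_simps)
      then show ?thesis using r by (simp add: order_trans[OF _ zero_le_power2])
    qed
  next
    case 3
    then have "dcone e s = 0" "rcone e s = 0" by (auto simp: dcone_def rcone_def)
    then show ?thesis by simp
  qed
qed

text \<open>Firm nonexpansiveness of the residual of a projection: the projection is nondecreasing,
  and so is the residual. Uniqueness of the active set rests on it.\<close>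

lemma rcone_firm:
  assumes "e \<in> {-1, 0, 1}"
  shows "(rcone e s - rcone e t)\<^sup>2 \<le> (rcone e s - rcone e t) * (s - t)"
proof -
  let ?r = "rcone e s - rcone e t"
  have "0 \<le> ?r * ((s - rcone e s) - (t - rcone e t))"
    using assms
    by (cases rule: sign_cases)
       (auto simp: rcone_def mult_nonneg_nonpos mult_nonneg_nonneg mult_nonpos_nonneg mult_nonpos_nonpos)
  then show ?thesis by (simp add: power2_eq_square algebra_simps)
qed

text \<open>Residuals lie in the polar cone.\<close>

lemma rcone_mult_nonpos:
  assumes "e \<in> {-1, 0, 1}" "dcone e c = 0" shows "rcone e s * c \<le> 0"
  using assms(1)
  by (cases rule: sign_cases) (use assms(2) in \<open>auto simp: dcone_def rcone_def mult_le_0_iff max_def split: if_splits\<close>)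

text \<open>Vectors of length \<open>m\<close> are padded with zeros to sequences, so that
  compactness in the product topology is Tychonoff's theorem.\<close>

lemma compact_box:
  fixes R :: real
  shows "compact {mu :: nat => real. \<forall>l. (l < m \<longrightarrow> \<bar>mu l\<bar> \<le> R) \<and> (\<not> l < m \<longrightarrow> mu l = 0)}"
proof -
  let ?S = "%l. if l < m then {-R..R} else {0::real}"
  have "{mu :: nat => real. \<forall>l. (l < m \<longrightarrow> \<bar>mu l\<bar> \<le> R) \<and> (\<not> l < m \<longrightarrow> mu l = 0)} = PiE UNIV ?S"
    by (auto simp: PiE_def Pi_def abs_le_iff split: if_splits)
  moreover have "compactin (product_topology (%_. euclidean) UNIV) (PiE UNIV ?S)"
    by (subst compactin_PiE) auto
  ultimately show ?thesis by (simp add: euclidean_product_topology)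
qed

lemma continuous_on_linear_form:
  "continuous_on UNIV (%mu::nat => real. c + (\<Sum>l<m. mu l * v l))"
  by (intro continuous_intros continuous_on_product_coordinates)

definition shifted :: "('i => real) => (nat => 'i => real) => nat => (nat => real) => 'i => real" where
  "shifted g v m mu i = g i + (\<Sum>l<m. mu l * v l i)"

lemma shifted_add: "shifted g v m (%l. mu l + eta l) i = shifted g v m mu i + (\<Sum>l<m. eta l * v l i)"
  by (simp add: shifted_def distrib_right sum.distrib)

text \<open>By \<open>dcone_upper\<close>, a quadratic polynomial in \<open>t\<close> without
  constant term is nonnegative near 0, hence its linear coefficient is zero.\<close>

lemma stationary_of_local_min:
  fixes v :: "nat => 'i => real"
  assumes A: "finite A" and eps: "\<And>i. i \<in> A ==> eps i \<in> {-1, 0, 1}"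
    and k: "k < m" and r0: "r0 > 0"
    and min: "\<And>t. \<bar>t\<bar> \<le> r0 ==> (\<Sum>i\<in>A. (dcone (eps i) (shifted g v m mu i))\<^sup>2)
       \<le> (\<Sum>i\<in>A. (dcone (eps i) (shifted g v m (%l. mu l + (if l = k then t else 0)) i))\<^sup>2)"
  shows "(\<Sum>i\<in>A. rcone (eps i) (shifted g v m mu i) * v k i) = 0"
proof -
  let ?s = "shifted g v m mu"
  define B where "B = (\<Sum>i\<in>A. rcone (eps i) (?s i) * v k i)"
  define Q where "Q = (\<Sum>i\<in>A. (v k i)\<^sup>2)"
  have Q: "Q \<ge> 0" by (simp add: Q_def sum_nonneg)
  have ineq: "0 \<le> 2 * t * B + t\<^sup>2 * Q" if t: "\<bar>t\<bar> \<le> r0" for t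
  proof -
    have s: "shifted g v m (%l. mu l + (if l = k then t else 0)) i = ?s i + t * v k i" for i
    proof -
      have "(\<Sum>l<m. (if l = k then t else 0) * v l i) = t * v k i"
        using k by (simp add: if_distrib[where f = "%u. u * _"] cong: if_cong)
      then show ?thesis by (simp add: shifted_add)
    qed
    have "(\<Sum>i\<in>A. (dcone (eps i) (?s i))\<^sup>2) \<le> (\<Sum>i\<in>A. (dcone (eps i) (?s i + t * v k i))\<^sup>2)"
      using min[OF t] by (simp only: s)
    also have "\<dots> \<le> (\<Sum>i\<in>A. (dcone (eps i) (?s i))\<^sup>2 + 2 * rcone (eps i) (?s i) * (t * v k i) + (t * v k i)\<^sup>2)"
      by (intro sum_mono dcone_upper eps)
    also have "\<dots> = (\<Sum>i\<in>A. (dcone (eps i) (?s i))\<^sup>2) + 2 * t * B + t\<^sup>2 * Q"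
      unfolding B_def Q_def by (simp add: sum.distrib sum_distrib_left power_mult_distrib mult_ac)
    finally show ?thesis by simp
  qed
  have "B = 0"
  proof (rule ccontr)
    assume "B ~= 0"
    \<comment> \<open>Small enough for the linear term to outweigh the quadratic one.\<close>
    define t where "t = min r0 (\<bar>B\<bar> / (Q + 1))"
    have tpos: "t > 0" using r0 \<open>B ~= 0\<close> Q by (simp add: t_def)
    have "t * (Q + 1) \<le> \<bar>B\<bar>"
    proof -
      have "t \<le> \<bar>B\<bar> / (Q + 1)" by (simp add: t_def)
      then show ?thesis using Q by (simp add: pos_le_divide_eq)
    qed
    then have "t * Q < 2 * \<bar>B\<bar>" using tpos \<open>B ~= 0\<close> by (simp add: distrib_left)
    then have "t * (t * Q) < t * (2 * \<bar>B\<bar>)" using tpos by simp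
    moreover have "0 \<le> 2 * (- sgn B * t) * B + (- sgn B * t)\<^sup>2 * Q"
      by (rule ineq) (use tpos \<open>B ~= 0\<close> in \<open>simp add: abs_mult t_def\<close>)
    moreover have "2 * (- sgn B * t) * B + (- sgn B * t)\<^sup>2 * Q = - (t * (2 * \<bar>B\<bar>)) + t * (t * Q)"
    proof -
      have "sgn B * B = \<bar>B\<bar>" "(sgn B)\<^sup>2 = 1" using \<open>B ~= 0\<close> by (auto simp: sgn_if)
      then show ?thesis by (simp add: power_mult_distrib power2_eq_square mult_ac)
    qed
    ultimately show False by linarith
  qed
  then show ?thesis by (simp add: B_def)
qed

text \<open>
  Minimisers \<open>mu R\<close> over balls of radius \<open>R\<close> either lie in the interior for some \<open>R\<close>, or their
  directions accumulate at a direction \<open>d\<close> of recession; subtracting \<open>d\<close> from \<open>mu R\<close> does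
  not change the objective for large \<open>R\<close>, as this is piecewise quadratic, but decreases the norm.
\<close>

lemma ex_stationary:
  fixes v :: "nat => 'i => real"
  assumes A: "finite A" and eps: "\<And>i. i \<in> A ==> eps i \<in> {-1, 0, 1}"
  shows "\<exists>mu. \<forall>k<m. (\<Sum>i\<in>A. rcone (eps i) (shifted g v m mu i) * v k i) = 0"
proof -
  define H where "H mu = (\<Sum>i\<in>A. (dcone (eps i) (shifted g v m mu i))\<^sup>2)" for mu
  define N where "N mu = (\<Sum>l<m. (mu l)\<^sup>2)" for mu :: "nat => real"
  define Z where "Z = {mu :: nat => real. \<forall>l. \<not> l < m \<longrightarrow> mu l = 0}"
  have cH: "continuous_on UNIV H"
    unfolding H_def shifted_def
    by (intro continuous_on_sum continuous_on_power continuous_on_compose2[OF continuous_on_dcone[of UNIV]]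
        continuous_on_linear_form) auto
  have cN: "continuous_on UNIV N"
    unfolding N_def by (intro continuous_intros continuous_on_product_coordinates)
  have coord: "\<bar>mu l\<bar> \<le> r" if "N mu \<le> r\<^sup>2" "l < m" "r \<ge> 0" for mu l and r :: real
  proof -
    have "(mu l)\<^sup>2 \<le> N mu" unfolding N_def using that(2) by (intro member_le_sum) auto
    then have "(mu l)\<^sup>2 \<le> r\<^sup>2" using that(1) by linarith
    then show ?thesis using that(3) abs_le_square_iff[of "mu l" r] by simp
  qed
  have cpt: "compact {mu \<in> Z. N mu \<le> r\<^sup>2}" if "r \<ge> 0" for r :: real
  proof -
    have "{mu \<in> Z. N mu \<le> r\<^sup>2} = {mu. \<forall>l. (l < m \<longrightarrow> \<bar>mu l\<bar> \<le> r) \<and> (\<not> l < m \<longrightarrow> mu l = 0)} \<inter> {mu. N mu \<le> r\<^sup>2}"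
      using coord that by (auto simp: Z_def)
    moreover have "closed {mu. N mu \<le> r\<^sup>2}"
      by (intro closed_Collect_le cN continuous_on_const)
    ultimately show ?thesis using compact_box[of m r] by (simp add: compact_Int_closed)
  qed
  have "\<exists>mu\<in>Z. N mu \<le> (real R)\<^sup>2 \<and> (\<forall>eta\<in>Z. N eta \<le> (real R)\<^sup>2 \<longrightarrow> H mu \<le> H eta)" for R :: nat
  proof -
    have ne: "{mu \<in> Z. N mu \<le> (real R)\<^sup>2} ~= {}"
    proof -
      have "(%_. 0) \<in> {mu \<in> Z. N mu \<le> (real R)\<^sup>2}" by (simp add: Z_def N_def)
      then show ?thesis by blast
    qed
    have "continuous_on {mu \<in> Z. N mu \<le> (real R)\<^sup>2} H" using cH by (rule continuous_on_subset) simp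
    from continuous_attains_inf[OF cpt ne this] show ?thesis by auto
  qed
  then have "\<forall>R. \<exists>mu. mu \<in> Z \<and> N mu \<le> (real R)\<^sup>2 \<and> (\<forall>eta\<in>Z. N eta \<le> (real R)\<^sup>2 \<longrightarrow> H mu \<le> H eta)" by blast
  from choice[OF this] obtain mu where mu: "\<And>R. mu R \<in> Z" "\<And>R. N (mu R) \<le> (real R)\<^sup>2"
    "\<And>R eta. eta \<in> Z ==> N eta \<le> (real R)\<^sup>2 ==> H (mu R) \<le> H eta" by blast
  have "\<exists>\<xi> R. \<xi> \<in> Z \<and> N \<xi> < (real R)\<^sup>2 \<and> (\<forall>eta\<in>Z. N eta \<le> (real R)\<^sup>2 \<longrightarrow> H \<xi> \<le> H eta)"
  proof (cases "\<exists>R. N (mu R) < (real R)\<^sup>2")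
    case True
    then show ?thesis using mu by blast
  next
    case False
    then have NR: "N (mu R) = (real R)\<^sup>2" for R using mu(2)[of R] by (simp add: not_less antisym)
    define d where "d n l = mu (Suc n) l / real (Suc n)" for n l
    have "N (d n) = 1" for n
    proof -
      have "N (d n) = N (mu (Suc n)) / (real (Suc n))\<^sup>2"
        by (simp add: N_def d_def power_divide sum_divide_distrib)
      then show ?thesis by (simp add: NR)
    qed
    then have dn: "d n \<in> {mu \<in> Z. N mu \<le> 1\<^sup>2}" "N (d n) = 1" for n
      using mu(1)[of "Suc n"] by (auto simp: Z_def d_def)
    have "seq_compact {mu \<in> Z. N mu \<le> 1\<^sup>2}" by (rule compact_imp_seq_compact[OF cpt]) simp
    then obtain e \<sigma> where e: "e \<in> {mu \<in> Z. N mu \<le> 1\<^sup>2}" "strict_mono \<sigma>" "(d \<circ> \<sigma>) \<longlonglongrightarrow> e"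
      by (rule seq_compactE[of _ d]) (use dn(1) in auto)
    have contD: "(%n. F (d (\<sigma> n))) \<longlonglongrightarrow> F e" if "continuous_on UNIV F" for F :: "(nat => real) => real"
      using continuous_on_tendsto_compose[OF that e(3)] by (simp add: comp_def)
    have Ne: "N e = 1" using contD[OF cN] dn(2) by (simp add: LIMSEQ_const_iff)
    define R where "R n = real (Suc (\<sigma> n))" for n
    have Rlim: "filterlim R at_top sequentially"
      unfolding R_def
      by (rule filterlim_compose[OF filterlim_real_sequentially],
          rule filterlim_compose[OF filterlim_Suc filterlim_subseq[OF e(2)]])
    have Rpos: "R n > 0" for n by (simp add: R_def)
    define mu' where "mu' n = mu (Suc (\<sigma> n))" for n
    have mu'd: "mu' n l = R n * d (\<sigma> n) l" for n l by (simp add: mu'_def R_def d_def)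
    define y where "y x i = (\<Sum>l<m. x l * v l i)" for x :: "nat => real" and i
    have y_lim: "(%n. y (d (\<sigma> n)) i) \<longlonglongrightarrow> y e i" for i
      using contD[OF continuous_on_linear_form[where c = 0 and m = m and v = "%l. v l i"]] by (simp add: y_def)
    have sh: "shifted g v m (mu' n) i = R n * (g i * inverse (R n) + y (d (\<sigma> n)) i)" for n i
      using Rpos[of n] by (simp add: shifted_def y_def mu'd distrib_left sum_distrib_left mult.assoc)
    have in_lim: "(%n. g i * inverse (R n) + y (d (\<sigma> n)) i) \<longlonglongrightarrow> y e i" for i
    proof -
      have "(%n. g i * inverse (R n) + y (d (\<sigma> n)) i) \<longlonglongrightarrow> g i * 0 + y e i"
        by (intro tendsto_intros y_lim tendsto_inverse_0_at_top[OF Rlim])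
      then show ?thesis by simp
    qed
    text \<open>\<open>e\<close> is a direction of recession, as \<open>H\<close> stays bounded along the minimisers.\<close>
    have rec: "dcone (eps i) (y e i) = 0" if i: "i \<in> A" for i
    proof -
      have "(%n. (dcone (eps i) (g i * inverse (R n) + y (d (\<sigma> n)) i))\<^sup>2) \<longlonglongrightarrow> (dcone (eps i) (y e i))\<^sup>2"
        by (intro tendsto_power continuous_on_tendsto_compose[OF continuous_on_dcone[of UNIV] in_lim]) auto
      moreover have "(dcone (eps i) (g i * inverse (R n) + y (d (\<sigma> n)) i))\<^sup>2 \<le> H (%_. 0) * (inverse (R n))\<^sup>2" for n
      proof -
        have "(dcone (eps i) (shifted g v m (mu' n) i))\<^sup>2 \<le> H (mu' n)"
          unfolding H_def using i A by (intro member_le_sum) auto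
        also have "\<dots> \<le> H (%_. 0)"
          unfolding mu'_def by (rule mu(3)) (simp_all add: Z_def N_def)
        finally have "(R n)\<^sup>2 * (dcone (eps i) (g i * inverse (R n) + y (d (\<sigma> n)) i))\<^sup>2 \<le> H (%_. 0)"
          unfolding sh dcone_scale[OF Rpos] by (simp add: power_mult_distrib)
        then show ?thesis using Rpos[of n] by (simp add: field_simps)
      qed
      moreover have "(%n. H (%_. 0) * (inverse (R n))\<^sup>2) \<longlonglongrightarrow> H (%_. 0) * 0\<^sup>2"
        by (intro tendsto_intros tendsto_inverse_0_at_top[OF Rlim])
      ultimately have "(dcone (eps i) (y e i))\<^sup>2 \<le> H (%_. 0) * 0\<^sup>2"
        by (intro LIMSEQ_le) auto
      then show ?thesis by simp
    qed
    \<comment> \<open>Where \<open>y e i\<close> is nonzero it points strictly into the half-line,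
      and the shifted row moves in this direction at a linear rate. Eventually the row satisfies its
      constraint both before and after the subtraction.\<close>
    have same: "eventually (%n. dcone (eps i) (shifted g v m (mu' n) i - y e i) = dcone (eps i) (shifted g v m (mu' n) i)) sequentially"
      if i: "i \<in> A" for i
    proof (cases "y e i = 0")
      case False
      then have e0: "eps i ~= 0" and neg: "eps i * y e i < 0"
        using rec[OF i] eps[OF i] by (auto simp: dcone_def max_def split: if_splits)
      have "filterlim (%n. (eps i * (g i * inverse (R n) + y (d (\<sigma> n)) i)) * R n) at_bot sequentially"
        by (rule filterlim_tendsto_neg_mult_at_bot[OF tendsto_mult[OF tendsto_const in_lim] neg Rlim])
      then have "eventually (%n. (eps i * (g i * inverse (R n) + y (d (\<sigma> n)) i)) * R n \<le> eps i * y e i) sequentially"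
        by (auto simp: filterlim_at_bot)
      then show ?thesis
      proof eventually_elim
        case (elim n)
        have eq: "(eps i * (g i * inverse (R n) + y (d (\<sigma> n)) i)) * R n = eps i * shifted g v m (mu' n) i"
          unfolding sh by (simp only: mult_ac)
        have le: "eps i * shifted g v m (mu' n) i \<le> eps i * y e i" using elim unfolding eq .
        then show ?case using e0 neg by (simp add: dcone_def right_diff_distrib)
      qed
    qed simp
    have "eventually (%n. \<forall>i\<in>A. dcone (eps i) (shifted g v m (mu' n) i - y e i) = dcone (eps i) (shifted g v m (mu' n) i)) sequentially"
      using A same by (simp add: eventually_ball_finite_distrib)
    \<comment> \<open>The minimiser has norm \<open>R n\<close> and its direction tends to the unit
      vector \<open>e\<close>, so the cross term in the squared norm of the difference exceeds the
      contribution 1 of \<open>e\<close>.\<close>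
    moreover have "eventually (%n. 1 < R n * (2 * (\<Sum>l<m. d (\<sigma> n) l * e l))) sequentially"
    proof -
      have "(%n. 2 * (\<Sum>l<m. d (\<sigma> n) l * e l)) \<longlonglongrightarrow> 2 * (\<Sum>l<m. e l * e l)"
        using contD[OF continuous_on_linear_form[where c = 0 and m = m and v = e]] by (intro tendsto_mult tendsto_const) simp
      moreover have "(\<Sum>l<m. e l * e l) = 1" using Ne by (simp add: N_def power2_eq_square)
      ultimately have l: "(%n. 2 * (\<Sum>l<m. d (\<sigma> n) l * e l)) \<longlonglongrightarrow> 2" by simp
      have "filterlim (%n. (2 * (\<Sum>l<m. d (\<sigma> n) l * e l)) * R n) at_top sequentially"
        by (rule filterlim_tendsto_pos_mult_at_top[OF l _ Rlim]) simp
      then show ?thesis by (auto simp: filterlim_at_top_dense mult.commute)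
    qed
    ultimately have "eventually (%n. (\<forall>i\<in>A. dcone (eps i) (shifted g v m (mu' n) i - y e i) = dcone (eps i) (shifted g v m (mu' n) i)) \<and>
        1 < R n * (2 * (\<Sum>l<m. d (\<sigma> n) l * e l))) sequentially"
      by (rule eventually_conj)
    then obtain n where n1: "\<And>i. i \<in> A ==> dcone (eps i) (shifted g v m (mu' n) i - y e i) = dcone (eps i) (shifted g v m (mu' n) i)"
      and n2: "1 < R n * (2 * (\<Sum>l<m. d (\<sigma> n) l * e l))"
      by (auto simp: eventually_sequentially)
    define \<xi> where "\<xi> l = mu' n l + - e l" for l
    have "shifted g v m \<xi> i = shifted g v m (mu' n) i - y e i" for i
      unfolding \<xi>_def[abs_def] shifted_add by (simp add: y_def sum_negf)
    then have H\<xi>: "H \<xi> = H (mu' n)" unfolding H_def using n1 by simp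
    have "\<xi> \<in> Z" using e(1) mu(1)[of "Suc (\<sigma> n)"] by (auto simp: Z_def \<xi>_def mu'_def)
    moreover have "N \<xi> < (real (Suc (\<sigma> n)))\<^sup>2"
    proof -
      have "N \<xi> = N (mu' n) - 2 * (\<Sum>l<m. mu' n l * e l) + N e"
        by (simp add: N_def \<xi>_def power2_diff sum.distrib sum_subtractf sum_distrib_left mult.assoc)
      also have "N (mu' n) = (real (Suc (\<sigma> n)))\<^sup>2" unfolding mu'_def by (rule NR)
      also have "2 * (\<Sum>l<m. mu' n l * e l) = R n * (2 * (\<Sum>l<m. d (\<sigma> n) l * e l))"
        by (simp add: mu'd sum_distrib_left mult_ac)
      finally show ?thesis using n2 Ne by simp
    qed
    moreover have "\<forall>eta\<in>Z. N eta \<le> (real (Suc (\<sigma> n)))\<^sup>2 \<longrightarrow> H \<xi> \<le> H eta"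
      unfolding H\<xi> unfolding mu'_def using mu(3) by blast
    ultimately show ?thesis by blast
  qed
  then obtain \<xi> R where \<xi>: "\<xi> \<in> Z" "N \<xi> < (real R)\<^sup>2" "\<And>eta. eta \<in> Z ==> N eta \<le> (real R)\<^sup>2 ==> H \<xi> \<le> H eta" by blast
  have "(\<Sum>i\<in>A. rcone (eps i) (shifted g v m \<xi> i) * v k i) = 0" if k: "k < m" for k
  proof -
    let ?p = "%t l. \<xi> l + (if l = k then t else 0)"
    have Np: "N (?p t) = N \<xi> + (2 * \<xi> k * t + t\<^sup>2)" for t
    proof -
      have "N (?p t) = (\<Sum>l<m. (\<xi> l)\<^sup>2 + (if l = k then 2 * \<xi> k * t + t\<^sup>2 else 0))"
        unfolding N_def by (rule sum.cong) (auto simp: power2_sum)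
      then show ?thesis using k by (simp add: sum.distrib N_def)
    qed
    have "((%t. N \<xi> + (2 * \<xi> k * t + t\<^sup>2)) \<longlongrightarrow> N \<xi> + (2 * \<xi> k * 0 + 0\<^sup>2)) (at 0)"
      by (intro tendsto_intros)
    then have "eventually (%t. N (?p t) < (real R)\<^sup>2) (at 0)"
      unfolding Np using \<xi>(2) by (intro order_tendstoD(2)) auto
    then obtain \<delta> where \<delta>: "\<delta> > 0" "\<And>t. t ~= 0 ==> \<bar>t\<bar> < \<delta> ==> N (?p t) < (real R)\<^sup>2"
      by (auto simp: eventually_at dist_real_def)
    show ?thesis
    proof (rule stationary_of_local_min[where ?r0.0 = "\<delta> / 2", OF A eps k])
      fix t :: real assume t: "\<bar>t\<bar> \<le> \<delta> / 2"
      have "N (?p t) \<le> (real R)\<^sup>2"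
      proof (cases "t = 0")
        case True
        then have "?p t = \<xi>" by auto
        then show ?thesis using \<xi>(2) by simp
      next
        case False
        then show ?thesis using \<delta>(2)[of t] t \<delta>(1) by simp
      qed
      moreover have "?p t \<in> Z" using \<xi>(1) k by (auto simp: Z_def)
      ultimately have "H \<xi> \<le> H (?p t)" by (rule \<xi>(3)[rotated])
      then show "(\<Sum>i\<in>A. (dcone (eps i) (shifted g v m \<xi> i))\<^sup>2) \<le> (\<Sum>i\<in>A. (dcone (eps i) (shifted g v m (?p t) i))\<^sup>2)"
        by (simp only: H_def)
    qed (use \<delta> in auto)
  qed
  then show ?thesis by blast
qed

subsection \<open>Feasibility and active sets\<close>

text \<open>The positive last coefficient stands for \<open><f, b> > 0\<close> in coordinates where
  \<open>f\<close> lies along the last axis.\<close>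

definition feasible :: "'i set => ('i => real) => ('i => real) => nat => ('i \<times> nat => real) => bool" where
  "feasible A eps u q X \<longleftrightarrow>
     (\<exists>beta. 0 < beta (Suc q) \<and> (\<forall>i\<in>A. dcone (eps i) (\<Sum>k\<le>Suc q. beta k * cols u X k i) = 0))"

lemma gs_cols_eq:
  "\<exists>c. \<forall>i. gs S (cols u X) (Suc q) i = cols u X (Suc q) i + (\<Sum>k\<le>q. c k * cols u X k i)"
proof -
  have "gs S (cols u X) (Suc q) i = cols u X (Suc q) i + (\<Sum>k\<le>q. gc S (cols u X) (Suc q) k * cols u X k i)" for i
    unfolding gs_eq_gc by simp
  then show ?thesis by blast
qed

text \<open>The residual on \<open>S\<close> separates. It is orthogonal to all columns but the
  last, with which its inner product is its own squared norm; hence it pairs positively with every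
  combination whose last coefficient is positive. But it lies in the polar of the cone.\<close>

lemma kkt_not_feasible:
  assumes A: "finite A" and S: "S \<subseteq> A" and eps: "\<And>i. i \<in> A ==> eps i \<in> {-1, 0, 1}" and kkt: "kkt A eps u q S X"
  shows "\<not> feasible A eps u q X"
proof
  assume "feasible A eps u q X"
  then obtain beta where beta: "0 < beta (Suc q)" "\<And>i. i \<in> A ==> dcone (eps i) (\<Sum>k\<le>Suc q. beta k * cols u X k i) = 0"
    by (auto simp: feasible_def)
  have finS: "finite S" using A S finite_subset by blast
  define s where "s = gs S (cols u X) (Suc q)"
  define w where "w i = (\<Sum>k\<le>Suc q. beta k * cols u X k i)" for i
  have orth: "ip S s (cols u X k) = 0" if "k \<le> q" for k
    unfolding s_def using gs_orth_z[OF finS, of k "Suc q"] that by simp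
  obtain c where c: "\<And>i. s i = cols u X (Suc q) i + (\<Sum>k\<le>q. c k * cols u X k i)"
    using gs_cols_eq[of S u X q] unfolding s_def by blast
  have "ip S s s = ip S s (%i. cols u X (Suc q) i + (\<Sum>k\<le>q. c k * cols u X k i))"
    using c by (intro ip_cong) auto
  also have "\<dots> = ip S s (cols u X (Suc q))"
    unfolding ip_add_right ip_sum_right ip_scale_right using orth by simp
  finally have ss: "ip S s (cols u X (Suc q)) = ip S s s" by simp
  have "ip S s w = (\<Sum>k\<le>Suc q. beta k * ip S s (cols u X k))"
    unfolding w_def[abs_def] ip_sum_right ip_scale_right ..
  also have "\<dots> = beta (Suc q) * ip S s s"
    using orth by (simp add: ss del: cols_simps)
  finally have sw: "ip S s w = beta (Suc q) * ip S s s" .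
  obtain i0 where "i0 \<in> S" "s i0 ~= 0" using kkt by (auto simp: kkt_def s_def)
  then have "ip S s s > 0" by (rule ip_self_pos[OF finS])
  then have "ip S s w > 0" using sw beta(1) by simp
  moreover have "ip S s w \<le> 0"
    unfolding ip_def
  proof (rule sum_nonpos)
    fix i assume i: "i \<in> S"
    then have "s i = rcone (eps i) (s i)" using kkt by (auto simp: kkt_def s_def rcone_def)
    moreover have "rcone (eps i) (s i) * w i \<le> 0"
      using i S eps beta(2)[of i] by (intro rcone_mult_nonpos) (auto simp: w_def)
    ultimately show "s i * w i \<le> 0" by simp
  qed
  ultimately show False by simp
qed

text \<open>The two residuals are orthogonal to the columns up to \<open>q\<close>, while the two
  shifted last columns differ by a combination of these. Firm nonexpansiveness then forces the
  residuals to be equal.\<close>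

lemma kkt_unique:
  assumes A: "finite A" and S: "S \<subseteq> A" "S' \<subseteq> A" and eps: "\<And>i. i \<in> A ==> eps i \<in> {-1, 0, 1}"
    and kkt: "kkt A eps u q S X" "kkt A eps u q S' X"
  shows "S = S'"
proof -
  define s where "s T = gs T (cols u X) (Suc q)" for T
  define r where "r T i = rcone (eps i) (s T i)" for T i
  have r_eq: "r T i = (if i \<in> T then s T i else 0)" if "T \<subseteq> A" "kkt A eps u q T X" "i \<in> A" for T i
  proof (cases "i \<in> T")
    case True
    then show ?thesis using that by (auto simp: r_def rcone_def kkt_def s_def)
  next
    case False
    then have "eps i ~= 0 \<and> eps i * s T i \<le> 0" using that by (auto simp: kkt_def s_def)
    then show ?thesis using False by (simp add: r_def rcone_def)
  qed
  have orth: "ip A (r T) (cols u X k) = 0" if T: "T \<subseteq> A" "kkt A eps u q T X" and k: "k \<le> q" for T k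
  proof -
    have "ip A (r T) (cols u X k) = ip T (s T) (cols u X k)"
      unfolding ip_def using A T r_eq[OF T] by (intro sum.mono_neutral_cong_right) auto
    also have "\<dots> = 0"
      unfolding s_def using gs_orth_z[of T k "Suc q"] k T A finite_subset by auto
    finally show ?thesis .
  qed
  obtain c where c: "\<And>i. s S i = cols u X (Suc q) i + (\<Sum>k\<le>q. c k * cols u X k i)"
    using gs_cols_eq[of S u X q] unfolding s_def by blast
  obtain c' where c': "\<And>i. s S' i = cols u X (Suc q) i + (\<Sum>k\<le>q. c' k * cols u X k i)"
    using gs_cols_eq[of S' u X q] unfolding s_def by blast
  have diff: "s S i - s S' i = (\<Sum>k\<le>q. (c k - c' k) * cols u X k i)" for i
    unfolding c c' by (simp add: left_diff_distrib sum_subtractf del: cols_simps)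
  have "(\<Sum>i\<in>A. (r S i - r S' i)\<^sup>2) \<le> (\<Sum>i\<in>A. (r S i - r S' i) * (s S i - s S' i))"
    unfolding r_def by (intro sum_mono rcone_firm eps)
  also have "\<dots> = ip A (%i. r S i - r S' i) (%i. \<Sum>k\<le>q. (c k - c' k) * cols u X k i)"
    unfolding ip_def diff ..
  also have "\<dots> = (\<Sum>k\<le>q. (c k - c' k) * (ip A (r S) (cols u X k) - ip A (r S') (cols u X k)))"
    unfolding ip_sum_right ip_scale_right ip_diff_left ..
  also have "\<dots> = 0"
    using orth[OF S(1) kkt(1)] orth[OF S(2) kkt(2)] by (intro sum.neutral) auto
  finally have "(\<Sum>i\<in>A. (r S i - r S' i)\<^sup>2) \<le> 0" .
  then have "(\<Sum>i\<in>A. (r S i - r S' i)\<^sup>2) = 0" by (intro antisym sum_nonneg) auto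
  then have rr: "r S i = r S' i" if "i \<in> A" for i
    using A that by (auto simp: sum_nonneg_eq_0_iff)
  \<comment> \<open>The active set can be read off the residual, once the rows of sign 0 are
    added.\<close>
  have mem: "i \<in> T \<longleftrightarrow> eps i = 0 \<or> r T i ~= 0" if "T \<subseteq> A" "kkt A eps u q T X" "i \<in> A" for T i
    using that r_eq[OF that] by (auto simp: kkt_def s_def)
  show ?thesis
    using mem[OF S(1) kkt(1)] mem[OF S(2) kkt(2)] rr S by auto
qed

text \<open>A stationary point of the squared distance supplies the residual \<open>s\<close>, and
  \<open>S\<close> collects the rows that it violates. If \<open>s\<close> vanished on
  \<open>S\<close>, the point would be feasible. So \<open>s\<close> is nonzero on \<open>S\<close>
  and orthogonal there to \<open>q + 1\<close> columns; in general position this takes more than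
  \<open>q + 1\<close> rows, and then the columns are independent on \<open>S\<close> and determine
  \<open>s\<close>.\<close>

lemma ex_kkt:
  assumes A: "finite A" and eps: "\<And>i. i \<in> A ==> eps i \<in> {-1, 0, 1}"
    and gp: "general_position A q u X" and nf: "\<not> feasible A eps u q X"
  shows "\<exists>S\<subseteq>A. Suc q < card S \<and> kkt A eps u q S X"
proof -
  let ?z = "cols u X"
  obtain mu where mu: "\<And>k. k < Suc q ==> (\<Sum>i\<in>A. rcone (eps i) (shifted (?z (Suc q)) ?z (Suc q) mu i) * ?z k i) = 0"
    using ex_stationary[of A eps "Suc q" "?z (Suc q)" ?z, OF A eps] by blast
  define s where "s = shifted (?z (Suc q)) ?z (Suc q) mu"
  have s: "s i = ?z (Suc q) i + (\<Sum>l<Suc q. mu l * ?z l i)" for i by (simp only: s_def shifted_def)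
  define S where "S = {i\<in>A. eps i = 0 \<or> 0 < eps i * s i}"
  have SA: "S \<subseteq> A" and finS: "finite S" using A by (auto simp: S_def)
  have orth: "ip S s (?z k) = 0" if k: "k < Suc q" for k
  proof -
    have "ip S s (?z k) = (\<Sum>i\<in>A. rcone (eps i) (s i) * ?z k i)"
      unfolding ip_def using A by (intro sum.mono_neutral_cong_left) (auto simp: S_def rcone_def)
    then show ?thesis using mu[OF k] by (simp only: s_def)
  qed
  have nz: "\<exists>i\<in>S. s i ~= 0"
  proof (rule ccontr)
    assume n: "\<not> ?thesis"
    have "feasible A eps u q X"
      unfolding feasible_def
    proof (intro exI[of _ "%k. if k = Suc q then 1 else mu k"] conjI ballI)
      fix i assume i: "i \<in> A"
      have "(\<Sum>k\<le>Suc q. (if k = Suc q then 1 else mu k) * ?z k i) = (\<Sum>k\<le>q. mu k * ?z k i) + ?z (Suc q) i"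
        by (simp del: cols_simps)
      also have "\<dots> = s i" unfolding s lessThan_Suc_atMost by (simp del: cols_simps)
      finally have "(\<Sum>k\<le>Suc q. (if k = Suc q then 1 else mu k) * ?z k i) = s i" .
      moreover have "dcone (eps i) (s i) = 0"
      proof (cases "i \<in> S")
        case True
        then show ?thesis using n by (auto simp: dcone_def)
      next
        case False
        then show ?thesis using i by (auto simp: S_def dcone_def)
      qed
      ultimately show "dcone (eps i) (\<Sum>k\<le>Suc q. (if k = Suc q then 1 else mu k) * ?z k i) = 0" by (simp only:)
    qed simp
    then show False using nf by simp
  qed
  have gp': "\<exists>i\<in>S. gs S ?z k i ~= 0" if "k \<le> Suc q" "k < card S" for k
    using gp SA that by (auto simp: general_position_def)
  have card: "Suc q < card S"
  proof (rule ccontr)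
    assume "\<not> ?thesis"
    then have c: "card S \<le> Suc q" by simp
    have "\<forall>j<card S. ip S s (gs S ?z j) = 0"
      unfolding orth_gs_iff using orth c by simp
    then have "s i = 0" if "i \<in> S" for i
      using gp' c by (intro orth_basis_complete[OF finS order_refl, of "gs S ?z" s i] that gs_orth[OF finS]) auto
    then show False using nz by blast
  qed
  have "s = gs S ?z (Suc q)"
    by (rule gs_unique[OF finS s orth]) (use gp' card in auto)
  then have "kkt A eps u q S X"
    unfolding kkt_def using nz by (auto simp: S_def)
  then show ?thesis using SA card by blast
qed

subsection \<open>Strictly convex losses\<close>

text \<open>The value -1 is the default; for strictly convex functions the trichotomy below makes it
  mean strictly decreasing.\<close>

definition loss_sign :: "(real => real) => real" where
  "loss_sign f = (if coercive f then 0 else if strict_mono f then 1 else -1)"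

lemma loss_sign_range: "loss_sign f \<in> {-1, 0, 1}"
  by (simp add: loss_sign_def)

lemma strictly_convexD:
  "strictly_convex f ==> s ~= t ==> 0 < u ==> u < 1 ==> f ((1 - u) * s + u * t) < (1 - u) * f s + u * f t"
  by (simp add: strictly_convex_def)

lemma strictly_convex_secant:
  assumes f: "strictly_convex f" and x: "s < t" "t < x"
  shows "(f t - f s) * (x - t) < (f x - f t) * (t - s)"
proof -
  define u where "u = (t - s) / (x - s)"
  have u: "0 < u" "u < 1" using x by (auto simp: u_def)
  have ux: "u * (x - s) = t - s" using x by (simp add: u_def)
  have t: "(1 - u) * s + u * x = t"
  proof -
    have "(1 - u) * s + u * x = s + u * (x - s)" by (simp add: algebra_simps)
    then show ?thesis using ux by simp
  qed
  have "f t < (1 - u) * f s + u * f x"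
    using strictly_convexD[OF f _ u, of s x] x by (simp add: t)
  then have "f t * (x - s) < ((1 - u) * f s + u * f x) * (x - s)" using x by simp
  also have "\<dots> = (x - s) * f s + (u * (x - s)) * (f x - f s)"
    by (simp add: algebra_simps)
  also have "\<dots> = (x - t) * f s + (t - s) * f x"
    unfolding ux by (simp add: algebra_simps)
  finally show ?thesis by (simp add: algebra_simps)
qed

text \<open>Once a secant slope is nonnegative, all later ones are positive and increase;
  \<open>alpha\<close> is the slope over the unit interval after \<open>t\<close>.\<close>

lemma strictly_convex_growth:
  assumes f: "strictly_convex f" and st: "s < t" "f s \<le> f t"
  shows "\<exists>alpha>0. \<forall>x\<ge>t + 1. f t + alpha * (x - t) \<le> f x"
proof -
  define alpha where "alpha = f (t + 1) - f t"
  have "0 \<le> (f t - f s) * (t + 1 - t)" using st by simp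
  also have "\<dots> < (f (t + 1) - f t) * (t - s)" by (rule strictly_convex_secant[OF f]) (use st in auto)
  finally have "alpha > 0" using st by (simp add: alpha_def zero_less_mult_iff)
  moreover have "f t + alpha * (x - t) \<le> f x" if "x \<ge> t + 1" for x
  proof (cases "x = t + 1")
    case False
    then have "(f (t + 1) - f t) * (x - (t + 1)) < (f x - f (t + 1)) * (t + 1 - t)"
      using that by (intro strictly_convex_secant[OF f]) auto
    then show ?thesis by (simp add: alpha_def algebra_simps)
  qed (simp add: alpha_def)
  ultimately show ?thesis by blast
qed

lemma strictly_convex_reflect: "strictly_convex f ==> strictly_convex (%x. f (- x))"
  unfolding strictly_convex_def
proof (intro allI impI)
  fix s t u :: real
  assume f: "\<forall>s t u. s ~= t \<longrightarrow> 0 < u \<longrightarrow> u < 1 \<longrightarrow> f ((1 - u) * s + u * t) < (1 - u) * f s + u * f t"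
    and a: "s ~= t" "0 < u" "u < 1"
  have "f ((1 - u) * (- s) + u * (- t)) < (1 - u) * f (- s) + u * f (- t)"
    by (rule f[rule_format]) (use a in simp_all)
  moreover have "- ((1 - u) * s + u * t) = (1 - u) * (- s) + u * (- t)" by simp
  ultimately show "f (- ((1 - u) * s + u * t)) < (1 - u) * f (- s) + u * f (- t)" by (simp only:)
qed

text \<open>A secant that does not fall gives linear growth to the right, and one that does not rise
  gives it to the left, by reflection.\<close>

lemma strictly_convex_coerciveI:
  assumes f: "strictly_convex f" and r: "s < t" "f s \<le> f t" and l: "s' < t'" "f t' \<le> f s'"
  shows "coercive f"
proof -
  have lin: "filterlim (%x. c + alpha * (x - t)) at_top at_top" if "alpha > 0" for alpha c t :: real
    by (rule filterlim_tendsto_add_at_top[OF tendsto_const],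
        rule filterlim_tendsto_pos_mult_at_top[OF tendsto_const that],
        subst diff_conv_add_uminus, subst add.commute,
        rule filterlim_tendsto_add_at_top[OF tendsto_const filterlim_ident])
  have top: "filterlim g at_top at_top" if g: "strictly_convex g" "s < t" "g s \<le> g t" for g :: "real => real" and s t
  proof -
    obtain alpha where alpha: "alpha > 0" "\<And>x. x \<ge> t + 1 ==> g t + alpha * (x - t) \<le> g x"
      using strictly_convex_growth[OF g] by blast
    show ?thesis
      by (rule filterlim_at_top_mono[OF lin[OF alpha(1)]]) (use alpha(2) in \<open>auto simp: eventually_at_top_linorder\<close>)
  qed
  have 1: "filterlim f at_top at_top" by (rule top[OF f r])
  have "filterlim (%x. f (- x)) at_top at_top"
    by (rule top[OF strictly_convex_reflect[OF f], of "- t'" "- s'"]) (use l in auto)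
  then have 2: "filterlim f at_top at_bot" by (simp add: filterlim_at_bot_mirror)
  show ?thesis
    unfolding coercive_def at_infinity_eq_at_top_bot using 1 2 by (intro filterlim_sup)
qed

lemma strictly_convex_trichotomy:
  assumes "strictly_convex f" "\<not> coercive f"
  shows "strict_mono f \<or> strictly_decreasing f"
proof (rule ccontr)
  assume "\<not> ?thesis"
  then obtain s t s' t' where "s < t" "f s \<le> f t" "s' < t'" "f t' \<le> f s'"
    unfolding strict_mono_def strictly_decreasing_def by (metis not_less)
  then show False using strictly_convex_coerciveI[OF assms(1)] assms(2) by blast
qed

lemma coercive_not_monotone:
  assumes "coercive f" shows "\<not> strict_mono f" "\<not> strictly_decreasing f"
proof -
  have top: "filterlim f at_top at_top" and bot: "filterlim f at_top at_bot"
    using assms by (auto simp: coercive_def at_infinity_eq_at_top_bot filterlim_at_top eventually_sup)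
  show "\<not> strict_mono f"
  proof
    assume m: "strict_mono f"
    obtain b where "\<And>x. x \<le> b ==> f x > f 0"
      using bot by (auto simp: filterlim_at_top_dense eventually_at_bot_linorder)
    from this[of "min b 0"] show False using m by (auto simp: strict_mono_less)
  qed
  show "\<not> strictly_decreasing f"
  proof
    assume m: "strictly_decreasing f"
    obtain b where b: "\<And>x. x \<ge> b ==> f x > f 0"
      using top by (auto simp: filterlim_at_top_dense eventually_at_top_linorder)
    have "f (max b 1) < f 0" using m by (simp add: strictly_decreasing_def)
    then show False using b[of "max b 1"] by simp
  qed
qed

lemma loss_sign_iff:
  assumes "strictly_convex f"
  shows "loss_sign f = 0 \<longleftrightarrow> coercive f" "loss_sign f = 1 \<longleftrightarrow> strict_mono f" "loss_sign f = -1 \<longleftrightarrow> strictly_decreasing f"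
proof -
  have ex: "\<not> (strict_mono f \<and> strictly_decreasing f)"
  proof
    assume "strict_mono f \<and> strictly_decreasing f"
    then have "f 0 < f 1" "f 1 < f 0" by (auto simp: strict_mono_def strictly_decreasing_def)
    then show False by simp
  qed
  show "loss_sign f = 0 \<longleftrightarrow> coercive f" "loss_sign f = 1 \<longleftrightarrow> strict_mono f" "loss_sign f = -1 \<longleftrightarrow> strictly_decreasing f"
    using coercive_not_monotone[of f] strictly_convex_trichotomy[OF assms] ex by (auto simp: loss_sign_def)
qed

lemma one_sided_growth:
  assumes f: "strictly_convex f" and st: "s < t" "f s \<le> f t" and bdd: "\<And>x. - m \<le> f x"
  shows "\<exists>alpha>0. \<exists>\<gamma>. \<forall>x. alpha * max x 0 - \<gamma> \<le> f x"
proof -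
  obtain alpha where alpha: "alpha > 0" "\<And>x. x \<ge> t + 1 ==> f t + alpha * (x - t) \<le> f x"
    using strictly_convex_growth[OF f st] by blast
  define \<gamma> where "\<gamma> = \<bar>m\<bar> + alpha * (\<bar>t\<bar> + 1) + \<bar>f t\<bar>"
  have "alpha * max x 0 - \<gamma> \<le> f x" for x
  proof (cases "x \<ge> t + 1 \<and> x \<ge> 0")
    case True
    have "alpha * t \<le> alpha * (\<bar>t\<bar> + 1)" using alpha(1) by simp
    then show ?thesis using alpha(2)[of x] True by (simp add: \<gamma>_def right_diff_distrib)
  next
    case False
    then have "max x 0 \<le> \<bar>t\<bar> + 1" by auto
    then have "alpha * max x 0 \<le> alpha * (\<bar>t\<bar> + 1)" using alpha(1) by simp
    then show ?thesis using bdd[of x] by (simp add: \<gamma>_def)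
  qed
  then show ?thesis using alpha(1) by blast
qed

text \<open>Boundedness from below covers the side on which a monotone loss decreases, convexity
  gives linear growth on the other. Thus the coercivity of the risk is reduced to that of a sum of
  distances.\<close>

lemma dcone_growth:
  assumes f: "strictly_convex f" and bdd: "\<And>x. - m \<le> f x"
  shows "\<exists>alpha>0. \<exists>\<gamma>. \<forall>x. alpha * dcone (loss_sign f) x - \<gamma> \<le> f x"
proof -
  have up: "\<exists>alpha>0. \<exists>\<gamma>. \<forall>x. alpha * max x 0 - \<gamma> \<le> f x" if "\<not> strictly_decreasing f"
  proof -
    obtain s t where "s < t" "f s \<le> f t" using \<open>\<not> strictly_decreasing f\<close> by (auto simp: strictly_decreasing_def not_less)
    then show ?thesis using one_sided_growth[OF f _ _ bdd] by blast
  qed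
  have down: "\<exists>alpha>0. \<exists>\<gamma>. \<forall>x. alpha * max (- x) 0 - \<gamma> \<le> f x" if "\<not> strict_mono f"
  proof -
    obtain s t where "s < t" "f t \<le> f s" using \<open>\<not> strict_mono f\<close> by (auto simp: strict_mono_def not_less)
    then have "\<exists>alpha>0. \<exists>\<gamma>. \<forall>x. alpha * max x 0 - \<gamma> \<le> f (- x)"
      using one_sided_growth[OF strictly_convex_reflect[OF f], of "- t" "- s" m] bdd by auto
    then show ?thesis by (metis minus_minus)
  qed
  consider "loss_sign f = 0" | "loss_sign f = 1" | "loss_sign f = -1" using loss_sign_range[of f] by auto
  then show ?thesis
  proof cases
    case 1
    then have "coercive f" using loss_sign_iff(1)[OF f] by blast
    then obtain alpha \<gamma> alpha' \<gamma>' where a: "alpha > 0" "\<And>x. alpha * max x 0 - \<gamma> \<le> f x" "alpha' > 0" "\<And>x. alpha' * max (- x) 0 - \<gamma>' \<le> f x"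
      using up down coercive_not_monotone by blast
    have "min alpha alpha' * \<bar>x\<bar> - (\<bar>\<gamma>\<bar> + \<bar>\<gamma>'\<bar>) \<le> f x" for x
    proof (cases "x \<ge> 0")
      case True
      have "min alpha alpha' * x \<le> alpha * x" using True by (intro mult_right_mono) auto
      then show ?thesis using a(2)[of x] True by simp
    next
      case False
      have "min alpha alpha' * (- x) \<le> alpha' * (- x)" using False by (intro mult_right_mono) auto
      moreover have ax: "\<bar>x\<bar> = - x" "max (- x) 0 = - x" using False by auto
      ultimately show ?thesis using a(4)[of x] unfolding ax by linarith
    qed
    then show ?thesis using a(1,3) 1 by (intro exI[of _ "min alpha alpha'"]) (auto simp: dcone_def)
  next
    case 2
    then have "\<not> strictly_decreasing f" using loss_sign_iff[OF f] by auto
    then show ?thesis using up 2 by (simp add: dcone_def)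
  next
    case 3
    then have "\<not> strict_mono f" using loss_sign_iff[OF f] by auto
    then show ?thesis using down 3 by (simp add: dcone_def)
  qed
qed

lemma loss_decreases_along_cone:
  assumes f: "strictly_convex f" and c: "dcone (loss_sign f) c = 0"
  shows "f (a + c) \<le> f a" "c ~= 0 ==> f (a + c) < f a"
proof -
  have "f (a + c) < f a" if "c ~= 0"
  proof -
    consider "loss_sign f = 0" | "loss_sign f = 1" | "loss_sign f = -1" using loss_sign_range[of f] by auto
    then show ?thesis
    proof cases
      case 1
      then show ?thesis using c that by (simp add: dcone_def)
    next
      case 2
      then have "strict_mono f" "c < 0" using loss_sign_iff[OF f] c that by (auto simp: dcone_def max_def split: if_splits)
      then show ?thesis by (simp add: strict_mono_def)
    next
      case 3
      then have "strictly_decreasing f" "c > 0" using loss_sign_iff[OF f] c that by (auto simp: dcone_def max_def split: if_splits)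
      then show ?thesis by (simp add: strictly_decreasing_def)
    qed
  qed
  then show "f (a + c) \<le> f a" "c ~= 0 ==> f (a + c) < f a" by (cases "c = 0"; force)+
qed

lemma inner_prod_add: "inner_prod p a (%j. b j + c j) = inner_prod p a b + inner_prod p a c"
  by (simp add: inner_prod_def algebra_simps sum.distrib)

lemma inner_prod_scale: "inner_prod p a (%j. c * b j) = c * inner_prod p a b"
  by (simp add: inner_prod_def algebra_simps sum_distrib_left)

lemma inner_prod_restrict: "inner_prod p a (restrict b {..<p}) = inner_prod p a b"
  by (simp add: inner_prod_def)

lemma not_attained:
  fixes \<l> :: "real => real => real"
  assumes cv: "\<And>i. i < n ==> strictly_convex (\<l> (y i))"
    and c: "\<And>i. i < n ==> dcone (loss_sign (\<l> (y i))) (inner_prod p (x i) b) = 0"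
    and nz: "i0 < n" "inner_prod p (x i0) b ~= 0"
  shows "\<not> infimum_attained (real_vectors p) (empirical_risk \<l> n p x y)"
proof
  assume "infimum_attained (real_vectors p) (empirical_risk \<l> n p x y)"
  then obtain a where a: "a \<in> real_vectors p"
    "\<And>a'. a' \<in> real_vectors p ==> empirical_risk \<l> n p x y a \<le> empirical_risk \<l> n p x y a'"
    by (auto simp: infimum_attained_def)
  let ?a' = "restrict (%j. a j + b j) {..<p}"
  have "empirical_risk \<l> n p x y ?a' < empirical_risk \<l> n p x y a"
    unfolding empirical_risk_def inner_prod_restrict inner_prod_add
  proof (rule sum_strict_mono_ex1)
    show "\<exists>i\<in>{..<n}. \<l> (y i) (inner_prod p (x i) a + inner_prod p (x i) b) < \<l> (y i) (inner_prod p (x i) a)"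
      using loss_decreases_along_cone(2)[OF cv[OF nz(1)] c[OF nz(1)] nz(2), of "inner_prod p (x i0) a"] nz(1)
      by (intro bexI[of _ i0]) auto
  qed (use loss_decreases_along_cone(1)[OF cv c] in auto)
  moreover have "?a' \<in> real_vectors p" by (simp add: real_vectors_def)
  ultimately show False using a(2) by fastforce
qed

text \<open>The sum \<open>Gr\<close> of the distances is continuous, positively homogeneous and
  positive off the origin, so by compactness of the unit sphere it dominates a multiple of the norm
  \<open>Nm\<close>. Hence the risk exceeds its value at 0 outside a box, and it has a minimiser
  inside.\<close>

lemma attained:
  fixes \<l> :: "real => real => real"
  assumes cv: "\<And>i. i < n ==> strictly_convex (\<l> (y i))"
    and ct: "\<And>i. i < n ==> continuous_on UNIV (\<l> (y i))"
    and bdd: "\<And>i. i < n ==> \<exists>m. \<forall>t. - m \<le> \<l> (y i) t"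
    and c: "\<And>b. (\<And>i. i < n ==> dcone (loss_sign (\<l> (y i))) (inner_prod p (x i) b) = 0) ==> \<forall>j<p. b j = 0"
  shows "infimum_attained (real_vectors p) (empirical_risk \<l> n p x y)"
proof -
  define f where "f b = (\<Sum>i<n. \<l> (y i) (inner_prod p (x i) b))" for b :: "nat => real"
  define e where "e i = loss_sign (\<l> (y i))" for i
  define Gr where "Gr b = (\<Sum>i<n. dcone (e i) (inner_prod p (x i) b))" for b :: "nat => real"
  define Nm where "Nm b = (\<Sum>j<p. \<bar>b j\<bar>)" for b :: "nat => real"
  define K where "K R = {b :: nat => real. \<forall>l. (l < p \<longrightarrow> \<bar>b l\<bar> \<le> R) \<and> (\<not> l < p \<longrightarrow> b l = 0)}" for R
  define Z where "Z b = (%l. if l < p then b l else 0 :: real)" for b :: "nat => real"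
  have ipZ: "inner_prod p a (Z b) = inner_prod p a b" for a b by (simp add: inner_prod_def Z_def)
  have fZ: "f (Z b) = f b" and GZ: "Gr (Z b) = Gr b" for b by (simp_all only: f_def Gr_def ipZ)
  have NZ: "Nm (Z b) = Nm b" for b by (simp add: Nm_def Z_def)
  have cip: "continuous_on UNIV (%b. inner_prod p a b)" for a
    unfolding inner_prod_def by (intro continuous_intros continuous_on_product_coordinates)
  have cf: "continuous_on UNIV f"
    unfolding f_def by (intro continuous_on_sum continuous_on_compose2[OF ct cip]) auto
  have cG: "continuous_on UNIV Gr"
    unfolding Gr_def by (intro continuous_on_sum continuous_on_compose2[OF continuous_on_dcone[of UNIV] cip]) auto
  have cN: "continuous_on UNIV Nm"
    unfolding Nm_def by (intro continuous_intros continuous_on_product_coordinates)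
  have cK: "compact (K R)" for R unfolding K_def by (rule compact_box)
  have ZK: "Z b \<in> K R" if "Nm b \<le> R" for b R
  proof -
    have "\<bar>b l\<bar> \<le> R" if "l < p" for l
    proof -
      have "\<bar>b l\<bar> \<le> Nm b" unfolding Nm_def using that by (intro member_le_sum) auto
      then show ?thesis using \<open>Nm b \<le> R\<close> by simp
    qed
    then show ?thesis by (simp add: K_def Z_def)
  qed
  have "\<exists>alpha>0. \<exists>\<gamma>. \<forall>t. alpha * dcone (e i) t - \<gamma> \<le> \<l> (y i) t" if "i < n" for i
    using bdd[OF that] dcone_growth[OF cv[OF that]] unfolding e_def by blast
  then have "\<forall>i. \<exists>alpha \<gamma>. i < n \<longrightarrow> alpha > 0 \<and> (\<forall>t. alpha * dcone (e i) t - \<gamma> \<le> \<l> (y i) t)" by blast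
  from choice[OF this] obtain alpha' where "\<forall>i. \<exists>\<gamma>. i < n \<longrightarrow> alpha' i > 0 \<and> (\<forall>t. alpha' i * dcone (e i) t - \<gamma> \<le> \<l> (y i) t)" by blast
  from choice[OF this] obtain \<gamma>' where ag: "\<And>i. i < n ==> alpha' i > 0"
    "\<And>i t. i < n ==> alpha' i * dcone (e i) t - \<gamma>' i \<le> \<l> (y i) t" by blast
  define alpha where "alpha = Min (insert 1 (alpha' ` {..<n}))"
  have alpha: "alpha > 0" "\<And>i. i < n ==> alpha \<le> alpha' i"
    using ag(1) by (auto simp: alpha_def Min_gr_iff)
  define \<gamma> where "\<gamma> = (\<Sum>i<n. \<gamma>' i)"
  have low: "alpha * Gr b - \<gamma> \<le> f b" for b
  proof -
    have "alpha * Gr b - \<gamma> = (\<Sum>i<n. alpha * dcone (e i) (inner_prod p (x i) b) - \<gamma>' i)"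
      by (simp add: Gr_def \<gamma>_def sum_distrib_left sum_subtractf)
    also have "\<dots> \<le> f b"
      unfolding f_def
    proof (rule sum_mono)
      fix i assume "i \<in> {..<n}"
      then have i: "i < n" by simp
      have "alpha * dcone (e i) (inner_prod p (x i) b) \<le> alpha' i * dcone (e i) (inner_prod p (x i) b)"
        using alpha(2)[OF i] by (intro mult_right_mono) auto
      then show "alpha * dcone (e i) (inner_prod p (x i) b) - \<gamma>' i \<le> \<l> (y i) (inner_prod p (x i) b)"
        using ag(2)[OF i, of "inner_prod p (x i) b"] by linarith
    qed
    finally show ?thesis .
  qed
  have "\<exists>kappa>0. \<forall>b. kappa * Nm b \<le> Gr b"
  proof (cases "p = 0")
    case True
    then have "Nm b = 0" for b by (simp add: Nm_def)
    moreover have "0 \<le> Gr b" for b by (simp add: Gr_def sum_nonneg)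
    ultimately show ?thesis by (intro exI[of _ 1]) simp
  next
    case False
    let ?Sp = "K 1 \<inter> {b. Nm b = 1}"
    have cSp: "compact ?Sp"
      by (intro compact_Int_closed cK closed_Collect_eq cN continuous_on_const)
    have "Z (%l. if l = 0 then 1 else 0) \<in> ?Sp"
    proof -
      have "Nm (%l. if l = 0 then 1 else 0) = 1"
        using False by (simp add: Nm_def if_distrib[where f = abs] cong: if_cong)
      then show ?thesis using ZK[of "%l. if l = 0 then 1 else 0" 1] NZ by simp
    qed
    then have "?Sp ~= {}" by blast
    from continuous_attains_inf[OF cSp this continuous_on_subset[OF cG]]
    obtain b0 where b0: "b0 \<in> ?Sp" "\<And>b. b \<in> ?Sp ==> Gr b0 \<le> Gr b" by auto
    have "Gr b0 > 0"
    proof (rule ccontr)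
      assume "\<not> ?thesis"
      moreover have "Gr b0 \<ge> 0" by (simp add: Gr_def sum_nonneg)
      ultimately have "Gr b0 = 0" by simp
      then have "dcone (loss_sign (\<l> (y i))) (inner_prod p (x i) b0) = 0" if "i < n" for i
        using that unfolding Gr_def by (subst (asm) sum_nonneg_eq_0_iff) (auto simp: e_def)
      then have "\<forall>j<p. b0 j = 0" by (rule c)
      then have "Nm b0 = 0" by (simp add: Nm_def)
      then show False using b0(1) by simp
    qed
    moreover have "Gr b0 * Nm b \<le> Gr b" for b
    proof (cases "Nm b = 0")
      case True
      then show ?thesis by (simp add: Gr_def sum_nonneg)
    next
      case False
      then have pos: "Nm b > 0" using sum_nonneg[of "{..<p}" "%j. \<bar>b j\<bar>"] by (simp add: Nm_def less_le)
      define b' where "b' j = inverse (Nm b) * b j" for j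
      have "Nm b' = inverse (Nm b) * Nm b"
        unfolding b'_def Nm_def using pos by (simp add: abs_mult sum_distrib_left Nm_def)
      then have "Nm b' = 1" using pos by simp
      then have "Z b' \<in> ?Sp" using ZK[of b' 1] NZ by simp
      then have "Gr b0 \<le> Gr b'" using b0(2) GZ by metis
      moreover have "Gr b' = inverse (Nm b) * Gr b"
        unfolding Gr_def b'_def inner_prod_scale using pos by (simp add: dcone_scale sum_distrib_left)
      ultimately show ?thesis using pos by (simp add: field_simps)
    qed
    ultimately show ?thesis by blast
  qed
  then obtain kappa where kappa: "kappa > 0" "\<And>b. kappa * Nm b \<le> Gr b" by blast
  \<comment> \<open>The radius from which on the linear lower bound is at least the value of the
    risk at 0.\<close>
  define R where "R = (\<bar>f (%_. 0)\<bar> + \<bar>\<gamma>\<bar>) / (alpha * kappa)"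
  have R0: "R \<ge> 0" using alpha kappa by (simp add: R_def)
  have far: "f (%_. 0) \<le> f b" if "Nm b \<ge> R" for b
  proof -
    have "\<bar>f (%_. 0)\<bar> + \<bar>\<gamma>\<bar> \<le> alpha * kappa * Nm b"
      using that alpha(1) kappa(1) by (simp add: R_def pos_divide_le_eq mult.commute)
    also have "\<dots> \<le> alpha * Gr b" using kappa(2)[of b] alpha(1) by (simp add: mult.assoc)
    finally show ?thesis using low[of b] by linarith
  qed
  have zK: "(%_. 0) \<in> K R" using R0 by (simp add: K_def)
  then have "K R ~= {}" by blast
  from continuous_attains_inf[OF cK this continuous_on_subset[OF cf]]
  obtain b where b: "b \<in> K R" "\<And>b'. b' \<in> K R ==> f b \<le> f b'" by auto
  have min: "f b \<le> f b'" for b'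
  proof (cases "Nm b' \<le> R")
    case True
    then show ?thesis using b(2)[OF ZK[OF True]] fZ by simp
  next
    case False
    then show ?thesis using far[of b'] b(2)[OF zK] by simp
  qed
  show ?thesis
    unfolding infimum_attained_def
  proof (intro bexI[of _ "restrict b {..<p}"] ballI)
    fix b' assume "b' \<in> real_vectors p"
    show "empirical_risk \<l> n p x y (restrict b {..<p}) \<le> empirical_risk \<l> n p x y b'"
      using min[of b'] unfolding empirical_risk_def inner_prod_restrict f_def .
  qed (simp add: real_vectors_def)
qed

subsection \<open>Laws of large numbers and Gaussian integration by parts\<close>

text \<open>Chebyshev's inequality on each finite product. The sample sizes \<open>n k\<close> live
  on different spaces, as in a triangular array, so convergence in probability is the natural
  form.\<close>

lemma weak_law_of_large_numbers:
  fixes f :: "'b => real"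
  assumes T: "prob_space T" and f: "f \<in> borel_measurable T" and f2: "integrable T (%x. (f x)\<^sup>2)"
    and eps: "eps > 0" and n: "filterlim n at_top sequentially"
  shows "(%k. measure (PiM {..<n k} (%_. T))
     {theta \<in> space (PiM {..<n k} (%_. T)). eps * real (n k) \<le> \<bar>(\<Sum>i<n k. f (theta i)) - real (n k) * (\<integral>x. f x \<partial>T)\<bar>}) \<longlonglongrightarrow> 0"
proof -
  interpret T: prob_space T by fact
  have psf: "product_sigma_finite (%_::nat. T)"
    by (simp add: product_sigma_finite_def prob_space_imp_sigma_finite T)
  have f1: "integrable T f"
    using f f2 by (rule T.square_integrable_imp_integrable)
  define m where "m = (\<integral>x. f x \<partial>T)"
  define h where "h x = f x - m" for x
  have mh: "h \<in> borel_measurable T" using f unfolding h_def by simp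
  have h1: "integrable T h" "(\<integral>x. h x \<partial>T) = 0"
    using f1 T.prob_space by (simp_all add: h_def[abs_def] m_def)
  have h2: "integrable T (%x. h x * h x)"
  proof -
    have "integrable T (%x. (f x)\<^sup>2 - 2 * m * f x + m\<^sup>2)" using f1 f2 by simp
    then show ?thesis by (simp add: h_def power2_eq_square algebra_simps)
  qed
  define V where "V = (\<integral>x. h x * h x \<partial>T)"
  have V0: "V \<ge> 0" by (simp add: V_def)
  have bound: "measure (PiM {..<N} (%_. T)) {theta \<in> space (PiM {..<N} (%_. T)). eps * real N \<le> \<bar>(\<Sum>i<N. f (theta i)) - real N * m\<bar>}
      \<le> V / eps\<^sup>2 / real N" if N: "N > 0" for N :: nat
  proof -
    let ?P = "PiM {..<N} (%_. T)"
    interpret P: prob_space ?P by (rule prob_space_PiM[OF T])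
    have coord: "(%theta. h (theta i)) \<in> borel_measurable ?P" if "i < N" for i
      using measurable_compose[OF measurable_component_singleton[of i "{..<N}" "%_. T"] mh] that by simp
    have prod: "integrable ?P (%theta. h (theta i) * h (theta j)) \<and> (\<integral>theta. h (theta i) * h (theta j) \<partial>?P) = (if i = j then V else 0)"
      if ij: "i < N" "j < N" for i j
    proof -
      \<comment> \<open>Writing the product of two terms as a product over all coordinates lets one
        product formula give both the variance, for \<open>i = j\<close>, and the vanishing
        covariances.\<close>
      define F where "F k x = (if k = i then h x else 1) * (if k = j then h x else 1)" for k x
      have Fi: "integrable T (F k)" for k
        using h1 h2 by (cases "k = i"; cases "k = j") (auto simp: F_def[abs_def])
      have eq: "(\<Prod>k\<in>{..<N}. F k (theta k)) = h (theta i) * h (theta j)" for theta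
        using ij unfolding F_def prod.distrib by (simp add: prod.delta)
      have "integrable ?P (%theta. \<Prod>k\<in>{..<N}. F k (theta k))"
        using Fi by (intro product_sigma_finite.product_integrable_prod[OF psf]) auto
      moreover have "(\<integral>theta. (\<Prod>k\<in>{..<N}. F k (theta k)) \<partial>?P) = (\<Prod>k\<in>{..<N}. \<integral>x. F k x \<partial>T)"
        using Fi by (intro product_sigma_finite.product_integral_prod[OF psf]) auto
      moreover have "(\<Prod>k\<in>{..<N}. \<integral>x. F k x \<partial>T) = (if i = j then V else 0)"
      proof (cases "i = j")
        case True
        have "(\<integral>x. F k x \<partial>T) = (if k = i then V else 1)" for k
          using True T.prob_space by (simp add: F_def V_def)
        then show ?thesis using ij True by (simp add: prod.delta)
      next
        case False
        then have "(\<integral>x. F i x \<partial>T) = 0" using h1(2) by (simp add: F_def)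
        then show ?thesis using ij False by (auto intro!: prod_zero)
      qed
      ultimately show ?thesis unfolding eq by simp
    qed
    define S where "S theta = (\<Sum>i<N. h (theta i))" for theta
    have mS: "S \<in> borel_measurable ?P" unfolding S_def using coord by (intro borel_measurable_sum) auto
    have S2: "(S theta)\<^sup>2 = (\<Sum>i<N. \<Sum>j<N. h (theta i) * h (theta j))" for theta
      by (simp add: S_def power2_eq_square sum_product)
    have iS: "integrable ?P (%theta. (S theta)\<^sup>2)"
      unfolding S2 using prod by (intro Bochner_Integration.integrable_sum) auto
    have "(\<integral>theta. (S theta)\<^sup>2 \<partial>?P) = (\<Sum>i<N. \<Sum>j<N. \<integral>theta. h (theta i) * h (theta j) \<partial>?P)"
      unfolding S2 using prod
      by (subst Bochner_Integration.integral_sum; (intro Bochner_Integration.integrable_sum sum.cong Bochner_Integration.integral_sum refl)?; auto)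
    also have "\<dots> = (\<Sum>i<N. \<Sum>j<N. if i = j then V else 0)"
      using prod by (intro sum.cong) auto
    also have "\<dots> = real N * V" by simp
    finally have ES: "(\<integral>theta. (S theta)\<^sup>2 \<partial>?P) = real N * V" .
    have "measure ?P {theta \<in> space ?P. eps * real N \<le> \<bar>S theta\<bar>} \<le> (\<integral>theta. (S theta)\<^sup>2 \<partial>?P) / (eps * real N)\<^sup>2"
      using eps N by (intro P.second_moment_method mS iS) auto
    also have "\<dots> = V / eps\<^sup>2 / real N"
      unfolding ES using N eps by (simp add: power2_eq_square field_simps)
    finally show ?thesis by (simp add: S_def h_def sum_subtractf)
  qed
  have ev: "eventually (%k. n k > 0) sequentially"
  proof -
    have "eventually (%k. 1 \<le> n k) sequentially" using n by (simp add: filterlim_at_top)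
    then show ?thesis by eventually_elim simp
  qed
  have lim: "(%k. V / eps\<^sup>2 / real (n k)) \<longlonglongrightarrow> 0"
    by (rule tendsto_divide_0[OF tendsto_const])
      (rule filterlim_at_top_imp_at_infinity, rule filterlim_compose[OF filterlim_real_sequentially n])
  show ?thesis
    unfolding m_def[symmetric]
  proof (rule tendsto_sandwich[OF _ _ tendsto_const lim])
    show "eventually (%k. measure (PiM {..<n k} (%_. T))
       {theta \<in> space (PiM {..<n k} (%_. T)). eps * real (n k) \<le> \<bar>(\<Sum>i<n k. f (theta i)) - real (n k) * m\<bar>}
       \<le> V / eps\<^sup>2 / real (n k)) sequentially"
      using ev by eventually_elim (rule bound)
  qed simp
qed

lemma std_normal_density_deriv:
  "(std_normal_density has_real_derivative - x * std_normal_density x) (at x)"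
proof -
  have "((%x::real. exp (- x\<^sup>2 / 2)) has_real_derivative exp (- x\<^sup>2 / 2) * (- x)) (at x)"
    by (auto intro!: derivative_eq_intros simp: power2_eq_square)
  from DERIV_cmult[OF this, of "1 / sqrt (2 * pi)"] show ?thesis
    by (simp add: std_normal_density_def[abs_def] mult.commute)
qed

lemma tendsto_std_normal_density_linear:
  "((%x. (x + a) * std_normal_density x) \<longlongrightarrow> 0) at_top"
proof (rule Lim_null_comparison)
  show "\<forall>\<^sub>F x in at_top. norm ((x + a) * std_normal_density x) \<le> 4 * inverse x"
    using eventually_ge_at_top[of "max 1 \<bar>a\<bar>"]
  proof eventually_elim
    case (elim x)
    then have x: "x \<ge> 1" "\<bar>x + a\<bar> \<le> 2 * x" by auto
    have "exp (- x\<^sup>2 / 2) \<le> 2 / x\<^sup>2"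
    proof -
      have "x\<^sup>2 / 2 \<le> exp (x\<^sup>2 / 2)" using exp_ge_add_one_self[of "x\<^sup>2 / 2"] by linarith
      then have "inverse (exp (x\<^sup>2 / 2)) \<le> inverse (x\<^sup>2 / 2)" using x by (intro le_imp_inverse_le) auto
      then show ?thesis by (simp add: exp_minus)
    qed
    moreover have "1 / sqrt (2 * pi) \<le> 1"
      using pi_ge_two by (simp add: real_le_rsqrt)
    ultimately have "std_normal_density x \<le> 1 * (2 / x\<^sup>2)"
      unfolding std_normal_density_def by (intro mult_mono) auto
    then have "\<bar>x + a\<bar> * std_normal_density x \<le> (2 * x) * (2 / x\<^sup>2)"
      using x by (intro mult_mono) auto
    also have "\<dots> = 4 * inverse x" using x by (simp add: power2_eq_square field_simps)
    finally show ?case by (simp add: abs_mult)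
  qed
  have "((%x::real. 4 * inverse x) \<longlongrightarrow> 4 * 0) at_top"
    by (intro tendsto_intros tendsto_inverse_0_at_top filterlim_ident)
  then show "((%x::real. 4 * inverse x) \<longlongrightarrow> 0) at_top" by simp
qed

lemma std_normal_integral_eq:
  fixes f :: "real => real"
  assumes "f \<in> borel_measurable borel"
  shows "(\<integral>x. f x \<partial>gauss) = (\<integral>x. f x * std_normal_density x \<partial>lborel)"
    "integrable gauss f \<longleftrightarrow> integrable lborel (%x. f x * std_normal_density x)"
  using assms by (simp_all add: integral_density integrable_density mult.commute)

text \<open>Integration by parts with the antiderivative \<open>F\<close> of \<open>f\<close>. It
  vanishes at \<open>- a\<close> because of the factor \<open>x + a\<close>, and at infinity because
  of the density; so there are no boundary terms.\<close>

lemma stein_half_line: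
  "(\<integral>x. indicator {x. - a < x} x * ((x + a) * x) \<partial>gauss) =
    measure gauss {x. - a < x}"
proof -
  let ?N = "gauss"
  interpret N: prob_space ?N by (rule prob_space_std_normal)
  define f where "f x = ((x + a) * x - 1) * std_normal_density x" for x
  define F where "F x = - ((x + a) * std_normal_density x)" for x
  have Ff: "(F has_real_derivative f x) (at x)" for x
    unfolding F_def f_def
    by (auto intro!: derivative_eq_intros std_normal_density_deriv simp: algebra_simps)
  have int_poly: "integrable ?N (%x. (x + a) * x - 1)"
    using integrable_std_normal_distribution_moment[of 1] integrable_std_normal_distribution_moment[of 2]
    by (simp add: distrib_right power2_eq_square)
  then have intf: "integrable lborel f"
    unfolding f_def by (subst (asm) std_normal_integral_eq(2)) auto
  have cont: "isCont f x" for x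
    unfolding f_def std_normal_density_def by (intro continuous_intros) auto
  have e: "einterval (ereal (- a)) \<infinity> = {x. - a < x}" by (auto simp: einterval_def)
  have "(LBINT x=ereal (- a)..\<infinity>. f x) = 0 - 0"
  proof (rule interval_integral_FTC_integrable)
    show "set_integrable lborel (einterval (ereal (- a)) \<infinity>) f"
      unfolding set_integrable_def using intf by (intro integrable_mult_indicator) auto
    have "(F \<longlongrightarrow> F (- a)) (at_right (- a))"
      using DERIV_isCont[OF Ff[of "- a"]] by (simp add: isCont_def filterlim_at_split)
    then show "((F \<circ> real_of_ereal) \<longlongrightarrow> 0) (at_right (ereal (- a)))"
      by (simp add: ereal_tendsto_simps F_def)
    have "(F \<longlongrightarrow> - 0) at_top" unfolding F_def by (intro tendsto_minus tendsto_std_normal_density_linear)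
    then show "((F \<circ> real_of_ereal) \<longlongrightarrow> 0) (at_left \<infinity>)"
      by (simp add: ereal_tendsto_simps)
  qed (use Ff cont in \<open>auto simp: has_real_derivative_iff_has_vector_derivative\<close>)
  then have "(\<integral>x. indicator {x. - a < x} x * f x \<partial>lborel) = 0"
    by (simp add: interval_lebesgue_integral_def e[simplified] set_lebesgue_integral_def greaterThan_def)
  then have z: "(\<integral>x. indicator {x. - a < x} x * ((x + a) * x - 1) \<partial>?N) = 0"
    by (subst std_normal_integral_eq(1)) (auto simp: f_def mult.assoc)
  have i1: "integrable ?N (%x. indicator {x. - a < x} x * ((x + a) * x - 1))"
    using integrable_mult_indicator[OF _ int_poly, of "{x. - a < x}"] by simp
  have i2: "integrable ?N (%x. indicator {x. - a < x} x :: real)"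
    by (rule N.integrable_const_bound[of _ 1]) auto
  have "(\<integral>x. indicator {x. - a < x} x * ((x + a) * x) \<partial>?N) =
     (\<integral>x. indicator {x. - a < x} x * ((x + a) * x - 1) + indicator {x. - a < x} x \<partial>?N)"
    by (intro Bochner_Integration.integral_cong) (auto simp: algebra_simps)
  also have "\<dots> = measure ?N {x. - a < x}"
    by (subst Bochner_Integration.integral_add[OF i1 i2]) (simp add: z)
  finally show ?thesis .
qed

lemma std_normal_integral_uminus:
  fixes f :: "real => real"
  assumes "f \<in> borel_measurable borel"
  shows "(\<integral>x. f (- x) \<partial>gauss) = (\<integral>x. f x \<partial>gauss)"
proof -
  have "(\<integral>x. f (- x) \<partial>gauss) = (\<integral>x. f (- x) * std_normal_density x \<partial>lborel)"
    using assms by (intro std_normal_integral_eq(1)) simp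
  also have "\<dots> = (\<integral>x. f (- x) * std_normal_density (- x) \<partial>lborel)"
    by (simp add: std_normal_density_def)
  also have "\<dots> = (\<integral>x. f x * std_normal_density x \<partial>lborel)"
    using lborel_integral_real_affine[of "-1" "%x. f x * std_normal_density x" 0] by simp
  finally show ?thesis using std_normal_integral_eq(1)[OF assms] by simp
qed

text \<open>Stein's identity: \<open>rcone\<close> has a kink but no jump, and its derivative is the
  indicator on the right.\<close>

lemma stein_rcone:
  assumes "e \<in> {-1, 0, 1}"
  shows "(\<integral>x. rcone e (x + a) * x \<partial>gauss) =
    measure gauss {x. e = 0 \<or> 0 < e * (x + a)}"
proof -
  let ?N = "gauss"
  interpret N: prob_space ?N by (rule prob_space_std_normal)
  consider (1) "e = -1" | (2) "e = 0" | (3) "e = 1" using assms by blast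
  then show ?thesis
  proof cases
    case 1
    have "(\<integral>x. rcone e (x + a) * x \<partial>?N) = (\<integral>x. indicator {x. - (- a) < x} (- x) * ((- x + - a) * (- x)) \<partial>?N)"
      using 1 by (intro Bochner_Integration.integral_cong) (auto simp: rcone_def algebra_simps split: split_indicator)
    also have "\<dots> = (\<integral>x. indicator {x. - (- a) < x} x * ((x + - a) * x) \<partial>?N)"
      by (rule std_normal_integral_uminus) simp
    also have "\<dots> = measure ?N {x. - (- a) < x}" by (rule stein_half_line)
    also have "\<dots> = (\<integral>x. indicator {x. a < x} x \<partial>?N)" by simp
    also have "\<dots> = (\<integral>x. indicator {x. a < x} (- x) \<partial>?N)"
      by (rule std_normal_integral_uminus[symmetric]) simp
    also have "\<dots> = (\<integral>x. indicator {x. e = 0 \<or> 0 < e * (x + a)} x \<partial>?N)"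
      using 1 by (intro Bochner_Integration.integral_cong) (auto split: split_indicator)
    finally show ?thesis by simp
  next
    case 2
    have "(\<integral>x. rcone e (x + a) * x \<partial>?N) = (\<integral>x. x ^ 2 + a * x ^ 1 \<partial>?N)"
      using 2 by (intro Bochner_Integration.integral_cong) (auto simp: rcone_def power2_eq_square algebra_simps)
    also have "\<dots> = (\<integral>x. x ^ 2 \<partial>?N) + a * (\<integral>x. x ^ 1 \<partial>?N)"
      using integrable_std_normal_distribution_moment[of 1] integrable_std_normal_distribution_moment[of 2] by simp
    also have "\<dots> = 1"
      using std_normal_distribution_even_moments(1)[of 1] integral_std_normal_distribution_moment_odd[of 1]
      by (simp add: numeral_2_eq_2)
    finally show ?thesis using 2 N.prob_space by simp
  next
    case 3
    have "(\<integral>x. rcone e (x + a) * x \<partial>?N) = (\<integral>x. indicator {x. - a < x} x * ((x + a) * x) \<partial>?N)"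
      using 3 by (intro Bochner_Integration.integral_cong) (auto simp: rcone_def split: split_indicator)
    also have "\<dots> = measure ?N {x. - a < x}" by (rule stein_half_line)
    also have "{x. - a < x} = {x. e = 0 \<or> 0 < e * (x + a)}" using 3 by auto
    finally show ?thesis .
  qed
qed

lemma std_normal_ray_pos:
  assumes "e \<in> {-1, 0, 1}"
  shows "\<not> (AE x in gauss. dcone e (x + a) = 0)"
proof
  assume "AE x in gauss. dcone e (x + a) = 0"
  then have "AE x in lborel. dcone e (x + a) = 0"
    by (subst (asm) AE_density) (auto simp: std_normal_density_def elim: eventually_mono)
  \<comment> \<open>An interval of length 1 on which the distance is positive, on the side that
    \<open>e\<close> dictates.\<close>
  then have "AE x in lborel. \<not> (if e = -1 then x \<in> {- a - 2<..<- a - 1} else x \<in> {- a + 1<..<- a + 2})"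
    by eventually_elim (use assms in \<open>auto simp: dcone_def max_def split: if_splits\<close>)
  then have "emeasure lborel {x. if e = -1 then x \<in> {- a - 2<..<- a - 1} else x \<in> {- a + 1<..<- a + 2}} = 0"
    by (subst (asm) AE_iff_measurable[OF _ refl]) auto
  moreover have "{x. if e = -1 then x \<in> {- a - 2<..<- a - 1} else x \<in> {- a + 1<..<- a + 2}} =
     (if e = -1 then {- a - 2<..<- a - 1} else {- a + 1<..<- a + 2})" by auto
  ultimately show False by (cases "e = -1") simp_all
qed

text \<open>On the active region the squared distance is strictly convex. This will give the
  uniqueness of the minimiser of \<open>\<phi>\<close>.\<close>

lemma dcone_lower_strict:
  assumes e: "e \<in> {-1, 0, 1}" and a: "e = 0 \<or> 0 < e * s" and t: "t ~= 0"
  shows "(dcone e s)\<^sup>2 + 2 * rcone e s * t < (dcone e (s + t))\<^sup>2"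
proof -
  have sq: "(s + t)\<^sup>2 = s\<^sup>2 + 2 * s * t + t\<^sup>2" by (simp add: power2_sum)
  have neg: "(- s - t)\<^sup>2 = (s + t)\<^sup>2" by (simp add: power2_eq_square algebra_simps)
  have t2: "t\<^sup>2 > 0" using t by simp
  have r: "(dcone e s)\<^sup>2 = s\<^sup>2" using e
    by (rule sign_cases) (use a in \<open>auto simp: dcone_def max_def\<close>)
  have r': "rcone e s = s" using a by (auto simp: rcone_def)
  show ?thesis
  proof (cases "e = 0 \<or> e * (s + t) > 0")
    case True
    then have "(dcone e (s + t))\<^sup>2 = (s + t)\<^sup>2"
      using e by (cases rule: sign_cases) (auto simp: dcone_def max_def neg)
    then show ?thesis using r r' sq t2 by simp
  next
    case False
    then have e0: "e ~= 0" and p: "e * s > 0" and f: "e * s + e * t \<le> 0" using a by (auto simp: distrib_left)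
    have ee: "e * e = 1" using e e0 by auto
    have "s * (s + 2 * t) = (e * e) * (s * (s + 2 * t))" by (simp only: ee mult_1_left)
    also have "\<dots> = (e * s) * (e * s + 2 * (e * t))" by (simp add: algebra_simps)
    also have "\<dots> < 0" using p f by (intro mult_pos_neg) auto
    finally have "s\<^sup>2 + 2 * s * t < 0" by (simp add: power2_eq_square algebra_simps)
    then show ?thesis unfolding r r' using zero_le_power2[of "dcone e (s + t)"] by linarith
  qed
qed

lemma abs_dcone_le: "e \<in> {-1, 0, 1} ==> dcone e s \<le> \<bar>s\<bar>"
  by (erule sign_cases) (auto simp: dcone_def)

lemma abs_rcone_le: "\<bar>rcone e s\<bar> \<le> \<bar>s\<bar>"
  by (simp add: rcone_def)

lemma dcone_measurable [measurable (raw)]: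
  assumes [measurable]: "f \<in> borel_measurable M" "g \<in> borel_measurable M"
  shows "(%x. dcone (f x) (g x)) \<in> borel_measurable M"
  unfolding dcone_def by measurable

lemma rcone_measurable [measurable (raw)]:
  assumes [measurable]: "f \<in> borel_measurable M" "g \<in> borel_measurable M"
  shows "(%x. rcone (f x) (g x)) \<in> borel_measurable M"
  unfolding rcone_def by measurable

subsection \<open>The limiting one-dimensional problem\<close>

lemma distr_pair_snd:
  assumes A: "prob_space A" and B: "prob_space B"
  shows "distr (A \<Otimes>\<^sub>M B) B snd = B"
proof (rule measure_eqI)
  interpret A: prob_space A by fact
  interpret B: prob_space B by fact
  fix C assume "C \<in> sets (distr (A \<Otimes>\<^sub>M B) B snd)"
  then have C: "C \<in> sets B" by simp
  have eq: "snd -` C \<inter> space (A \<Otimes>\<^sub>M B) = space A \<times> C"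
    using sets.sets_into_space[OF C] by (auto simp: space_pair_measure)
  show "emeasure (distr (A \<Otimes>\<^sub>M B) B snd) C = emeasure B C"
    unfolding emeasure_distr[OF measurable_snd C] eq B.emeasure_pair_measure_Times[OF sets.top C]
    by (simp add: A.emeasure_space_1)
qed simp

lemma distr_pair_indep:
  assumes N: "prob_space N" and X: "X \<in> N \<rightarrow>\<^sub>M A" and Z: "Z \<in> N \<rightarrow>\<^sub>M B"
    and indep: "\<And>a b. a \<in> sets A ==> b \<in> sets B ==> measure N ((X -` a \<inter> space N) \<inter> (Z -` b \<inter> space N)) =
      measure N (X -` a \<inter> space N) * measure N (Z -` b \<inter> space N)"
  shows "distr N (A \<Otimes>\<^sub>M B) (%omega. (X omega, Z omega)) = distr N A X \<Otimes>\<^sub>M distr N B Z"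
proof (rule sym, rule pair_measure_eqI)
  interpret prob_space N by fact
  show "sigma_finite_measure (distr N A X)" "sigma_finite_measure (distr N B Z)"
    by (intro prob_space_imp_sigma_finite prob_space_distr X Z)+
  show "sets (distr N A X \<Otimes>\<^sub>M distr N B Z) = sets (distr N (A \<Otimes>\<^sub>M B) (%omega. (X omega, Z omega)))"
    unfolding sets_distr by (rule sets_pair_measure_cong[OF sets_distr sets_distr])
  fix a b assume "a \<in> sets (distr N A X)" "b \<in> sets (distr N B Z)"
  then have a: "a \<in> sets A" and b: "b \<in> sets B" by simp_all
  have e: "(%omega. (X omega, Z omega)) -` (a \<times> b) \<inter> space N = (X -` a \<inter> space N) \<inter> (Z -` b \<inter> space N)" by auto
  show "emeasure (distr N A X) a * emeasure (distr N B Z) b = emeasure (distr N (A \<Otimes>\<^sub>M B) (%omega. (X omega, Z omega))) (a \<times> b)"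
    unfolding emeasure_distr[OF X a] emeasure_distr[OF Z b] emeasure_distr[OF measurable_Pair[OF X Z] pair_measureI[OF a b]]
      e emeasure_eq_measure indep[OF a b] by (simp add: ennreal_mult)
qed

text \<open>\<open>kappa\<close> is the joint law of the index \<open>U\<close> and the sign of the
  loss, which is all that the limit depends on. The last two assumptions express (N): moving along
  \<open>w\<close>, respectively \<open>- w\<close>, increases the loss with positive
  probability.\<close>

locale limit_law = prob_space kappa for kappa :: "(real \<times> real) measure" +
  assumes sets_kappa: "sets kappa = sets (borel \<Otimes>\<^sub>M borel)"
    and sign: "AE z in kappa. snd z \<in> {-1, 0, 1}"
    and normal: "distr kappa borel fst = gauss"
    and nontrivial_pos: "\<not> (AE z in kappa. dcone (snd z) (fst z) = 0)"
    and nontrivial_neg: "\<not> (AE z in kappa. dcone (snd z) (- fst z) = 0)"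
begin

definition tau :: "((real \<times> real) \<times> real) measure" where "tau = kappa \<Otimes>\<^sub>M gauss"

abbreviation U :: "(real \<times> real) \<times> real => real" where "U theta \<equiv> fst (fst theta)"
abbreviation E :: "(real \<times> real) \<times> real => real" where "E theta \<equiv> snd (fst theta)"
abbreviation G :: "(real \<times> real) \<times> real => real" where "G theta \<equiv> snd theta"

sublocale N: prob_space gauss by (rule prob_space_std_normal)
sublocale P: pair_prob_space kappa gauss ..
sublocale T: prob_space tau unfolding tau_def by unfold_locales

lemma measurable_kappa: "measurable kappa M = measurable (borel \<Otimes>\<^sub>M borel) M"
  by (rule measurable_cong_sets[OF sets_kappa refl])

lemma fst_measurable [measurable]: "fst \<in> borel_measurable kappa" unfolding measurable_kappa by simp
lemma snd_measurable [measurable]: "snd \<in> borel_measurable kappa" unfolding measurable_kappa by simp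

lemma sets_tau: "sets tau = sets ((borel \<Otimes>\<^sub>M borel) \<Otimes>\<^sub>M borel)"
  unfolding tau_def by (intro sets_pair_measure_cong sets_kappa) simp

lemma measurable_tau: "measurable tau M = measurable ((borel \<Otimes>\<^sub>M borel) \<Otimes>\<^sub>M borel) M"
  by (rule measurable_cong_sets[OF sets_tau refl])

lemma space_tau [simp]: "space tau = UNIV"
  using sets_eq_imp_space_eq[OF sets_tau] by (simp add: space_pair_measure)

lemma UEG_measurable [measurable]: "U \<in> borel_measurable tau" "E \<in> borel_measurable tau" "G \<in> borel_measurable tau"
  unfolding measurable_tau by measurable

lemma fst_measurable_tau: "fst \<in> tau \<rightarrow>\<^sub>M kappa" unfolding tau_def by simp

lemma distr_fst: "distr tau kappa fst = kappa"
  unfolding tau_def by (rule N.distr_pair_fst)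

lemma distr_G: "distr tau borel G = gauss"
proof -
  have "distr tau borel G = distr (kappa \<Otimes>\<^sub>M gauss) gauss snd"
    unfolding tau_def by (rule distr_cong) simp_all
  also have "\<dots> = gauss" by (rule distr_pair_snd[OF prob_space_axioms prob_space_std_normal])
  finally show ?thesis .
qed

lemma distr_U: "distr tau borel U = gauss"
  using distr_distr[OF fst_measurable fst_measurable_tau] distr_fst normal by (simp add: comp_def)

lemma AE_fst:
  assumes "AE z in kappa. Q z" shows "AE theta in tau. Q (fst theta)"
proof -
  have "AE z in distr tau kappa fst. Q z" unfolding distr_fst by fact
  from AE_distrD[OF fst_measurable_tau this] show ?thesis .
qed

lemma AE_sign: "AE theta in tau. E theta \<in> {-1, 0, 1}"
  by (rule AE_fst[OF sign])

lemma AE_normal_nonzero: "AE x in gauss. x ~= (c::real)"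
  by (subst AE_density) (auto intro: eventually_mono[OF AE_lborel_singleton])

lemma AE_U: "AE theta in tau. U theta ~= 0"
proof -
  have "AE x in distr tau borel U. x ~= 0" unfolding distr_U by (rule AE_normal_nonzero)
  from AE_distrD[OF UEG_measurable(1) this] show ?thesis .
qed

lemma integrable_U: "integrable tau (%theta. (U theta) ^ k)"
  using integrable_distr[OF UEG_measurable(1), of "%x. x ^ k"] integrable_std_normal_distribution_moment[of k]
  by (simp add: distr_U)

lemma integrable_G: "integrable tau (%theta. (G theta) ^ k)"
  using integrable_distr[OF UEG_measurable(3), of "%x. x ^ k"] integrable_std_normal_distribution_moment[of k]
  by (simp add: distr_G)

lemma AE_shift_nonzero: "AE theta in tau. G theta + U theta * t ~= 0"
  unfolding tau_def
proof (rule P.AE_pair_measure)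
  have [measurable]: "(%theta. G theta + U theta * t) \<in> borel_measurable tau" by measurable
  have "{theta \<in> space tau. G theta + U theta * t ~= 0} \<in> sets tau" by measurable
  then show "{theta \<in> space (kappa \<Otimes>\<^sub>M gauss). G theta + U theta * t ~= 0} \<in> sets (kappa \<Otimes>\<^sub>M gauss)"
    by (simp only: tau_def)
  show "AE z in kappa. AE x in gauss. G (z, x) + U (z, x) * t ~= 0"
  proof (rule AE_I2)
    fix z :: "real \<times> real"
    show "AE x in gauss. G (z, x) + U (z, x) * t ~= 0"
      using AE_normal_nonzero[of "- fst z * t"] by eventually_elim auto
  qed
qed

definition H :: "real => (real \<times> real) \<times> real => real" where
  "H t theta = (dcone (E theta) (G theta + U theta * t))\<^sup>2"

lemma H_measurable [measurable]: "H t \<in> borel_measurable tau"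
  unfolding H_def[abs_def] by measurable

lemma H_le: "E theta \<in> {-1, 0, 1} ==> H t theta \<le> 2 * (G theta)\<^sup>2 + 2 * t\<^sup>2 * (U theta)\<^sup>2"
proof -
  assume e: "E theta \<in> {-1, 0, 1}"
  have "H t theta \<le> (G theta + U theta * t)\<^sup>2"
    unfolding H_def using power_mono[OF abs_dcone_le[OF e], of "G theta + U theta * t" 2] by simp
  also have "\<dots> \<le> 2 * (G theta)\<^sup>2 + 2 * t\<^sup>2 * (U theta)\<^sup>2"
    using sum_squares_bound[of "G theta" "U theta * t"] by (simp add: power2_sum power_mult_distrib mult_ac)
  finally show ?thesis .
qed

lemma integrable_bound2: "integrable tau (%theta. a * (G theta)\<^sup>2 + b * (U theta)\<^sup>2)"
  using integrable_U[of 2] integrable_G[of 2] by simp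

lemma integrable_H: "integrable tau (H t)"
proof (rule Bochner_Integration.integrable_bound[OF integrable_bound2[of 2 "2 * t\<^sup>2"] H_measurable])
  show "AE theta in tau. norm (H t theta) \<le> norm (2 * (G theta)\<^sup>2 + 2 * t\<^sup>2 * (U theta)\<^sup>2)"
    using AE_sign
  proof eventually_elim
    case (elim theta)
    have "0 \<le> H t theta" by (simp add: H_def)
    then show ?case using H_le[OF elim, of t] by simp
  qed
qed

lemma integrable_H2: "integrable tau (%theta. (H t theta)\<^sup>2)"
proof (rule Bochner_Integration.integrable_bound)
  show "integrable tau (%theta. 8 * (G theta) ^ 4 + 8 * t ^ 4 * (U theta) ^ 4)"
    using integrable_U[of 4] integrable_G[of 4] by simp
  show "AE theta in tau. norm ((H t theta)\<^sup>2) \<le> norm (8 * (G theta) ^ 4 + 8 * t ^ 4 * (U theta) ^ 4)"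
    using AE_sign
  proof eventually_elim
    case (elim theta)
    have "0 \<le> H t theta" by (simp add: H_def)
    then have "(H t theta)\<^sup>2 \<le> (2 * (G theta)\<^sup>2 + 2 * t\<^sup>2 * (U theta)\<^sup>2)\<^sup>2"
      using H_le[OF elim, of t] by (intro power_mono)
    also have "\<dots> \<le> 2 * (2 * (G theta)\<^sup>2)\<^sup>2 + 2 * (2 * t\<^sup>2 * (U theta)\<^sup>2)\<^sup>2"
      using sum_squares_bound[of "2 * (G theta)\<^sup>2" "2 * t\<^sup>2 * (U theta)\<^sup>2"] by (simp add: power2_sum)
    also have "\<dots> = 8 * (G theta) ^ 4 + 8 * t ^ 4 * (U theta) ^ 4"
      by (simp add: power_mult_distrib power_mult[symmetric])
    finally show ?case by simp
  qed
qed simp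

definition \<phi> :: "real => real" where "\<phi> t = (\<integral>theta. H t theta \<partial>tau)"

lemma integrable_rcone: "integrable tau (%theta. rcone (E theta) (G theta + U theta * t) * U theta)"
  "integrable tau (%theta. rcone (E theta) (G theta + U theta * t) * G theta)"
proof -
  have b: "\<bar>rcone (E theta) (G theta + U theta * t) * v\<bar> \<le> (G theta)\<^sup>2 + t\<^sup>2 * (U theta)\<^sup>2 + v\<^sup>2" for theta v
  proof -
    have "\<bar>rcone (E theta) (G theta + U theta * t)\<bar> * \<bar>v\<bar> \<le> \<bar>G theta + U theta * t\<bar> * \<bar>v\<bar>"
      by (intro mult_right_mono abs_rcone_le) simp
    also have "\<dots> \<le> ((G theta + U theta * t)\<^sup>2 + v\<^sup>2) / 2"
      using sum_squares_bound[of "\<bar>G theta + U theta * t\<bar>" "\<bar>v\<bar>"] by simp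
    also have "\<dots> \<le> (G theta)\<^sup>2 + t\<^sup>2 * (U theta)\<^sup>2 + v\<^sup>2"
    proof -
      have "(G theta + U theta * t)\<^sup>2 \<le> 2 * (G theta)\<^sup>2 + 2 * (U theta * t)\<^sup>2"
        using sum_squares_bound[of "G theta" "U theta * t"] unfolding power2_sum by linarith
      moreover have "(U theta * t)\<^sup>2 = t\<^sup>2 * (U theta)\<^sup>2" by (simp add: power_mult_distrib)
      moreover have "(x + v2) / 2 \<le> g + k + v2" if "x \<le> 2 * g + 2 * k'" "k' = k" "0 \<le> v2" for x g k k' v2 :: real
        using that by (simp add: field_simps)
      ultimately show ?thesis using zero_le_power2[of v] by blast
    qed
    finally show ?thesis by (simp add: abs_mult)
  qed
  show "integrable tau (%theta. rcone (E theta) (G theta + U theta * t) * U theta)"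
  proof (rule Bochner_Integration.integrable_bound[OF integrable_bound2[of 1 "t\<^sup>2 + 1"]])
    show "AE theta in tau. norm (rcone (E theta) (G theta + U theta * t) * U theta) \<le> norm (1 * (G theta)\<^sup>2 + (t\<^sup>2 + 1) * (U theta)\<^sup>2)"
    proof (rule AE_I2)
      fix theta
      have "\<bar>rcone (E theta) (G theta + U theta * t) * U theta\<bar> \<le> 1 * (G theta)\<^sup>2 + (t\<^sup>2 + 1) * (U theta)\<^sup>2"
        using b[of theta "U theta"] by (simp add: distrib_right)
      then show "norm (rcone (E theta) (G theta + U theta * t) * U theta) \<le> norm (1 * (G theta)\<^sup>2 + (t\<^sup>2 + 1) * (U theta)\<^sup>2)" by simp
    qed
  qed measurable
  show "integrable tau (%theta. rcone (E theta) (G theta + U theta * t) * G theta)"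
  proof (rule Bochner_Integration.integrable_bound[OF integrable_bound2[of 2 "t\<^sup>2"]])
    show "AE theta in tau. norm (rcone (E theta) (G theta + U theta * t) * G theta) \<le> norm (2 * (G theta)\<^sup>2 + t\<^sup>2 * (U theta)\<^sup>2)"
    proof (rule AE_I2)
      fix theta
      have "\<bar>rcone (E theta) (G theta + U theta * t) * G theta\<bar> \<le> 2 * (G theta)\<^sup>2 + t\<^sup>2 * (U theta)\<^sup>2"
        using b[of theta "G theta"] by simp
      then show "norm (rcone (E theta) (G theta + U theta * t) * G theta) \<le> norm (2 * (G theta)\<^sup>2 + t\<^sup>2 * (U theta)\<^sup>2)" by simp
    qed
  qed measurable
qed

text \<open>Half the derivative of \<open>\<phi>\<close>. Only the quadratic bounds below are used,
  which avoids differentiation under the integral.\<close>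

definition B :: "real => real" where "B t = (\<integral>theta. rcone (E theta) (G theta + U theta * t) * U theta \<partial>tau)"

lemma EU2: "(\<integral>theta. (U theta)\<^sup>2 \<partial>tau) = 1"
  using integral_distr[OF UEG_measurable(1), of "%x. x\<^sup>2"] std_normal_distribution_even_moments(1)[of 1]
  by (simp add: distr_U numeral_2_eq_2)

lemma EG2: "(\<integral>theta. (G theta)\<^sup>2 \<partial>tau) = 1"
  using integral_distr[OF UEG_measurable(3), of "%x. x\<^sup>2"] std_normal_distribution_even_moments(1)[of 1]
  by (simp add: distr_G numeral_2_eq_2)

lemma shift_eq: "G theta + U theta * (t + s) = (G theta + U theta * t) + U theta * s"
  by (simp add: algebra_simps)

lemma \<phi>_upper: "\<phi> (t + s) \<le> \<phi> t + 2 * s * B t + s\<^sup>2"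
proof -
  have "\<phi> (t + s) \<le> (\<integral>theta. H t theta + 2 * s * (rcone (E theta) (G theta + U theta * t) * U theta) + s\<^sup>2 * (U theta)\<^sup>2 \<partial>tau)"
    unfolding \<phi>_def
  proof (rule integral_mono_AE)
    show "AE theta in tau. H (t + s) theta \<le> H t theta + 2 * s * (rcone (E theta) (G theta + U theta * t) * U theta) + s\<^sup>2 * (U theta)\<^sup>2"
      using AE_sign
    proof eventually_elim
      case (elim theta)
      show ?case
        using dcone_upper[OF elim, of "G theta + U theta * t" "U theta * s"]
        unfolding H_def shift_eq by (simp add: power_mult_distrib mult_ac)
    qed
  qed (use integrable_H integrable_rcone integrable_U[of 2] in auto)
  also have "\<dots> = \<phi> t + 2 * s * B t + s\<^sup>2"
    using integrable_H[of t] integrable_rcone(1)[of t] integrable_U[of 2] by (simp add: \<phi>_def B_def EU2)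
  finally show ?thesis .
qed

lemma \<phi>_lower: "\<phi> t + 2 * s * B t \<le> \<phi> (t + s)"
proof -
  have "(\<integral>theta. H t theta + 2 * s * (rcone (E theta) (G theta + U theta * t) * U theta) \<partial>tau) \<le> \<phi> (t + s)"
    unfolding \<phi>_def
  proof (rule integral_mono_AE)
    show "AE theta in tau. H t theta + 2 * s * (rcone (E theta) (G theta + U theta * t) * U theta) \<le> H (t + s) theta"
      using AE_sign
    proof eventually_elim
      case (elim theta)
      show ?case
        using dcone_lower[OF elim, of "G theta + U theta * t" "U theta * s"]
        unfolding H_def shift_eq by (simp add: mult_ac)
    qed
  qed (use integrable_H integrable_rcone in auto)
  then show ?thesis
    using integrable_H[of t] integrable_rcone(1)[of t] by (simp add: \<phi>_def B_def)
qed

lemma continuous_\<phi>: "continuous_on UNIV \<phi>"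
proof -
  have "isCont \<phi> t" for t
  proof -
    have "((%s. \<phi> (t + s)) \<longlongrightarrow> \<phi> t) (at 0)"
    proof (rule tendsto_sandwich)
      show "((%s. \<phi> t + 2 * s * B t) \<longlongrightarrow> \<phi> t) (at 0)"
        by (auto intro!: tendsto_eq_intros)
      show "((%s. \<phi> t + 2 * s * B t + s\<^sup>2) \<longlongrightarrow> \<phi> t) (at 0)"
        by (auto intro!: tendsto_eq_intros)
    qed (use \<phi>_upper \<phi>_lower in auto)
    then show ?thesis by (simp add: isCont_iff)
  qed
  then show ?thesis by (simp add: continuous_on_eq_continuous_at)
qed

lemma dcone_square_le: "e \<in> {-1, 0, 1} ==> (dcone e y)\<^sup>2 \<le> 2 * (dcone e (x + y))\<^sup>2 + 2 * x\<^sup>2"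
proof -
  assume e: "e \<in> {-1, 0, 1::real}"
  have "dcone e y \<le> dcone e (x + y) + \<bar>x\<bar>"
    using e by (cases rule: sign_cases) (auto simp: dcone_def)
  then have "(dcone e y)\<^sup>2 \<le> (dcone e (x + y) + \<bar>x\<bar>)\<^sup>2" by (intro power_mono) auto
  also have "\<dots> \<le> 2 * (dcone e (x + y))\<^sup>2 + 2 * x\<^sup>2"
    using sum_squares_bound[of "dcone e (x + y)" "\<bar>x\<bar>"] by (simp add: power2_sum)
  finally show ?thesis .
qed

text \<open>Along the ray of sign \<open>\<sigma>\<close> the part in \<open>U\<close> grows
  quadratically, with the mean of \<open>K\<close> as its rate. This mean is positive by
  non-triviality. Adding \<open>G\<close> to the argument costs the constant 1, the second moment of
  \<open>G\<close>.\<close>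

lemma \<phi>_coercive_aux:
  assumes \<sigma>: "\<sigma> = 1 \<or> \<sigma> = -1"
  shows "\<exists>c>0. \<forall>t>0. c * t\<^sup>2 - 1 \<le> \<phi> (\<sigma> * t)"
proof -
  define K where "K theta = (dcone (E theta) (\<sigma> * U theta))\<^sup>2" for theta
  have mK [measurable]: "K \<in> borel_measurable tau" unfolding K_def[abs_def] by measurable
  have K0: "0 \<le> K theta" for theta by (simp add: K_def)
  have iK: "integrable tau K"
  proof (rule Bochner_Integration.integrable_bound[OF integrable_U[of 2] mK])
    show "AE theta in tau. norm (K theta) \<le> norm ((U theta)\<^sup>2)"
      using AE_sign
    proof eventually_elim
      case (elim theta)
      have "K theta \<le> \<bar>\<sigma> * U theta\<bar>\<^sup>2" unfolding K_def using abs_dcone_le[OF elim] by (intro power_mono) auto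
      also have "\<dots> = (U theta)\<^sup>2" using \<sigma> by auto
      finally show ?case using K0 by simp
    qed
  qed
  have "(\<integral>theta. K theta \<partial>tau) ~= 0"
  proof
    assume "(\<integral>theta. K theta \<partial>tau) = 0"
    then have "AE theta in tau. K theta = 0"
      using integral_nonneg_eq_0_iff_AE[OF iK] K0 by auto
    then have "AE theta in tau. dcone (snd (fst theta)) (\<sigma> * fst (fst theta)) = 0" by (simp add: K_def)
    moreover have "{z \<in> space kappa. dcone (snd z) (\<sigma> * fst z) = 0} \<in> sets kappa" by measurable
    ultimately have "AE z in distr tau kappa fst. dcone (snd z) (\<sigma> * fst z) = 0"
      by (subst AE_distr_iff[OF fst_measurable_tau]) auto
    then have "AE z in kappa. dcone (snd z) (\<sigma> * fst z) = 0" unfolding distr_fst .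
    then show False using \<sigma> nontrivial_pos nontrivial_neg by auto
  qed
  then have pos: "(\<integral>theta. K theta \<partial>tau) > 0"
    using Bochner_Integration.integral_nonneg[of tau K] K0 by (simp add: less_le)
  have "(\<integral>theta. K theta \<partial>tau) / 2 * t\<^sup>2 - 1 \<le> \<phi> (\<sigma> * t)" if t: "t > 0" for t
  proof -
    have "(\<integral>theta. t\<^sup>2 * K theta \<partial>tau) \<le> (\<integral>theta. 2 * H (\<sigma> * t) theta + 2 * (G theta)\<^sup>2 \<partial>tau)"
    proof (rule integral_mono_AE)
      show "AE theta in tau. t\<^sup>2 * K theta \<le> 2 * H (\<sigma> * t) theta + 2 * (G theta)\<^sup>2"
        using AE_sign
      proof eventually_elim
        case (elim theta)
        have "t\<^sup>2 * K theta = (dcone (E theta) (U theta * (\<sigma> * t)))\<^sup>2"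
          using dcone_scale[OF t, of "E theta" "\<sigma> * U theta"] by (simp add: K_def power_mult_distrib[symmetric] mult_ac)
        then show ?case using dcone_square_le[OF elim, of "U theta * (\<sigma> * t)" "G theta"] by (simp add: H_def)
      qed
    qed (use iK integrable_H integrable_G[of 2] in auto)
    also have "(\<integral>theta. t\<^sup>2 * K theta \<partial>tau) = t\<^sup>2 * (\<integral>theta. K theta \<partial>tau)" by simp
    also have "(\<integral>theta. 2 * H (\<sigma> * t) theta + 2 * (G theta)\<^sup>2 \<partial>tau) = 2 * \<phi> (\<sigma> * t) + 2"
      using integrable_H[of "\<sigma> * t"] integrable_G[of 2] by (simp add: \<phi>_def EG2)
    finally show ?thesis by (simp add: field_simps)
  qed
  then show ?thesis using pos by (intro exI[of _ "(\<integral>theta. K theta \<partial>tau) / 2"]) auto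
qed

lemma ex_minimum: "\<exists>t0. \<forall>t. \<phi> t0 \<le> \<phi> t"
proof -
  obtain c where c: "c > 0" "\<And>t. t > 0 ==> c * t\<^sup>2 - 1 \<le> \<phi> (1 * t)" using \<phi>_coercive_aux[of 1] by auto
  obtain d where d: "d > 0" "\<And>t. t > 0 ==> d * t\<^sup>2 - 1 \<le> \<phi> (-1 * t)" using \<phi>_coercive_aux[of "-1"] by auto
  \<comment> \<open>Beyond \<open>R\<close> the quadratic bounds exceed \<open>\<phi> 0\<close>; the
    1 allows for replacing the square of \<open>t\<close> by \<open>\<bar>t\<bar>\<close>.\<close>
  define R where "R = max 1 ((\<phi> 0 + 1) / min c d)"
  have R1: "R \<ge> 1" by (simp add: R_def)
  have far: "\<phi> 0 \<le> \<phi> t" if "\<bar>t\<bar> \<ge> R" for t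
  proof -
    have "(\<phi> 0 + 1) / min c d \<le> \<bar>t\<bar>" using that by (simp add: R_def)
    then have "\<phi> 0 + 1 \<le> \<bar>t\<bar> * min c d" using c(1) d(1) by (simp add: pos_divide_le_eq)
    also have "\<dots> \<le> (\<bar>t\<bar> * \<bar>t\<bar>) * min c d"
    proof -
      have "\<bar>t\<bar> * 1 \<le> \<bar>t\<bar> * \<bar>t\<bar>" using that R1 by (intro mult_left_mono) auto
      then show ?thesis using c(1) d(1) by (intro mult_right_mono) auto
    qed
    also have "\<dots> = min c d * t\<^sup>2" by (simp add: power2_eq_square)
    finally have m: "\<phi> 0 + 1 \<le> min c d * t\<^sup>2" .
    show ?thesis
    proof (cases "t > 0")
      case True
      have "min c d * t\<^sup>2 \<le> c * t\<^sup>2" by (intro mult_right_mono) auto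
      then show ?thesis using c(2)[OF True] m by simp
    next
      case False
      then have "- t > 0" using that R1 by auto
      have "min c d * t\<^sup>2 \<le> d * t\<^sup>2" by (intro mult_right_mono) auto
      then show ?thesis using d(2)[OF \<open>- t > 0\<close>] m by simp
    qed
  qed
  have "{-R..R} ~= {}" using R1 by simp
  have "\<exists>t0\<in>{-R..R}. \<forall>t\<in>{-R..R}. \<phi> t0 \<le> \<phi> t"
    by (rule continuous_attains_inf[OF compact_Icc \<open>{-R..R} ~= {}\<close> continuous_on_subset[OF continuous_\<phi> subset_UNIV]])
  then obtain t0 where t0: "\<And>t. t \<in> {-R..R} ==> \<phi> t0 \<le> \<phi> t" by blast
  have "\<phi> t0 \<le> \<phi> t" for t
  proof (cases "\<bar>t\<bar> \<ge> R")
    case True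
    then show ?thesis using far[OF True] t0[of 0] R1 by simp
  next
    case False
    then have "t \<in> {-R..R}" by (auto simp: abs_le_iff not_le)
    then show ?thesis by (rule t0)
  qed
  then show ?thesis by blast
qed

definition t0 :: real where "t0 = (SOME t0. \<forall>t. \<phi> t0 \<le> \<phi> t)"

lemma t0: "\<phi> t0 \<le> \<phi> t"
  using someI_ex[OF ex_minimum] by (simp add: t0_def)

lemma INF_\<phi>: "(INF t. \<phi> t) = \<phi> t0"
  using t0 by (intro cInf_eq_minimum) auto

text \<open>A step of \<open>- B t0\<close> would lower \<open>\<phi>\<close> by at least the square
  of \<open>B t0\<close>.\<close>

lemma stationary: "B t0 = 0"
proof (rule ccontr)
  assume B: "B t0 ~= 0"
  have "\<phi> t0 \<le> \<phi> (t0 + - B t0)" by (rule t0)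
  also have "\<dots> \<le> \<phi> t0 + 2 * (- B t0) * B t0 + (- B t0)\<^sup>2" by (rule \<phi>_upper)
  finally have "(B t0)\<^sup>2 \<le> 0" by (simp add: power2_eq_square)
  then show False using B by simp
qed

definition active :: "(real \<times> real) \<times> real => bool" where
  "active theta \<longleftrightarrow> E theta = 0 \<or> 0 < E theta * (G theta + U theta * t0)"

lemma active_sets: "{theta. active theta} \<in> sets tau"
proof -
  have "{theta \<in> space tau. active theta} \<in> sets tau" unfolding active_def by measurable
  then show ?thesis by simp
qed

text \<open>For fixed \<open>U\<close> and sign, the Gaussian \<open>G\<close> charges the region at
  positive distance from the ray. Positivity allows the threshold to be written as
  \<open>1 / \<phi> t0\<close>.\<close>

lemma \<phi>_pos: "\<phi> t0 > 0"
proof -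
  have "\<phi> t0 ~= 0"
  proof
    assume "\<phi> t0 = 0"
    have nn: "AE theta in tau. 0 \<le> H t0 theta" by (simp add: H_def)
    have "AE theta in tau. H t0 theta = 0"
      using \<open>\<phi> t0 = 0\<close> integral_nonneg_eq_0_iff_AE[OF integrable_H nn] unfolding \<phi>_def by blast
    then have "AE theta in tau. dcone (E theta) (G theta + U theta * t0) = 0" by (simp add: H_def)
    from P.AE_pair[OF this[unfolded tau_def]]
    have "AE z in kappa. AE x in gauss. dcone (snd z) (x + fst z * t0) = 0" by simp
    with sign have "AE z in kappa. False"
      by eventually_elim (use std_normal_ray_pos in blast)
    then show False by simp
  qed
  moreover have "\<phi> t0 \<ge> 0" by (simp add: \<phi>_def H_def)
  ultimately show ?thesis by simp
qed

text \<open>Stationarity removes the term in \<open>U\<close>, and Gaussian integration by parts in \<open>G\<close> does the rest.\<close>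

lemma prob_active: "measure tau {theta. active theta} = \<phi> t0"
proof -
  have "\<phi> t0 = (\<integral>theta. rcone (E theta) (G theta + U theta * t0) * G theta + t0 * (rcone (E theta) (G theta + U theta * t0) * U theta) \<partial>tau)"
    unfolding \<phi>_def
  proof (rule integral_cong_AE)
    show "AE theta in tau. H t0 theta = rcone (E theta) (G theta + U theta * t0) * G theta + t0 * (rcone (E theta) (G theta + U theta * t0) * U theta)"
      using AE_sign
    proof eventually_elim
      case (elim theta)
      show ?case unfolding H_def dcone_power2[OF elim] by (simp add: algebra_simps)
    qed
  qed measurable
  also have "\<dots> = (\<integral>theta. rcone (E theta) (G theta + U theta * t0) * G theta \<partial>tau) + t0 * B t0"
    using integrable_rcone[of t0] by (simp add: B_def)
  also have "\<dots> = (\<integral>theta. rcone (E theta) (G theta + U theta * t0) * G theta \<partial>tau)" by (simp add: stationary)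
  also have "\<dots> = (\<integral>z. \<integral>x. rcone (snd z) (x + fst z * t0) * x \<partial>gauss \<partial>kappa)"
    using P.integral_fst'[OF integrable_rcone(2)[of t0, unfolded tau_def]] by (simp add: tau_def)
  also have "\<dots> = (\<integral>z. \<integral>x. indicator {theta. active theta} (z, x) \<partial>gauss \<partial>kappa)"
  proof (rule integral_cong_AE)
    show "AE z in kappa. (\<integral>x. rcone (snd z) (x + fst z * t0) * x \<partial>gauss) =
       (\<integral>x. indicator {theta. active theta} (z, x) \<partial>gauss)"
      using sign
    proof eventually_elim
      case (elim z)
      have "(\<integral>x. indicator {theta. active theta} (z, x) \<partial>gauss) =
        (\<integral>x. indicator {x. snd z = 0 \<or> 0 < snd z * (x + fst z * t0)} x \<partial>gauss)"
        by (intro Bochner_Integration.integral_cong) (auto simp: active_def split: split_indicator)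
      also have "\<dots> = measure gauss {x. snd z = 0 \<or> 0 < snd z * (x + fst z * t0)}"
        unfolding Bochner_Integration.integral_indicator by simp
      finally show ?case unfolding stein_rcone[OF elim, of "fst z * t0"] by (rule sym)
    qed
    have "(%theta. rcone (E theta) (G theta + U theta * t0) * G theta) \<in> borel_measurable (kappa \<Otimes>\<^sub>M gauss)"
      unfolding tau_def[symmetric] by measurable
    from N.borel_measurable_lebesgue_integral[of "%z x. rcone (snd z) (x + fst z * t0) * x"] this
    show "(%z. \<integral>x. rcone (snd z) (x + fst z * t0) * x \<partial>gauss) \<in> borel_measurable kappa"
      by (simp add: split_def)
    have "(%theta. indicator {theta. active theta} theta :: real) \<in> borel_measurable (kappa \<Otimes>\<^sub>M gauss)"
      unfolding tau_def[symmetric] using active_sets by simp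
    from N.borel_measurable_lebesgue_integral[of "%z x. indicator {theta. active theta} (z, x)"] this
    show "(%z. \<integral>x. (indicator {theta. active theta} (z, x) :: real) \<partial>gauss) \<in> borel_measurable kappa"
      by (simp add: split_def)
  qed
  also have "\<dots> = (\<integral>theta. indicator {theta. active theta} theta \<partial>tau)"
    unfolding tau_def
  proof (rule P.integral_fst')
    show "integrable (kappa \<Otimes>\<^sub>M gauss) (%theta. indicator {theta. active theta} theta :: real)"
      unfolding tau_def[symmetric] using active_sets by (intro T.integrable_const_bound[of _ 1]) auto
  qed
  finally show ?thesis using active_sets by simp
qed

text \<open>Equality in the tangent bound at \<open>t0\<close> would make almost no observation
  active, whereas the probability of being active is \<open>\<phi> t0\<close>, which is
  positive.\<close>

lemma \<phi>_unique:
  assumes s: "s ~= 0" shows "\<phi> t0 < \<phi> (t0 + s)"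
proof (rule ccontr)
  assume n: "\<not> ?thesis"
  define D where "D theta = H (t0 + s) theta - (H t0 theta + 2 * s * (rcone (E theta) (G theta + U theta * t0) * U theta))" for theta
  have iD: "integrable tau D"
    unfolding D_def[abs_def] using integrable_H integrable_rcone(1)[of t0] by simp
  have D0: "AE theta in tau. 0 \<le> D theta"
    using AE_sign
  proof eventually_elim
    case (elim theta)
    show ?case
      using dcone_lower[OF elim, of "G theta + U theta * t0" "U theta * s"]
      unfolding D_def H_def shift_eq by (simp add: mult_ac)
  qed
  have "(\<integral>theta. D theta \<partial>tau) = \<phi> (t0 + s) - \<phi> t0"
    using integrable_H integrable_rcone(1)[of t0] stationary by (simp add: D_def \<phi>_def B_def)
  then have "(\<integral>theta. D theta \<partial>tau) = 0" using n integral_nonneg_AE[OF D0] by simp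
  then have "AE theta in tau. D theta = 0"
    using integral_nonneg_eq_0_iff_AE[OF iD D0] by simp
  with AE_sign AE_U have "AE theta in tau. \<not> active theta"
  proof eventually_elim
    case (elim theta)
    show ?case
    proof
      assume "active theta"
      then have "(dcone (E theta) (G theta + U theta * t0))\<^sup>2 + 2 * rcone (E theta) (G theta + U theta * t0) * (U theta * s)
          < (dcone (E theta) (G theta + U theta * t0 + U theta * s))\<^sup>2"
        using elim s by (intro dcone_lower_strict) (auto simp: active_def)
      then have "0 < D theta" unfolding D_def H_def shift_eq by (simp add: mult_ac)
      then show False using elim by simp
    qed
  qed
  then have "measure tau {theta. active theta} = 0"
    using T.prob_eq_0[OF active_sets] by simp
  then show False using prob_active \<phi>_pos by simp
qed

end

section \<open>The size of the active set with one Gaussian column\<close>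

text \<open>The objective \<open>a\<close> is convex and larger at distance \<open>eta\<close> from
  \<open>t0\<close> on both sides, so a stationary parameter \<open>t\<close> lies in between. Row
  \<open>i\<close> then moves by less than \<open>eta * \<bar>u i\<bar>\<close>, which brackets the
  active set. Nonemptiness of \<open>L\<close> makes the residual nonzero.\<close>

lemma kkt_near:
  fixes X :: "'i \<times> nat => real" and t0 eta :: real
  assumes A: "finite A" and e: "\<And>i. i \<in> A ==> e i \<in> {-1, 0, 1}" and u: "\<And>i. i \<in> A ==> u i ~= 0" and eta: "eta > 0"
  defines "s \<equiv> %t i. X (i, 0) + u i * t"
  defines "a \<equiv> %t. \<Sum>i\<in>A. (dcone (e i) (s t i))\<^sup>2"
  assumes right: "a t0 < a (t0 + eta)" and left: "a t0 < a (t0 - eta)"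
  defines "L \<equiv> {i\<in>A. (e i = 0 \<or> eta * \<bar>u i\<bar> < e i * s t0 i) \<and> eta * \<bar>u i\<bar> < \<bar>s t0 i\<bar>}"
  assumes L: "L ~= {}"
  shows "\<exists>S\<subseteq>A. kkt A e u 0 S X \<and> L \<subseteq> S \<and> S \<subseteq> {i\<in>A. e i = 0 \<or> 0 < e i * s t0 i + eta * \<bar>u i\<bar>}"
proof -
  obtain mu where mu: "\<forall>k<1::nat. (\<Sum>i\<in>A. rcone (e i) (shifted (%i. X (i, 0)) (%_. u) 1 mu i) * u i) = 0"
    using ex_stationary[OF A, of e 1 "%i. X (i, 0)" "%_. u"] e by blast
  define t where "t = mu 0"
  define b where "b r = (\<Sum>i\<in>A. rcone (e i) (s r i) * u i)" for r
  have b0: "b t = 0" using mu by (simp add: b_def s_def t_def shifted_def mult.commute)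
  have tangent: "a r + 2 * h * b r \<le> a (r + h)" for r h
  proof -
    have "a r + 2 * h * b r = (\<Sum>i\<in>A. (dcone (e i) (s r i))\<^sup>2 + 2 * rcone (e i) (s r i) * (u i * h))"
      by (simp add: a_def b_def sum.distrib sum_distrib_left mult_ac)
    also have "\<dots> \<le> (\<Sum>i\<in>A. (dcone (e i) (s r i + u i * h))\<^sup>2)"
      using e by (intro sum_mono dcone_lower)
    also have "\<dots> = a (r + h)" by (simp add: a_def s_def algebra_simps)
    finally show ?thesis .
  qed
  have min: "a t \<le> a r" for r using tangent[of t "r - t"] b0 by simp
  have near: "\<bar>t - t0\<bar> < eta"
  proof (rule ccontr)
    assume "\<not> ?thesis"
    then consider "t \<ge> t0 + eta" | "t \<le> t0 - eta" by linarith
    then show False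
    proof cases
      case 1
      \<comment> \<open>The tangent at \<open>t0 + eta\<close> passes below the value at
        \<open>t0\<close>, so its slope is positive and \<open>a\<close> cannot come down again
        further to the right.\<close>
      have "2 * eta * b (t0 + eta) > 0" using tangent[of "t0 + eta" "- eta"] right by simp
      then have "b (t0 + eta) > 0" using eta by (simp add: zero_less_mult_iff)
      then have "0 \<le> 2 * (t - (t0 + eta)) * b (t0 + eta)" using 1 by (intro mult_nonneg_nonneg) auto
      then have "a (t0 + eta) \<le> a t" using tangent[of "t0 + eta" "t - (t0 + eta)"] by simp
      then show False using right min[of t0] by linarith
    next
      case 2
      have "2 * eta * b (t0 - eta) < 0" using tangent[of "t0 - eta" "eta"] left by simp
      then have "b (t0 - eta) < 0" using eta by (simp add: mult_less_0_iff)
      then have "0 \<le> 2 * (t - (t0 - eta)) * b (t0 - eta)" using 2 by (intro mult_nonpos_nonpos) auto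
      then have "a (t0 - eta) \<le> a t" using tangent[of "t0 - eta" "t - (t0 - eta)"] by simp
      then show False using left min[of t0] by linarith
    qed
  qed
  have close: "\<bar>s t i - s t0 i\<bar> < eta * \<bar>u i\<bar>" if "i \<in> A" for i
  proof -
    have "s t i - s t0 i = u i * (t - t0)" by (simp add: s_def algebra_simps)
    then show ?thesis using near u[OF that] by (simp add: abs_mult mult.commute)
  qed
  have close': "\<bar>e i * s t i - e i * s t0 i\<bar> < eta * \<bar>u i\<bar>" if "i \<in> A" "e i ~= 0" for i
  proof -
    have "\<bar>e i\<bar> = 1" using e[OF that(1)] that(2) by auto
    moreover have "e i * s t i - e i * s t0 i = e i * (s t i - s t0 i)" by (simp add: algebra_simps)
    ultimately show ?thesis using close[OF that(1)] by (simp add: abs_mult)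
  qed
  define S where "S = {i\<in>A. e i = 0 \<or> 0 < e i * s t i}"
  have SA: "S \<subseteq> A" and S: "finite S" using A by (auto simp: S_def)
  have LS: "L \<subseteq> S"
  proof
    fix i assume i: "i \<in> L"
    then have iA: "i \<in> A" by (simp add: L_def)
    show "i \<in> S"
    proof (cases "e i = 0")
      case False
      then show ?thesis using i close'[OF iA False] by (auto simp: L_def S_def)
    qed (simp add: S_def iA)
  qed
  have SU: "S \<subseteq> {i\<in>A. e i = 0 \<or> 0 < e i * s t0 i + eta * \<bar>u i\<bar>}"
  proof
    fix i assume i: "i \<in> S"
    then have iA: "i \<in> A" by (simp add: S_def)
    show "i \<in> {i\<in>A. e i = 0 \<or> 0 < e i * s t0 i + eta * \<bar>u i\<bar>}"
    proof (cases "e i = 0")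
      case False
      then show ?thesis using i close'[OF iA False] by (auto simp: S_def)
    qed (simp add: iA)
  qed
  obtain i0 where i0: "i0 \<in> L" using L by blast
  have gs: "s t = gs S (cols u X) (Suc 0)"
  proof (rule gs_unique[OF S, of _ _ _ "%_. t"])
    show "s t i = cols u X (Suc 0) i + (\<Sum>l<Suc 0. t * cols u X l i)" for i by (simp add: s_def mult.commute)
    show "\<exists>i\<in>S. gs S (cols u X) l i ~= 0" if "l < Suc 0" for l
      using that i0 LS SA u by auto
    show "ip S (s t) (cols u X l) = 0" if "l < Suc 0" for l
    proof -
      have "ip S (s t) u = b t"
        unfolding ip_def b_def
        by (rule sum.mono_neutral_cong_left) (use A in \<open>auto simp: S_def rcone_def\<close>)
      then show ?thesis using that b0 by simp
    qed
  qed
  have "kkt A e u 0 S X"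
    unfolding kkt_def gs[symmetric]
  proof (intro conjI ballI impI)
    have "i0 \<in> A" "eta * \<bar>u i0\<bar> < \<bar>s t0 i0\<bar>" using i0 by (auto simp: L_def)
    then have "s t i0 ~= 0" using close[of i0] by auto
    then show "\<exists>i\<in>S. s t i ~= 0" using i0 LS by blast
  qed (auto simp: S_def)
  then show ?thesis using SA LS SU by blast
qed

lemma Ex_kkt_sets:
  assumes A: "finite A" and e: "\<And>i. i \<in> A ==> (%omega. e omega i) \<in> borel_measurable M"
    and u: "\<And>i. i \<in> A ==> (%omega. u omega i) \<in> borel_measurable M"
    and X: "\<And>i j. i \<in> A ==> j \<le> q ==> (%omega. X omega (i, j)) \<in> borel_measurable M"
  shows "{omega \<in> space M. \<exists>S\<subseteq>A. Q S \<and> kkt A (e omega) (u omega) q S (X omega)} \<in> sets M"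
proof -
  have "{omega \<in> space M. \<exists>S\<in>{S. S \<subseteq> A \<and> Q S}. kkt A (e omega) (u omega) q S (X omega)} \<in> sets M"
    using A by (intro sets.sets_Collect_finite_Ex kkt_sets_joint e u X) auto
  also have "{omega \<in> space M. \<exists>S\<in>{S. S \<subseteq> A \<and> Q S}. kkt A (e omega) (u omega) q S (X omega)} =
    {omega \<in> space M. \<exists>S\<subseteq>A. Q S \<and> kkt A (e omega) (u omega) q S (X omega)}" by auto
  finally show ?thesis .
qed

context limit_law begin

text \<open>Contains every observation that can become active for some parameter within distance
  \<open>eta\<close> of \<open>t0\<close>.\<close>

definition outer :: "real => ((real \<times> real) \<times> real) set" where
  "outer eta = {theta. E theta = 0 \<or> 0 < E theta * (G theta + U theta * t0) + eta * \<bar>U theta\<bar>}"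

text \<open>Observations that stay active for all parameters within distance \<open>eta\<close>. The
  second condition keeps the residual away from zero, in coercive rows as well.\<close>

definition inner :: "real => ((real \<times> real) \<times> real) set" where
  "inner eta = {theta. (E theta = 0 \<or> eta * \<bar>U theta\<bar> < E theta * (G theta + U theta * t0)) \<and> eta * \<bar>U theta\<bar> < \<bar>G theta + U theta * t0\<bar>}"

lemma outer_sets: "outer eta \<in> sets tau"
proof -
  have "{theta \<in> space tau. E theta = 0 \<or> 0 < E theta * (G theta + U theta * t0) + eta * \<bar>U theta\<bar>} \<in> sets tau" by measurable
  then show ?thesis by (simp add: outer_def)
qed

lemma inner_sets: "inner eta \<in> sets tau"
proof -
  have "{theta \<in> space tau. (E theta = 0 \<or> eta * \<bar>U theta\<bar> < E theta * (G theta + U theta * t0)) \<and> eta * \<bar>U theta\<bar> < \<bar>G theta + U theta * t0\<bar>} \<in> sets tau"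
    by measurable
  then show ?thesis by (simp add: inner_def)
qed

lemma archimedean_quotient:
  fixes x y :: real
  assumes "y > 0" shows "\<exists>m. inverse (real (Suc m)) * x < y"
proof -
  have "(%m. inverse (real (Suc m)) * x) \<longlonglongrightarrow> 0 * x"
    by (intro tendsto_mult LIMSEQ_inverse_real_of_nat tendsto_const)
  then have "\<forall>\<^sub>F m in sequentially. inverse (real (Suc m)) * x < y"
    by (rule order_tendstoD) (use assms in simp)
  from eventually_happens'[OF sequentially_bot this] show ?thesis .
qed

text \<open>As \<open>eta\<close> decreases to 0, only the boundary \<open>G + U * t0 = 0\<close>
  separates the limit from the active observations, and it is null because \<open>G\<close> has a
  density.\<close>

lemma tendsto_outer: "(%m. measure tau (outer (inverse (real (Suc m))))) \<longlonglongrightarrow> \<phi> t0"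
proof -
  let ?O = "%m. outer (inverse (real (Suc m)))"
  have dec: "decseq ?O"
  proof (rule decseq_SucI)
    fix m
    have "inverse (real (Suc (Suc m))) \<le> inverse (real (Suc m))" by simp
    then have "inverse (real (Suc (Suc m))) * \<bar>U theta\<bar> \<le> inverse (real (Suc m)) * \<bar>U theta\<bar>" for theta
      by (rule mult_right_mono) simp
    then show "?O (Suc m) \<subseteq> ?O m" unfolding outer_def by (auto intro: less_le_trans add_left_mono)
  qed
  have "(%m. measure tau (?O m)) \<longlonglongrightarrow> measure tau (\<Inter>m. ?O m)"
    using outer_sets dec by (intro T.finite_Lim_measure_decseq) auto
  also have "measure tau (\<Inter>m. ?O m) = measure tau {theta. active theta}"
  proof (rule measure_eq_AE)
    show "(\<Inter>m. ?O m) \<in> sets tau" using outer_sets by (intro sets.countable_INT) auto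
    show "AE theta in tau. theta \<in> (\<Inter>m. ?O m) \<longleftrightarrow> theta \<in> {theta. active theta}"
      using AE_shift_nonzero[of t0]
    proof eventually_elim
      case (elim theta)
      show ?case
      proof
        assume o: "theta \<in> (\<Inter>m. ?O m)"
        show "theta \<in> {theta. active theta}"
        proof (rule ccontr)
          assume n: "theta \<notin> {theta. active theta}"
          then have "E theta ~= 0" "E theta * (G theta + U theta * t0) \<le> 0" by (auto simp: active_def)
          then have "- (E theta * (G theta + U theta * t0)) > 0" using elim by (simp add: less_le)
          from archimedean_quotient[OF this, of "\<bar>U theta\<bar>"] obtain m
            where "inverse (real (Suc m)) * \<bar>U theta\<bar> < - (E theta * (G theta + U theta * t0))" ..
          then have "theta \<notin> ?O m" using \<open>E theta ~= 0\<close> by (simp add: outer_def)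
          then show False using o by blast
        qed
      next
        assume a: "theta \<in> {theta. active theta}"
        have "0 \<le> inverse (real (Suc m)) * \<bar>U theta\<bar>" for m by simp
        then show "theta \<in> (\<Inter>m. ?O m)"
          using a by (auto simp: active_def outer_def intro: add_pos_nonneg)
      qed
    qed
  qed (rule active_sets)
  finally show ?thesis by (simp only: prob_active)
qed

lemma tendsto_inner: "(%m. measure tau (inner (inverse (real (Suc m))))) \<longlonglongrightarrow> \<phi> t0"
proof -
  let ?I = "%m. inner (inverse (real (Suc m)))"
  have inc: "incseq ?I"
  proof (rule incseq_SucI)
    fix m
    have "inverse (real (Suc (Suc m))) \<le> inverse (real (Suc m))" by simp
    then have "inverse (real (Suc (Suc m))) * \<bar>U theta\<bar> \<le> inverse (real (Suc m)) * \<bar>U theta\<bar>" for theta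
      by (rule mult_right_mono) simp
    then show "?I m \<subseteq> ?I (Suc m)" unfolding inner_def by (auto intro: le_less_trans)
  qed
  have "(%m. measure tau (?I m)) \<longlonglongrightarrow> measure tau (\<Union>m. ?I m)"
    using inner_sets inc by (intro T.finite_Lim_measure_incseq) auto
  also have "measure tau (\<Union>m. ?I m) = measure tau {theta. active theta}"
  proof (rule measure_eq_AE)
    show "(\<Union>m. ?I m) \<in> sets tau" using inner_sets by (intro sets.countable_UN) auto
    show "AE theta in tau. theta \<in> (\<Union>m. ?I m) \<longleftrightarrow> theta \<in> {theta. active theta}"
      using AE_shift_nonzero[of t0]
    proof eventually_elim
      case (elim theta)
      show ?case
      proof
        assume "theta \<in> (\<Union>m. ?I m)"
        then obtain m where m: "theta \<in> ?I m" by blast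
        have "0 \<le> inverse (real (Suc m)) * \<bar>U theta\<bar>" by simp
        from le_less_trans[OF this] m show "theta \<in> {theta. active theta}" by (auto simp: active_def inner_def)
      next
        assume a: "theta \<in> {theta. active theta}"
        define y where "y = (if E theta = 0 then \<bar>G theta + U theta * t0\<bar> else min (E theta * (G theta + U theta * t0)) \<bar>G theta + U theta * t0\<bar>)"
        have "y > 0" using a elim by (auto simp: y_def active_def)
        from archimedean_quotient[OF this, of "\<bar>U theta\<bar>"] obtain m
          where "inverse (real (Suc m)) * \<bar>U theta\<bar> < y" ..
        then have "theta \<in> ?I m" by (auto simp: inner_def y_def split: if_splits)
        then show "theta \<in> (\<Union>m. ?I m)" by blast
      qed
    qed
  qed (rule active_sets)
  finally show ?thesis by (simp only: prob_active)
qed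

lemma ex_shell:
  assumes "nu > 0"
  shows "\<exists>eta>0. measure tau (outer eta) < \<phi> t0 + nu \<and> \<phi> t0 - nu < measure tau (inner eta)"
proof -
  have "\<forall>\<^sub>F m in sequentially. measure tau (outer (inverse (real (Suc m)))) < \<phi> t0 + nu"
    by (rule order_tendstoD(2)[OF tendsto_outer]) (use assms in simp)
  moreover have "\<forall>\<^sub>F m in sequentially. \<phi> t0 - nu < measure tau (inner (inverse (real (Suc m))))"
    by (rule order_tendstoD(1)[OF tendsto_inner]) (use assms in simp)
  ultimately have "\<forall>\<^sub>F m in sequentially. measure tau (outer (inverse (real (Suc m)))) < \<phi> t0 + nu \<and>
      \<phi> t0 - nu < measure tau (inner (inverse (real (Suc m))))" by (rule eventually_conj)
  from eventually_happens'[OF sequentially_bot this] obtain m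
    where "measure tau (outer (inverse (real (Suc m)))) < \<phi> t0 + nu \<and>
      \<phi> t0 - nu < measure tau (inner (inverse (real (Suc m))))" ..
  moreover have "inverse (real (Suc m)) > 0" by simp
  ultimately show ?thesis by blast
qed

text \<open>The map \<open>r\<close> extracts the triple from an observation of another type, so
  that the sample may store its Gaussian part as a vector.\<close>

lemma weak_law:
  fixes r :: "'t => (real \<times> real) \<times> real"
  assumes T: "prob_space T" and r: "r \<in> T \<rightarrow>\<^sub>M tau" and law: "distr T tau r = tau"
    and f: "f \<in> borel_measurable tau" "integrable tau (%theta. (f theta)\<^sup>2)" and zeta: "zeta > 0" and n: "filterlim n at_top sequentially"
  shows "(%k. measure (PiM {..<n k} (%_. T)) {theta \<in> space (PiM {..<n k} (%_. T)).
     zeta * real (n k) \<le> \<bar>(\<Sum>i<n k. f (r (theta i))) - real (n k) * (\<integral>theta. f theta \<partial>tau)\<bar>}) \<longlonglongrightarrow> 0"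
proof -
  have m: "(%x. f (r x)) \<in> borel_measurable T" by (rule measurable_compose[OF r f(1)])
  have i: "integrable T (%x. (f (r x))\<^sup>2)"
    using integrable_distr[OF r, of "%theta. (f theta)\<^sup>2"] f(2) unfolding law by simp
  have "(\<integral>x. f (r x) \<partial>T) = (\<integral>theta. f theta \<partial>tau)"
    using integral_distr[OF r f(1)] unfolding law by simp
  with weak_law_of_large_numbers[OF T m i zeta n] show ?thesis by simp
qed

definition typical :: "real => nat => (nat => (real \<times> real) \<times> real) => bool" where
  "typical nu n theta \<longleftrightarrow>
    (\<exists>S\<subseteq>{..<n}. \<bar>real (card S) - real n * \<phi> t0\<bar> \<le> real n * nu \<and>
       kkt {..<n} (%i. E (theta i)) (%i. U (theta i)) 0 S (%k. G (theta (fst k))))"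

text \<open>Five empirical means decide. The objective at \<open>t0\<close> and
  \<open>t0 \<plusminus> eta\<close> confines the minimiser, and the frequencies of
  \<open>outer eta\<close> and \<open>inner eta\<close> bracket the number of active rows.\<close>

lemma typical_if:
  assumes sg: "\<And>i. i < n ==> E (theta i) \<in> {-1, 0, 1}" and nz: "\<And>i. i < n ==> U (theta i) ~= 0"
    and n: "n > 0" and eta: "eta > 0"
    and gap: "2 * zeta \<le> \<phi> (t0 + eta) - \<phi> t0" "2 * zeta \<le> \<phi> (t0 - eta) - \<phi> t0"
    and outer: "measure tau (outer eta) + zeta \<le> \<phi> t0 + nu" and inner: "\<phi> t0 - nu \<le> measure tau (inner eta) - zeta"
    and nu: "nu < \<phi> t0"
    and H: "\<And>t. t \<in> {t0, t0 + eta, t0 - eta} ==> \<bar>(\<Sum>i<n. H t (theta i)) - real n * \<phi> t\<bar> < zeta * real n"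
    and I: "\<And>B. B \<in> {outer eta, inner eta} ==> \<bar>(\<Sum>i<n. indicator B (theta i)) - real n * measure tau B\<bar> < zeta * real n"
  shows "typical nu n theta"
proof -
  have a: "(\<Sum>i<n. H t0 (theta i)) < (\<Sum>i<n. H t (theta i))" if t: "t \<in> {t0 + eta, t0 - eta}" for t
  proof -
    have "real n * (2 * zeta) \<le> real n * (\<phi> t - \<phi> t0)" using gap t by (intro mult_left_mono) auto
    then have "real n * \<phi> t0 + 2 * (zeta * real n) \<le> real n * \<phi> t" by (simp add: algebra_simps)
    then show ?thesis using H[of t0] H[of t] t by (auto simp: abs_less_iff)
  qed
  define L where "L = {i \<in> {..<n}. (E (theta i) = 0 \<or> eta * \<bar>U (theta i)\<bar> < E (theta i) * (G (theta i) + U (theta i) * t0)) \<and>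
      eta * \<bar>U (theta i)\<bar> < \<bar>G (theta i) + U (theta i) * t0\<bar>}"
  define V where "V = {i \<in> {..<n}. E (theta i) = 0 \<or> 0 < E (theta i) * (G (theta i) + U (theta i) * t0) + eta * \<bar>U (theta i)\<bar>}"
  have cL: "real (card L) = (\<Sum>i<n. indicator (inner eta) (theta i))"
  proof -
    have "(\<Sum>i<n. indicator (inner eta) (theta i)) = (\<Sum>i<n. if i \<in> L then 1 else 0 :: real)"
      by (intro sum.cong) (auto simp: L_def inner_def split: split_indicator)
    also have "\<dots> = (\<Sum>i\<in>{..<n} \<inter> L. 1)" by (rule sum.inter_restrict[symmetric]) simp
    also have "{..<n} \<inter> L = L" by (auto simp: L_def)
    finally show ?thesis by simp
  qed
  have cV: "real (card V) = (\<Sum>i<n. indicator (outer eta) (theta i))"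
  proof -
    have "(\<Sum>i<n. indicator (outer eta) (theta i)) = (\<Sum>i<n. if i \<in> V then 1 else 0 :: real)"
      by (intro sum.cong) (auto simp: V_def outer_def split: split_indicator)
    also have "\<dots> = (\<Sum>i\<in>{..<n} \<inter> V. 1)" by (rule sum.inter_restrict[symmetric]) simp
    also have "{..<n} \<inter> V = V" by (auto simp: V_def)
    finally show ?thesis by simp
  qed
  have low: "real n * (\<phi> t0 - nu) \<le> real (card L)"
  proof -
    have "real n * (\<phi> t0 - nu) \<le> real n * (measure tau (inner eta) - zeta)" using inner by (intro mult_left_mono) auto
    then show ?thesis using I[of "inner eta"] unfolding cL by (auto simp: algebra_simps abs_less_iff)
  qed
  have up: "real (card V) \<le> real n * (\<phi> t0 + nu)"
  proof -
    have "real n * (measure tau (outer eta) + zeta) \<le> real n * (\<phi> t0 + nu)" using outer by (intro mult_left_mono) auto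
    then show ?thesis using I[of "outer eta"] unfolding cV by (auto simp: algebra_simps abs_less_iff)
  qed
  \<comment> \<open>This is where \<open>nu < \<phi> t0\<close> enters: the inner set has a positive
    frequency.\<close>
  have "real (card L) > 0" using low n nu by (intro less_le_trans[OF _ low]) simp
  then have L: "L ~= {}" by auto
  have "\<exists>S\<subseteq>{..<n}. kkt {..<n} (%i. E (theta i)) (%i. U (theta i)) 0 S (%k. G (theta (fst k))) \<and> L \<subseteq> S \<and> S \<subseteq> V"
    unfolding L_def V_def
    using kkt_near[of "{..<n}" "%i. E (theta i)" "%i. U (theta i)" eta "%k. G (theta (fst k))" t0] sg nz eta a[of "t0 + eta"] a[of "t0 - eta"] L
    unfolding H_def L_def by (simp only: fst_conv finite_lessThan lessThan_iff simp_thms insert_iff) 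
  then obtain S where S: "S \<subseteq> {..<n}" "kkt {..<n} (%i. E (theta i)) (%i. U (theta i)) 0 S (%k. G (theta (fst k)))" "L \<subseteq> S" "S \<subseteq> V"
    by blast
  have "card L \<le> card S" using S by (intro card_mono) (auto intro: finite_subset)
  moreover have "card S \<le> card V" using S by (intro card_mono) (auto simp: V_def)
  ultimately have c: "\<bar>real (card S) - real n * \<phi> t0\<bar> \<le> real n * nu"
    using low up by (auto simp: abs_le_iff algebra_simps)
  show ?thesis
    unfolding typical_def using S(1,2) c by auto
qed

lemma tendsto_typical:
  fixes r :: "'t => (real \<times> real) \<times> real"
  assumes T: "prob_space T" and r: "r \<in> T \<rightarrow>\<^sub>M tau" and law: "distr T tau r = tau"
    and nu: "nu > 0" and n: "filterlim n at_top sequentially"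
  shows "(%k. measure (PiM {..<n k} (%_. T)) {theta \<in> space (PiM {..<n k} (%_. T)). typical nu (n k) (%i. r (theta i))}) \<longlonglongrightarrow> 1"
proof -
  \<comment> \<open>The cap keeps the accuracy below \<open>\<phi> t0\<close>, as
    \<open>typical_if\<close> demands.\<close>
  define nu' where "nu' = min nu (\<phi> t0 / 2)"
  have nu': "nu' > 0" "nu' \<le> nu" "nu' < \<phi> t0" using nu \<phi>_pos by (auto simp: nu'_def)
  obtain eta where eta: "eta > 0" "measure tau (outer eta) < \<phi> t0 + nu'" "\<phi> t0 - nu' < measure tau (inner eta)"
    using ex_shell[OF nu'(1)] by blast
  \<comment> \<open>The smallest of the tolerances that \<open>typical_if\<close> leaves. The first
    two are positive since the minimiser of \<open>\<phi>\<close> is unique, the others by the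
    choice of \<open>eta\<close>.\<close>
  define zeta where "zeta = Min {(\<phi> (t0 + eta) - \<phi> t0) / 2, (\<phi> (t0 - eta) - \<phi> t0) / 2,
    \<phi> t0 + nu' - measure tau (outer eta), measure tau (inner eta) - (\<phi> t0 - nu')}"
  have zeta: "zeta > 0" using eta \<phi>_unique[of eta] \<phi>_unique[of "- eta"] by (simp add: zeta_def)
  have "zeta \<le> (\<phi> (t0 + eta) - \<phi> t0) / 2" "zeta \<le> (\<phi> (t0 - eta) - \<phi> t0) / 2"
    "zeta \<le> \<phi> t0 + nu' - measure tau (outer eta)" "zeta \<le> measure tau (inner eta) - (\<phi> t0 - nu')"
    unfolding zeta_def by (rule Min_le; simp)+
  then have zeta': "2 * zeta \<le> \<phi> (t0 + eta) - \<phi> t0" "2 * zeta \<le> \<phi> (t0 - eta) - \<phi> t0"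
    "measure tau (outer eta) + zeta \<le> \<phi> t0 + nu" "\<phi> t0 - nu \<le> measure tau (inner eta) - zeta"
    "measure tau (outer eta) + zeta \<le> \<phi> t0 + nu'" "\<phi> t0 - nu' \<le> measure tau (inner eta) - zeta"
    using nu' by auto
  let ?P = "%k. PiM {..<n k} (%_. T)"
  define bad where "bad f k = {theta \<in> space (?P k). zeta * real (n k) \<le>
    \<bar>(\<Sum>i<n k. f (r (theta i))) - real (n k) * (\<integral>theta. f theta \<partial>tau)\<bar>}" for f k
  define F where "F = H ` {t0, t0 + eta, t0 - eta} \<union> (%B. indicator B) ` {outer eta, inner eta}"
  have finF: "finite F" by (simp add: F_def)
  have fF: "f \<in> borel_measurable tau" "integrable tau (%theta. (f theta)\<^sup>2)" if "f \<in> F" for f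
  proof -
    show "f \<in> borel_measurable tau" using that outer_sets inner_sets by (auto simp: F_def)
    have "integrable tau (%theta. (indicator B theta :: real)\<^sup>2)" if "B \<in> sets tau" for B
      using that by (intro T.integrable_const_bound[of _ 1]) (auto split: split_indicator)
    then show "integrable tau (%theta. (f theta)\<^sup>2)"
      using that outer_sets inner_sets integrable_H2 by (auto simp: F_def)
  qed
  have prob: "prob_space (?P k)" for k by (rule prob_space_PiM[OF T])
  have comp: "(%theta. r (theta i)) \<in> ?P k \<rightarrow>\<^sub>M tau" if "i < n k" for i k
    using that by (intro measurable_compose[OF measurable_component_singleton[of i "{..<n k}" "%_. T"] r]) simp
  have badsets: "bad f k \<in> sets (?P k)" if f: "f \<in> F" for f k
  proof -
    have [measurable]: "(%theta. \<Sum>i<n k. f (r (theta i))) \<in> borel_measurable (?P k)"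
      by (intro borel_measurable_sum measurable_compose[OF comp fF(1)[OF f]]) simp
    show ?thesis unfolding bad_def by measurable
  qed
  have badlim: "(%k. \<Sum>f\<in>F. measure (?P k) (bad f k)) \<longlonglongrightarrow> (\<Sum>f\<in>F. 0)"
    unfolding bad_def by (intro tendsto_sum weak_law[OF T r law] fF zeta n)
  define W where "W k = {theta \<in> space (?P k). typical nu (n k) (%i. r (theta i))}" for k
  have Wsets: "W k \<in> sets (?P k)" for k
  proof -
    have [measurable]: "(%theta. E (r (theta i))) \<in> borel_measurable (?P k)" "(%theta. U (r (theta i))) \<in> borel_measurable (?P k)"
      "(%theta. G (r (theta i))) \<in> borel_measurable (?P k)" if "i < n k" for i
      using measurable_compose[OF comp[OF that] UEG_measurable(1)] measurable_compose[OF comp[OF that] UEG_measurable(2)]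
        measurable_compose[OF comp[OF that] UEG_measurable(3)] by auto
    note m = this
    have "{theta \<in> space (?P k). \<exists>S\<subseteq>{..<n k}. \<bar>real (card S) - real (n k) * \<phi> t0\<bar> \<le> real (n k) * nu \<and>
       kkt {..<n k} (%i. E (r (theta i))) (%i. U (r (theta i))) 0 S (%j. G (r (theta (fst j))))} \<in> sets (?P k)"
      by (rule Ex_kkt_sets) (use m in auto)
    then show ?thesis unfolding W_def typical_def .
  qed
  have "\<forall>\<^sub>F k in sequentially. 1 \<le> n k" using n by (simp add: filterlim_at_top)
  then have ev: "\<forall>\<^sub>F k in sequentially. 1 - (\<Sum>f\<in>F. measure (?P k) (bad f k)) \<le> measure (?P k) (W k)"
  proof eventually_elim
    case (elim k)
    interpret P: prob_space "?P k" by (rule prob)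
    have good: "AE theta in ?P k. \<forall>i\<in>{..<n k}. E (r (theta i)) \<in> {-1, 0, 1} \<and> U (r (theta i)) ~= 0"
    proof (rule AE_finite_allI)
      fix i assume i: "i \<in> {..<n k}"
      have "AE theta in distr T tau r. E theta \<in> {-1, 0, 1} \<and> U theta ~= 0"
        unfolding law using AE_sign AE_U by (rule AE_conjI)
      from AE_distrD[OF r this] have a: "AE t in T. E (r t) \<in> {-1, 0, 1} \<and> U (r t) ~= 0" .
      show "AE theta in ?P k. E (r (theta i)) \<in> {-1, 0, 1} \<and> U (r (theta i)) ~= 0"
        by (rule AE_PiM_component[OF T i a])
    qed simp
    have "AE theta in ?P k. theta \<in> space (?P k) - W k \<longrightarrow> theta \<in> (\<Union>f\<in>F. bad f k)"
      using good
    proof eventually_elim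
      fix theta assume g: "\<forall>i\<in>{..<n k}. E (r (theta i)) \<in> {-1, 0, 1} \<and> U (r (theta i)) ~= 0"
      show "theta \<in> space (?P k) - W k \<longrightarrow> theta \<in> (\<Union>f\<in>F. bad f k)"
      proof (intro impI, rule ccontr)
        assume w: "theta \<in> space (?P k) - W k" and "theta \<notin> (\<Union>f\<in>F. bad f k)"
        then have b: "\<bar>(\<Sum>i<n k. f (r (theta i))) - real (n k) * (\<integral>theta. f theta \<partial>tau)\<bar> < zeta * real (n k)" if "f \<in> F" for f
          using that by (auto simp: bad_def not_le)
        have "typical nu' (n k) (%i. r (theta i))"
        proof (rule typical_if[OF _ _ _ eta(1) zeta'(1,2,5,6) nu'(3)])
          show "\<bar>(\<Sum>i<n k. H t (r (theta i))) - real (n k) * \<phi> t\<bar> < zeta * real (n k)" if "t \<in> {t0, t0 + eta, t0 - eta}" for t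
            unfolding \<phi>_def using that by (intro b) (auto simp: F_def)
          show "\<bar>(\<Sum>i<n k. indicator B (r (theta i))) - real (n k) * measure tau B\<bar> < zeta * real (n k)"
            if "B \<in> {outer eta, inner eta}" for B
          proof -
            have "(\<integral>theta. indicator B theta \<partial>tau) = measure tau B" by simp
            then show ?thesis using b[of "indicator B"] that unfolding F_def by auto
          qed
        qed (use g elim in auto)
        then have "typical nu (n k) (%i. r (theta i))"
          unfolding typical_def using mult_left_mono[OF nu'(2), of "real (n k)"] by (auto intro: order_trans)
        then show False using w by (simp add: W_def)
      qed
    qed
    then have "measure (?P k) (space (?P k) - W k) \<le> measure (?P k) (\<Union>f\<in>F. bad f k)"
      using finF badsets by (intro P.finite_measure_mono_AE sets.finite_UN) auto
    also have "\<dots> \<le> (\<Sum>f\<in>F. measure (?P k) (bad f k))"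
      using finF badsets by (intro P.finite_measure_subadditive_finite) auto
    finally show ?case using P.prob_compl[OF Wsets] by simp
  qed
  show ?thesis
    unfolding W_def[symmetric]
  proof (rule tendsto_sandwich[OF ev _ _ tendsto_const])
    show "\<forall>\<^sub>F k in sequentially. measure (?P k) (W k) \<le> 1"
      using prob_space.prob_le_1[OF prob] by simp
    show "(%k. 1 - (\<Sum>f\<in>F. measure (?P k) (bad f k))) \<longlonglongrightarrow> 1"
      using tendsto_diff[OF tendsto_const[of 1] badlim] by simp
  qed
qed

end

subsection \<open>From one Gaussian column to several\<close>

lemma distr_zip:
  assumes A: "finite A" and K: "prob_space K" and L: "prob_space L"
  shows zip_measurable: "(%z. \<lambda>i\<in>A. (fst z i, snd z i)) \<in> PiM A (%_. K) \<Otimes>\<^sub>M PiM A (%_. L) \<rightarrow>\<^sub>M PiM A (%_. K \<Otimes>\<^sub>M L)"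
    and "distr (PiM A (%_. K) \<Otimes>\<^sub>M PiM A (%_. L)) (PiM A (%_. K \<Otimes>\<^sub>M L)) (%z. \<lambda>i\<in>A. (fst z i, snd z i)) =
      PiM A (%_. K \<Otimes>\<^sub>M L)"
proof -
  let ?PK = "PiM A (%_. K)" and ?PL = "PiM A (%_. L)" and ?z = "%z. \<lambda>i\<in>A. (fst z i, snd z i)"
  have psK: "product_sigma_finite (%_. K)" and psL: "product_sigma_finite (%_. L)"
    using K L by (auto simp: product_sigma_finite_def prob_space_imp_sigma_finite)
  interpret L: prob_space L by fact
  interpret PL: prob_space ?PL by (rule prob_space_PiM[OF L])
  have KL: "prob_space (K \<Otimes>\<^sub>M L)" using K L by (rule prob_space_pair)
  have psKL: "product_sigma_finite (%_. K \<Otimes>\<^sub>M L)"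
    using KL by (auto simp: product_sigma_finite_def prob_space_imp_sigma_finite)
  have z: "?z \<in> ?PK \<Otimes>\<^sub>M ?PL \<rightarrow>\<^sub>M PiM A (%_. K \<Otimes>\<^sub>M L)"
  proof (rule measurable_restrict)
    fix i assume i: "i \<in> A"
    show "(%z. (fst z i, snd z i)) \<in> ?PK \<Otimes>\<^sub>M ?PL \<rightarrow>\<^sub>M K \<Otimes>\<^sub>M L"
      by (intro measurable_Pair measurable_compose[OF measurable_fst measurable_component_singleton[OF i]]
        measurable_compose[OF measurable_snd measurable_component_singleton[OF i]])
  qed
  show "?z \<in> ?PK \<Otimes>\<^sub>M ?PL \<rightarrow>\<^sub>M PiM A (%_. K \<Otimes>\<^sub>M L)" by (rule z)
  show "distr (?PK \<Otimes>\<^sub>M ?PL) (PiM A (%_. K \<Otimes>\<^sub>M L)) ?z = PiM A (%_. K \<Otimes>\<^sub>M L)"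
  proof (rule product_sigma_finite.PiM_eqI[OF psKL A])
    fix C assume C: "\<And>i. i \<in> A ==> C i \<in> sets (K \<Otimes>\<^sub>M L)"
    have Cm: "Pi\<^sub>E A C \<in> sets (PiM A (%_. K \<Otimes>\<^sub>M L))" using A C by (intro sets_PiM_I_finite) auto
    let ?P = "?z -` Pi\<^sub>E A C \<inter> space (?PK \<Otimes>\<^sub>M ?PL)"
    have "emeasure (distr (?PK \<Otimes>\<^sub>M ?PL) (PiM A (%_. K \<Otimes>\<^sub>M L)) ?z) (Pi\<^sub>E A C) = emeasure (?PK \<Otimes>\<^sub>M ?PL) ?P"
      by (rule emeasure_distr[OF z Cm])
    also have "\<dots> = (\<integral>\<^sup>+a. \<integral>\<^sup>+b. indicator ?P (a, b) \<partial>?PL \<partial>?PK)"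
      by (rule PL.emeasure_pair_measure[OF measurable_sets[OF z Cm]])
    also have "\<dots> = (\<integral>\<^sup>+a. \<integral>\<^sup>+b. (\<Prod>i\<in>A. indicator (C i) (a i, b i)) \<partial>?PL \<partial>?PK)"
    proof (intro nn_integral_cong)
      fix a b assume "a \<in> space ?PK" "b \<in> space ?PL"
      then have "(a, b) \<in> ?P \<longleftrightarrow> (\<forall>i\<in>A. (a i, b i) \<in> C i)"
        by (auto simp: space_pair_measure PiE_iff)
      then show "indicator ?P (a, b) = (\<Prod>i\<in>A. indicator (C i) (a i, b i) :: ennreal)"
        using A by (auto simp: indicator_def prod_zero_iff)
    qed
    also have "\<dots> = (\<integral>\<^sup>+a. (\<Prod>i\<in>A. \<integral>\<^sup>+b. indicator (C i) (a i, b) \<partial>L) \<partial>?PK)"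
    proof (intro nn_integral_cong product_sigma_finite.product_nn_integral_prod[OF psL A])
      fix a i assume "a \<in> space ?PK" and i: "i \<in> A"
      then have "a i \<in> space K" by (auto simp: space_PiM)
      then show "(%b. indicator (C i) (a i, b)) \<in> borel_measurable L"
        using C[OF i] by (intro measurable_compose[OF measurable_Pair1' borel_measurable_indicator])
    qed
    also have "\<dots> = (\<Prod>i\<in>A. \<integral>\<^sup>+a. \<integral>\<^sup>+b. indicator (C i) (a, b) \<partial>L \<partial>K)"
    proof (rule product_sigma_finite.product_nn_integral_prod[OF psK A])
      fix i assume i: "i \<in> A"
      have "(%z. indicator (C i) z :: ennreal) \<in> borel_measurable (K \<Otimes>\<^sub>M L)" using C[OF i] by simp
      from L.borel_measurable_nn_integral_fst[OF this]
      show "(%a. \<integral>\<^sup>+b. indicator (C i) (a, b) \<partial>L) \<in> borel_measurable K" .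
    qed
    also have "\<dots> = (\<Prod>i\<in>A. emeasure (K \<Otimes>\<^sub>M L) (C i))"
      using C by (intro prod.cong refl L.emeasure_pair_measure[symmetric])
    finally show "emeasure (distr (?PK \<Otimes>\<^sub>M ?PL) (PiM A (%_. K \<Otimes>\<^sub>M L)) ?z) (Pi\<^sub>E A C) =
      (\<Prod>i\<in>A. emeasure (K \<Otimes>\<^sub>M L) (C i))" .
  qed simp
qed

text \<open>Separates a sample of pairs of label and Gaussian row into the labels and one Gaussian
  matrix.\<close>

definition unzip :: "'a set => 'j set => ('a => 'k \<times> ('j => real)) => ('a => 'k) \<times> ('a \<times> 'j => real)" where
  "unzip A J theta = ((\<lambda>i\<in>A. fst (theta i)), (\<lambda>k\<in>A \<times> J. snd (theta (fst k)) (snd k)))"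

lemma distr_unzip:
  assumes A: "finite A" and J: "finite J" and K: "prob_space K"
  shows unzip_measurable: "unzip A J \<in> PiM A (%_. K \<Otimes>\<^sub>M Gam J) \<rightarrow>\<^sub>M PiM A (%_. K) \<Otimes>\<^sub>M Gam (A \<times> J)"
    and "distr (PiM A (%_. K \<Otimes>\<^sub>M Gam J)) (PiM A (%_. K) \<Otimes>\<^sub>M Gam (A \<times> J)) (unzip A J) = PiM A (%_. K) \<Otimes>\<^sub>M Gam (A \<times> J)"
proof -
  let ?P = "PiM A (%_. K \<Otimes>\<^sub>M Gam J)" and ?PK = "PiM A (%_. K)" and ?PL = "PiM A (%_. Gam J)"
  let ?z = "%z. \<lambda>i\<in>A. (fst z i, snd z i)" and ?c = "%x. \<lambda>k\<in>A \<times> J. x (fst k) (snd k)"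
  have 1: "(%theta. \<lambda>i\<in>A. fst (theta i)) \<in> ?P \<rightarrow>\<^sub>M ?PK"
  proof (rule measurable_restrict)
    fix i assume "i \<in> A"
    from measurable_component_singleton[OF this, of "%_. K \<Otimes>\<^sub>M Gam J"]
    show "(%theta. fst (theta i)) \<in> ?P \<rightarrow>\<^sub>M K" by (rule measurable_compose) (rule measurable_fst)
  qed
  have 2: "(%theta. \<lambda>k\<in>A \<times> J. snd (theta (fst k)) (snd k)) \<in> ?P \<rightarrow>\<^sub>M Gam (A \<times> J)"
  proof (rule measurable_GamI)
    fix k assume k: "k \<in> A \<times> J"
    then have i: "fst k \<in> A" and j: "snd k \<in> J" by auto
    have "(%theta. snd (theta (fst k)) (snd k)) \<in> borel_measurable ?P"
      by (rule measurable_compose[OF measurable_compose[OF measurable_component_singleton[OF i, of "%_. K \<Otimes>\<^sub>M Gam J"] measurable_snd] Gam_component_measurable[OF j]])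
    then show "(%theta. (\<lambda>k\<in>A \<times> J. snd (theta (fst k)) (snd k)) k) \<in> borel_measurable ?P" using k by simp
  qed simp
  have m: "unzip A J \<in> ?P \<rightarrow>\<^sub>M ?PK \<Otimes>\<^sub>M Gam (A \<times> J)"
    unfolding unzip_def[abs_def] by (rule measurable_Pair[OF 1 2])
  then show "unzip A J \<in> ?P \<rightarrow>\<^sub>M ?PK \<Otimes>\<^sub>M Gam (A \<times> J)" .
  note z = distr_zip[OF A K prob_space_Gam[of J]]
  have c: "?c \<in> ?PL \<rightarrow>\<^sub>M Gam (A \<times> J)" and cd: "distr ?PL (Gam (A \<times> J)) ?c = Gam (A \<times> J)"
    using distr_uncurry[OF A J, of id "A \<times> J"] by (auto simp: bij_betw_def)
  have "distr ?P (?PK \<Otimes>\<^sub>M Gam (A \<times> J)) (unzip A J) =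
      distr (distr (?PK \<Otimes>\<^sub>M ?PL) ?P ?z) (?PK \<Otimes>\<^sub>M Gam (A \<times> J)) (unzip A J)" unfolding z(2) ..
  also have "\<dots> = distr (?PK \<Otimes>\<^sub>M ?PL) (?PK \<Otimes>\<^sub>M Gam (A \<times> J)) (unzip A J \<circ> ?z)"
    by (rule distr_distr[OF m z(1)])
  also have "\<dots> = distr (?PK \<Otimes>\<^sub>M ?PL) (?PK \<Otimes>\<^sub>M Gam (A \<times> J)) (%(a, b). (a, ?c b))"
    by (intro distr_cong) (auto simp: unzip_def space_pair_measure space_PiM PiE_def extensional_def restrict_def fun_eq_iff)
  also have "\<dots> = distr ?PK ?PK (%a. a) \<Otimes>\<^sub>M distr ?PL (Gam (A \<times> J)) ?c"
  proof (rule pair_measure_distr[symmetric, OF measurable_ident_sets[OF refl] c])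
    show "sigma_finite_measure (distr ?PL (Gam (A \<times> J)) ?c)"
      unfolding cd by (rule prob_space_imp_sigma_finite[OF prob_space_Gam])
  qed
  also have "\<dots> = ?PK \<Otimes>\<^sub>M Gam (A \<times> J)" unfolding cd by simp
  finally show "distr ?P (?PK \<Otimes>\<^sub>M Gam (A \<times> J)) (unzip A J) = ?PK \<Otimes>\<^sub>M Gam (A \<times> J)" .
qed

lemma kkt_cong:
  assumes S: "S \<subseteq> A" and e: "\<And>i. i \<in> A ==> e i = e' i" and u: "\<And>i. i \<in> A ==> u i = u' i"
    and X: "\<And>i j. i \<in> A ==> j \<le> q ==> X (i, j) = X' (i, j)"
  shows "kkt A e u q S X \<longleftrightarrow> kkt A e' u' q S X'"
proof -
  have "gs S (cols u X) (Suc q) i = gs S (cols u' X') (Suc q) i" if "i \<in> A" for i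
  proof -
    have c: "cols u X k i = cols u' X' k i" if "k \<le> Suc q" "i \<in> A" for k i
      using that u X by (cases k) auto
    have "gs S (cols u X) (Suc q) i = gs (S \<inter> A) (cols u X) (Suc q) i" using S by (simp add: Int_absorb2)
    also have "\<dots> = (\<Sum>l\<le>Suc q. gc S (cols u X) (Suc q) l * cols u X l i)"
      using S unfolding gs_eq_gc[of "S \<inter> A"] by (simp only: Int_absorb2)
    also have "\<dots> = (\<Sum>l\<le>Suc q. gc S (cols u' X') (Suc q) l * cols u' X' l i)"
      using c \<open>i \<in> A\<close> S by (intro sum.cong refl arg_cong2[where f = "(*)"] gc_cong_on c) auto
    also have "\<dots> = gs S (cols u' X') (Suc q) i" by (rule gs_eq_gc[symmetric])
    finally show ?thesis .
  qed
  note g = this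
  have "(\<exists>i\<in>S. gs S (cols u X) (Suc q) i ~= 0) \<longleftrightarrow> (\<exists>i\<in>S. gs S (cols u' X') (Suc q) i ~= 0)"
    using g S by (intro bex_cong refl) auto
  moreover have "(\<forall>i\<in>S. e i ~= 0 \<longrightarrow> 0 < e i * gs S (cols u X) (Suc q) i) \<longleftrightarrow>
      (\<forall>i\<in>S. e' i ~= 0 \<longrightarrow> 0 < e' i * gs S (cols u' X') (Suc q) i)"
    using g e S by (intro ball_cong refl) auto
  moreover have "(\<forall>i\<in>A - S. e i ~= 0 \<and> e i * gs S (cols u X) (Suc q) i \<le> 0) \<longleftrightarrow>
      (\<forall>i\<in>A - S. e' i ~= 0 \<and> e' i * gs S (cols u' X') (Suc q) i \<le> 0)"
    using g e by (intro ball_cong refl) auto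
  ultimately show ?thesis unfolding kkt_def by (simp only:)
qed

text \<open>The size bound \<open>m\<close> is kept apart from the column number \<open>q\<close>,
  so that the count required by many columns can be asked of a single one.\<close>

definition proper_active :: "'i set => nat => nat => ('i => real \<times> real) \<times> ('i \<times> nat => real) => bool" where
  "proper_active A m q z \<longleftrightarrow> (\<exists>S\<subseteq>A. m < card S \<and> kkt A (%i. snd (fst z i)) (%i. fst (fst z i)) q S (snd z))"

lemma proper_active_sets:
  assumes A: "finite A" and K: "sets K = sets (borel \<Otimes>\<^sub>M borel)"
  shows "{z \<in> space (PiM A (%_. K) \<Otimes>\<^sub>M Gam (A \<times> {..q})). proper_active A m q z} \<in> sets (PiM A (%_. K) \<Otimes>\<^sub>M Gam (A \<times> {..q}))"
proof -
  let ?P = "PiM A (%_. K) \<Otimes>\<^sub>M Gam (A \<times> {..q})"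
  have c: "(%z. fst z i) \<in> ?P \<rightarrow>\<^sub>M borel \<Otimes>\<^sub>M borel" if "i \<in> A" for i
    using measurable_compose[OF measurable_fst measurable_component_singleton[OF that]]
      measurable_cong_sets[OF refl K, of ?P] by blast
  show ?thesis
    unfolding proper_active_def
  proof (rule Ex_kkt_sets[OF A])
    fix i assume i: "i \<in> A"
    show "(%z. snd (fst z i)) \<in> borel_measurable ?P" by (rule measurable_compose[OF c[OF i] measurable_snd])
    show "(%z. fst (fst z i)) \<in> borel_measurable ?P" by (rule measurable_compose[OF c[OF i] measurable_fst])
  next
    fix i j assume "i \<in> A" "j \<le> q"
    then show "(%z. snd z (i, j)) \<in> borel_measurable ?P"
      by (intro measurable_compose[OF measurable_snd Gam_component_measurable]) auto
  qed
qed

text \<open>At most one set satisfies the conditions, hence the probability of the union is the sum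
  over \<open>S\<close>, and each summand is independent of the number of columns. The restriction
  on \<open>card S\<close> is exactly what the latter requires.\<close>

lemma prob_ex_kkt:
  assumes A: "finite A" and u: "\<And>i. i \<in> A ==> u i ~= 0" and e: "\<And>i. i \<in> A ==> e i \<in> {-1, 0, 1}"
  shows "measure (Gam (A \<times> {..q})) {X \<in> space (Gam (A \<times> {..q})). \<exists>S\<subseteq>A. Suc q < card S \<and> kkt A e u q S X} =
    measure (Gam (A \<times> {..0})) {X \<in> space (Gam (A \<times> {..0})). \<exists>S\<subseteq>A. Suc q < card S \<and> kkt A e u 0 S X}"
proof -
  define F where "F = {S. S \<subseteq> A \<and> Suc q < card S}"
  have F: "finite F" using A by (simp add: F_def)
  have eq: "measure (Gam (A \<times> {..r})) {X \<in> space (Gam (A \<times> {..r})). \<exists>S\<subseteq>A. Suc q < card S \<and> kkt A e u r S X} =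
     (\<Sum>S\<in>F. measure (Gam (A \<times> {..r})) {X \<in> space (Gam (A \<times> {..r})). kkt A e u r S X})" for r
  proof -
    interpret P: prob_space "Gam (A \<times> {..r})" by (rule prob_space_Gam)
    have "{X \<in> space (Gam (A \<times> {..r})). \<exists>S\<subseteq>A. Suc q < card S \<and> kkt A e u r S X} =
      (\<Union>S\<in>F. {X \<in> space (Gam (A \<times> {..r})). kkt A e u r S X})" by (auto simp: F_def)
    also have "measure (Gam (A \<times> {..r})) \<dots> = (\<Sum>S\<in>F. measure (Gam (A \<times> {..r})) {X \<in> space (Gam (A \<times> {..r})). kkt A e u r S X})"
    proof (rule P.finite_measure_finite_Union[OF F])
      show "(%S. {X \<in> space (Gam (A \<times> {..r})). kkt A e u r S X}) ` F \<subseteq> sets (Gam (A \<times> {..r}))"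
        using kkt_sets[OF A] by (auto simp: F_def)
      show "disjoint_family_on (%S. {X \<in> space (Gam (A \<times> {..r})). kkt A e u r S X}) F"
        unfolding disjoint_family_on_def
      proof (intro ballI impI)
        fix S S' assume S: "S \<in> F" "S' \<in> F" "S ~= S'"
        have "\<not> (kkt A e u r S X \<and> kkt A e u r S' X)" for X
          using kkt_unique[of A S S' e u r X] A S e by (auto simp: F_def)
        then show "{X \<in> space (Gam (A \<times> {..r})). kkt A e u r S X} \<inter> {X \<in> space (Gam (A \<times> {..r})). kkt A e u r S' X} = {}"
          by blast
      qed
    qed
    finally show ?thesis .
  qed
  show ?thesis
    unfolding eq
  proof (intro sum.cong refl kkt_prob_independent_of_dimension A u)
    fix i assume "i \<in> A"
    from e[OF this] show "\<bar>e i\<bar> \<le> 1" by auto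
  qed (auto simp: F_def)
qed

text \<open>The identity holds for fixed indices and signs, almost surely in them, and is then
  integrated.\<close>

lemma prob_proper_active:
  assumes A: "finite A" and K: "prob_space K" and sets: "sets K = sets (borel \<Otimes>\<^sub>M borel)"
    and AE: "AE z in K. fst z ~= 0 \<and> snd z \<in> {-1, 0, 1}"
  shows "measure (PiM A (%_. K) \<Otimes>\<^sub>M Gam (A \<times> {..q})) {z \<in> space (PiM A (%_. K) \<Otimes>\<^sub>M Gam (A \<times> {..q})). proper_active A (Suc q) q z} =
    measure (PiM A (%_. K) \<Otimes>\<^sub>M Gam (A \<times> {..0})) {z \<in> space (PiM A (%_. K) \<Otimes>\<^sub>M Gam (A \<times> {..0})). proper_active A (Suc q) 0 z}"
proof -
  let ?PK = "PiM A (%_. K)"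
  let ?B = "%r. {z \<in> space (?PK \<Otimes>\<^sub>M Gam (A \<times> {..r})). proper_active A (Suc q) r z}"
  have good: "AE x in ?PK. \<forall>i\<in>A. fst (x i) ~= 0 \<and> snd (x i) \<in> {-1, 0, 1}"
    using A by (intro AE_finite_allI AE_PiM_component[OF K _ AE])
  have em: "emeasure (?PK \<Otimes>\<^sub>M Gam (A \<times> {..r})) (?B r) = (\<integral>\<^sup>+x. emeasure (Gam (A \<times> {..r}))
      {X \<in> space (Gam (A \<times> {..r})). \<exists>S\<subseteq>A. Suc q < card S \<and> kkt A (%i. snd (x i)) (%i. fst (x i)) r S X} \<partial>?PK)" for r
  proof -
    interpret P: prob_space "Gam (A \<times> {..r})" by (rule prob_space_Gam)
    have "emeasure (?PK \<Otimes>\<^sub>M Gam (A \<times> {..r})) (?B r) = (\<integral>\<^sup>+x. emeasure (Gam (A \<times> {..r})) (Pair x -` ?B r) \<partial>?PK)"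
      by (rule P.emeasure_pair_measure_alt[OF proper_active_sets[OF A sets]])
    also have "\<dots> = (\<integral>\<^sup>+x. emeasure (Gam (A \<times> {..r}))
      {X \<in> space (Gam (A \<times> {..r})). \<exists>S\<subseteq>A. Suc q < card S \<and> kkt A (%i. snd (x i)) (%i. fst (x i)) r S X} \<partial>?PK)"
    proof (rule nn_integral_cong)
      fix x assume "x \<in> space ?PK"
      then have "Pair x -` ?B r =
        {X \<in> space (Gam (A \<times> {..r})). \<exists>S\<subseteq>A. Suc q < card S \<and> kkt A (%i. snd (x i)) (%i. fst (x i)) r S X}"
        unfolding proper_active_def space_pair_measure by auto
      then show "emeasure (Gam (A \<times> {..r})) (Pair x -` ?B r) = emeasure (Gam (A \<times> {..r}))
        {X \<in> space (Gam (A \<times> {..r})). \<exists>S\<subseteq>A. Suc q < card S \<and> kkt A (%i. snd (x i)) (%i. fst (x i)) r S X}"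
        by (simp only:)
    qed
    finally show ?thesis .
  qed
  have "emeasure (?PK \<Otimes>\<^sub>M Gam (A \<times> {..q})) (?B q) = emeasure (?PK \<Otimes>\<^sub>M Gam (A \<times> {..0})) (?B 0)"
    unfolding em
  proof (rule nn_integral_cong_AE)
    show "AE x in ?PK. emeasure (Gam (A \<times> {..q}))
        {X \<in> space (Gam (A \<times> {..q})). \<exists>S\<subseteq>A. Suc q < card S \<and> kkt A (%i. snd (x i)) (%i. fst (x i)) q S X} =
       emeasure (Gam (A \<times> {..0}))
        {X \<in> space (Gam (A \<times> {..0})). \<exists>S\<subseteq>A. Suc q < card S \<and> kkt A (%i. snd (x i)) (%i. fst (x i)) 0 S X}"
      using good
    proof eventually_elim
      case (elim x)
      then show ?case
        unfolding emeasure_prob_eq_measure[OF prob_space_Gam]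
        using prob_ex_kkt[OF A, of "%i. fst (x i)" "%i. snd (x i)" q] by simp
    qed
  qed
  then show ?thesis by (simp only: measure_def)
qed

lemma general_position_AE_joint:
  fixes A :: "'i set"
  assumes A: "finite A" and K: "prob_space K" and sets: "sets K = sets (borel \<Otimes>\<^sub>M borel)"
    and AE: "AE z in K. fst z ~= 0"
  shows "AE z in PiM A (%_. K) \<Otimes>\<^sub>M Gam (A \<times> {..q}). general_position A q (%i. fst (fst z i)) (snd z)"
proof -
  let ?PK = "PiM A (%_. K)" and ?G = "Gam (A \<times> {..q})"
  interpret PK: prob_space ?PK by (rule prob_space_PiM[OF K])
  interpret G: prob_space ?G by (rule prob_space_Gam)
  interpret P: pair_prob_space ?PK ?G ..
  have c: "(%z. fst z i) \<in> ?PK \<Otimes>\<^sub>M ?G \<rightarrow>\<^sub>M borel \<Otimes>\<^sub>M borel" if "i \<in> A" for i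
    using measurable_compose[OF measurable_fst measurable_component_singleton[OF that]]
      measurable_cong_sets[OF refl sets, of "?PK \<Otimes>\<^sub>M ?G"] by blast
  have g: "(%z. gs S (cols (%i. fst (fst z i)) (snd z)) k i) \<in> borel_measurable (?PK \<Otimes>\<^sub>M ?G)"
    if "k \<le> Suc q" "S \<subseteq> A" "i \<in> A" for S k i
  proof (rule gs_measurable[OF _ that(2,3)])
    fix k' i assume k': "k' \<le> k" and i: "i \<in> A"
    show "(%z. cols (%i. fst (fst z i)) (snd z) k' i) \<in> borel_measurable (?PK \<Otimes>\<^sub>M ?G)"
    proof (cases k')
      case 0
      then show ?thesis using measurable_compose[OF c[OF i] measurable_fst] by simp
    next
      case (Suc j)
      then have "(i, j) \<in> A \<times> {..q}" using k' i that by auto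
      from measurable_compose[OF measurable_snd Gam_component_measurable[OF this]] Suc show ?thesis by simp
    qed
  qed
  have "{z \<in> space (?PK \<Otimes>\<^sub>M ?G). \<forall>S\<in>Pow A. \<forall>k\<in>{..Suc q}. k < card S \<longrightarrow>
      (\<exists>i\<in>S. gs S (cols (%i. fst (fst z i)) (snd z)) k i ~= 0)} \<in> sets (?PK \<Otimes>\<^sub>M ?G)"
  proof (rule sets.sets_Collect_finite_All)
    fix S assume S: "S \<in> Pow A"
    then have finS: "finite S" using A by (auto intro: finite_subset)
    show "{z \<in> space (?PK \<Otimes>\<^sub>M ?G). \<forall>k\<in>{..Suc q}. k < card S \<longrightarrow>
      (\<exists>i\<in>S. gs S (cols (%i. fst (fst z i)) (snd z)) k i ~= 0)} \<in> sets (?PK \<Otimes>\<^sub>M ?G)"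
    proof (rule sets.sets_Collect_finite_All[OF _ finite_atMost])
      fix k assume k: "k \<in> {..Suc q}"
      have "{z \<in> space (?PK \<Otimes>\<^sub>M ?G). \<exists>i\<in>S. gs S (cols (%i. fst (fst z i)) (snd z)) k i ~= 0} \<in> sets (?PK \<Otimes>\<^sub>M ?G)"
      proof (rule sets.sets_Collect_finite_Ex[OF _ finS])
        fix i assume "i \<in> S"
        then have "(%z. gs S (cols (%i. fst (fst z i)) (snd z)) k i) \<in> borel_measurable (?PK \<Otimes>\<^sub>M ?G)"
          using S k by (intro g) auto
        then show "{z \<in> space (?PK \<Otimes>\<^sub>M ?G). gs S (cols (%i. fst (fst z i)) (snd z)) k i ~= 0} \<in> sets (?PK \<Otimes>\<^sub>M ?G)"
          by measurable
      qed
      then show "{z \<in> space (?PK \<Otimes>\<^sub>M ?G). k < card S \<longrightarrow>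
        (\<exists>i\<in>S. gs S (cols (%i. fst (fst z i)) (snd z)) k i ~= 0)} \<in> sets (?PK \<Otimes>\<^sub>M ?G)"
        by (rule sets.sets_Collect_imp[OF _ sets.sets_Collect_const])
    qed
  qed (use A in simp)
  then have m: "{z \<in> space (?PK \<Otimes>\<^sub>M ?G). general_position A q (%i. fst (fst z i)) (snd z)} \<in> sets (?PK \<Otimes>\<^sub>M ?G)"
    unfolding general_position_def .
  have "AE x in ?PK. \<forall>i\<in>A. fst (x i) ~= 0"
    using A by (intro AE_finite_allI AE_PiM_component[OF K _ AE])
  then have "AE x in ?PK. AE X in ?G. general_position A q (%i. fst (fst (x, X) i)) (snd (x, X))"
  proof eventually_elim
    case (elim x)
    then show ?case using general_position_AE[OF A, of "%i. fst (x i)" q] by simp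
  qed
  from P.AE_pair_measure[OF m this] show ?thesis .
qed

section \<open>Convergence of the probability of a proper active set\<close>

context limit_law begin

lemma AE_regular: "AE z in kappa. fst z ~= 0 \<and> snd z \<in> {-1, 0, 1}"
proof (rule AE_conjI[OF _ sign])
  have "AE x in distr kappa borel fst. x ~= 0" unfolding normal by (rule AE_normal_nonzero)
  from AE_distrD[OF fst_measurable this] show "AE z in kappa. fst z ~= 0" .
qed

text \<open>The Gaussian variable is stored as a vector with one entry, which matches the rows of a
  matrix with a single Gaussian column; \<open>flat\<close> returns to the form of
  \<open>tau\<close>.\<close>

definition base :: "((real \<times> real) \<times> (nat => real)) measure" where "base = kappa \<Otimes>\<^sub>M Gam {..0}"

definition flat :: "(real \<times> real) \<times> (nat => real) => (real \<times> real) \<times> real" where "flat t = (fst t, snd t 0)"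

lemma prob_space_base: "prob_space base"
  unfolding base_def by (rule prob_space_pair[OF prob_space_axioms prob_space_Gam])

lemma flat_measurable: "flat \<in> base \<rightarrow>\<^sub>M tau"
proof -
  have "(%t. snd t 0) \<in> base \<rightarrow>\<^sub>M gauss"
    unfolding base_def using measurable_compose[OF measurable_snd Gam_component_measurable[of 0 "{..0}"], of kappa] by simp
  moreover have "fst \<in> base \<rightarrow>\<^sub>M kappa" unfolding base_def by simp
  ultimately show ?thesis unfolding flat_def[abs_def] tau_def by (rule measurable_Pair[rotated])
qed

lemma distr_flat: "distr base tau flat = tau"
proof -
  have c: "(%x. x 0) \<in> Gam {..0::nat} \<rightarrow>\<^sub>M gauss"
    using Gam_component_measurable[of 0 "{..0::nat}"] by simp
  have d: "distr (Gam {..0::nat}) gauss (%x. x 0) = gauss"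
    using Gam_component_distr[of 0 "{..0::nat}"] distr_cong[of "Gam {..0::nat}" "Gam {..0::nat}" gauss borel] by simp
  have "distr base tau flat = distr (kappa \<Otimes>\<^sub>M Gam {..0::nat}) (kappa \<Otimes>\<^sub>M gauss) (%(x, y). (x, y 0))"
    unfolding base_def tau_def by (rule distr_cong[OF refl refl]) (auto simp: flat_def)
  also have "\<dots> = distr kappa kappa (%x. x) \<Otimes>\<^sub>M distr (Gam {..0::nat}) gauss (%x. x 0)"
  proof (rule pair_measure_distr[symmetric, OF measurable_ident_sets[OF refl] c])
    show "sigma_finite_measure (distr (Gam {..0::nat}) gauss (%x. x 0))"
      unfolding d by (rule prob_space_imp_sigma_finite[OF prob_space_std_normal])
  qed
  also have "\<dots> = tau" unfolding d tau_def by simp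
  finally show ?thesis .
qed

abbreviation sample_law :: "nat => nat => ((nat => real \<times> real) \<times> (nat \<times> nat => real)) measure" where
  "sample_law n q \<equiv> PiM {..<n} (%_. kappa) \<Otimes>\<^sub>M Gam ({..<n} \<times> {..q})"

lemma prob_active_base:
  "measure (sample_law n q) {z \<in> space (sample_law n q). proper_active {..<n} (Suc q) q z} =
    measure (PiM {..<n} (%_. base)) {theta \<in> space (PiM {..<n} (%_. base)). \<exists>S\<subseteq>{..<n}. Suc q < card S \<and>
      kkt {..<n} (%i. E (flat (theta i))) (%i. U (flat (theta i))) 0 S (%k. G (flat (theta (fst k))))}"
proof -
  let ?Q = "PiM {..<n} (%_. base)"
  let ?B = "{z \<in> space (sample_law n 0). proper_active {..<n} (Suc q) 0 z}"
  note um = unzip_measurable[OF finite_lessThan[of n] finite_atMost[of "0::nat"] prob_space_axioms]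
  have "measure (sample_law n q) {z \<in> space (sample_law n q). proper_active {..<n} (Suc q) q z} = measure (sample_law n 0) ?B"
    by (rule prob_proper_active[OF finite_lessThan prob_space_axioms sets_kappa AE_regular])
  also have "\<dots> = measure (distr ?Q (sample_law n 0) (unzip {..<n} {..0})) ?B"
    unfolding base_def distr_unzip(2)[OF finite_lessThan[of n] finite_atMost[of "0::nat"] prob_space_axioms] ..
  also have "\<dots> = measure ?Q (unzip {..<n} {..0} -` ?B \<inter> space ?Q)"
    unfolding base_def by (rule measure_distr[OF um proper_active_sets[OF finite_lessThan sets_kappa]])
  also have "unzip {..<n} {..0} -` ?B \<inter> space ?Q = {theta \<in> space ?Q. \<exists>S\<subseteq>{..<n}. Suc q < card S \<and>
      kkt {..<n} (%i. E (flat (theta i))) (%i. U (flat (theta i))) 0 S (%k. G (flat (theta (fst k))))}"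
  proof -
    have "kkt {..<n} (%i. snd (fst (unzip {..<n} {..0} theta) i)) (%i. fst (fst (unzip {..<n} {..0} theta) i)) 0 S (snd (unzip {..<n} {..0} theta)) \<longleftrightarrow>
      kkt {..<n} (%i. E (flat (theta i))) (%i. U (flat (theta i))) 0 S (%k. G (flat (theta (fst k))))" if "S \<subseteq> {..<n}"
      for S and theta :: "nat => (real \<times> real) \<times> (nat => real)"
      by (rule kkt_cong[OF that]) (simp_all add: unzip_def flat_def)
    moreover have "theta \<in> space ?Q ==> unzip {..<n} {..0} theta \<in> space (sample_law n 0)" for theta
      unfolding base_def by (rule measurable_space[OF um])
    ultimately show ?thesis unfolding proper_active_def by blast
  qed
  finally show ?thesis .
qed

text \<open>The required size \<open>q + 1\<close> was fixed by many columns, while the active set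
  is that of one column and has about \<open>n * \<phi> t0\<close> rows. Hence the comparison of
  \<open>c\<close> with \<open>\<phi> t0\<close>.\<close>

lemma tendsto_proper_active:
  assumes n: "filterlim n at_top sequentially" and q: "(%k. real (q k) / real (n k)) \<longlonglongrightarrow> c"
  defines "rho \<equiv> %k. measure (sample_law (n k) (q k)) {z \<in> space (sample_law (n k) (q k)). proper_active {..<n k} (Suc (q k)) (q k) z}"
  shows "c < \<phi> t0 ==> rho \<longlonglongrightarrow> 1" and "\<phi> t0 < c ==> rho \<longlonglongrightarrow> 0"
proof -
  let ?Q = "%k. PiM {..<n k} (%_. base)"
  define K where "K k S theta = kkt {..<n k} (%i. E (flat (theta i))) (%i. U (flat (theta i))) 0 S (%j. G (flat (theta (fst j))))" for k S theta
  define R where "R k = {theta \<in> space (?Q k). \<exists>S\<subseteq>{..<n k}. Suc (q k) < card S \<and> K k S theta}" for k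
  define W where "W nu k = {theta \<in> space (?Q k). typical nu (n k) (%i. flat (theta i))}" for nu k
  have rho: "rho k = measure (?Q k) (R k)" for k unfolding rho_def R_def K_def by (rule prob_active_base)
  have prob: "prob_space (?Q k)" for k by (rule prob_space_PiM[OF prob_space_base])
  have limW: "(%k. measure (?Q k) (W nu k)) \<longlonglongrightarrow> 1" if "nu > 0" for nu
    unfolding W_def by (rule tendsto_typical[OF prob_space_base flat_measurable distr_flat that n])
  have m: "(%theta. E (flat (theta i))) \<in> borel_measurable (?Q k)" "(%theta. U (flat (theta i))) \<in> borel_measurable (?Q k)"
    "(%theta. G (flat (theta i))) \<in> borel_measurable (?Q k)" if "i < n k" for i k
  proof -
    have c: "(%theta. flat (theta i)) \<in> ?Q k \<rightarrow>\<^sub>M tau"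
      using that by (intro measurable_compose[OF measurable_component_singleton[of i "{..<n k}" "%_. base"] flat_measurable]) simp
    show "(%theta. E (flat (theta i))) \<in> borel_measurable (?Q k)" "(%theta. U (flat (theta i))) \<in> borel_measurable (?Q k)"
      "(%theta. G (flat (theta i))) \<in> borel_measurable (?Q k)"
      by (rule measurable_compose[OF c UEG_measurable(2)] measurable_compose[OF c UEG_measurable(1)]
        measurable_compose[OF c UEG_measurable(3)])+
  qed
  have Rsets: "R k \<in> sets (?Q k)" for k
    unfolding R_def K_def by (rule Ex_kkt_sets) (use m in auto)
  have Wsets: "W nu k \<in> sets (?Q k)" for nu k
    unfolding W_def typical_def by (rule Ex_kkt_sets) (use m in auto)
  have sg: "AE theta in ?Q k. \<forall>i\<in>{..<n k}. E (flat (theta i)) \<in> {-1, 0, 1}" for k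
  proof (rule AE_finite_allI)
    fix i assume i: "i \<in> {..<n k}"
    have "AE theta in distr base tau flat. E theta \<in> {-1, 0, 1}" unfolding distr_flat by (rule AE_sign)
    from AE_distrD[OF flat_measurable this] have a: "AE t in base. E (flat t) \<in> {-1, 0, 1}" .
    show "AE theta in ?Q k. E (flat (theta i)) \<in> {-1, 0, 1}"
      by (rule AE_PiM_component[OF prob_space_base i a])
  qed simp
  have n1: "\<forall>\<^sub>F k in sequentially. 1 \<le> n k" using n by (simp add: filterlim_at_top)
  have q': "(%k. real (Suc (q k)) / real (n k)) \<longlonglongrightarrow> c"
  proof -
    have "(%k. 1 / real (n k)) \<longlonglongrightarrow> 0"
      by (rule tendsto_divide_0[OF tendsto_const])
        (rule filterlim_at_top_imp_at_infinity, rule filterlim_compose[OF filterlim_real_sequentially n])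
    from tendsto_add[OF q this] show ?thesis by (simp add: add_divide_distrib add.commute)
  qed
  show "rho \<longlonglongrightarrow> 1" if c: "c < \<phi> t0"
  proof -
    \<comment> \<open>Half of the gap goes to the size of the active set and half to the convergence
      of the ratio.\<close>
    define nu where "nu = (\<phi> t0 - c) / 2"
    have nu: "nu > 0" "\<phi> t0 - nu = c + nu" using c by (auto simp: nu_def field_simps)
    have "\<forall>\<^sub>F k in sequentially. real (Suc (q k)) / real (n k) < c + nu"
      by (rule order_tendstoD(2)[OF q']) (use nu in simp)
    with n1 have "\<forall>\<^sub>F k in sequentially. measure (?Q k) (W nu k) \<le> rho k"
    proof eventually_elim
      case (elim k)
      interpret Q: prob_space "?Q k" by (rule prob)
      have "real (Suc (q k)) < real (n k) * (c + nu)" using elim by (simp add: pos_divide_less_eq mult.commute)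
      then have b: "real (Suc (q k)) < real (n k) * \<phi> t0 - real (n k) * nu" unfolding right_diff_distrib[symmetric] nu(2) .
      have "W nu k \<subseteq> R k"
      proof
        fix theta assume "theta \<in> W nu k"
        then obtain S where S: "theta \<in> space (?Q k)" "S \<subseteq> {..<n k}" "\<bar>real (card S) - real (n k) * \<phi> t0\<bar> \<le> real (n k) * nu" "K k S theta"
          unfolding W_def typical_def K_def by blast
        then have "real (Suc (q k)) < real (card S)" using b by linarith
        then show "theta \<in> R k" using S unfolding R_def of_nat_less_iff by blast
      qed
      then show ?case unfolding rho by (rule Q.finite_measure_mono[OF _ Rsets])
    qed
    then show ?thesis
    proof (rule tendsto_sandwich[OF _ _ limW[OF nu(1)] tendsto_const])
      show "\<forall>\<^sub>F k in sequentially. rho k \<le> 1" unfolding rho using prob_space.prob_le_1[OF prob] by simp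
    qed
  qed
  show "rho \<longlonglongrightarrow> 0" if c: "\<phi> t0 < c"
  proof -
    define nu where "nu = (c - \<phi> t0) / 2"
    have nu: "nu > 0" "\<phi> t0 + nu = c - nu" using c by (auto simp: nu_def field_simps)
    have "\<forall>\<^sub>F k in sequentially. c - nu < real (Suc (q k)) / real (n k)"
      by (rule order_tendstoD(1)[OF q']) (use nu in simp)
    with n1 have ev: "\<forall>\<^sub>F k in sequentially. rho k \<le> 1 - measure (?Q k) (W nu k)"
    proof eventually_elim
      case (elim k)
      interpret Q: prob_space "?Q k" by (rule prob)
      have "real (n k) * (c - nu) < real (Suc (q k))" using elim by (simp add: pos_less_divide_eq mult.commute)
      then have b: "real (n k) * \<phi> t0 + real (n k) * nu < real (Suc (q k))" unfolding distrib_left[symmetric] nu(2) .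
      have "AE theta in ?Q k. theta \<in> R k \<longrightarrow> theta \<in> space (?Q k) - W nu k"
        using sg
      proof eventually_elim
        fix theta assume sg: "\<forall>i\<in>{..<n k}. E (flat (theta i)) \<in> {-1, 0, 1}"
        show "theta \<in> R k \<longrightarrow> theta \<in> space (?Q k) - W nu k"
        proof (intro impI DiffI notI)
          assume R: "theta \<in> R k" then show "theta \<in> space (?Q k)" by (simp add: R_def)
          assume "theta \<in> W nu k"
          then obtain S where S: "S \<subseteq> {..<n k}" "\<bar>real (card S) - real (n k) * \<phi> t0\<bar> \<le> real (n k) * nu" "K k S theta"
            unfolding W_def typical_def K_def by blast
          obtain S' where S': "S' \<subseteq> {..<n k}" "Suc (q k) < card S'" "K k S' theta" using R unfolding R_def by blast
          \<comment> \<open>A larger active set next to the typical one is excluded by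
            uniqueness.\<close>
          have "S = S'"
            using kkt_unique[OF finite_lessThan S(1) S'(1) _ S(3)[unfolded K_def] S'(3)[unfolded K_def]] sg by blast
          then have "real (Suc (q k)) < real (card S)" using S'(2) by simp
          then show False using b S(2) by linarith
        qed
      qed
      then have "measure (?Q k) (R k) \<le> measure (?Q k) (space (?Q k) - W nu k)"
        using Wsets by (intro Q.finite_measure_mono_AE) auto
      then show ?case unfolding rho using Q.prob_compl[OF Wsets] by simp
    qed
    have lim: "(%k. 1 - measure (?Q k) (W nu k)) \<longlonglongrightarrow> 0" using tendsto_diff[OF tendsto_const[of 1] limW[OF nu(1)]] by simp
    show ?thesis
    proof (rule tendsto_sandwich[OF _ ev tendsto_const lim])
      show "\<forall>\<^sub>F k in sequentially. 0 \<le> rho k" unfolding rho by simp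
    qed
  qed
qed

text \<open>The rows are independent and each satisfies its constraint with the same probability,
  which is below 1 by non-triviality.\<close>

lemma tendsto_recession:
  fixes n :: "nat => nat"
  assumes n: "filterlim n at_top sequentially" and \<sigma>: "\<sigma> = 1 \<or> \<sigma> = -1"
  shows "(%k. measure (PiM {..<n k} (%_. kappa)) {x \<in> space (PiM {..<n k} (%_. kappa)). \<forall>i<n k. dcone (snd (x i)) (\<sigma> * fst (x i)) = 0}) \<longlonglongrightarrow> 0"
proof -
  define Z where "Z = {z \<in> space kappa. dcone (snd z) (\<sigma> * fst z) = 0}"
  have Z: "Z \<in> sets kappa" unfolding Z_def by measurable
  have sp: "space kappa = UNIV" using sets_eq_imp_space_eq[OF sets_kappa] by (simp add: space_pair_measure)
  have "prob Z ~= 1"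
  proof
    assume "prob Z = 1"
    then have "AE z in kappa. z \<in> Z" using prob_eq_1[OF Z] by simp
    then have "AE z in kappa. dcone (snd z) (\<sigma> * fst z) = 0" by eventually_elim (simp add: Z_def)
    then show False using \<sigma> nontrivial_pos nontrivial_neg by auto
  qed
  then have Z1: "prob Z < 1" using prob_le_1[of Z] by (simp add: less_le)
  have psf: "product_sigma_finite (%_::nat. kappa)"
    by (simp add: product_sigma_finite_def prob_space_imp_sigma_finite prob_space_axioms)
  have "measure (PiM {..<n k} (%_. kappa)) {x \<in> space (PiM {..<n k} (%_. kappa)). \<forall>i<n k. dcone (snd (x i)) (\<sigma> * fst (x i)) = 0} = prob Z ^ n k" for k
  proof -
    have "{x \<in> space (PiM {..<n k} (%_. kappa)). \<forall>i<n k. dcone (snd (x i)) (\<sigma> * fst (x i)) = 0} = (\<Pi>\<^sub>E i\<in>{..<n k}. Z)"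
    proof (rule set_eqI)
      fix x show "x \<in> {x \<in> space (PiM {..<n k} (%_. kappa)). \<forall>i<n k. dcone (snd (x i)) (\<sigma> * fst (x i)) = 0} \<longleftrightarrow> x \<in> (\<Pi>\<^sub>E i\<in>{..<n k}. Z)"
        by (simp add: space_PiM PiE_iff Z_def sp Ball_def conj_commute)
    qed
    moreover have "emeasure (PiM {..<n k} (%_. kappa)) (\<Pi>\<^sub>E i\<in>{..<n k}. Z) = (\<Prod>i\<in>{..<n k}. emeasure kappa Z)"
      by (rule product_sigma_finite.emeasure_PiM[OF psf]) (use Z in auto)
    moreover have "(\<Prod>i\<in>{..<n k}. emeasure kappa Z) = ennreal (prob Z ^ n k)"
      unfolding emeasure_eq_measure prod_constant by (simp add: ennreal_power)
    ultimately show ?thesis by (intro measure_eq_emeasure_eq_ennreal) simp_all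
  qed
  moreover have "(%k. prob Z ^ n k) \<longlonglongrightarrow> 0"
    by (rule filterlim_compose[OF LIMSEQ_realpow_zero n]) (use Z1 in simp_all)
  ultimately show ?thesis by simp
qed

end

subsection \<open>The law of the sample\<close>

lemma distr_Gam_Suc:
  shows Gam_split_measurable: "(%x. (x 0, \<lambda>j\<in>{..q}. x (Suc j))) \<in> Gam {..Suc q} \<rightarrow>\<^sub>M gauss \<Otimes>\<^sub>M Gam {..q}"
    and "distr (Gam {..Suc q}) (gauss \<Otimes>\<^sub>M Gam {..q}) (%x. (x 0, \<lambda>j\<in>{..q}. x (Suc j))) =
      gauss \<Otimes>\<^sub>M Gam {..q}"
proof -
  let ?NG = "gauss \<Otimes>\<^sub>M Gam {..q}"
  let ?s = "%x. (x 0, \<lambda>j\<in>{..q}. x (Suc j))" and ?J = "%z. \<lambda>i\<in>{..Suc q}. case i of 0 => fst z | Suc j => snd z j"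
  interpret G: prob_space "Gam {..q}" by (rule prob_space_Gam)
  have s: "?s \<in> Gam {..Suc q} \<rightarrow>\<^sub>M ?NG"
  proof (rule measurable_Pair)
    show "(%x. x 0) \<in> Gam {..Suc q} \<rightarrow>\<^sub>M gauss"
      using Gam_component_measurable[of 0 "{..Suc q}"] by simp
    show "(%x. \<lambda>j\<in>{..q}. x (Suc j)) \<in> Gam {..Suc q} \<rightarrow>\<^sub>M Gam {..q}"
    proof (rule measurable_GamI)
      fix j assume "j \<in> {..q}"
      then show "(%x. (\<lambda>j\<in>{..q}. x (Suc j)) j) \<in> borel_measurable (Gam {..Suc q})"
        using Gam_component_measurable[of "Suc j" "{..Suc q}"] by simp
    qed simp
  qed
  then show "?s \<in> Gam {..Suc q} \<rightarrow>\<^sub>M ?NG" .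
  have J: "?J \<in> ?NG \<rightarrow>\<^sub>M Gam {..Suc q}"
  proof (rule measurable_GamI)
    fix i assume i: "i \<in> {..Suc q}"
    show "(%z. ?J z i) \<in> borel_measurable ?NG"
    proof (cases i)
      case 0
      have "fst \<in> ?NG \<rightarrow>\<^sub>M gauss" by (rule measurable_fst)
      then show ?thesis using 0 by simp
    next
      case (Suc j)
      then have "j \<in> {..q}" using i by simp
      from measurable_compose[OF measurable_snd Gam_component_measurable[OF this]] show ?thesis using Suc i by simp
    qed
  qed simp
  have dJ: "distr ?NG (Gam {..Suc q}) ?J = Gam {..Suc q}"
  proof (subst (2) Gam_def, rule product_sigma_finite.PiM_eqI[OF product_sigma_finite_std_normal])
    show "sets (distr ?NG (Gam {..Suc q}) ?J) = sets (PiM {..Suc q} (%_. gauss))"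
      by (simp add: Gam_def[symmetric] del: sets_Gam)
    fix C :: "nat => real set" assume C: "\<And>i. i \<in> {..Suc q} ==> C i \<in> sets gauss"
    have Cm: "Pi\<^sub>E {..Suc q} C \<in> sets (Gam {..Suc q})"
      unfolding Gam_def using C by (intro sets_PiM_I_finite) auto
    have "?J -` Pi\<^sub>E {..Suc q} C \<inter> space ?NG = C 0 \<times> (\<Pi>\<^sub>E j\<in>{..q}. C (Suc j))"
    proof (intro set_eqI iffI)
      fix z assume z: "z \<in> ?J -` Pi\<^sub>E {..Suc q} C \<inter> space ?NG"
      then have c: "?J z i \<in> C i" if "i \<le> Suc q" for i using that by (auto simp: PiE_iff)
      have "fst z \<in> C 0" using c[of 0] by simp
      moreover have "snd z j \<in> C (Suc j)" if "j \<le> q" for j using c[of "Suc j"] that by simp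
      moreover have "snd z \<in> extensional {..q}" using z by (auto simp: space_pair_measure PiE_iff)
      ultimately show "z \<in> C 0 \<times> (\<Pi>\<^sub>E j\<in>{..q}. C (Suc j))" by (auto simp: mem_Times_iff PiE_iff)
    next
      fix z assume "z \<in> C 0 \<times> (\<Pi>\<^sub>E j\<in>{..q}. C (Suc j))"
      then show "z \<in> ?J -` Pi\<^sub>E {..Suc q} C \<inter> space ?NG"
        by (auto simp: space_pair_measure PiE_iff split: nat.split)
    qed
    then have "emeasure (distr ?NG (Gam {..Suc q}) ?J) (Pi\<^sub>E {..Suc q} C) = emeasure ?NG (C 0 \<times> (\<Pi>\<^sub>E j\<in>{..q}. C (Suc j)))"
      using emeasure_distr[OF J Cm] by simp
    also have "\<dots> = emeasure gauss (C 0) * emeasure (Gam {..q}) (\<Pi>\<^sub>E j\<in>{..q}. C (Suc j))"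
    proof (rule G.emeasure_pair_measure_Times)
      show "C 0 \<in> sets gauss" using C by simp
      show "(\<Pi>\<^sub>E j\<in>{..q}. C (Suc j)) \<in> sets (Gam {..q})"
        unfolding Gam_def using C by (intro sets_PiM_I_finite) auto
    qed
    also have "emeasure (Gam {..q}) (\<Pi>\<^sub>E j\<in>{..q}. C (Suc j)) = (\<Prod>j\<le>q. emeasure gauss (C (Suc j)))"
      unfolding Gam_def by (rule product_sigma_finite.emeasure_PiM[OF product_sigma_finite_std_normal]) (use C in auto)
    also have "emeasure gauss (C 0) * \<dots> = (\<Prod>i\<in>{..Suc q}. emeasure gauss (C i))"
      by (rule prod.atMost_Suc_shift[symmetric])
    finally show "emeasure (distr ?NG (Gam {..Suc q}) ?J) (Pi\<^sub>E {..Suc q} C) =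
      (\<Prod>i\<in>{..Suc q}. emeasure gauss (C i))" .
  qed simp
  have "distr (Gam {..Suc q}) ?NG ?s = distr (distr ?NG (Gam {..Suc q}) ?J) ?NG ?s" unfolding dJ ..
  also have "\<dots> = distr ?NG ?NG (?s \<circ> ?J)" by (rule distr_distr[OF s J])
  also have "\<dots> = distr ?NG ?NG (%z. z)"
  proof (rule distr_cong[OF refl refl])
    fix z assume "z \<in> space ?NG"
    then have "snd z \<in> extensional {..q}" by (auto simp: space_pair_measure PiE_iff)
    then have "(\<lambda>j\<in>{..q}. snd z j) = snd z" by (simp add: extensional_restrict)
    moreover have "(\<lambda>j\<in>{..q}. ?J z (Suc j)) = (\<lambda>j\<in>{..q}. snd z j)" by (rule restrict_ext) simp
    ultimately show "(?s \<circ> ?J) z = z" by (simp add: prod_eq_iff)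
  qed
  finally show "distr (Gam {..Suc q}) ?NG ?s = ?NG" by simp
qed

text \<open>The first reflection takes \<open>w\<close> to axis 0. The second takes the image of
  \<open>f\<close> to axis \<open>Suc q\<close>, and it fixes axis 0 if \<open>f\<close> is
  orthogonal to \<open>w\<close>. The vector \<open>f = 0\<close> is permitted; then only
  \<open>w\<close> is moved.\<close>

definition rot :: "nat => (nat => real) => (nat => real) => (nat => real) => nat => real" where
  "rot q w f = (let S = {..Suc q}; a = (%i. w i - (if i = 0 then nrm S w else 0)); g = hrefl S a f;
     b = (%i. g i - (if i = Suc q then nrm S g else 0)) in (%x. hrefl S b (hrefl S a x)))"

lemma rot:
  fixes q :: nat
  assumes w: "ip {..Suc q} w w = 1" and f: "ip {..Suc q} f w = 0"
  shows mpres_rot: "mpres (Gam {..Suc q}) (rot q w f)"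
    and ip_rot: "ip {..Suc q} (rot q w f x) (rot q w f y) = ip {..Suc q} x y"
    and rot_surj: "\<exists>x. rot q w f x = y"
    and rot_first: "rot q w f x 0 = ip {..Suc q} x w"
    and rot_last: "nrm {..Suc q} f * rot q w f x (Suc q) = ip {..Suc q} x f"
proof -
  let ?S = "{..Suc q}"
  define a where "a = (%i. w i - (if i = 0 then nrm ?S w else 0))"
  define g where "g = hrefl ?S a f"
  define b where "b = (%i. g i - (if i = Suc q then nrm ?S g else 0))"
  have R: "rot q w f x = hrefl ?S b (hrefl ?S a x)" for x unfolding rot_def Let_def a_def g_def b_def ..
  show "mpres (Gam ?S) (rot q w f)"
    unfolding R[abs_def] by (rule mpres_comp) (rule mpres_hrefl; simp)+
  have iso: "ip ?S (rot q w f x) (rot q w f y) = ip ?S x y" for x y unfolding R by (simp add: ip_hrefl)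
  show "ip ?S (rot q w f x) (rot q w f y) = ip ?S x y" by (rule iso)
  show "\<exists>x. rot q w f x = y" unfolding R by (rule exI[of _ "hrefl ?S a (hrefl ?S b y)"]) (simp add: hrefl_hrefl)
  have aw: "hrefl ?S a w i = (if i = 0 then 1 else 0)" if "i \<in> ?S" for i
    using hrefl_to_axis[of ?S 0 i w] that w by (simp add: a_def)
  have g0: "g 0 = 0"
  proof -
    have "ip ?S g (hrefl ?S a w) = 0" unfolding g_def by (simp add: ip_hrefl f)
    also have "ip ?S g (hrefl ?S a w) = ip ?S g (%i. if i = 0 then 1 else 0)"
      by (rule ip_cong) (simp_all add: aw)
    also have "\<dots> = g 0" by (simp add: ip_def if_distrib cong: if_cong)
    finally show ?thesis by simp
  qed
  have Rw: "rot q w f w i = (if i = 0 then 1 else 0)" if i: "i \<in> ?S" for i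
  proof -
    have "rot q w f w i = hrefl ?S b (%i. if i = 0 then 1 else 0) i"
      unfolding R by (rule hrefl_cong[OF aw i])
    also have "hrefl ?S b (%i. if i = 0 then 1 else 0) = (%i. if i = 0 then 1 else 0)"
    proof (rule hrefl_orth)
      have "ip ?S (%i. if i = 0 then 1 else 0) b = b 0" by (simp add: ip_def if_distrib if_distribR cong: if_cong)
      then show "ip ?S (%i. if i = 0 then 1 else 0) b = 0" by (simp add: b_def g0)
    qed
    finally show ?thesis .
  qed
  have Rf: "rot q w f f i = (if i = Suc q then nrm ?S f else 0)" if i: "i \<in> ?S" for i
    using hrefl_to_axis[of ?S "Suc q" i g] i nrm_hrefl[of ?S a f] unfolding R b_def by (simp add: g_def[symmetric])
  have "rot q w f x 0 = ip ?S (rot q w f x) (%i. if i = 0 then 1 else 0)"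
    by (simp add: ip_def if_distrib cong: if_cong)
  also have "\<dots> = ip ?S (rot q w f x) (rot q w f w)" by (rule ip_cong) (simp_all add: Rw)
  finally show "rot q w f x 0 = ip ?S x w" by (simp add: iso)
  have "nrm ?S f * rot q w f x (Suc q) = ip ?S (rot q w f x) (%i. if i = Suc q then nrm ?S f else 0)"
    by (simp add: ip_def if_distrib cong: if_cong)
  also have "\<dots> = ip ?S (rot q w f x) (rot q w f f)" by (rule ip_cong) (simp_all add: Rf)
  finally show "nrm ?S f * rot q w f x (Suc q) = ip ?S x f" by (simp add: iso)
qed

lemma atMost_prod: "{..(a, t)} = {..a} \<times> {..t::'b::preorder}" for a :: "'a::preorder"
  by (auto simp: less_eq_prod_def)

text \<open>The conditional law of \<open>y\<close> given \<open>x\<close> only involves the first coordinate of \<open>R x\<close>, so the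
  remaining ones are independent of \<open>y\<close> as well.\<close>

lemma observation_law:
  fixes x :: "'a => nat => real" and y :: "'a => real" and c :: "real => real"
  assumes M: "prob_space M" and x: "x \<in> M \<rightarrow>\<^sub>M borel_vec (Suc (Suc q))" and y: "y \<in> borel_measurable M"
    and law: "distr M (borel_vec (Suc (Suc q))) x = std_gaussian_vec (Suc (Suc q))"
    and F: "\<And>t. F t \<in> borel_measurable borel" "\<And>t u. 0 \<le> F t u \<and> F t u \<le> 1"
    and cond: "\<And>t. AE omega in M. real_cond_exp M (vimage_algebra (space M) x (borel_vec (Suc (Suc q))))
      (indicator {omega' \<in> space M. y omega' \<le> t}) omega = F t (R (x omega) 0)"
    and R: "mpres (Gam {..Suc q}) R" and c: "c \<in> borel_measurable borel"
  defines "u \<equiv> %omega. R (x omega) 0" and "z \<equiv> %omega. \<lambda>j\<in>{..q}. R (x omega) (Suc j)"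
  shows "distr M ((borel \<Otimes>\<^sub>M borel) \<Otimes>\<^sub>M Gam {..q}) (%omega. ((u omega, c (y omega)), z omega)) =
      distr M (borel \<Otimes>\<^sub>M borel) (%omega. (u omega, c (y omega))) \<Otimes>\<^sub>M Gam {..q}"
    and "distr M borel u = gauss"
proof -
  interpret prob_space M by fact
  let ?V = "borel_vec (Suc (Suc q))" and ?NG = "gauss \<Otimes>\<^sub>M Gam {..q}"
  have idx: "{..<Suc (Suc q)} = {..Suc q}" by auto
  have gl: "std_gaussian_vec (Suc (Suc q)) = Gam {..Suc q}" by (simp add: std_gaussian_vec_def Gam_def idx)
  have setsV: "sets ?V = sets (Gam {..Suc q})" unfolding idx by simp
  have x': "x \<in> M \<rightarrow>\<^sub>M Gam {..Suc q}" using x measurable_cong_sets[OF refl setsV, of M] by blast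
  have law': "distr M (Gam {..Suc q}) x = Gam {..Suc q}"
    using law distr_cong[OF refl setsV, of M x x] unfolding gl by simp
  note Rm = mpres_measurable[OF R]
  have lawR: "distr M (Gam {..Suc q}) (%omega. R (x omega)) = Gam {..Suc q}"
  proof -
    have "distr M (Gam {..Suc q}) (R \<circ> x) = distr (distr M (Gam {..Suc q}) x) (Gam {..Suc q}) R"
      by (rule distr_distr[OF Rm x', symmetric])
    also have "\<dots> = Gam {..Suc q}" unfolding law' using R by (simp add: mpres_def)
    finally show ?thesis by (simp add: comp_def)
  qed
  have Rx: "(%omega. R (x omega)) \<in> M \<rightarrow>\<^sub>M Gam {..Suc q}" by (rule measurable_compose[OF x' Rm])
  have uz: "(%omega. (u omega, z omega)) \<in> M \<rightarrow>\<^sub>M ?NG"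
    unfolding u_def z_def by (rule measurable_compose[OF Rx Gam_split_measurable])
  have lawuz: "distr M ?NG (%omega. (u omega, z omega)) = ?NG"
  proof -
    have "distr M ?NG ((%x. (x 0, \<lambda>j\<in>{..q}. x (Suc j))) \<circ> (%omega. R (x omega))) =
        distr (distr M (Gam {..Suc q}) (%omega. R (x omega))) ?NG (%x. (x 0, \<lambda>j\<in>{..q}. x (Suc j)))"
      by (rule distr_distr[OF Gam_split_measurable Rx, symmetric])
    also have "\<dots> = ?NG" unfolding lawR by (rule distr_Gam_Suc(2))
    finally show ?thesis by (simp add: comp_def u_def z_def)
  qed
  interpret G: prob_space "Gam {..q}" by (rule prob_space_Gam)
  interpret Nn: prob_space gauss by (rule prob_space_std_normal)
  have u: "u \<in> M \<rightarrow>\<^sub>M gauss" and z: "z \<in> M \<rightarrow>\<^sub>M Gam {..q}"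
    using measurable_compose[OF uz measurable_fst] measurable_compose[OF uz measurable_snd] by simp_all
  have ub: "u \<in> borel_measurable M" using u by simp
  have du: "distr M gauss u = gauss"
  proof -
    have "distr M gauss (fst \<circ> (%omega. (u omega, z omega))) = distr (distr M ?NG (%omega. (u omega, z omega))) gauss fst"
      by (rule distr_distr[OF measurable_fst uz, symmetric])
    also have "\<dots> = gauss" unfolding lawuz by (rule G.distr_pair_fst)
    finally show ?thesis by (simp add: comp_def)
  qed
  then show "distr M borel u = gauss"
    using distr_cong[of M M gauss borel u u] by simp
  have dz: "distr M (Gam {..q}) z = Gam {..q}"
  proof -
    have "distr M (Gam {..q}) (snd \<circ> (%omega. (u omega, z omega))) = distr (distr M ?NG (%omega. (u omega, z omega))) (Gam {..q}) snd"
      by (rule distr_distr[OF measurable_snd uz, symmetric])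
    also have "\<dots> = Gam {..q}" unfolding lawuz by (rule distr_pair_snd[OF prob_space_std_normal prob_space_Gam])
    finally show ?thesis by (simp add: comp_def)
  qed
  interpret P: pair_prob_space gauss "Gam {..q}" ..
  let ?A = "vimage_algebra (space M) x ?V"
  have sub: "subalgebra M ?A" unfolding subalgebra_def using sets_image_in_sets[OF refl x] by simp
  interpret A: finite_measure_subalgebra M ?A
    by (rule finite_measure_subalgebra.intro[OF finite_measure_axioms]) (rule finite_measure_subalgebra_axioms.intro[OF sub])
  have xA: "x \<in> ?A \<rightarrow>\<^sub>M Gam {..Suc q}"
  proof -
    have "x \<in> ?A \<rightarrow>\<^sub>M ?V" using measurable_space[OF x] by (intro measurable_vimage_algebra1) auto
    then show ?thesis using measurable_cong_sets[OF refl setsV, of ?A] by blast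
  qed
  have uzA: "(%omega. (u omega, z omega)) \<in> ?A \<rightarrow>\<^sub>M ?NG"
    unfolding u_def z_def by (rule measurable_compose[OF measurable_compose[OF xA Rm] Gam_split_measurable])
  have uA: "u \<in> borel_measurable ?A" and zA: "z \<in> ?A \<rightarrow>\<^sub>M Gam {..q}"
    using measurable_compose[OF uzA measurable_fst] measurable_compose[OF uzA measurable_snd] by simp_all
  \<comment> \<open>It suffices to treat the generators \<open>u \<le> a\<close>,
    \<open>y \<le> t\<close>. Conditioning on \<open>x\<close> replaces the event for
    \<open>y\<close> by \<open>F t u\<close>, a function of \<open>u\<close> alone, and
    \<open>u\<close> is independent of \<open>z\<close>.\<close>
  have key: "prob {omega \<in> space M. u omega \<le> a \<and> y omega \<le> t \<and> z omega \<in> C} = (\<integral>omega. indicator {..a} (u omega) * F t (u omega) \<partial>M) * prob {omega \<in> space M. z omega \<in> C}"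
    if C: "C \<in> sets (Gam {..q})" for a t C
  proof -
    define h where "h v = indicator {..a} v * F t v" for v
    have hm: "h \<in> borel_measurable borel" unfolding h_def using F(1) by measurable
    have h1: "\<bar>h v\<bar> \<le> 1" for v using F(2)[of t v] by (auto simp: h_def split: split_indicator)
    \<comment> \<open>Measurable with respect to \<open>x\<close>, so it may be moved across the
      conditional expectation.\<close>
    define I where "I omega = (indicator {..a} (u omega) * indicator C (z omega) :: real)" for omega
    have IA: "I \<in> borel_measurable ?A"
      unfolding I_def using measurable_compose[OF zA borel_measurable_indicator[OF C]] uA by measurable
    let ?Y = "{omega' \<in> space M. y omega' \<le> t}"
    have Y: "?Y \<in> sets M" using y by measurable
    have Im: "I \<in> borel_measurable M" by (rule measurable_from_subalg[OF sub IA])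
    have int: "integrable M (%omega. I omega * indicator ?Y omega)"
    proof (rule integrable_const_bound[of _ 1])
      show "(%omega. I omega * indicator ?Y omega) \<in> borel_measurable M" using Im Y by measurable
    qed (auto simp: I_def split: split_indicator)
    have E: "{omega \<in> space M. u omega \<le> a \<and> y omega \<le> t \<and> z omega \<in> C} \<in> sets M"
    proof -
      have "{omega \<in> space M. u omega \<le> a} \<in> sets M" using ub by measurable
      moreover have "{omega \<in> space M. z omega \<in> C} \<in> sets M" using measurable_sets[OF z C] by (simp add: vimage_def Int_def conj_commute)
      ultimately show ?thesis using Y by (intro sets.sets_Collect_conj)
    qed
    have "prob {omega \<in> space M. u omega \<le> a \<and> y omega \<le> t \<and> z omega \<in> C} = (\<integral>omega. indicator {omega \<in> space M. u omega \<le> a \<and> y omega \<le> t \<and> z omega \<in> C} omega \<partial>M)"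
      using E by simp
    also have "\<dots> = (\<integral>omega. I omega * indicator ?Y omega \<partial>M)"
      by (intro Bochner_Integration.integral_cong) (auto simp: I_def split: split_indicator)
    also have "\<dots> = (\<integral>omega. I omega * real_cond_exp M ?A (indicator ?Y) omega \<partial>M)"
      by (rule A.real_cond_exp_intg(2)[symmetric, OF int IA]) (use Y in simp)
    also have "\<dots> = (\<integral>omega. h (u omega) * indicator C (z omega) \<partial>M)"
    proof (rule integral_cong_AE)
      show "AE omega in M. I omega * real_cond_exp M ?A (indicator ?Y) omega = h (u omega) * indicator C (z omega)"
        using cond[of t] by eventually_elim (simp add: I_def h_def u_def mult_ac)
      show "(%omega. I omega * real_cond_exp M ?A (indicator ?Y) omega) \<in> borel_measurable M"
        using Im by (intro borel_measurable_times borel_measurable_cond_exp2)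
      show "(%omega. h (u omega) * indicator C (z omega)) \<in> borel_measurable M"
        by (intro borel_measurable_times measurable_compose[OF ub hm] measurable_compose[OF z borel_measurable_indicator[OF C]])
    qed
    also have "\<dots> = (\<integral>omega. h (u omega) \<partial>M) * (\<integral>omega. indicator C (z omega) \<partial>M)"
    proof -
      have hN: "h \<in> borel_measurable gauss" using hm by simp
      define f where "f p = h (fst p) * (indicator C (snd p) :: real)" for p
      have f: "f \<in> borel_measurable ?NG"
        unfolding f_def by (intro borel_measurable_times measurable_compose[OF measurable_fst hN]
          measurable_compose[OF measurable_snd borel_measurable_indicator[OF C]])
      have "integrable ?NG f"
        using f h1 by (intro P.integrable_const_bound[of _ 1]) (auto simp: f_def split: split_indicator)
      from P.integral_fst'[OF this]
      have "(\<integral>p. f p \<partial>?NG) = (\<integral>v. \<integral>x. f (v, x) \<partial>Gam {..q} \<partial>gauss)" by simp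
      also have "\<dots> = (\<integral>v. h v * (\<integral>x. (indicator C x :: real) \<partial>Gam {..q}) \<partial>gauss)" by (simp add: f_def)
      also have "\<dots> = (\<integral>v. h v \<partial>gauss) * (\<integral>x. (indicator C x :: real) \<partial>Gam {..q})" by simp
      also have "(\<integral>v. h v \<partial>gauss) = (\<integral>omega. h (u omega) \<partial>M)"
        using integral_distr[OF u hN] unfolding du .
      also have "(\<integral>x. (indicator C x :: real) \<partial>Gam {..q}) = (\<integral>omega. indicator C (z omega) \<partial>M)"
        using integral_distr[OF z borel_measurable_indicator[OF C]] unfolding dz .
      also have "(\<integral>p. f p \<partial>?NG) = (\<integral>omega. f (u omega, z omega) \<partial>M)"
        using integral_distr[OF uz f] unfolding lawuz .
      finally show ?thesis by (simp add: f_def)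
    qed
    also have "(\<integral>omega. (indicator C (z omega) :: real) \<partial>M) = (\<integral>omega. indicator {omega \<in> space M. z omega \<in> C} omega \<partial>M)"
      by (intro Bochner_Integration.integral_cong) (auto split: split_indicator)
    also have "\<dots> = prob {omega \<in> space M. z omega \<in> C}"
      using measurable_sets[OF z C] by (simp add: vimage_def Int_def conj_commute)
    finally show ?thesis unfolding h_def .
  qed
  have uy: "(%omega. (u omega, y omega)) \<in> M \<rightarrow>\<^sub>M borel \<Otimes>\<^sub>M borel" using ub y by measurable
  define E1 where "E1 = range (%c::real \<times> real. (%omega. (u omega, y omega)) -` {..c} \<inter> space M)"
  define E2 where "E2 = {z -` C \<inter> space M | C. C \<in> sets (Gam {..q})}"
  have gen: "{(%omega. (u omega, y omega)) -` D \<inter> space M | D. D \<in> sets (borel \<Otimes>\<^sub>M borel)} = sigma_sets (space M) E1"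
  proof -
    have b: "sets (borel \<Otimes>\<^sub>M borel) = sigma_sets UNIV (range (%c::real \<times> real. {..c}))"
      unfolding borel_prod unfolding borel_eq_atMost by (rule sets_measure_of) auto
    have e: "E1 = {(%omega. (u omega, y omega)) -` D \<inter> space M | D. D \<in> range (%c::real \<times> real. {..c})}"
      by (auto simp: E1_def)
    show ?thesis unfolding b e by (rule sigma_sets_vimage_commute) simp
  qed
  have "indep_set (sigma_sets (space M) E1) (sigma_sets (space M) E2)"
  proof (rule indep_set_sigma_sets)
    show "Int_stable E1"
      unfolding E1_def
    proof (rule Int_stableI_image)
      fix c d :: "real \<times> real"
      have "{..c} \<inter> {..d} = {..inf c d}" by auto
      then show "\<exists>k\<in>UNIV. ((%omega. (u omega, y omega)) -` {..c} \<inter> space M) \<inter> ((%omega. (u omega, y omega)) -` {..d} \<inter> space M) =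
         (%omega. (u omega, y omega)) -` {..k} \<inter> space M" by blast
    qed
    show "Int_stable E2"
    proof (rule Int_stableI)
      fix a b assume "a \<in> E2" "b \<in> E2"
      then obtain C D where "C \<in> sets (Gam {..q})" "D \<in> sets (Gam {..q})" "a = z -` C \<inter> space M" "b = z -` D \<inter> space M"
        unfolding E2_def by blast
      then show "a \<inter> b \<in> E2" unfolding E2_def by (intro CollectI exI[of _ "C \<inter> D"]) auto
    qed
    show "indep_set E1 E2"
    proof (rule indep_setI)
      show "E1 \<subseteq> events"
      proof
        fix e assume "e \<in> E1"
        then obtain c where c: "e = (%omega. (u omega, y omega)) -` {..c} \<inter> space M" by (auto simp: E1_def)
        have "{..c} \<in> sets (borel \<Otimes>\<^sub>M borel)" unfolding borel_prod by simp
        from measurable_sets[OF uy this] show "e \<in> events" unfolding c .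
      qed
      show "E2 \<subseteq> events" using measurable_sets[OF z] by (auto simp: E2_def)
      fix e g assume "e \<in> E1" "g \<in> E2"
      then obtain c C where c: "e = (%omega. (u omega, y omega)) -` {..c} \<inter> space M" and C: "C \<in> sets (Gam {..q})" "g = z -` C \<inter> space M"
        unfolding E1_def E2_def by blast
      obtain a t where at: "c = (a, t)" by (cases c)
      have e: "e = {omega \<in> space M. u omega \<le> a \<and> y omega \<le> t \<and> z omega \<in> space (Gam {..q})}"
        unfolding c at atMost_prod using measurable_space[OF z] by auto
      have g: "g = {omega \<in> space M. z omega \<in> C}" unfolding C by auto
      have eg: "e \<inter> g = {omega \<in> space M. u omega \<le> a \<and> y omega \<le> t \<and> z omega \<in> C}"
        unfolding c at atMost_prod C by auto
      \<comment> \<open>The whole space as third event recovers the marginal probability from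
        \<open>key\<close>.\<close>
      have one: "prob {omega \<in> space M. z omega \<in> space (Gam {..q})} = 1"
      proof -
        have "{omega \<in> space M. z omega \<in> space (Gam {..q})} = space M" using measurable_space[OF z] by auto
        then show ?thesis using prob_space by (simp only:)
      qed
      show "prob (e \<inter> g) = prob e * prob g"
        unfolding eg key[OF C(1)] unfolding e g key[OF sets.top] one by simp
    qed
  qed
  note ind = indep_setD[OF this]
  let ?L = "distr M (borel \<Otimes>\<^sub>M borel) (%omega. (u omega, c (y omega)))"
  have uc: "(%omega. (u omega, c (y omega))) \<in> M \<rightarrow>\<^sub>M borel \<Otimes>\<^sub>M borel"
    by (intro measurable_Pair ub measurable_compose[OF y c])
  have cc: "(%z. (fst z, c (snd z))) \<in> borel \<Otimes>\<^sub>M borel \<rightarrow>\<^sub>M (borel :: real measure) \<Otimes>\<^sub>M borel"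
    by (intro measurable_Pair measurable_fst measurable_compose[OF measurable_snd c])
  show "distr M ((borel \<Otimes>\<^sub>M borel) \<Otimes>\<^sub>M Gam {..q}) (%omega. ((u omega, c (y omega)), z omega)) = ?L \<Otimes>\<^sub>M Gam {..q}"
  proof (subst (2) dz[symmetric], rule distr_pair_indep[OF M uc z])
    fix A :: "(real \<times> real) set" and C assume A: "A \<in> sets (borel \<Otimes>\<^sub>M borel)" and C: "C \<in> sets (Gam {..q})"
    let ?D = "(%z. (fst z, c (snd z))) -` A"
    have D: "?D \<in> sets (borel \<Otimes>\<^sub>M borel)" using measurable_sets[OF cc A] by (simp add: space_pair_measure)
    have e: "(%omega. (u omega, c (y omega))) -` A \<inter> space M = (%omega. (u omega, y omega)) -` ?D \<inter> space M" by auto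
    show "prob (((%omega. (u omega, c (y omega))) -` A \<inter> space M) \<inter> (z -` C \<inter> space M)) =
        prob ((%omega. (u omega, c (y omega))) -` A \<inter> space M) * prob (z -` C \<inter> space M)"
      unfolding e
    proof (rule ind)
      show "(%omega. (u omega, y omega)) -` ?D \<inter> space M \<in> sigma_sets (space M) E1" unfolding gen[symmetric] using D by blast
      show "z -` C \<inter> space M \<in> sigma_sets (space M) E2" using C by (intro sigma_sets.Basic) (auto simp: E2_def)
    qed
  qed
qed

text \<open>Each transformed row is one fixed function of \<open>(x i, y i)\<close>, so that
  independence of the rows is inherited.\<close>

lemma sample_law:
  fixes x :: "nat => 'a => nat => real" and c :: "real => real"
  assumes F: "\<And>t. F t \<in> borel_measurable borel" "\<And>t u. 0 \<le> F t u \<and> F t u \<le> 1"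
    and s: "single_index_sample F \<Y> M n (Suc (Suc q)) w x y" and n: "n > 0"
    and c: "c \<in> borel_measurable borel"
    and R: "mpres (Gam {..Suc q}) R" and Rw: "\<And>x. R x 0 = inner_prod (Suc (Suc q)) x w"
    and kappa: "prob_space kappa" "sets kappa = sets (borel \<Otimes>\<^sub>M borel)"
    and law: "\<And>i. i < n ==> distr M (borel \<Otimes>\<^sub>M borel) (%omega. (inner_prod (Suc (Suc q)) (x i omega) w, c (y i omega))) = kappa"
  defines "theta \<equiv> %omega. \<lambda>i\<in>{..<n}. ((inner_prod (Suc (Suc q)) (x i omega) w, c (y i omega)), \<lambda>j\<in>{..q}. R (x i omega) (Suc j))"
  shows sample_law_measurable: "theta \<in> M \<rightarrow>\<^sub>M PiM {..<n} (%_. kappa \<Otimes>\<^sub>M Gam {..q})"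
    and "distr M (PiM {..<n} (%_. kappa \<Otimes>\<^sub>M Gam {..q})) theta = PiM {..<n} (%_. kappa \<Otimes>\<^sub>M Gam {..q})"
proof -
  let ?p = "Suc (Suc q)" and ?T = "kappa \<Otimes>\<^sub>M Gam {..q}"
  note s' = s[unfolded single_index_sample_def]
  have M: "prob_space M" using s' by blast
  interpret prob_space M by fact
  have idx: "{..<Suc (Suc q)} = {..Suc q}" by auto
  have setsV: "sets (borel_vec ?p) = sets (Gam {..Suc q})" unfolding idx by simp
  define f where "f z = ((R (fst z) 0, c (snd z)), \<lambda>j\<in>{..q}. R (fst z) (Suc j))" for z
  have f: "f \<in> borel_vec ?p \<Otimes>\<^sub>M borel \<rightarrow>\<^sub>M ?T"
  proof -
    have "fst \<in> borel_vec ?p \<Otimes>\<^sub>M borel \<rightarrow>\<^sub>M Gam {..Suc q}"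
      using measurable_fst[of "borel_vec ?p" borel] measurable_cong_sets[OF refl setsV, of "borel_vec ?p \<Otimes>\<^sub>M borel"] by blast
    from measurable_compose[OF measurable_compose[OF this mpres_measurable[OF R]] Gam_split_measurable]
    have r: "(%z. (R (fst z) 0, \<lambda>j\<in>{..q}. R (fst z) (Suc j))) \<in> borel_vec ?p \<Otimes>\<^sub>M borel \<rightarrow>\<^sub>M gauss \<Otimes>\<^sub>M Gam {..q}" .
    have "(%z. R (fst z) 0) \<in> borel_measurable (borel_vec ?p \<Otimes>\<^sub>M borel)" using measurable_compose[OF r measurable_fst] by simp
    moreover have "(%z. c (snd z)) \<in> borel_measurable (borel_vec ?p \<Otimes>\<^sub>M borel)" by (rule measurable_compose[OF measurable_snd c])
    ultimately have "(%z. (R (fst z) 0, c (snd z))) \<in> borel_vec ?p \<Otimes>\<^sub>M borel \<rightarrow>\<^sub>M borel \<Otimes>\<^sub>M borel" by (rule measurable_Pair)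
    then have "(%z. (R (fst z) 0, c (snd z))) \<in> borel_vec ?p \<Otimes>\<^sub>M borel \<rightarrow>\<^sub>M kappa"
      using measurable_cong_sets[OF refl kappa(2), of "borel_vec ?p \<Otimes>\<^sub>M borel"] by blast
    moreover have "(%z. \<lambda>j\<in>{..q}. R (fst z) (Suc j)) \<in> borel_vec ?p \<Otimes>\<^sub>M borel \<rightarrow>\<^sub>M Gam {..q}"
      using measurable_compose[OF r measurable_snd] by simp
    ultimately show ?thesis unfolding f_def[abs_def] by (rule measurable_Pair)
  qed
  have fx: "f (x i omega, y i omega) = ((inner_prod ?p (x i omega) w, c (y i omega)), \<lambda>j\<in>{..q}. R (x i omega) (Suc j))" for i omega
    by (simp add: f_def Rw)
  have "indep_vars (%_. borel_vec ?p \<Otimes>\<^sub>M borel) (%i omega. (x i omega, y i omega)) {..<n}" using s' by blast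
  from indep_vars_compose2[OF this, of "%_. f" "%_. ?T"] f
  have iv: "indep_vars (%_. ?T) (%i omega. f (x i omega, y i omega)) {..<n}" by blast
  have rv: "(%omega. f (x i omega, y i omega)) \<in> M \<rightarrow>\<^sub>M ?T" if "i < n" for i
    using iv that unfolding indep_vars_def2 by blast
  have one: "distr M ?T (%omega. f (x i omega, y i omega)) = ?T" if i: "i < n" for i
  proof -
    have a1: "x i \<in> M \<rightarrow>\<^sub>M borel_vec ?p" and a2: "y i \<in> borel_measurable M"
      and a3: "distr M (borel_vec ?p) (x i) = std_gaussian_vec ?p" using s' i by blast+
    have a4: "AE omega in M. real_cond_exp M (vimage_algebra (space M) (x i) (borel_vec ?p))
        (indicator {omega' \<in> space M. y i omega' \<le> t}) omega = F t (R (x i omega) 0)" for t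
      using s' i unfolding Rw by blast
    have "distr M (borel \<Otimes>\<^sub>M borel) (%omega. (R (x i omega) 0, c (y i omega))) \<Otimes>\<^sub>M Gam {..q} =
      distr M ((borel \<Otimes>\<^sub>M borel) \<Otimes>\<^sub>M Gam {..q}) (%omega. f (x i omega, y i omega))"
      unfolding f_def fst_conv snd_conv by (rule observation_law(1)[OF M a1 a2 a3 F a4 R c, symmetric])
    also have "distr M (borel \<Otimes>\<^sub>M borel) (%omega. (R (x i omega) 0, c (y i omega))) = kappa" using law[OF i] unfolding Rw .
    also have "distr M ((borel \<Otimes>\<^sub>M borel) \<Otimes>\<^sub>M Gam {..q}) (%omega. f (x i omega, y i omega)) = distr M ?T (%omega. f (x i omega, y i omega))"
      by (intro distr_cong refl sets_pair_measure_cong) (simp_all add: kappa(2))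
    finally show ?thesis by simp
  qed
  have th: "theta = (%omega. \<lambda>i\<in>{..<n}. f (x i omega, y i omega))" unfolding theta_def fx ..
  show "theta \<in> M \<rightarrow>\<^sub>M PiM {..<n} (%_. ?T)" unfolding th by (rule measurable_restrict) (use rv in simp)
  have "distr M (PiM {..<n} (%_. ?T)) (%omega. \<lambda>i\<in>{..<n}. f (x i omega, y i omega)) = PiM {..<n} (%i. distr M ?T (%omega. f (x i omega, y i omega)))"
    using iv n rv by (subst (asm) indep_vars_iff_distr_eq_PiM') auto
  also have "\<dots> = PiM {..<n} (%_. ?T)" using one by (intro PiM_cong) auto
  finally show "distr M (PiM {..<n} (%_. ?T)) theta = PiM {..<n} (%_. ?T)" unfolding th .
qed

subsection \<open>Recession directions of the sample\<close>

lemma inner_prod_ip: "inner_prod (Suc (Suc q)) u v = ip {..Suc q} u v"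
  by (simp add: inner_prod_def ip_def lessThan_Suc_atMost)

text \<open>The dimension has the form \<open>Suc (Suc q)\<close>: one coordinate for the index and
  \<open>q + 1\<close> for Gaussian columns, so that a last Gaussian column exists. The function
  \<open>c\<close> assigns signs on the whole line, which makes it composable with
  \<open>y i\<close> as a Borel map.\<close>

locale single_sample = limit_law kappa for kappa :: "(real \<times> real) measure" +
  fixes F :: "real => real => real" and \<Y> :: "real set" and M :: "'a measure" and n q :: nat and w :: "nat => real"
    and x :: "nat => 'a => nat => real" and y :: "nat => 'a => real" and c :: "real => real"
  assumes F_measurable: "\<And>t. F t \<in> borel_measurable borel" and F_range: "\<And>t u. 0 \<le> F t u \<and> F t u \<le> 1"
    and sample: "single_index_sample F \<Y> M n (Suc (Suc q)) w x y" and n_pos: "n > 0"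
    and c_measurable: "c \<in> borel_measurable borel" and c_sign: "\<And>v. c v \<in> {-1, 0, 1}"
    and law: "\<And>i. i < n ==> distr M (borel \<Otimes>\<^sub>M borel) (%omega. (inner_prod (Suc (Suc q)) (x i omega) w, c (y i omega))) = kappa"
begin

lemma prob_space_M: "prob_space M"
  using sample unfolding single_index_sample_def by blast

sublocale M: prob_space M by (rule prob_space_M)

lemma w_unit: "ip {..Suc q} w w = 1"
proof -
  have "L2_set w {..<Suc (Suc q)} = 1" using sample unfolding single_index_sample_def by blast
  then show ?thesis by (simp add: nrm_eq_L2_set[symmetric] lessThan_Suc_atMost)
qed

text \<open>The same sample in coordinates adapted to \<open>f\<close>. Its law does not depend on
  \<open>f\<close>, but the events formed from it do.\<close>

definition data :: "(nat => real) => 'a => (nat => real \<times> real) \<times> (nat \<times> nat => real)" where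
  "data f omega = unzip {..<n} {..q} (\<lambda>i\<in>{..<n}. ((inner_prod (Suc (Suc q)) (x i omega) w, c (y i omega)),
     \<lambda>j\<in>{..q}. rot q w f (x i omega) (Suc j)))"

lemma data_simps:
  "i < n ==> fst (data f omega) i = (inner_prod (Suc (Suc q)) (x i omega) w, c (y i omega))"
  "i < n ==> j \<le> q ==> snd (data f omega) (i, j) = rot q w f (x i omega) (Suc j)"
  by (simp_all add: data_def unzip_def)

lemma distr_data:
  assumes f: "ip {..Suc q} f w = 0"
  shows data_measurable: "data f \<in> M \<rightarrow>\<^sub>M sample_law n q"
    and "distr M (sample_law n q) (data f) = sample_law n q"
proof -
  have R: "rot q w f v 0 = inner_prod (Suc (Suc q)) v w" for v
    unfolding inner_prod_ip by (rule rot_first[OF w_unit f])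
  have sl: "(%omega. \<lambda>i\<in>{..<n}. ((inner_prod (Suc (Suc q)) (x i omega) w, c (y i omega)), \<lambda>j\<in>{..q}. rot q w f (x i omega) (Suc j)))
      \<in> M \<rightarrow>\<^sub>M PiM {..<n} (%_. kappa \<Otimes>\<^sub>M Gam {..q})"
    "distr M (PiM {..<n} (%_. kappa \<Otimes>\<^sub>M Gam {..q}))
      (%omega. \<lambda>i\<in>{..<n}. ((inner_prod (Suc (Suc q)) (x i omega) w, c (y i omega)), \<lambda>j\<in>{..q}. rot q w f (x i omega) (Suc j)))
      = PiM {..<n} (%_. kappa \<Otimes>\<^sub>M Gam {..q})"
    by (rule sample_law[OF F_measurable F_range sample n_pos c_measurable mpres_rot[OF w_unit f] R prob_space_axioms sets_kappa];
      rule law; assumption)+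
  note uz = distr_unzip[OF finite_lessThan[of n] finite_atMost[of q] prob_space_axioms]
  show "data f \<in> M \<rightarrow>\<^sub>M sample_law n q"
    unfolding data_def[abs_def] by (rule measurable_compose[OF sl(1) uz(1)])
  show "distr M (sample_law n q) (data f) = sample_law n q"
  proof -
    have "distr M (sample_law n q) (data f) = distr (distr M (PiM {..<n} (%_. kappa \<Otimes>\<^sub>M Gam {..q}))
        (%omega. \<lambda>i\<in>{..<n}. ((inner_prod (Suc (Suc q)) (x i omega) w, c (y i omega)), \<lambda>j\<in>{..q}. rot q w f (x i omega) (Suc j))))
        (sample_law n q) (unzip {..<n} {..q})"
      unfolding distr_distr[OF uz(1) sl(1)] comp_def data_def[abs_def] ..
    also have "\<dots> = sample_law n q" unfolding sl(2) by (rule uz(2))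
    finally show ?thesis .
  qed
qed

text \<open>On this event a certificate exists that no recession direction has a positive inner
  product with \<open>f\<close>.\<close>

definition regular :: "(nat => real) => 'a set" where
  "regular f = {omega \<in> space M. proper_active {..<n} (Suc q) q (data f omega)}"

definition rho :: real where
  "rho = measure (sample_law n q) {z \<in> space (sample_law n q). proper_active {..<n} (Suc q) q z}"

lemma regular_prob:
  assumes f: "ip {..Suc q} f w = 0"
  shows regular_sets: "regular f \<in> sets M" and "measure M (regular f) = rho"
proof -
  let ?Z = "{z \<in> space (sample_law n q). proper_active {..<n} (Suc q) q z}"
  have Z: "?Z \<in> sets (sample_law n q)" by (rule proper_active_sets[OF finite_lessThan sets_kappa])
  have eq: "regular f = data f -` ?Z \<inter> space M"
    unfolding regular_def using measurable_space[OF data_measurable[OF f]] by blast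
  show "regular f \<in> sets M" unfolding eq by (rule measurable_sets[OF data_measurable[OF f] Z])
  show "measure M (regular f) = rho"
    unfolding eq rho_def using measure_distr[OF data_measurable[OF f] Z] distr_data(2)[OF f] by simp
qed

lemma general_position_data:
  assumes f: "ip {..Suc q} f w = 0"
  shows "AE omega in M. general_position {..<n} q (%i. fst (fst (data f omega) i)) (snd (data f omega))"
proof -
  have nz: "AE z in kappa. fst z ~= 0" using AE_regular by eventually_elim simp
  have "AE z in distr M (sample_law n q) (data f). general_position {..<n} q (%i. fst (fst z i)) (snd z)"
    unfolding distr_data(2)[OF f] by (rule general_position_AE_joint[OF finite_lessThan prob_space_axioms sets_kappa nz])
  from AE_distrD[OF data_measurable[OF f] this] show ?thesis .
qed

lemma linear_form_data:
  assumes f: "ip {..Suc q} f w = 0" and i: "i < n"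
  shows "inner_prod (Suc (Suc q)) (x i omega) b =
    (\<Sum>k\<le>Suc q. rot q w f b k * cols (%i. fst (fst (data f omega) i)) (snd (data f omega)) k i)"
proof -
  have "inner_prod (Suc (Suc q)) (x i omega) b = ip {..Suc q} (rot q w f (x i omega)) (rot q w f b)"
    unfolding inner_prod_ip ip_rot[OF w_unit f] ..
  also have "\<dots> = (\<Sum>k\<le>Suc q. rot q w f b k * cols (%i. fst (fst (data f omega) i)) (snd (data f omega)) k i)"
    unfolding ip_def
  proof (rule sum.cong[OF refl])
    fix k assume k: "k \<in> {..Suc q}"
    have "cols (%i. fst (fst (data f omega) i)) (snd (data f omega)) k i = rot q w f (x i omega) k"
    proof (cases k)
      case 0
      then show ?thesis using i by (simp add: data_simps inner_prod_ip rot_first[OF w_unit f])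
    next
      case (Suc j)
      then show ?thesis using i k by (simp add: data_simps)
    qed
    then show "rot q w f (x i omega) k * rot q w f b k =
      rot q w f b k * cols (%i. fst (fst (data f omega) i)) (snd (data f omega)) k i" by simp
  qed
  finally show ?thesis .
qed

definition recession :: "'a => (nat => real) => bool" where
  "recession omega b \<longleftrightarrow> (\<forall>i<n. dcone (c (y i omega)) (inner_prod (Suc (Suc q)) (x i omega) b) = 0)"

lemma feasible_data_iff:
  assumes f: "ip {..Suc q} f w = 0" and nz: "nrm {..Suc q} f > 0"
  shows "feasible {..<n} (%i. snd (fst (data f omega) i)) (%i. fst (fst (data f omega) i)) q (snd (data f omega)) \<longleftrightarrow>
    (\<exists>b. 0 < ip {..Suc q} b f \<and> recession omega b)"
proof -
  let ?C = "cols (%i. fst (fst (data f omega) i)) (snd (data f omega))"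
  have iff: "0 < rot q w f b (Suc q) \<and> (\<forall>i\<in>{..<n}. dcone (snd (fst (data f omega) i)) (\<Sum>k\<le>Suc q. rot q w f b k * ?C k i) = 0) \<longleftrightarrow>
    0 < ip {..Suc q} b f \<and> recession omega b" for b
  proof -
    have "0 < rot q w f b (Suc q) \<longleftrightarrow> 0 < ip {..Suc q} b f"
      unfolding rot_last[OF w_unit f, of b, symmetric] using nz by (simp add: zero_less_mult_iff)
    moreover have "(\<forall>i\<in>{..<n}. dcone (snd (fst (data f omega) i)) (\<Sum>k\<le>Suc q. rot q w f b k * ?C k i) = 0) \<longleftrightarrow> recession omega b"
    proof -
      have "dcone (snd (fst (data f omega) i)) (\<Sum>k\<le>Suc q. rot q w f b k * ?C k i) =
          dcone (c (y i omega)) (inner_prod (Suc (Suc q)) (x i omega) b)" if "i < n" for i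
        unfolding linear_form_data[OF f that, of omega b] data_simps(1)[OF that] snd_conv ..
      then show ?thesis unfolding recession_def lessThan_iff Ball_def by (simp only: cong: imp_cong)
    qed
    ultimately show ?thesis by simp
  qed
  show ?thesis
  proof
    assume "feasible {..<n} (%i. snd (fst (data f omega) i)) (%i. fst (fst (data f omega) i)) q (snd (data f omega))"
    then obtain beta where beta: "0 < beta (Suc q)" "\<forall>i\<in>{..<n}. dcone (snd (fst (data f omega) i)) (\<Sum>k\<le>Suc q. beta k * ?C k i) = 0"
      unfolding feasible_def by blast
    obtain b where "rot q w f b = beta" using rot_surj[OF w_unit f] by blast
    with beta have "0 < rot q w f b (Suc q) \<and> (\<forall>i\<in>{..<n}. dcone (snd (fst (data f omega) i)) (\<Sum>k\<le>Suc q. rot q w f b k * ?C k i) = 0)"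
      by (simp only: simp_thms)
    then have "0 < ip {..Suc q} b f \<and> recession omega b" unfolding iff .
    then show "\<exists>b. 0 < ip {..Suc q} b f \<and> recession omega b" by (intro exI[of _ b])
  next
    assume "\<exists>b. 0 < ip {..Suc q} b f \<and> recession omega b"
    then obtain b where "0 < ip {..Suc q} b f \<and> recession omega b" ..
    then have "0 < rot q w f b (Suc q) \<and> (\<forall>i\<in>{..<n}. dcone (snd (fst (data f omega) i)) (\<Sum>k\<le>Suc q. rot q w f b k * ?C k i) = 0)"
      unfolding iff .
    then show "feasible {..<n} (%i. snd (fst (data f omega) i)) (%i. fst (fst (data f omega) i)) q (snd (data f omega))"
      unfolding feasible_def by (intro exI[of _ "rot q w f b"])
  qed
qed

lemma data_sign: "i \<in> {..<n} ==> snd (fst (data f omega) i) \<in> {-1, 0, 1}"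
  using c_sign[of "y i omega"] by (simp add: data_simps)

lemma nrm_pos: "ip {..Suc q} b f ~= 0 ==> nrm {..Suc q} f > 0"
proof -
  assume "ip {..Suc q} b f ~= 0"
  then have "\<exists>i\<in>{..Suc q}. f i ~= 0" unfolding ip_def by (metis (no_types, lifting) mult_zero_right sum.neutral)
  then show ?thesis using ip_self_pos[of "{..Suc q}" _ f] by auto
qed

lemma regular_no_recession:
  assumes f: "ip {..Suc q} f w = 0" and omega: "omega \<in> regular f" and b: "0 < ip {..Suc q} b f"
  shows "\<not> recession omega b"
proof
  assume r: "recession omega b"
  have "feasible {..<n} (%i. snd (fst (data f omega) i)) (%i. fst (fst (data f omega) i)) q (snd (data f omega))"
  proof -
    have "ip {..Suc q} b f ~= 0" using b by simp
    from feasible_data_iff[OF f nrm_pos[OF this]] show ?thesis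
      by (rule iffD2) (intro exI[of _ b] conjI b r)
  qed
  moreover obtain S where S: "S \<subseteq> {..<n}" "kkt {..<n} (%i. snd (fst (data f omega) i)) (%i. fst (fst (data f omega) i)) q S (snd (data f omega))"
    using omega unfolding regular_def proper_active_def by blast
  moreover have "\<not> feasible {..<n} (%i. snd (fst (data f omega) i)) (%i. fst (fst (data f omega) i)) q (snd (data f omega))"
    by (rule kkt_not_feasible[OF finite_lessThan S(1) data_sign S(2)])
  ultimately show False by blast
qed

text \<open>Infeasibility would yield a proper active set, so some recession direction
  \<open>b\<close> has \<open><f, b> > 0\<close>. If it vanished on the sample, the last column
  would lie in the span of the others, against general position with more than \<open>q + 1\<close>
  rows.\<close>

lemma irregular_recession:
  assumes f: "ip {..Suc q} f w = 0" and nz: "nrm {..Suc q} f > 0" and omega: "omega \<in> space M - regular f" and n: "Suc q < n"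
    and gp: "general_position {..<n} q (%i. fst (fst (data f omega) i)) (snd (data f omega))"
  shows "\<exists>b. recession omega b \<and> (\<exists>i<n. inner_prod (Suc (Suc q)) (x i omega) b ~= 0)"
proof -
  let ?C = "cols (%i. fst (fst (data f omega) i)) (snd (data f omega))"
  have "feasible {..<n} (%i. snd (fst (data f omega) i)) (%i. fst (fst (data f omega) i)) q (snd (data f omega))"
  proof (rule ccontr)
    assume "\<not> ?thesis"
    from ex_kkt[OF finite_lessThan data_sign gp this] have "omega \<in> regular f"
      using omega unfolding regular_def proper_active_def by simp
    then show False using omega by simp
  qed
  then obtain b where b: "0 < ip {..Suc q} b f" "recession omega b" unfolding feasible_data_iff[OF f nz] by blast
  have "\<exists>i<n. inner_prod (Suc (Suc q)) (x i omega) b ~= 0"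
  proof (rule ccontr)
    assume "\<not> ?thesis"
    then have z: "(\<Sum>k\<le>Suc q. rot q w f b k * ?C k i) = 0" if "i < n" for i
      using that linear_form_data[OF f that, of omega b] by auto
    define beta where "beta = rot q w f b"
    have pos: "beta (Suc q) > 0"
      using b(1) nz unfolding rot_last[OF w_unit f, of b, symmetric] beta_def by (simp add: zero_less_mult_iff)
    \<comment> \<open>Division by the positive last coefficient makes the combination monic. It is
      zero on all rows, hence orthogonal to everything, and so it would be the Gram-Schmidt residual
      of the last column.\<close>
    define s where "s i = ?C (Suc q) i + (\<Sum>l<Suc q. (beta l / beta (Suc q)) * ?C l i)" for i
    have s0: "s i = 0" if "i < n" for i
    proof -
      have "beta (Suc q) * s i = (\<Sum>k\<le>Suc q. beta k * ?C k i)"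
        using pos by (simp add: s_def distrib_left sum_distrib_left lessThan_Suc_atMost del: cols_simps)
      then show ?thesis using z[OF that] pos by (simp add: beta_def)
    qed
    have gpA: "\<exists>i\<in>{..<n}. gs {..<n} ?C k i ~= 0" if "k \<le> Suc q" for k
      using gp n that unfolding general_position_def by auto
    have "s = gs {..<n} ?C (Suc q)"
    proof (rule gs_unique[OF finite_lessThan s_def])
      fix l assume "l < Suc q"
      show "ip {..<n} s (?C l) = 0" by (rule ip_zero_left) (simp add: s0)
      show "\<exists>i\<in>{..<n}. gs {..<n} ?C l i ~= 0" using \<open>l < Suc q\<close> by (intro gpA) simp
    qed
    then show False using gpA[of "Suc q"] s0 by auto
  qed
  then show ?thesis using b(2) by blast
qed

lemma measure_all_recession:
  "measure M {omega \<in> space M. recession omega (%j. \<sigma> * w j)} =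
    measure (PiM {..<n} (%_. kappa)) {v \<in> space (PiM {..<n} (%_. kappa)). \<forall>i<n. dcone (snd (v i)) (\<sigma> * fst (v i)) = 0}"
  and recession_sets: "{omega \<in> space M. recession omega (%j. \<sigma> * w j)} \<in> sets M"
proof -
  let ?PK = "PiM {..<n} (%_. kappa)"
  let ?Z = "{v \<in> space ?PK. \<forall>i\<in>{..<n}. dcone (snd (v i)) (\<sigma> * fst (v i)) = 0}"
  have Z: "?Z \<in> sets ?PK"
  proof (rule sets.sets_Collect_finite_All[OF _ finite_lessThan])
    fix i assume i: "i \<in> {..<n}"
    have "(%v. dcone (snd (v i)) (\<sigma> * fst (v i))) \<in> borel_measurable ?PK"
      using measurable_compose[OF measurable_component_singleton[OF i, of "%_. kappa"] fst_measurable]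
        measurable_compose[OF measurable_component_singleton[OF i, of "%_. kappa"] snd_measurable]
      by (intro dcone_measurable borel_measurable_times) auto
    then show "{v \<in> space ?PK. dcone (snd (v i)) (\<sigma> * fst (v i)) = 0} \<in> sets ?PK" by measurable
  qed
  \<comment> \<open>Only the index matters here, so the degenerate choice \<open>f = 0\<close> of
    the adapted coordinates will do.\<close>
  have f0: "ip {..Suc q} (%_. 0) w = 0" by (simp add: ip_def)
  have m: "(%omega. fst (data (%_. 0) omega)) \<in> M \<rightarrow>\<^sub>M ?PK" by (rule measurable_compose[OF data_measurable[OF f0] measurable_fst])
  have d: "distr M ?PK (%omega. fst (data (%_. 0) omega)) = ?PK"
  proof -
    have "distr M ?PK (fst \<circ> data (%_. 0)) = distr (distr M (sample_law n q) (data (%_. 0))) ?PK fst"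
      by (rule distr_distr[OF measurable_fst data_measurable[OF f0], symmetric])
    also have "\<dots> = ?PK" unfolding distr_data(2)[OF f0] by (rule prob_space.distr_pair_fst[OF prob_space_Gam])
    finally show ?thesis by (simp add: comp_def)
  qed
  have eq: "{omega \<in> space M. recession omega (%j. \<sigma> * w j)} = (%omega. fst (data (%_. 0) omega)) -` ?Z \<inter> space M"
    using measurable_space[OF m] by (auto simp: recession_def data_simps inner_prod_scale)
  show "{omega \<in> space M. recession omega (%j. \<sigma> * w j)} \<in> sets M" unfolding eq by (rule measurable_sets[OF m Z])
  show "measure M {omega \<in> space M. recession omega (%j. \<sigma> * w j)} =
    measure ?PK {v \<in> space ?PK. \<forall>i<n. dcone (snd (v i)) (\<sigma> * fst (v i)) = 0}"
    unfolding eq using measure_distr[OF m Z] unfolding d by (simp add: Ball_def)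
qed

text \<open>Directions on the moment curve, projected to the orthogonal complement of \<open>w\<close>.  A nonzero vector
  orthogonal to \<open>w\<close> is orthogonal to at most \<open>q + 1\<close> of them.\<close>

definition probe :: "nat => nat => real" where
  "probe k j = real k ^ j - ip {..Suc q} (%j. real k ^ j) w * w j"

lemma probe_orth: "ip {..Suc q} (probe k) w = 0"
  unfolding probe_def[abs_def] ip_diff_left ip_scale_left w_unit by simp

text \<open>Orthogonality to \<open>w\<close> removes the projection, and
  \<open><b, probe k>\<close> is a nonzero polynomial of degree at most \<open>q + 1\<close>
  evaluated at \<open>k\<close>. It vanishes at no more than \<open>q + 1\<close> of the
  \<open>2 * q + 3\<close> nodes.\<close>

lemma card_probe:
  assumes b: "ip {..Suc q} b w = 0" and nz: "j0 \<le> Suc q" "b j0 ~= 0"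
  shows "Suc q < card {k\<in>{..<2 * Suc q + 1}. ip {..Suc q} b (probe k) ~= 0}"
proof -
  let ?K = "{..<2 * Suc q + 1}"
  have eq: "ip {..Suc q} b (probe k) = (\<Sum>j\<le>Suc q. b j * real k ^ j)" for k
    unfolding probe_def[abs_def] ip_diff_right ip_scale_right b by (simp add: ip_def)
  let ?Z = "{z::real. (\<Sum>j\<le>Suc q. b j * z ^ j) = 0}"
  have Z: "finite ?Z" "card ?Z \<le> Suc q"
  proof -
    have "\<exists>k\<le>Suc q. b k ~= 0" using nz by blast
    from polyfun_rootbound[OF this] show "finite ?Z" "card ?Z \<le> Suc q" by blast+
  qed
  have "card {k\<in>?K. ip {..Suc q} b (probe k) = 0} \<le> card ?Z"
    by (rule card_inj_on_le[of real]) (use Z in \<open>auto simp: eq inj_on_def\<close>)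
  moreover have "card ?K = card {k\<in>?K. ip {..Suc q} b (probe k) = 0} + card {k\<in>?K. ip {..Suc q} b (probe k) ~= 0}"
  proof -
    have "?K = {k\<in>?K. ip {..Suc q} b (probe k) = 0} \<union> {k\<in>?K. ip {..Suc q} b (probe k) ~= 0}" by blast
    moreover have "card ({k\<in>?K. ip {..Suc q} b (probe k) = 0} \<union> {k\<in>?K. ip {..Suc q} b (probe k) ~= 0}) =
        card {k\<in>?K. ip {..Suc q} b (probe k) = 0} + card {k\<in>?K. ip {..Suc q} b (probe k) ~= 0}"
      by (rule card_Un_disjoint) auto
    ultimately show ?thesis by presburger
  qed
  ultimately show ?thesis using Z by simp
qed

text \<open>Regularity only excludes directions on one side of a probe, so both signs are required;
  this is the origin of the factor 2 in the bound below.\<close>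

definition defect :: "nat => 'a set" where
  "defect k = space M - (regular (probe k) \<inter> regular (%j. - probe k j))"

lemma probe_orth': "ip {..Suc q} (%j. - probe k j) w = 0"
  using probe_orth[of k] ip_scale_left[of "{..Suc q}" "-1" "probe k" w] by simp

lemma defect_prob: "defect k \<in> sets M" "measure M (defect k) \<le> 2 * (1 - rho)"
proof -
  note s = regular_sets[OF probe_orth] regular_sets[OF probe_orth']
  show "defect k \<in> sets M" unfolding defect_def using s by blast
  have "measure M (defect k) \<le> measure M ((space M - regular (probe k)) \<union> (space M - regular (%j. - probe k j)))"
    unfolding defect_def using s by (intro M.finite_measure_mono) auto
  also have "\<dots> \<le> measure M (space M - regular (probe k)) + measure M (space M - regular (%j. - probe k j))"
    using s by (intro measure_Un_le) auto
  also have "\<dots> = 2 * (1 - rho)"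
    unfolding M.prob_compl[OF s(1)] M.prob_compl[OF s(2)] regular_prob(2)[OF probe_orth] regular_prob(2)[OF probe_orth'] by simp
  finally show "measure M (defect k) \<le> 2 * (1 - rho)" .
qed

text \<open>The threshold \<open>q + 2\<close> is the number of probes that
  \<open>card_probe\<close> guarantees to see a given direction.\<close>

definition failure :: "'a set" where
  "failure = {omega \<in> space M. real (Suc (Suc q)) \<le> (\<Sum>k<2 * Suc q + 1. indicator (defect k) omega)}"

text \<open>Markov's inequality for the number of defective probes: its mean is at most
  \<open>(2 * q + 3) * 2 * (1 - rho)\<close>, and \<open>2 * q + 3\<close> is less than twice the
  threshold \<open>q + 2\<close>. The dimension cancels.\<close>

lemma failure_prob: "failure \<in> sets M" "measure M failure \<le> 4 * (1 - rho)"
proof -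
  let ?f = "%omega. \<Sum>k<2 * Suc q + 1. indicator (defect k) omega :: real"
  have [measurable]: "?f \<in> borel_measurable M" using defect_prob(1) by (intro borel_measurable_sum) simp
  show fs: "failure \<in> sets M" unfolding failure_def by measurable
  have int: "integrable M (%omega. indicator (defect k) omega :: real)" for k
    using defect_prob(1) by (intro M.integrable_const_bound[of _ 1]) (auto split: split_indicator)
  have nn: "0 \<le> rho" "rho \<le> 1" unfolding regular_prob(2)[OF probe_orth[of 0], symmetric] by simp_all
  have "real (Suc (Suc q)) * measure M failure = (\<integral>omega. real (Suc (Suc q)) * indicator failure omega \<partial>M)"
    using fs by simp
  also have "\<dots> \<le> (\<integral>omega. ?f omega \<partial>M)"
  proof (rule integral_mono)
    show "integrable M ?f" using int by (intro Bochner_Integration.integrable_sum) simp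
    show "integrable M (%omega. real (Suc (Suc q)) * indicator failure omega)"
      using fs by (intro integrable_mult_right M.integrable_const_bound[of _ 1]) (auto split: split_indicator)
    fix omega
    have nn: "0 \<le> ?f omega" by (intro sum_nonneg) simp
    show "real (Suc (Suc q)) * indicator failure omega \<le> ?f omega"
    proof (cases "omega \<in> failure")
      case True
      then have "real (Suc (Suc q)) \<le> ?f omega" unfolding failure_def by blast
      then show ?thesis using True by (simp only: indicator_simps mult_1_right)
    next
      case False
      then have "indicator failure omega = (0::real)" by simp
      then show ?thesis using nn by (simp only: mult_zero_right)
    qed
  qed
  also have "\<dots> = (\<Sum>k<2 * Suc q + 1. measure M (defect k))"
    using int defect_prob(1) by (subst Bochner_Integration.integral_sum) auto
  also have "\<dots> \<le> (\<Sum>k<2 * Suc q + 1. 2 * (1 - rho))" by (intro sum_mono defect_prob(2))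
  also have "\<dots> = real (2 * Suc q + 1) * (2 * (1 - rho))" by simp
  also have "\<dots> \<le> (2 * real (Suc (Suc q))) * (2 * (1 - rho))" using nn by (intro mult_right_mono) auto
  also have "\<dots> = real (Suc (Suc q)) * (4 * (1 - rho))" by (simp add: algebra_simps)
  finally show "measure M failure \<le> 4 * (1 - rho)" by (simp only: mult_le_cancel_left_pos of_nat_0_less_iff zero_less_Suc)
qed

text \<open>Remove from \<open>b\<close> its component along \<open>w\<close>, which the probes do
  not see. If something remains, at least \<open>q + 2\<close> probes see it, and each of them is
  defective. Otherwise \<open>b\<close> is a nonzero multiple of \<open>w\<close> and can be
  rescaled to \<open>w\<close> or \<open>- w\<close>.\<close>

lemma recession_failure:
  assumes omega: "omega \<in> space M" and r: "recession omega b" and nz: "j0 < Suc (Suc q)" "b j0 ~= 0"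
  shows "omega \<in> failure \<or> recession omega (%j. 1 * w j) \<or> recession omega (%j. (-1) * w j)"
proof -
  define t where "t = ip {..Suc q} b w"
  define b' where "b' j = b j - t * w j" for j
  have b'w: "ip {..Suc q} b' w = 0"
    unfolding b'_def[abs_def] ip_diff_left ip_scale_left w_unit t_def by simp
  show ?thesis
  proof (cases "\<exists>j\<le>Suc q. b' j ~= 0")
    case True
    then obtain j where j: "j \<le> Suc q" "b' j ~= 0" by blast
    let ?K = "{..<2 * Suc q + 1}"
    have sub: "{k\<in>?K. ip {..Suc q} b' (probe k) ~= 0} \<subseteq> {k\<in>?K. omega \<in> defect k}"
    proof safe
      fix k assume "ip {..Suc q} b' (probe k) ~= 0"
      also have "ip {..Suc q} b' (probe k) = ip {..Suc q} b (probe k)"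
        unfolding b'_def[abs_def] ip_diff_left ip_scale_left using probe_orth[of k] by (simp add: ip_sym[of _ w])
      finally consider "0 < ip {..Suc q} b (probe k)" | "0 < ip {..Suc q} b (%j. - probe k j)"
        using ip_scale_right[of "{..Suc q}" b "-1" "probe k"] by fastforce
      then show "omega \<in> defect k"
        unfolding defect_def using regular_no_recession[OF probe_orth] regular_no_recession[OF probe_orth'] r omega by cases blast+
    qed
    have "Suc q < card {k\<in>?K. ip {..Suc q} b' (probe k) ~= 0}" by (rule card_probe[OF b'w j])
    also have "\<dots> \<le> card {k\<in>?K. omega \<in> defect k}" using sub by (intro card_mono) auto
    finally have "real (Suc (Suc q)) \<le> real (card {k\<in>?K. omega \<in> defect k})" by simp
    also have "\<dots> = (\<Sum>k\<in>?K. indicator (defect k) omega)"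
    proof -
      have "(\<Sum>k\<in>?K. indicator (defect k) omega) = (\<Sum>k\<in>?K. if k \<in> {k\<in>?K. omega \<in> defect k} then 1 else 0 :: real)"
        by (intro sum.cong) (auto split: split_indicator)
      also have "\<dots> = (\<Sum>k\<in>?K \<inter> {k\<in>?K. omega \<in> defect k}. 1)" by (rule sum.inter_restrict[symmetric]) simp
      also have "?K \<inter> {k\<in>?K. omega \<in> defect k} = {k\<in>?K. omega \<in> defect k}" by blast
      finally show ?thesis by simp
    qed
    finally show ?thesis using omega unfolding failure_def by blast
  next
    case False
    then have b: "b j = t * w j" if "j \<le> Suc q" for j using that by (auto simp: b'_def)
    have t: "t ~= 0" using b[of j0] nz by auto
    have ib: "inner_prod (Suc (Suc q)) (x i omega) b = \<bar>t\<bar> * inner_prod (Suc (Suc q)) (x i omega) (%j. sgn t * w j)" for i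
    proof -
      have "inner_prod (Suc (Suc q)) (x i omega) b = inner_prod (Suc (Suc q)) (x i omega) (%j. t * w j)"
        unfolding inner_prod_def using b by (intro sum.cong) auto
      then show ?thesis unfolding inner_prod_scale using sgn_mult_abs[of t] by (simp add: mult_ac)
    qed
    have "recession omega (%j. sgn t * w j)"
      using r t unfolding recession_def ib by (simp add: dcone_scale)
    moreover have "sgn t = 1 \<or> sgn t = -1" using t by (auto simp: sgn_if)
    ultimately show ?thesis by auto
  qed
qed

lemma ex_orth_direction: "\<exists>f. ip {..Suc q} f w = 0 \<and> nrm {..Suc q} f > 0"
proof -
  obtain a where "\<exists>i\<in>{..Suc q}. a i ~= 0" "\<forall>j<1::nat. ip {..Suc q} a w = 0"
    using ex_orth_vector[of "{..Suc q}" 1 "%_. w"] by auto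
  then show ?thesis using ip_self_pos[of "{..Suc q}" _ a] by (intro exI[of _ a]) auto
qed

end

section \<open>Bounds on the probability that the infimum is attained\<close>

locale attainment = single_sample kappa F \<Y> M n q w x y c
  for kappa F \<Y> and M :: "'a measure" and n q w x y c +
  fixes \<l> :: "real => real => real"
  assumes convex: "\<And>v. v \<in> \<Y> ==> strictly_convex (\<l> v)"
    and c_loss: "\<And>v. v \<in> \<Y> ==> c v = loss_sign (\<l> v)"
begin

definition attained_event :: "'a set" where
  "attained_event = {omega \<in> space M. infimum_attained (real_vectors (Suc (Suc q)))
     (empirical_risk \<l> n (Suc (Suc q)) (%i. x i omega) (%i. y i omega))}"

lemma y_range: "i < n ==> omega \<in> space M ==> y i omega \<in> \<Y>"
  using sample unfolding single_index_sample_def by blast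

text \<open>For nonattainment a single recession direction suffices, so one fixed \<open>f\<close>
  orthogonal to \<open>w\<close> settles this bound.\<close>

lemma attained_le: 
  assumes n: "Suc q < n" and m: "attained_event \<in> sets M"
  shows "measure M attained_event \<le> rho"
proof -
  obtain f where f: "ip {..Suc q} f w = 0" "nrm {..Suc q} f > 0" using ex_orth_direction by blast
  have "AE omega in M. omega \<in> attained_event \<longrightarrow> omega \<in> regular f"
    using general_position_data[OF f(1)]
  proof eventually_elim
    case (elim omega)
    show ?case
    proof (intro impI, rule ccontr)
      assume a: "omega \<in> attained_event" and "omega \<notin> regular f"
      then have omega: "omega \<in> space M" "omega \<in> space M - regular f" by (auto simp: attained_event_def)
      obtain b i where b: "recession omega b" and i: "i < n" "inner_prod (Suc (Suc q)) (x i omega) b ~= 0"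
        using irregular_recession[OF f omega(2) n elim] by blast
      have "\<not> infimum_attained (real_vectors (Suc (Suc q))) (empirical_risk \<l> n (Suc (Suc q)) (%i. x i omega) (%i. y i omega))"
        by (rule not_attained[of n \<l> "%i. y i omega" "Suc (Suc q)" "%i. x i omega" b i])
          (use convex y_range[OF _ omega(1)] b i in \<open>auto simp: recession_def c_loss\<close>)
      then show False using a by (simp add: attained_event_def)
    qed
  qed
  then have "measure M attained_event \<le> measure M (regular f)"
    using regular_sets[OF f(1)] by (intro M.finite_measure_mono_AE) auto
  then show ?thesis unfolding regular_prob(2)[OF f(1)] .
qed

text \<open>Nonattainment produces a nonzero recession direction, which is accounted for by
  \<open>failure\<close> or by one of the two multiples of \<open>w\<close>.\<close>

lemma attained_ge:
  assumes m: "attained_event \<in> sets M"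
    and ct: "\<And>v. v \<in> \<Y> ==> continuous_on UNIV (\<l> v)"
    and bdd: "\<And>i. i < n ==> AE omega in M. \<exists>m. \<forall>t. - m \<le> \<l> (y i omega) t"
  shows "1 - 4 * (1 - rho) - measure M {omega \<in> space M. recession omega (%j. 1 * w j)} - measure M {omega \<in> space M. recession omega (%j. (-1) * w j)}
    \<le> measure M attained_event"
proof -
  let ?R1 = "{omega \<in> space M. recession omega (%j. 1 * w j)}" and ?R2 = "{omega \<in> space M. recession omega (%j. (-1) * w j)}"
  note sets = failure_prob(1) recession_sets[of 1] recession_sets[of "-1"]
  have "AE omega in M. \<forall>i\<in>{..<n}. \<exists>m. \<forall>t. - m \<le> \<l> (y i omega) t" by (rule AE_finite_allI) (use bdd in auto)
  then have "AE omega in M. omega \<in> space M - attained_event \<longrightarrow> omega \<in> failure \<union> ?R1 \<union> ?R2"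
  proof eventually_elim
    case (elim omega)
    show ?case
    proof (intro impI, rule ccontr)
      assume omega: "omega \<in> space M - attained_event" and no: "omega \<notin> failure \<union> ?R1 \<union> ?R2"
      have sp: "omega \<in> space M" using omega by simp
      have "infimum_attained (real_vectors (Suc (Suc q))) (empirical_risk \<l> n (Suc (Suc q)) (%i. x i omega) (%i. y i omega))"
      proof (rule attained)
        fix i assume "i < n"
        then show "strictly_convex (\<l> (y i omega))" "continuous_on UNIV (\<l> (y i omega))" "\<exists>m. \<forall>t. - m \<le> \<l> (y i omega) t"
          using convex ct y_range[OF _ sp] elim by auto
      next
        fix b assume "\<And>i. i < n ==> dcone (loss_sign (\<l> (y i omega))) (inner_prod (Suc (Suc q)) (x i omega) b) = 0"
        then have "recession omega b" using y_range[OF _ sp] by (auto simp: recession_def c_loss)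
        then show "\<forall>j<Suc (Suc q). b j = 0" using recession_failure[OF sp] no sp by blast
      qed
      then show False using omega sp by (simp add: attained_event_def)
    qed
  qed
  then have "measure M (space M - attained_event) \<le> measure M (failure \<union> ?R1 \<union> ?R2)"
    using sets by (intro M.finite_measure_mono_AE) auto
  also have "\<dots> \<le> measure M (failure \<union> ?R1) + measure M ?R2"
    using sets by (intro measure_Un_le) auto
  also have "measure M (failure \<union> ?R1) \<le> measure M failure + measure M ?R1"
    using sets by (intro measure_Un_le) auto
  finally show ?thesis using failure_prob(2) M.prob_compl[OF m] by linarith
qed

end

subsection \<open>Measurability and passage to the limit\<close>

text \<open>Makes monotonicity a countable condition, so that the class of the loss depends
  measurably on \<open>y\<close>. Both a coercive and a decreasing function exceed
  \<open>f 0\<close> at some negative integer.\<close>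

lemma strict_mono_iff_nonpos:
  assumes f: "strictly_convex f"
  shows "strict_mono f \<longleftrightarrow> (\<forall>m::nat. f (- real m) \<le> f 0)"
proof
  assume "strict_mono f"
  then show "\<forall>m::nat. f (- real m) \<le> f 0" by (simp add: strict_mono_less_eq)
next
  assume m: "\<forall>m::nat. f (- real m) \<le> f 0"
  show "strict_mono f"
  proof (rule ccontr)
    assume n: "\<not> strict_mono f"
    show False
    proof (cases "coercive f")
      case True
      have "filterlim (%m. - real m) at_infinity sequentially"
        by (intro filterlim_at_bot_imp_at_infinity)
          (simp add: filterlim_uminus_at_bot filterlim_real_sequentially)
      from filterlim_compose[OF True[unfolded coercive_def] this]
      have "eventually (%m. f 0 + 1 \<le> f (- real m)) sequentially" by (simp add: filterlim_at_top)
      from eventually_happens'[OF sequentially_bot this] obtain m where "f 0 + 1 \<le> f (- real m)" ..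
      then show False using m[rule_format, of m] by simp
    next
      case False
      then have "strictly_decreasing f" using strictly_convex_trichotomy[OF f] n by blast
      then have "f 0 < f (-1)" by (simp add: strictly_decreasing_def)
      then show False using m[rule_format, of 1] by simp
    qed
  qed
qed

lemma strictly_decreasing_iff_nonneg:
  assumes f: "strictly_convex f"
  shows "strictly_decreasing f \<longleftrightarrow> (\<forall>m::nat. f (real m) \<le> f 0)"
proof -
  have "strictly_decreasing f \<longleftrightarrow> strict_mono (%x. f (- x))"
  proof
    assume d: "strictly_decreasing f"
    show "strict_mono (%x. f (- x))"
      by (rule strict_monoI) (use d in \<open>simp add: strictly_decreasing_def\<close>)
  next
    assume m: "strict_mono (%x. f (- x))"
    show "strictly_decreasing f"
      unfolding strictly_decreasing_def
    proof (intro allI impI)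
      fix s t :: real assume "s < t"
      then show "f t < f s" using strict_monoD[OF m, of "- t" "- s"] by simp
    qed
  qed
  also have "\<dots> \<longleftrightarrow> (\<forall>m::nat. f (real m) \<le> f 0)"
    using strict_mono_iff_nonpos[OF strictly_convex_reflect[OF f]] by simp
  finally show ?thesis .
qed

text \<open>\<open>\<Y>\<close> is an arbitrary set of reals, hence conditions that are measurable
  on it are replaced by Borel sets with the same trace.\<close>

lemma restrict_space_borel_extension:
  assumes "A \<in> sets (restrict_space borel \<Y>)" shows "\<exists>A'\<in>sets borel. \<forall>v\<in>\<Y>. v \<in> A' \<longleftrightarrow> v \<in> A"
  using assms unfolding sets_restrict_space by auto

text \<open>The sign of the loss as a Borel function on the whole line. Its values off
  \<open>\<Y>\<close> come from the choice of the Borel sets and remain in {-1, 0, 1}.\<close>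

lemma ex_class_function:
  fixes \<l> :: "real => real => real"
  assumes m: "\<And>t. (%v. \<l> v t) \<in> borel_measurable (restrict_space borel \<Y>)"
    and cv: "\<And>v. v \<in> \<Y> ==> strictly_convex (\<l> v)"
  shows "\<exists>c\<in>borel_measurable borel. (\<forall>v. c v \<in> {-1, 0, 1}) \<and> (\<forall>v\<in>\<Y>. c v = loss_sign (\<l> v))"
proof -
  note m [measurable]
  have sp: "v \<in> space (restrict_space borel \<Y>) \<longleftrightarrow> v \<in> \<Y>" for v :: real by (simp add: space_restrict_space)
  have "{v \<in> space (restrict_space borel \<Y>). \<forall>k::nat. \<l> v (- real k) \<le> \<l> v 0} \<in> sets (restrict_space borel \<Y>)"
    by measurable
  from restrict_space_borel_extension[OF this] obtain I
    where I: "I \<in> sets borel" "\<And>v. v \<in> \<Y> ==> v \<in> I \<longleftrightarrow> (\<forall>k::nat. \<l> v (- real k) \<le> \<l> v 0)" using sp by auto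
  have "{v \<in> space (restrict_space borel \<Y>). \<forall>k::nat. \<l> v (real k) \<le> \<l> v 0} \<in> sets (restrict_space borel \<Y>)"
    by measurable
  from restrict_space_borel_extension[OF this] obtain D
    where D: "D \<in> sets borel" "\<And>v. v \<in> \<Y> ==> v \<in> D \<longleftrightarrow> (\<forall>k::nat. \<l> v (real k) \<le> \<l> v 0)" using sp by auto
  define c :: "real => real" where "c v = (if v \<in> I then 1 else if v \<in> D then -1 else 0)" for v
  have "c \<in> borel_measurable borel"
    unfolding c_def[abs_def] using I(1) D(1) by measurable
  moreover have "c v = loss_sign (\<l> v)" if v: "v \<in> \<Y>" for v
  proof -
    have "v \<in> I \<longleftrightarrow> loss_sign (\<l> v) = 1" "v \<in> D \<longleftrightarrow> loss_sign (\<l> v) = -1"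
      using I(2)[OF v] D(2)[OF v] strict_mono_iff_nonpos[OF cv[OF v]] strictly_decreasing_iff_nonneg[OF cv[OF v]]
        loss_sign_iff[OF cv[OF v]] by auto
    then show ?thesis using loss_sign_range[of "\<l> v"] by (auto simp: c_def)
  qed
  ultimately show ?thesis by (intro bexI[of _ c]) (auto simp: c_def)
qed

lemma bounded_below_on_rats:
  fixes f :: "real => real"
  assumes f: "continuous_on UNIV f" and r: "\<And>r::rat. - m \<le> f (of_rat r)"
  shows "- m \<le> f t"
proof (rule ccontr)
  assume "\<not> ?thesis"
  then have t: "t \<in> {s. f s < - m}" by simp
  have "open {s. f s < - m}" by (intro open_Collect_less f continuous_on_const)
  then obtain d where d: "d > 0" "\<And>s. dist s t < d ==> f s < - m" using t unfolding open_dist by blast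
  obtain r where r': "t < of_rat r" "of_rat r < t + d" using of_rat_dense[of t "t + d"] d(1) by auto
  then have "dist (of_rat r) t < d" by (simp add: dist_real_def)
  then show False using d(2)[of "of_rat r"] r[of r] by simp
qed

text \<open>By continuity it is enough to test integer bounds at rational arguments.\<close>

lemma ex_bounded_below_set:
  fixes \<l> :: "real => real => real"
  assumes m: "\<And>t. (%v. \<l> v t) \<in> borel_measurable (restrict_space borel \<Y>)"
    and ct: "\<And>v. v \<in> \<Y> ==> continuous_on UNIV (\<l> v)"
  shows "\<exists>B\<in>sets borel. \<forall>v\<in>\<Y>. v \<in> B \<longleftrightarrow> (\<exists>m. \<forall>t. - m \<le> \<l> v t)"
proof -
  note m [measurable]
  have "{v \<in> space (restrict_space borel \<Y>). \<exists>k::nat. \<forall>r::rat. - real k \<le> \<l> v (of_rat r)} \<in> sets (restrict_space borel \<Y>)"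
    by measurable
  from restrict_space_borel_extension[OF this] obtain B
    where B: "B \<in> sets borel" "\<And>v. v \<in> \<Y> ==> v \<in> B \<longleftrightarrow> (\<exists>k::nat. \<forall>r::rat. - real k \<le> \<l> v (of_rat r))"
    by (auto simp: space_restrict_space)
  have "(\<exists>k::nat. \<forall>r::rat. - real k \<le> \<l> v (of_rat r)) \<longleftrightarrow> (\<exists>m. \<forall>t. - m \<le> \<l> v t)" if v: "v \<in> \<Y>" for v
  proof
    assume "\<exists>k::nat. \<forall>r::rat. - real k \<le> \<l> v (of_rat r)"
    then obtain k :: nat where k: "\<And>r::rat. - real k \<le> \<l> v (of_rat r)" by blast
    have "- real k \<le> \<l> v t" for t by (rule bounded_below_on_rats[OF ct[OF v] k])
    then show "\<exists>m. \<forall>t. - m \<le> \<l> v t" by (intro exI[of _ "real k"] allI)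
  next
    assume "\<exists>m. \<forall>t. - m \<le> \<l> v t"
    then obtain m where m: "\<And>t. - m \<le> \<l> v t" by blast
    obtain k :: nat where "m \<le> real k" using real_arch_simple by blast
    then have "- real k \<le> \<l> v (of_rat r)" for r using m[of "of_rat r"] by linarith
    then show "\<exists>k::nat. \<forall>r::rat. - real k \<le> \<l> v (of_rat r)" by blast
  qed
  with B(2) have "\<forall>v\<in>\<Y>. v \<in> B \<longleftrightarrow> (\<exists>m. \<forall>t. - m \<le> \<l> v t)" by simp
  then show ?thesis by (rule bexI[OF _ B(1)])
qed

text \<open>Where the loss is unbounded below its infimum is minus infinity, and an integrable
  function is infinite on a null set only.\<close>

lemma AE_bounded_below:
  fixes \<l> :: "real => real => real"
  assumes N: "prob_space N" and Y: "Y \<in> borel_measurable N" "\<And>omega. omega \<in> space N ==> Y omega \<in> \<Y>"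
    and B: "B \<in> sets borel" "\<And>v. v \<in> \<Y> ==> v \<in> B \<longleftrightarrow> (\<exists>m. \<forall>t. - m \<le> \<l> v t)"
    and inf: "(\<integral>\<^sup>+omega. e2ennreal \<bar>INF u. ereal (\<l> (Y omega) u)\<bar> \<partial>N) < \<infinity>"
  shows "AE omega in N. Y omega \<in> B"
proof -
  define A where "A = {omega \<in> space N. Y omega \<notin> B}"
  have A: "A \<in> sets N"
  proof -
    have "A = space N - (Y -` B \<inter> space N)" by (auto simp: A_def)
    then show ?thesis using measurable_sets[OF Y(1) B(1)] by simp
  qed
  have top: "e2ennreal \<bar>INF u. ereal (\<l> (Y omega) u)\<bar> = \<infinity>" if omega: "omega \<in> A" for omega
  proof -
    have nb: "\<not> (\<exists>m. \<forall>t. - m \<le> \<l> (Y omega) t)" using omega B(2) Y(2) by (auto simp: A_def)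
    have le: "(INF u. ereal (\<l> (Y omega) u)) \<le> ereal (\<l> (Y omega) t)" for t by (rule INF_lower) simp
    have "(INF u. ereal (\<l> (Y omega) u)) = - \<infinity>"
    proof (cases "INF u. ereal (\<l> (Y omega) u)")
      case (real r)
      then have "- (- r) \<le> \<l> (Y omega) t" for t using le[of t] by simp
      then show ?thesis using nb by blast
    next
      case PInf
      then show ?thesis using le[of 0] by simp
    qed simp
    then show ?thesis by simp
  qed
  have "\<infinity> * emeasure N A = (\<integral>\<^sup>+omega. \<infinity> * indicator A omega \<partial>N)" using A by (simp add: nn_integral_cmult_indicator)
  also have "\<dots> \<le> (\<integral>\<^sup>+omega. e2ennreal \<bar>INF u. ereal (\<l> (Y omega) u)\<bar> \<partial>N)"
    by (rule nn_integral_mono) (auto simp: top split: split_indicator)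
  also have "\<dots> < \<infinity>" by (rule inf)
  finally have "emeasure N A = 0" by (auto simp: ennreal_top_mult split: if_splits)
  then have "AE omega in N. omega \<notin> A" using A by (intro AE_not_in) (simp add: null_setsI)
  then show ?thesis by (rule AE_mp) (auto intro!: AE_I2 simp: A_def)
qed

lemma tendsto_dyadic_floor: "(%m. of_int \<lfloor>real (Suc m) * t\<rfloor> / real (Suc m)) \<longlonglongrightarrow> t"
proof (rule tendsto_sandwich)
  show "\<forall>\<^sub>F m in sequentially. t - inverse (real (Suc m)) \<le> of_int \<lfloor>real (Suc m) * t\<rfloor> / real (Suc m)"
  proof (rule always_eventually, rule allI)
    fix m
    have "real (Suc m) * t - 1 \<le> of_int \<lfloor>real (Suc m) * t\<rfloor>" by linarith
    then have "(real (Suc m) * t - 1) / real (Suc m) \<le> of_int \<lfloor>real (Suc m) * t\<rfloor> / real (Suc m)"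
      by (rule divide_right_mono) simp
    then show "t - inverse (real (Suc m)) \<le> of_int \<lfloor>real (Suc m) * t\<rfloor> / real (Suc m)"
      by (simp add: diff_divide_distrib inverse_eq_divide del: of_nat_Suc)
  qed
  show "\<forall>\<^sub>F m in sequentially. of_int \<lfloor>real (Suc m) * t\<rfloor> / real (Suc m) \<le> t"
  proof (rule always_eventually, rule allI)
    fix m
    have "of_int \<lfloor>real (Suc m) * t\<rfloor> / real (Suc m) \<le> (real (Suc m) * t) / real (Suc m)"
      by (rule divide_right_mono) (simp_all add: of_int_floor_le del: of_nat_Suc)
    then show "of_int \<lfloor>real (Suc m) * t\<rfloor> / real (Suc m) \<le> t" by (simp del: of_nat_Suc)
  qed
  have "(%m. t - inverse (real (Suc m))) \<longlonglongrightarrow> t - 0" by (intro tendsto_intros LIMSEQ_inverse_real_of_nat)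
  then show "(%m. t - inverse (real (Suc m))) \<longlonglongrightarrow> t" by simp
qed simp

text \<open>The loss is measurable in one variable and continuous in the other. Rounding
  \<open>g\<close> to a grid of mesh \<open>1 / Suc k\<close> leaves countably many values, and
  continuity recovers the limit.\<close>

lemma caratheodory_measurable:
  fixes \<l> :: "real => real => real"
  assumes m: "\<And>t. (%v. \<l> v t) \<in> borel_measurable (restrict_space borel \<Y>)"
    and ct: "\<And>v. v \<in> \<Y> ==> continuous_on UNIV (\<l> v)"
    and h: "h \<in> borel_measurable M" "\<And>omega. omega \<in> space M ==> h omega \<in> \<Y>" and g: "g \<in> borel_measurable M"
  shows "(%omega. \<l> (h omega) (g omega)) \<in> borel_measurable M"
proof (rule borel_measurable_LIMSEQ_real)
  have h': "h \<in> M \<rightarrow>\<^sub>M restrict_space borel \<Y>" using h by (intro measurable_restrict_space2) auto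
  show "(%omega. \<l> (h omega) (of_int \<lfloor>real (Suc k) * g omega\<rfloor> / real (Suc k))) \<in> borel_measurable M" for k
  proof (rule measurable_compose_countable[of "%i omega. \<l> (h omega) (of_int i / real (Suc k))" M borel "%omega. \<lfloor>real (Suc k) * g omega\<rfloor>"])
    show "(%omega. \<l> (h omega) (of_int i / real (Suc k))) \<in> borel_measurable M" for i
      by (rule measurable_compose[OF h' m])
    show "(%omega. \<lfloor>real (Suc k) * g omega\<rfloor>) \<in> M \<rightarrow>\<^sub>M count_space UNIV" using g by measurable
  qed
  fix omega assume "omega \<in> space M"
  then have "isCont (\<l> (h omega)) (g omega)" using ct h(2) by (simp add: continuous_on_eq_continuous_at)
  from isCont_tendsto_compose[OF this tendsto_dyadic_floor]
  show "(%k. \<l> (h omega) (of_int \<lfloor>real (Suc k) * g omega\<rfloor> / real (Suc k))) \<longlonglongrightarrow> \<l> (h omega) (g omega)" .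
qed

lemma empirical_risk_tendsto:
  fixes \<l> :: "real => real => real"
  assumes ct: "\<And>i. i < n ==> continuous_on UNIV (\<l> (y i))" and b: "\<And>j. j < p ==> (%m. b m j) \<longlonglongrightarrow> b' j"
  shows "(%m. empirical_risk \<l> n p x y (b m)) \<longlonglongrightarrow> empirical_risk \<l> n p x y b'"
  unfolding empirical_risk_def inner_prod_def
proof (intro tendsto_sum)
  fix i assume "i \<in> {..<n}"
  then have "isCont (\<l> (y i)) (\<Sum>j<p. x i j * b' j)" using ct by (simp add: continuous_on_eq_continuous_at)
  then show "(%m. \<l> (y i) (\<Sum>j<p. x i j * b m j)) \<longlonglongrightarrow> \<l> (y i) (\<Sum>j<p. x i j * b' j)"
    by (rule isCont_tendsto_compose) (intro tendsto_sum tendsto_mult tendsto_const b, simp)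
qed

text \<open>A reformulation with countable quantifiers, from which the measurability of the event
  follows. Attainment means that some box already contains near-minimisers to every accuracy;
  compactness of the box gives the converse, and rational vectors suffice by continuity.\<close>

lemma infimum_attained_iff:
  fixes \<l> :: "real => real => real" and p :: nat and x :: "nat => nat => real" and y :: "nat => real"
  assumes ct: "\<And>i. i < n ==> continuous_on UNIV (\<l> (y i))"
  defines "r \<equiv> empirical_risk \<l> n p x y" and "Q \<equiv> {..<p} \<rightarrow>\<^sub>E (\<rat> :: real set)"
  shows "infimum_attained (real_vectors p) r \<longleftrightarrow>
    (\<exists>R::nat. \<forall>b'\<in>Q. \<forall>m::nat. \<exists>b\<in>{b\<in>Q. \<forall>j<p. \<bar>b j\<bar> \<le> real R}. r b < r b' + inverse (real (Suc m)))"
proof -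
  have restr: "r (restrict b {..<p}) = r b" for b
    unfolding r_def empirical_risk_def inner_prod_restrict ..
  define ap where "ap b m = (\<lambda>j\<in>{..<p}. of_int \<lfloor>real (Suc m) * b j\<rfloor> / real (Suc m))" for b :: "nat => real" and m
  have apQ: "ap b m \<in> Q" for b m by (auto simp: ap_def Q_def)
  have aplim: "(%m. r (ap b m)) \<longlonglongrightarrow> r b" for b
    unfolding r_def
  proof (rule empirical_risk_tendsto)
    show "continuous_on UNIV (\<l> (y i))" if "i < n" for i using that by (rule ct)
    fix j assume "j < p"
    then show "(%m. ap b m j) \<longlonglongrightarrow> b j" using tendsto_dyadic_floor[of "b j"] by (simp add: ap_def del: of_nat_Suc)
  qed
  show ?thesis
  proof
    assume "infimum_attained (real_vectors p) r"
    then obtain b0 where b0: "b0 \<in> real_vectors p" "\<And>b. b \<in> real_vectors p ==> r b0 \<le> r b"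
      unfolding infimum_attained_def by blast
    \<comment> \<open>The additional 1 leaves room for rounding the minimiser to a rational
      vector.\<close>
    obtain R :: nat where R: "(\<Sum>j<p. \<bar>b0 j\<bar>) + 1 \<le> real R" using real_arch_simple by blast
    show "\<exists>R::nat. \<forall>b'\<in>Q. \<forall>m::nat. \<exists>b\<in>{b\<in>Q. \<forall>j<p. \<bar>b j\<bar> \<le> real R}. r b < r b' + inverse (real (Suc m))"
    proof (intro exI[of _ R] ballI allI)
      fix b' and m :: nat assume "b' \<in> Q"
      then have "b' \<in> real_vectors p" by (auto simp: Q_def real_vectors_def)
      then have "r b0 < r b' + inverse (real (Suc m))" 
      proof -
        have "0 < inverse (real (Suc m))" by simp
        then show ?thesis using b0(2)[OF \<open>b' \<in> real_vectors p\<close>] by linarith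
      qed
      from eventually_happens'[OF sequentially_bot order_tendstoD(2)[OF aplim this]]
      obtain k where k: "r (ap b0 k) < r b' + inverse (real (Suc m))" ..
      have "\<bar>ap b0 k j\<bar> \<le> real R" if j: "j < p" for j
      proof -
        have "\<bar>b0 j\<bar> \<le> (\<Sum>j<p. \<bar>b0 j\<bar>)" using j by (intro member_le_sum) auto
        moreover have "\<bar>ap b0 k j\<bar> \<le> \<bar>b0 j\<bar> + 1"
        proof -
          have l: "real (Suc k) * b0 j - 1 \<le> of_int \<lfloor>real (Suc k) * b0 j\<rfloor>" "of_int \<lfloor>real (Suc k) * b0 j\<rfloor> \<le> real (Suc k) * b0 j" by linarith+
          have "\<bar>of_int \<lfloor>real (Suc k) * b0 j\<rfloor>\<bar> \<le> \<bar>real (Suc k) * b0 j\<bar> + 1" using l by linarith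
          also have "\<dots> \<le> real (Suc k) * (\<bar>b0 j\<bar> + 1)" by (simp add: abs_mult distrib_left)
          finally show ?thesis using j by (simp add: ap_def divide_le_eq mult.commute del: of_nat_Suc)
        qed
        ultimately show ?thesis using R by linarith
      qed
      then show "\<exists>b\<in>{b\<in>Q. \<forall>j<p. \<bar>b j\<bar> \<le> real R}. r b < r b' + inverse (real (Suc m))"
        using k apQ by blast
    qed
  next
    assume "\<exists>R::nat. \<forall>b'\<in>Q. \<forall>m::nat. \<exists>b\<in>{b\<in>Q. \<forall>j<p. \<bar>b j\<bar> \<le> real R}. r b < r b' + inverse (real (Suc m))"
    then obtain R :: nat
      where R: "\<forall>b'\<in>Q. \<forall>m::nat. \<exists>b\<in>{b\<in>Q. \<forall>j<p. \<bar>b j\<bar> \<le> real R}. r b < r b' + inverse (real (Suc m))" ..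
    let ?K = "{mu :: nat => real. \<forall>l. (l < p \<longrightarrow> \<bar>mu l\<bar> \<le> real R) \<and> (\<not> l < p \<longrightarrow> mu l = 0)}"
    have cont: "continuous_on UNIV r"
      unfolding r_def empirical_risk_def inner_prod_def
    proof (rule continuous_on_sum)
      fix i assume "i \<in> {..<n}"
      then have i: "i < n" by simp
      have "continuous_on UNIV (%b::nat => real. \<Sum>j<p. x i j * b j)"
        by (intro continuous_intros continuous_on_product_coordinates)
      from continuous_on_compose2[OF ct[OF i] this subset_UNIV]
      show "continuous_on UNIV (%b. \<l> (y i) (\<Sum>j<p. x i j * b j))" .
    qed
    have "?K ~= {}"
    proof
      assume e: "?K = {}"
      have "(%_. 0) \<in> ?K" by simp
      then show False unfolding e by (rule emptyE)
    qed
    have "\<exists>b0\<in>?K. \<forall>b\<in>?K. r b0 \<le> r b"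
      by (rule continuous_attains_inf[OF compact_box \<open>?K ~= {}\<close> continuous_on_subset[OF cont subset_UNIV]])
    then obtain b0 where b0: "\<forall>b\<in>?K. r b0 \<le> r b" ..
    have min: "r b0 \<le> r b'" if b': "b' \<in> Q" for b'
    proof (rule field_le_epsilon)
      fix e :: real assume "e > 0"
      then obtain m where m: "inverse (real (Suc m)) < e" using reals_Archimedean by blast
      obtain b where b: "\<forall>j<p. \<bar>b j\<bar> \<le> real R" "r b < r b' + inverse (real (Suc m))" using R[rule_format, OF b', of m] by blast
      have "r b0 \<le> r (%j. if j < p then b j else 0)" using b(1) by (intro b0[rule_format]) auto
      also have "r (%j. if j < p then b j else 0) = r b"
      proof -
        have "restrict (%j. if j < p then b j else 0) {..<p} = restrict b {..<p}" by (rule restrict_ext) simp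
        then show ?thesis using restr[of b] restr[of "%j. if j < p then b j else 0"] by simp
      qed
      finally show "r b0 \<le> r b' + e" using b(2) m by linarith
    qed
    have "r b0 \<le> r b" for b
      by (rule LIMSEQ_le_const[OF aplim]) (rule exI[of _ 0], use min[OF apQ] in simp)
    moreover have "restrict b0 {..<p} \<in> real_vectors p" by (simp add: real_vectors_def)
    ultimately show "infimum_attained (real_vectors p) r"
      unfolding infimum_attained_def by (intro bexI[of _ "restrict b0 {..<p}"]) (simp_all add: restr)
  qed
qed

lemma attained_sets:
  fixes \<l> :: "real => real => real"
  assumes m: "\<And>t. (%v. \<l> v t) \<in> borel_measurable (restrict_space borel \<Y>)"
    and ct: "\<And>v. v \<in> \<Y> ==> continuous_on UNIV (\<l> v)"
    and x: "\<And>i. i < n ==> x i \<in> M \<rightarrow>\<^sub>M borel_vec p"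
    and y: "\<And>i. i < n ==> y i \<in> borel_measurable M" "\<And>i omega. i < n ==> omega \<in> space M ==> y i omega \<in> \<Y>"
  shows "{omega \<in> space M. infimum_attained (real_vectors p) (empirical_risk \<l> n p (%i. x i omega) (%i. y i omega))} \<in> sets M"
proof -
  let ?r = "%omega. empirical_risk \<l> n p (%i. x i omega) (%i. y i omega)"
  let ?Q = "{..<p} \<rightarrow>\<^sub>E (\<rat> :: real set)"
  have Q: "countable ?Q" by (intro countable_PiE countable_rat) simp
  have r: "(%omega. ?r omega b) \<in> borel_measurable M" for b
    unfolding empirical_risk_def
  proof (rule borel_measurable_sum)
    fix i assume "i \<in> {..<n}"
    then have i: "i < n" by simp
    have "(%omega. inner_prod p (x i omega) b) \<in> borel_measurable M"
      unfolding inner_prod_def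
      by (intro borel_measurable_sum borel_measurable_times measurable_const
          measurable_compose[OF x[OF i] measurable_component_singleton]) simp_all
    then show "(%omega. \<l> (y i omega) (inner_prod p (x i omega) b)) \<in> borel_measurable M"
      using i by (intro caratheodory_measurable[OF m ct] y)
  qed
  have "{omega \<in> space M. \<exists>R::nat. \<forall>b'\<in>?Q. \<forall>m::nat. \<exists>b\<in>{b\<in>?Q. \<forall>j<p. \<bar>b j\<bar> \<le> real R}. ?r omega b < ?r omega b' + inverse (real (Suc m))} \<in> sets M"
  proof (rule sets.sets_Collect_countable_Ex)
    fix R :: nat
    show "{omega \<in> space M. \<forall>b'\<in>?Q. \<forall>m::nat. \<exists>b\<in>{b\<in>?Q. \<forall>j<p. \<bar>b j\<bar> \<le> real R}. ?r omega b < ?r omega b' + inverse (real (Suc m))} \<in> sets M"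
    proof (rule sets.sets_Collect_countable_All'[OF _ Q])
      fix b'
      show "{omega \<in> space M. \<forall>m::nat. \<exists>b\<in>{b\<in>?Q. \<forall>j<p. \<bar>b j\<bar> \<le> real R}. ?r omega b < ?r omega b' + inverse (real (Suc m))} \<in> sets M"
      proof (rule sets.sets_Collect_countable_All)
        fix m :: nat
        show "{omega \<in> space M. \<exists>b\<in>{b\<in>?Q. \<forall>j<p. \<bar>b j\<bar> \<le> real R}. ?r omega b < ?r omega b' + inverse (real (Suc m))} \<in> sets M"
        proof (rule sets.sets_Collect_countable_Ex')
          fix b
          show "{omega \<in> space M. ?r omega b < ?r omega b' + inverse (real (Suc m))} \<in> sets M"
            using r[of b] r[of b'] by measurable
        next
          show "countable {b\<in>?Q. \<forall>j<p. \<bar>b j\<bar> \<le> real R}" by (rule countable_subset[OF _ Q]) blast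
        qed
      qed
    qed
  qed
  also have "{omega \<in> space M. \<exists>R::nat. \<forall>b'\<in>?Q. \<forall>m::nat. \<exists>b\<in>{b\<in>?Q. \<forall>j<p. \<bar>b j\<bar> \<le> real R}. ?r omega b < ?r omega b' + inverse (real (Suc m))} =
    {omega \<in> space M. infimum_attained (real_vectors p) (?r omega)}"
  proof (rule Collect_cong, rule conj_cong[OF refl])
    fix omega assume "omega \<in> space M"
    then show "(\<exists>R::nat. \<forall>b'\<in>?Q. \<forall>m::nat. \<exists>b\<in>{b\<in>?Q. \<forall>j<p. \<bar>b j\<bar> \<le> real R}. ?r omega b < ?r omega b' + inverse (real (Suc m))) \<longleftrightarrow>
        infimum_attained (real_vectors p) (?r omega)"
      using ct y(2) by (intro infimum_attained_iff[symmetric]) auto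
  qed
  finally show ?thesis .
qed

section \<open>The threshold in terms of the limiting law\<close>

lemma delta_infty_eq:
  assumes "(INF t. phi \<l> N U Y G t) = a" "a > 0"
  shows "delta_infty \<l> N U Y G = ereal (1 / a)"
  using assms by (simp add: delta_infty_def)

lemma distr_triple:
  assumes N: "prob_space N" and V: "V \<in> N \<rightarrow>\<^sub>M borel \<Otimes>\<^sub>M (borel :: real measure)" and G: "distributed N lborel G std_normal_density"
    and indep: "prob_space.indep_set N (sets (vimage_algebra (space N) G borel)) (sets (vimage_algebra (space N) V (borel \<Otimes>\<^sub>M borel)))"
    and f: "f \<in> borel \<Otimes>\<^sub>M borel \<rightarrow>\<^sub>M (borel \<Otimes>\<^sub>M borel :: (real \<times> real) measure)"
  shows "distr N ((borel \<Otimes>\<^sub>M borel) \<Otimes>\<^sub>M borel) (%omega. (f (V omega), G omega)) =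
    distr N (borel \<Otimes>\<^sub>M borel) (%omega. f (V omega)) \<Otimes>\<^sub>M gauss"
proof -
  interpret prob_space N by fact
  have Gm: "G \<in> borel_measurable N" using distributed_measurable[OF G] by simp
  have dG: "distr N borel G = gauss"
    using distributed_distr_eq_density[OF G] distr_cong[of N N lborel borel G G] by simp
  have fV: "(%omega. f (V omega)) \<in> N \<rightarrow>\<^sub>M borel \<Otimes>\<^sub>M borel" by (rule measurable_compose[OF V f])
  show ?thesis
  proof (subst dG[symmetric], rule distr_pair_indep[OF N fV Gm])
    fix A :: "(real \<times> real) set" and C assume A: "A \<in> sets (borel \<Otimes>\<^sub>M borel)" and C: "C \<in> sets (borel :: real measure)"
    have fA: "f -` A \<in> sets (borel \<Otimes>\<^sub>M borel)" using measurable_sets[OF f A] by (simp add: space_pair_measure)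
    have e: "(%omega. f (V omega)) -` A \<inter> space N = V -` (f -` A) \<inter> space N" by auto
    show "prob (((%omega. f (V omega)) -` A \<inter> space N) \<inter> (G -` C \<inter> space N)) =
        prob ((%omega. f (V omega)) -` A \<inter> space N) * prob (G -` C \<inter> space N)"
      using indep_setD[OF indep in_vimage_algebra[OF C] in_vimage_algebra[OF fA]]
      unfolding e by (simp only: Int_commute mult.commute)
  qed
qed

lemma Omega_iff:
  fixes \<l> :: "real => real => real"
  assumes Y: "Y omega \<in> \<Y>" "omega \<in> space N" and c: "\<And>v. v \<in> \<Y> ==> c v = loss_sign (\<l> v)"
    and cv: "\<And>v. v \<in> \<Y> ==> strictly_convex (\<l> v)"
  shows "omega \<in> Omega_coercive N \<l> Y \<longleftrightarrow> c (Y omega) = 0" "omega \<in> Omega_incr N \<l> Y \<longleftrightarrow> c (Y omega) = 1"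
    "omega \<in> Omega_decr N \<l> Y \<longleftrightarrow> c (Y omega) = -1"
  using Y c[OF Y(1)] loss_sign_iff[OF cv[OF Y(1)]]
  by (simp_all add: Omega_coercive_def Omega_incr_def Omega_decr_def)

text \<open>If a summand in (N) is active and \<open>U\<close> is nonzero, the corresponding
  distance is positive. The second expectation belongs to the direction \<open>w\<close>, the first
  to \<open>- w\<close>.\<close>

lemma limit_law_class:
  fixes \<l> :: "real => real => real"
  assumes N: "prob_space N" and U: "U \<in> borel_measurable N" "distr N borel U = gauss"
    and Y: "Y \<in> borel_measurable N" "\<And>omega. omega \<in> space N ==> Y omega \<in> \<Y>"
    and c: "c \<in> borel_measurable borel" "\<And>v. c v \<in> {-1, 0, 1}" "\<And>v. v \<in> \<Y> ==> c v = loss_sign (\<l> v)"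
    and nt: "nontriviality_assumption \<Y> \<l> N U Y"
  shows "limit_law (distr N (borel \<Otimes>\<^sub>M borel) (%omega. (U omega, c (Y omega))))" (is "limit_law ?kappa")
proof -
  interpret prob_space N by fact
  have cv: "strictly_convex (\<l> v)" if "v \<in> \<Y>" for v using nt that by (simp add: nontriviality_assumption_def)
  have m: "(%omega. (U omega, c (Y omega))) \<in> N \<rightarrow>\<^sub>M borel \<Otimes>\<^sub>M borel"
    by (intro measurable_Pair U(1) measurable_compose[OF Y(1) c(1)])
  have no: "\<not> (AE z in ?kappa. dcone (snd z) (\<sigma> * fst z) = 0)"
    if pos: "0 < (\<integral>omega. (U omega)\<^sup>2 * f omega \<partial>N)"
      and f: "\<And>omega. omega \<in> space N ==> f omega ~= 0 ==> dcone (c (Y omega)) (\<sigma> * U omega) = 0 ==> U omega = 0" for \<sigma> and f :: "'a => real"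
  proof
    assume "AE z in ?kappa. dcone (snd z) (\<sigma> * fst z) = 0"
    from AE_distrD[OF m this] have "AE omega in N. dcone (c (Y omega)) (\<sigma> * U omega) = 0" by simp
    then have "AE omega in N. (U omega)\<^sup>2 * f omega = 0" using AE_space
    proof eventually_elim
      case (elim omega)
      then show ?case using f[of omega] by (cases "f omega = 0") auto
    qed
    then have "(\<integral>omega. (U omega)\<^sup>2 * f omega \<partial>N) = 0" by (rule integral_eq_zero_AE)
    then show False using pos by simp
  qed
  note cls = Omega_iff[of Y _ \<Y> N c \<l>, OF Y(2) _ c(3) cv]
  show ?thesis
  proof (intro limit_law.intro limit_law_axioms.intro)
    show "prob_space ?kappa" by (rule prob_space_distr[OF m])
    show "sets ?kappa = sets (borel \<Otimes>\<^sub>M borel)" by simp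
    show "AE z in ?kappa. snd z \<in> {-1, 0, 1}"
    proof (subst AE_distr_iff[OF m])
      show "{z \<in> space (borel \<Otimes>\<^sub>M borel). snd z \<in> {-1, 0, 1::real}} \<in> sets (borel \<Otimes>\<^sub>M (borel :: real measure))"
        by measurable
      show "AE omega in N. snd (U omega, c (Y omega)) \<in> {-1, 0, 1}" using c(2) by simp
    qed
    have "distr ?kappa borel fst = distr N borel (fst \<circ> (%omega. (U omega, c (Y omega))))" by (rule distr_distr[OF measurable_fst m])
    then show "distr ?kappa borel fst = gauss" using U(2) by (simp add: comp_def)
    have p1: "0 < (\<integral>omega. (U omega)\<^sup>2 * (indicator (Omega_coercive N \<l> Y) omega
            + indicator (Omega_decr N \<l> Y \<inter> {omega'. U omega' > 0}) omega
            + indicator (Omega_incr N \<l> Y \<inter> {omega'. U omega' < 0}) omega) \<partial>N)"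
      and p2: "0 < (\<integral>omega. (U omega)\<^sup>2 * (indicator (Omega_coercive N \<l> Y) omega
            + indicator (Omega_decr N \<l> Y \<inter> {omega'. U omega' < 0}) omega
            + indicator (Omega_incr N \<l> Y \<inter> {omega'. U omega' > 0}) omega) \<partial>N)"
      using nt by (simp_all add: nontriviality_assumption_def)
    have "\<not> (AE z in ?kappa. dcone (snd z) (1 * fst z) = 0)"
      by (rule no[OF p2]) (auto simp: cls dcone_def split: split_indicator_asm if_splits)
    then show "\<not> (AE z in ?kappa. dcone (snd z) (fst z) = 0)" by simp
    have "\<not> (AE z in ?kappa. dcone (snd z) ((-1) * fst z) = 0)"
      by (rule no[OF p1]) (auto simp: cls dcone_def split: split_indicator_asm if_splits)
    then show "\<not> (AE z in ?kappa. dcone (snd z) (- fst z) = 0)" by simp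
  qed
qed

text \<open>On each of the three classes the matching integrand is the squared distance for its
  sign, and every observation belongs to exactly one class.\<close>

lemma phi_eq:
  fixes \<l> :: "real => real => real"
  assumes N: "prob_space N" and U: "U \<in> borel_measurable N"
    and Y: "Y \<in> borel_measurable N" "\<And>omega. omega \<in> space N ==> Y omega \<in> \<Y>"
    and c: "c \<in> borel_measurable borel" "\<And>v. c v \<in> {-1, 0, 1}" "\<And>v. v \<in> \<Y> ==> c v = loss_sign (\<l> v)"
    and cv: "\<And>v. v \<in> \<Y> ==> strictly_convex (\<l> v)"
    and G: "distributed N lborel G std_normal_density"
    and indep: "prob_space.indep_set N (sets (vimage_algebra (space N) G borel))
      (sets (vimage_algebra (space N) (%omega. (U omega, Y omega)) (borel \<Otimes>\<^sub>M borel)))"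
    and L: "limit_law (distr N (borel \<Otimes>\<^sub>M borel) (%omega. (U omega, c (Y omega))))"
  shows "phi \<l> N U Y G t = limit_law.\<phi> (distr N (borel \<Otimes>\<^sub>M borel) (%omega. (U omega, c (Y omega)))) t"
proof -
  let ?kappa = "distr N (borel \<Otimes>\<^sub>M borel) (%omega. (U omega, c (Y omega)))"
  interpret L: limit_law ?kappa by (rule L)
  have Gm: "G \<in> borel_measurable N" using distributed_measurable[OF G] by simp
  let ?V = "%omega. ((U omega, c (Y omega)), G omega)"
  have cY: "(%omega. c (Y omega)) \<in> borel_measurable N" by (rule measurable_compose[OF Y(1) c(1)])
  have V: "?V \<in> N \<rightarrow>\<^sub>M L.tau"
    unfolding measurable_cong_sets[OF refl L.sets_tau] by (intro measurable_Pair U cY Gm)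
  have cc: "(%z. (fst z, c (snd z))) \<in> borel \<Otimes>\<^sub>M borel \<rightarrow>\<^sub>M (borel \<Otimes>\<^sub>M borel :: (real \<times> real) measure)"
    by (intro measurable_Pair measurable_fst measurable_compose[OF measurable_snd c(1)])
  have UY: "(%omega. (U omega, Y omega)) \<in> N \<rightarrow>\<^sub>M borel \<Otimes>\<^sub>M borel" by (intro measurable_Pair U Y(1))
  have law: "distr N L.tau ?V = L.tau"
  proof -
    have "distr N L.tau ?V = distr N ((borel \<Otimes>\<^sub>M borel) \<Otimes>\<^sub>M borel) ?V"
      by (rule distr_cong[OF refl L.sets_tau refl])
    also have "\<dots> = L.tau"
      unfolding L.tau_def using distr_triple[OF N UY G indep cc] by simp
    finally show ?thesis .
  qed
  note cls = Omega_iff[of Y _ \<Y> N c \<l>, OF Y(2) _ c(3) cv]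
  define H where "H omega = (dcone (c (Y omega)) (G omega + U omega * t))\<^sup>2" for omega
  have Hm: "H \<in> borel_measurable N"
    unfolding H_def[abs_def] by (intro borel_measurable_power dcone_measurable cY borel_measurable_add borel_measurable_times Gm U measurable_const) simp
  have Hi: "integrable N H"
    using L.integrable_H[of t] integrable_distr[OF V, of "L.H t"] unfolding law by (simp add: L.H_def H_def[abs_def])
  have Ii: "integrable N (%omega. H omega * indicator {omega \<in> space N. c (Y omega) = e} omega)" for e
  proof -
    have "{omega \<in> space N. c (Y omega) = e} \<in> sets N" using cY by measurable
    from integrable_mult_indicator[OF this Hi] show ?thesis by (simp add: mult.commute)
  qed
  have "L.\<phi> t = (\<integral>omega. H omega \<partial>N)"
    unfolding L.\<phi>_def using integral_distr[OF V, of "L.H t"] L.H_measurable[of t] unfolding law by (simp add: L.H_def H_def)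
  also have "\<dots> = (\<integral>omega. H omega * indicator {omega \<in> space N. c (Y omega) = 0} omega + H omega * indicator {omega \<in> space N. c (Y omega) = 1} omega
      + H omega * indicator {omega \<in> space N. c (Y omega) = -1} omega \<partial>N)"
    using c(2) by (intro Bochner_Integration.integral_cong) (force split: split_indicator)+
  also have "\<dots> = (\<integral>omega. H omega * indicator {omega \<in> space N. c (Y omega) = 0} omega \<partial>N) + (\<integral>omega. H omega * indicator {omega \<in> space N. c (Y omega) = 1} omega \<partial>N)
      + (\<integral>omega. H omega * indicator {omega \<in> space N. c (Y omega) = -1} omega \<partial>N)"
    by (simp only: Bochner_Integration.integral_add Bochner_Integration.integrable_add Ii)
  also have "\<dots> = phi \<l> N U Y G t"
    unfolding phi_def
    by (intro arg_cong2[where f = "(+)"] Bochner_Integration.integral_cong refl)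
      (auto simp: cls H_def dcone_def split: split_indicator)
  finally show ?thesis by (rule sym)
qed

section \<open>The phase transition\<close>

theorem theorem2p6:
  fixes F :: "real \<Rightarrow> real \<Rightarrow> real" and \<Y> :: "real set" and \<l> :: "real \<Rightarrow> real \<Rightarrow> real"
    and \<delta> :: real and n p :: "nat \<Rightarrow> nat"
    and M :: "nat \<Rightarrow> 'a measure" and w :: "nat \<Rightarrow> nat \<Rightarrow> real"
    and x :: "nat \<Rightarrow> nat \<Rightarrow> 'a \<Rightarrow> nat \<Rightarrow> real" and y :: "nat \<Rightarrow> nat \<Rightarrow> 'a \<Rightarrow> real"
    and N :: "'b measure" and U Y G :: "'b \<Rightarrow> real"
  assumes F_range: "\<And>t u. 0 \<le> F t u \<and> F t u \<le> 1"
    and F_measurable: "\<And>t. F t \<in> borel_measurable borel"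
    and loss_measurable: "\<And>t. (\<lambda>v. \<l> v t) \<in> borel_measurable (restrict_space borel \<Y>)"
    and delta: "1 < \<delta>"
    and n_lim: "filterlim n at_top sequentially"
    and p_lim: "filterlim p at_top sequentially"
    and ratio_lim: "(\<lambda>k. real (n k) / real (p k)) \<longlonglongrightarrow> \<delta>"
    and sample: "\<And>k. single_index_sample F \<Y> (M k) (n k) (p k) (w k) (x k) (y k)"
    and N_prob: "prob_space N"
    and U_measurable: "U \<in> borel_measurable N"
    and Y_measurable: "Y \<in> borel_measurable N"
    and Y_range: "\<And>\<omega>. \<omega> \<in> space N \<Longrightarrow> Y \<omega> \<in> \<Y>"
    and UY_law: "\<And>k i. i < n k \<Longrightarrow>
        distr N (borel \<Otimes>\<^sub>M borel) (\<lambda>\<omega>. (U \<omega>, Y \<omega>))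
        = distr (M k) (borel \<Otimes>\<^sub>M borel) (\<lambda>\<omega>. (inner_prod (p k) (x k i \<omega>) (w k), y k i \<omega>))"
    and G_normal: "distributed N lborel G std_normal_density"
    and G_indep: "prob_space.indep_set N
        (sets (vimage_algebra (space N) G borel))
        (sets (vimage_algebra (space N) (\<lambda>\<omega>. (U \<omega>, Y \<omega>)) (borel \<Otimes>\<^sub>M borel)))"
    and nontriviality: "nontriviality_assumption \<Y> \<l> N U Y"
    and loss: "loss_assumption \<Y> \<l> N Y G"
  shows "(ereal \<delta> > delta_infty \<l> N U Y G \<longrightarrow>
           (\<lambda>k. measure (M k) {\<omega> \<in> space (M k).
              infimum_attained (real_vectors (p k))
                (empirical_risk \<l> (n k) (p k) (\<lambda>i. x k i \<omega>) (\<lambda>i. y k i \<omega>))}) \<longlonglongrightarrow> 1) \<and>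
         (ereal \<delta> < delta_infty \<l> N U Y G \<longrightarrow>
           (\<lambda>k. measure (M k) {\<omega> \<in> space (M k).
              infimum_attained (real_vectors (p k))
                (empirical_risk \<l> (n k) (p k) (\<lambda>i. x k i \<omega>) (\<lambda>i. y k i \<omega>))}) \<longlonglongrightarrow> 0)"
proof -
  have cv: "strictly_convex (\<l> v)" if "v \<in> \<Y>" for v using loss that by (simp add: loss_assumption_def)
  have ct: "continuous_on UNIV (\<l> v)" if "v \<in> \<Y>" for v
    using loss that by (auto simp: loss_assumption_def intro: C1_differentiable_imp_continuous_on)
  obtain c where c: "c \<in> borel_measurable borel" and c_sign: "\<And>v. c v \<in> {-1, 0, 1}"
    and c_loss: "\<And>v. v \<in> \<Y> ==> c v = loss_sign (\<l> v)"
    using ex_class_function[of \<l> \<Y>, OF loss_measurable cv] by blast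
  obtain B where B: "B \<in> sets borel" and B_iff: "\<And>v. v \<in> \<Y> ==> v \<in> B \<longleftrightarrow> (\<exists>m. \<forall>t. - m \<le> \<l> v t)"
    using ex_bounded_below_set[of \<l> \<Y>, OF loss_measurable ct] by blast
  define kappa where "kappa = distr N (borel \<Otimes>\<^sub>M borel) (%omega. (U omega, c (Y omega)))"
  have UY: "(%omega. (U omega, Y omega)) \<in> N \<rightarrow>\<^sub>M borel \<Otimes>\<^sub>M borel" by (intro measurable_Pair U_measurable Y_measurable)
  have cc: "(%z. (fst z, c (snd z))) \<in> borel \<Otimes>\<^sub>M borel \<rightarrow>\<^sub>M (borel \<Otimes>\<^sub>M borel :: (real \<times> real) measure)"
    by (intro measurable_Pair measurable_fst measurable_compose[OF measurable_snd c])
  note s = sample[unfolded single_index_sample_def]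
  have xm: "x k i \<in> M k \<rightarrow>\<^sub>M borel_vec (p k)" if "i < n k" for k i using s[of k] that by blast
  have ym: "y k i \<in> borel_measurable (M k)" if "i < n k" for k i using s[of k] that by blast
  have yr: "y k i omega \<in> \<Y>" if "i < n k" "omega \<in> space (M k)" for k i omega using s[of k] that by blast
  have uym: "(%omega. (inner_prod (p k) (x k i omega) (w k), y k i omega)) \<in> M k \<rightarrow>\<^sub>M borel \<Otimes>\<^sub>M borel" if "i < n k" for k i
  proof (rule measurable_Pair[OF _ ym[OF that]])
    show "(%omega. inner_prod (p k) (x k i omega) (w k)) \<in> borel_measurable (M k)"
      unfolding inner_prod_def
      by (intro borel_measurable_sum borel_measurable_times measurable_const
          measurable_compose[OF xm[OF that] measurable_component_singleton]) simp_all
  qed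
  have law: "distr (M k) (borel \<Otimes>\<^sub>M borel) (%omega. (inner_prod (p k) (x k i omega) (w k), c (y k i omega))) = kappa" if i: "i < n k" for k i
  proof -
    have "kappa = distr (distr N (borel \<Otimes>\<^sub>M borel) (%omega. (U omega, Y omega))) (borel \<Otimes>\<^sub>M borel) (%z. (fst z, c (snd z)))"
      unfolding kappa_def distr_distr[OF cc UY] by (simp add: comp_def)
    also have "\<dots> = distr (M k) (borel \<Otimes>\<^sub>M borel) (%omega. (inner_prod (p k) (x k i omega) (w k), c (y k i omega)))"
      unfolding UY_law[OF i] distr_distr[OF cc uym[OF i]] by (simp add: comp_def)
    finally show ?thesis by (rule sym)
  qed
  have "\<forall>\<^sub>F k in sequentially. 2 \<le> p k" using p_lim by (simp add: filterlim_at_top)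
  \<comment> \<open>As the limit of the ratio exceeds 1, there are eventually more rows than
    columns, as general position of all columns demands; two dimensions are needed to have an index
    and a Gaussian column.\<close>
  with order_tendstoD(1)[OF ratio_lim delta] have ev: "\<forall>\<^sub>F k in sequentially. 2 \<le> p k \<and> p k < n k"
  proof eventually_elim
    case (elim k)
    then have "real (p k) < real (n k)" by (simp add: pos_less_divide_eq)
    then show ?case using elim by simp
  qed
  \<comment> \<open>The law of \<open>U\<close> is that of the index in any nonempty sample, so one
    large \<open>k\<close> is enough to identify it.\<close>
  have U_normal: "distr N borel U = gauss"
  proof -
    obtain k where k: "2 \<le> p k \<and> p k < n k" using eventually_happens'[OF sequentially_bot ev] ..
    define q where "q = p k - 2"
    have p: "p k = Suc (Suc q)" using k unfolding q_def by arith
    have i: "0 < n k" using k by simp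
    have f0: "ip {..Suc q} (%_. 0) (w k) = 0" by (simp add: ip_def)
    have w: "ip {..Suc q} (w k) (w k) = 1"
    proof -
      have "L2_set (w k) {..<p k} = 1" using s[of k] by blast
      then show ?thesis unfolding p by (simp add: nrm_eq_L2_set[symmetric] lessThan_Suc_atMost)
    qed
    have R: "rot q (w k) (%_. 0) v 0 = inner_prod (p k) v (w k)" for v
      unfolding p inner_prod_ip by (rule rot_first[OF w f0])
    have "distr (M k) borel (%omega. rot q (w k) (%_. 0) (x k 0 omega) 0) = gauss"
    proof (rule observation_law(2)[of "M k" "x k 0" q "y k 0" F "rot q (w k) (%_. 0)" c])
      show "prob_space (M k)" using s[of k] by blast
      show "x k 0 \<in> M k \<rightarrow>\<^sub>M borel_vec (Suc (Suc q))" using xm[OF i] unfolding p .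
      show "y k 0 \<in> borel_measurable (M k)" by (rule ym[OF i])
      show "distr (M k) (borel_vec (Suc (Suc q))) (x k 0) = std_gaussian_vec (Suc (Suc q))"
        using s[of k] i unfolding p by blast
      show "F t \<in> borel_measurable borel" "0 \<le> F t u \<and> F t u \<le> 1" for t u using F_measurable F_range by auto
      show "AE omega in M k. real_cond_exp (M k) (vimage_algebra (space (M k)) (x k 0) (borel_vec (Suc (Suc q))))
          (indicator {omega' \<in> space (M k). y k 0 omega' \<le> t}) omega = F t (rot q (w k) (%_. 0) (x k 0 omega) 0)" for t
        unfolding R unfolding p using s[of k] i unfolding p by blast
      show "mpres (Gam {..Suc q}) (rot q (w k) (%_. 0))" by (rule mpres_rot[OF w f0])
    qed (rule c)
    then have u: "distr (M k) borel (%omega. inner_prod (p k) (x k 0 omega) (w k)) = gauss" unfolding R .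
    have "distr N borel (fst \<circ> (%omega. (U omega, Y omega))) = distr (distr N (borel \<Otimes>\<^sub>M borel) (%omega. (U omega, Y omega))) borel fst"
      by (rule distr_distr[OF measurable_fst UY, symmetric])
    also have "\<dots> = distr (M k) borel (fst \<circ> (%omega. (inner_prod (p k) (x k 0 omega) (w k), y k 0 omega)))"
      unfolding UY_law[OF i] by (rule distr_distr[OF measurable_fst uym[OF i]])
    finally show ?thesis using u by (simp add: comp_def)
  qed
  have LL: "limit_law kappa"
    unfolding kappa_def by (rule limit_law_class[OF N_prob U_measurable U_normal Y_measurable Y_range c c_sign c_loss nontriviality])
  interpret L: limit_law kappa by (rule LL)
  have phi: "phi \<l> N U Y G t = L.\<phi> t" for t
    unfolding kappa_def
    by (rule phi_eq[OF N_prob U_measurable Y_measurable Y_range c c_sign c_loss cv G_normal G_indep LL[unfolded kappa_def]])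
  have dinf: "delta_infty \<l> N U Y G = ereal (1 / L.\<phi> L.t0)"
    by (rule delta_infty_eq) (simp_all only: phi L.INF_\<phi> L.\<phi>_pos)
  have bdd: "AE omega in M k. \<exists>m. \<forall>t. - m \<le> \<l> (y k i omega) t" if i: "i < n k" for k i
  proof -
    have inf: "(\<integral>\<^sup>+omega. e2ennreal \<bar>INF u. ereal (\<l> (Y omega) u)\<bar> \<partial>N) < \<infinity>" using loss by (simp add: loss_assumption_def)
    have S: "{z \<in> space (borel \<Otimes>\<^sub>M (borel :: real measure)). snd z \<in> B} \<in> sets (borel \<Otimes>\<^sub>M (borel :: real measure))"
      using B by measurable
    have "AE omega in N. Y omega \<in> B" by (rule AE_bounded_below[OF N_prob Y_measurable Y_range B B_iff inf])
    then have "AE z in distr N (borel \<Otimes>\<^sub>M borel) (%omega. (U omega, Y omega)). snd z \<in> B"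
      by (subst AE_distr_iff[OF UY S]) simp
    from AE_distrD[OF uym[OF i] this[unfolded UY_law[OF i]]] have "AE omega in M k. y k i omega \<in> B" by simp
    then show ?thesis using AE_space by eventually_elim (use B_iff yr[OF i] in blast)
  qed
  define P where "P k = measure (M k) {omega \<in> space (M k). infimum_attained (real_vectors (p k))
      (empirical_risk \<l> (n k) (p k) (%i. x k i omega) (%i. y k i omega))}" for k
  \<comment> \<open>Subtraction of natural numbers, faithful for the \<open>k\<close> with
    \<open>2 \<le> p k\<close> to which the bounds are restricted.\<close>
  define q where "q k = p k - 2" for k
  define r where "r k = measure (L.sample_law (n k) (q k)) {z \<in> space (L.sample_law (n k) (q k)). proper_active {..<n k} (Suc (q k)) (q k) z}" for k
  define e where "e \<sigma> k = measure (PiM {..<n k} (%_. kappa))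
      {v \<in> space (PiM {..<n k} (%_. kappa)). \<forall>i<n k. dcone (snd (v i)) (\<sigma> * fst (v i)) = 0}" for \<sigma> k
  have bounds: "\<forall>\<^sub>F k in sequentially. P k \<le> r k \<and> 1 - 4 * (1 - r k) - e 1 k - e (-1) k \<le> P k"
    using ev
  proof eventually_elim
    case (elim k)
    have p: "p k = Suc (Suc (q k))" using elim unfolding q_def by arith
    have At: "attainment kappa F \<Y> (M k) (n k) (q k) (w k) (x k) (y k) c \<l>"
    proof (intro attainment.intro single_sample.intro LL single_sample_axioms.intro attainment_axioms.intro)
      show "single_index_sample F \<Y> (M k) (n k) (Suc (Suc (q k))) (w k) (x k) (y k)" using sample[of k] unfolding p .
      show "distr (M k) (borel \<Otimes>\<^sub>M borel) (%omega. (inner_prod (Suc (Suc (q k))) (x k i omega) (w k), c (y k i omega))) = kappa"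
        if "i < n k" for i using law[OF that] unfolding p .
      show "0 < n k" using elim by simp
    qed (use F_measurable F_range c c_sign cv c_loss in auto)
    interpret A: attainment kappa F \<Y> "M k" "n k" "q k" "w k" "x k" "y k" c \<l> by (rule At)
    have m: "A.attained_event \<in> sets (M k)"
      unfolding A.attained_event_def p[symmetric] by (rule attained_sets[OF loss_measurable ct xm ym yr])
    have PA: "P k = measure (M k) A.attained_event" by (simp only: P_def A.attained_event_def p)
    have rA: "r k = A.rho" by (simp only: r_def A.rho_def)
    have "Suc (q k) < n k" using elim unfolding q_def by arith
    from A.attained_le[OF this m] A.attained_ge[OF m ct bdd] show ?case
      unfolding PA rA A.measure_all_recession e_def by simp
  qed
  \<comment> \<open>The shift by 2 is negligible, so the ratio to be compared with
    \<open>\<phi> t0\<close> is \<open>1 / \<delta>\<close>.\<close>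
  have q_lim: "(%k. real (q k) / real (n k)) \<longlonglongrightarrow> 1 / \<delta>"
  proof -
    have "(%k. inverse (real (n k) / real (p k))) \<longlonglongrightarrow> inverse \<delta>"
      by (rule tendsto_inverse[OF ratio_lim]) (use delta in simp)
    moreover have "(%k. 2 / real (n k)) \<longlonglongrightarrow> 0"
      by (rule tendsto_divide_0[OF tendsto_const])
        (rule filterlim_at_top_imp_at_infinity, rule filterlim_compose[OF filterlim_real_sequentially n_lim])
    ultimately have "(%k. inverse (real (n k) / real (p k)) - 2 / real (n k)) \<longlonglongrightarrow> inverse \<delta> - 0"
      by (rule tendsto_diff)
    moreover have "\<forall>\<^sub>F k in sequentially. inverse (real (n k) / real (p k)) - 2 / real (n k) = real (q k) / real (n k)"
      using ev by eventually_elim (simp add: q_def of_nat_diff diff_divide_distrib)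
    ultimately show ?thesis by (simp add: inverse_eq_divide Lim_transform_eventually)
  qed
  have e_lim: "e \<sigma> \<longlonglongrightarrow> 0" if "\<sigma> = 1 \<or> \<sigma> = -1" for \<sigma>
    unfolding e_def[abs_def] by (rule L.tendsto_recession[OF n_lim that])
  have P_bounds: "0 \<le> P k" "P k \<le> 1" for k
  proof -
    have "prob_space (M k)" using s[of k] by blast
    then show "0 \<le> P k" "P k \<le> 1" by (simp_all add: P_def prob_space.prob_le_1)
  qed
  have "P \<longlonglongrightarrow> 1" if "ereal \<delta> > delta_infty \<l> N U Y G"
  proof -
    have "1 / \<delta> < L.\<phi> L.t0" using that delta L.\<phi>_pos by (simp add: dinf field_simps)
    from L.tendsto_proper_active(1)[OF n_lim q_lim this] have r: "r \<longlonglongrightarrow> 1" unfolding r_def[abs_def] .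
    \<comment> \<open>The factor 4 from Markov's inequality multiplies a quantity that tends to 0,
      so no rate for \<open>r\<close> is needed.\<close>
    have low: "(%k. 1 - 4 * (1 - r k) - e 1 k - e (-1) k) \<longlonglongrightarrow> 1 - 4 * (1 - 1) - 0 - 0"
      by (intro tendsto_intros r e_lim) simp_all
    show ?thesis
    proof (rule tendsto_sandwich[OF _ _ _ tendsto_const])
      show "(%k. 1 - 4 * (1 - r k) - e 1 k - e (-1) k) \<longlonglongrightarrow> 1" using low by simp
      show "\<forall>\<^sub>F k in sequentially. 1 - 4 * (1 - r k) - e 1 k - e (-1) k \<le> P k" using bounds by eventually_elim blast
    qed (use P_bounds in simp)
  qed
  moreover have "P \<longlonglongrightarrow> 0" if "ereal \<delta> < delta_infty \<l> N U Y G"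
  proof -
    have "L.\<phi> L.t0 < 1 / \<delta>" using that delta L.\<phi>_pos by (simp add: dinf field_simps)
    from L.tendsto_proper_active(2)[OF n_lim q_lim this] have r: "r \<longlonglongrightarrow> 0" unfolding r_def[abs_def] .
    show ?thesis
    proof (rule tendsto_sandwich[OF _ _ tendsto_const r])
      show "\<forall>\<^sub>F k in sequentially. P k \<le> r k" using bounds by eventually_elim blast
    qed (use P_bounds in simp)
  qed
  ultimately show ?thesis unfolding P_def[abs_def] by blast
qed

end
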